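(* Let $\alpha\in\mathbb{R}$, $\alpha\neq 0,1$. For any $s,k\in\mathbb{R}$ with $s<-\frac12$ or $k<-\frac12$ or $|s-k|>2$, and for given $(\phi,\psi)\in H^s(\mathbb{R})\times H^k(\mathbb{R})$, there exists no time $T=T(\|(\phi,\psi)\|_{H^s\times H^k})>0$ such that the solution mapping that takes initial data $(\phi,\psi)$ to the solution $(v,w)\in C([0,T];H^s)\times C([0,T];H^k)$ of the initial value problem $$\begin{cases}\partial_t v+\partial_x^3 v+\partial_x(vw^2)=0, & v(x,0)=\phi(x),\\ \partial_t w+\alpha\,\partial_x^3 w+\partial_x(v^2w)=0, & w(x,0)=\psi(x)\end{cases}$$ is $C^3$ at the origin.
   Context: Here $(x,t)\in\mathbb{R}\times\mathbb{R}$. The solution mapping is regarded as a map $S:B_r\to C([0,T];H^s)\times C([0,T];H^k)$, $(\phi,\psi)\mapsto(v,w)$, where $B_r$ is a ball of some radius $r>0$ centered at the origin of $H^s(\mathbb{R})\times H^k(\mathbb{R})$ and $(v,w)$ satisfies on $[0,T]$ the integral equations $$v(t)=U(t)\phi-\int_0^tU(t-t')\partial_x(vw^2)(t')\,dt',\qquad w(t)=U^\alpha(t)\psi-\int_0^tU^\alpha(t-t')\partial_x(v^2w)(t')\,dt',$$ with $U^\alpha(t)=e^{-t\alpha\partial_x^3}$ the Fourier multiplier operator with symbol $e^{it\alpha\xi^3}$ and $U=U^1$. *)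

theory Defs
  imports "HOL-Analysis.Analysis" "HOL-Library.Function_Algebras"
begin

section \<open>Normed spaces with explicit carriers, and Frechet derivatives between them\<close>

text \<open>
  The Sobolev spaces below depend on a real parameter, so they are carriers inside one fixed vector
  space rather than types. Functions form a real vector space pointwise, which makes distributions,
  paths of distributions and linear operators elements of real vector spaces.
\<close>

instantiation "fun" :: (type, real_vector) real_vector
begin

definition scaleR_fun_def: "scaleR c f = (\<lambda>x. c *\<^sub>R f x)"

instance
  by standard (simp_all add: scaleR_fun_def fun_eq_iff algebra_simps)

end

record 'a nspace =
  vecs :: "'a set"
  vnorm :: "'a \<Rightarrow> real"

definition vball :: "'a::real_vector nspace \<Rightarrow> 'a \<Rightarrow> real \<Rightarrow> 'a set" where
  "vball X a r = {x \<in> vecs X. vnorm X (x - a) < r}"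

definition prod_space :: "'a nspace \<Rightarrow> 'b nspace \<Rightarrow> ('a \<times> 'b) nspace" where
  "prod_space X Y = \<lparr>vecs = vecs X \<times> vecs Y,
     vnorm = (\<lambda>(x, y). sqrt ((vnorm X x)\<^sup>2 + (vnorm Y y)\<^sup>2))\<rparr>"

text \<open>
  Bounded linear operators with the operator norm. They are set to zero off the carrier, so that an
  operator is determined by its values on the carrier.
\<close>

definition op_space :: "'a::real_vector nspace \<Rightarrow> 'b::real_vector nspace \<Rightarrow> ('a \<Rightarrow> 'b) nspace" where
  "op_space X Y = \<lparr>
     vecs = {L. (\<forall>x. x \<notin> vecs X \<longrightarrow> L x = 0) \<and> (\<forall>x\<in>vecs X. L x \<in> vecs Y)
              \<and> (\<forall>x\<in>vecs X. \<forall>y\<in>vecs X. L (x + y) = L x + L y)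
              \<and> (\<forall>c. \<forall>x\<in>vecs X. L (c *\<^sub>R x) = c *\<^sub>R L x)
              \<and> (\<exists>B. \<forall>x\<in>vecs X. vnorm Y (L x) \<le> B * vnorm X x)},
     vnorm = (\<lambda>L. SUP x\<in>{x \<in> vecs X. vnorm X x \<le> 1}. vnorm Y (L x))\<rparr>"

definition has_frechet :: "'a::real_vector nspace \<Rightarrow> 'b::real_vector nspace
    \<Rightarrow> ('a \<Rightarrow> 'b) \<Rightarrow> ('a \<Rightarrow> 'b) \<Rightarrow> 'a \<Rightarrow> bool" where
  "has_frechet X Y f L x \<longleftrightarrow> L \<in> vecs (op_space X Y) \<and>
     (\<forall>e>0. \<exists>d>0. \<forall>h\<in>vecs X. vnorm X h < d \<longrightarrow>
        vnorm Y (f (x + h) - f x - L h) \<le> e * vnorm X h)"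

definition vcontinuous_at :: "'a::real_vector nspace \<Rightarrow> 'b::real_vector nspace
    \<Rightarrow> ('a \<Rightarrow> 'b) \<Rightarrow> 'a \<Rightarrow> bool" where
  "vcontinuous_at X Y f x \<longleftrightarrow>
     (\<forall>e>0. \<exists>d>0. \<forall>h\<in>vecs X. vnorm X h < d \<longrightarrow> vnorm Y (f (x + h) - f x) < e)"

text \<open>
  The Frechet derivatives up to order three exist near the point and the third one is continuous at
  the point. This holds in particular for a map that is three times continuously differentiable in
  a neighbourhood of the point.
\<close>

definition C3_at :: "'a::real_vector nspace \<Rightarrow> 'b::real_vector nspace
    \<Rightarrow> ('a \<Rightarrow> 'b) \<Rightarrow> 'a \<Rightarrow> bool" where
  "C3_at X Y f a \<longleftrightarrow> (\<exists>d>0. \<exists>f1 f2 f3.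
     (\<forall>x\<in>vball X a d. has_frechet X Y f (f1 x) x
        \<and> has_frechet X (op_space X Y) f1 (f2 x) x
        \<and> has_frechet X (op_space X (op_space X Y)) f2 (f3 x) x)
     \<and> vcontinuous_at X (op_space X (op_space X (op_space X Y))) f3 a)"


section \<open>Schwartz functions and tempered distributions on the line\<close>

definition nderiv :: "nat \<Rightarrow> (real \<Rightarrow> complex) \<Rightarrow> real \<Rightarrow> complex" where
  "nderiv n = ((\<lambda>g x. vector_derivative g (at x)) ^^ n)"

definition schwartz :: "(real \<Rightarrow> complex) \<Rightarrow> bool" where
  "schwartz \<phi> \<longleftrightarrow> (\<forall>n x. nderiv n \<phi> differentiable at x) \<and>
     (\<forall>m n. bounded (range (\<lambda>x. x ^ m *\<^sub>R nderiv n \<phi> x)))"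

definition schwartz_norm :: "nat \<Rightarrow> (real \<Rightarrow> complex) \<Rightarrow> real" where
  "schwartz_norm N \<phi> = (\<Sum>m\<le>N. \<Sum>n\<le>N. SUP x. norm (x ^ m *\<^sub>R nderiv n \<phi> x))"

type_synonym distr = "(real \<Rightarrow> complex) \<Rightarrow> complex"

text \<open>Continuous complex-linear functionals on Schwartz space, set to zero on all other functions.\<close>

definition tempered :: "distr \<Rightarrow> bool" where
  "tempered u \<longleftrightarrow> (\<forall>\<phi>. \<not> schwartz \<phi> \<longrightarrow> u \<phi> = 0)
     \<and> (\<forall>a b \<phi> \<psi>. schwartz \<phi> \<longrightarrow> schwartz \<psi> \<longrightarrow>
          u (\<lambda>x. a * \<phi> x + b * \<psi> x) = a * u \<phi> + b * u \<psi>)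
     \<and> (\<exists>C N. \<forall>\<phi>. schwartz \<phi> \<longrightarrow> norm (u \<phi>) \<le> C * schwartz_norm N \<phi>)"

definition regular_distr :: "(real \<Rightarrow> complex) \<Rightarrow> distr" where
  "regular_distr g = (\<lambda>\<phi>. if schwartz \<phi> then LINT x|lborel. g x * \<phi> x else 0)"

definition distr_deriv :: "distr \<Rightarrow> distr" where
  "distr_deriv u = (\<lambda>\<phi>. if schwartz \<phi> then - u (nderiv 1 \<phi>) else 0)"

definition fourier :: "(real \<Rightarrow> complex) \<Rightarrow> real \<Rightarrow> complex" where
  "fourier \<phi> \<xi> = (LINT x|lborel. cis (- (x * \<xi>)) * \<phi> x)"

definition inv_fourier :: "(real \<Rightarrow> complex) \<Rightarrow> real \<Rightarrow> complex" where
  "inv_fourier \<phi> x = (LINT \<xi>|lborel. cis (x * \<xi>) * \<phi> \<xi>) / (2 * pi)"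

text \<open>The Fourier transform of the distribution u is the function f.\<close>

definition has_fourier :: "distr \<Rightarrow> (real \<Rightarrow> complex) \<Rightarrow> bool" where
  "has_fourier u f \<longleftrightarrow> f \<in> borel_measurable borel \<and>
     (\<forall>\<phi>. schwartz \<phi> \<longrightarrow> integrable lborel (\<lambda>\<xi>. f \<xi> * \<phi> \<xi>) \<and>
        u (fourier \<phi>) = (LINT \<xi>|lborel. f \<xi> * \<phi> \<xi>))"

text \<open>
  The choice is unique up to null sets when the Fourier transform is a function, and it is used
  only in that case.
\<close>

definition fourier_distr :: "distr \<Rightarrow> real \<Rightarrow> complex" where
  "fourier_distr u = (SOME f. has_fourier u f)"

definition inv_fourier_distr :: "(real \<Rightarrow> complex) \<Rightarrow> distr" where
  "inv_fourier_distr f =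
     (\<lambda>\<phi>. if schwartz \<phi> then LINT \<xi>|lborel. f \<xi> * inv_fourier \<phi> \<xi> else 0)"

definition fourier_multiplier :: "(real \<Rightarrow> complex) \<Rightarrow> distr \<Rightarrow> distr" where
  "fourier_multiplier m u = inv_fourier_distr (\<lambda>\<xi>. m \<xi> * fourier_distr u \<xi>)"


section \<open>Sobolev spaces and continuous paths in them\<close>

text \<open>
  The parameter F is the scalar field, the reals or the complex numbers. For F = \<real> the space consists
  of the real distributions, those that are real on real-valued test functions.
\<close>

definition sobolev :: "complex set \<Rightarrow> real \<Rightarrow> distr nspace" where
  "sobolev F s = \<lparr>
     vecs = {u. tempered u
              \<and> (\<forall>\<phi>. schwartz \<phi> \<longrightarrow> range \<phi> \<subseteq> \<real> \<longrightarrow> u \<phi> \<in> F)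
              \<and> (\<exists>f. has_fourier u f \<and>
                   integrable lborel (\<lambda>\<xi>. (1 + \<xi>\<^sup>2) powr s * (norm (f \<xi>))\<^sup>2))},
     vnorm = (\<lambda>u. sqrt (LINT \<xi>|lborel. (1 + \<xi>\<^sup>2) powr s * (norm (fourier_distr u \<xi>))\<^sup>2))\<rparr>"

text \<open>
  Continuous maps from [0,T] to X with the supremum norm. Outside [0,T] they are set to zero.
\<close>

definition path_space :: "real \<Rightarrow> 'a::real_vector nspace \<Rightarrow> (real \<Rightarrow> 'a) nspace" where
  "path_space T X = \<lparr>
     vecs = {u. (\<forall>t\<in>{0..T}. u t \<in> vecs X) \<and> (\<forall>t. t \<notin> {0..T} \<longrightarrow> u t = 0)
              \<and> (\<forall>t0\<in>{0..T}. ((\<lambda>t. vnorm X (u t - u t0)) \<longlongrightarrow> 0) (at t0 within {0..T}))},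
     vnorm = (\<lambda>u. SUP t\<in>{0..T}. vnorm X (u t))\<rparr>"


section \<open>The integral equations and the solution mapping\<close>

definition propagator :: "real \<Rightarrow> real \<Rightarrow> distr \<Rightarrow> distr" where
  "propagator \<alpha> t = fourier_multiplier (\<lambda>\<xi>. cis (t * \<alpha> * \<xi> ^ 3))"

text \<open>
  The integral over [0,t] of U^alpha(t - t') d/dx g(t') for a path g of functions, as a weak integral
  of distributions.
\<close>

definition duhamel :: "real \<Rightarrow> (real \<Rightarrow> real \<Rightarrow> complex) \<Rightarrow> real \<Rightarrow> distr" where
  "duhamel \<alpha> g t = (\<lambda>\<theta>. integral {0..t}
     (\<lambda>t'. propagator \<alpha> (t - t') (distr_deriv (regular_distr (g t'))) \<theta>))"

definition path_distr :: "(real \<Rightarrow> real \<Rightarrow> complex) \<Rightarrow> real \<Rightarrow> distr" where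
  "path_distr v = (\<lambda>t. regular_distr (v t))"

text \<open>
  Paths of functions that are continuous into every Sobolev space. Square integrability makes
  each v(t) an honest function, determined almost everywhere by its distribution.
\<close>

definition smooth_path :: "complex set \<Rightarrow> real \<Rightarrow> (real \<Rightarrow> real \<Rightarrow> complex) \<Rightarrow> bool" where
  "smooth_path F T v \<longleftrightarrow>
     (\<forall>t\<in>{0..T}. v t \<in> borel_measurable borel \<and> integrable lborel (\<lambda>x. (norm (v t x))\<^sup>2))
     \<and> (\<forall>\<sigma>. path_distr v \<in> vecs (path_space T (sobolev F \<sigma>)))"

definition smooth_solution :: "complex set \<Rightarrow> real \<Rightarrow> real \<Rightarrow> distr \<times> distr
    \<Rightarrow> (real \<Rightarrow> real \<Rightarrow> complex) \<Rightarrow> (real \<Rightarrow> real \<Rightarrow> complex) \<Rightarrow> bool" where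
  "smooth_solution F \<alpha> T = (\<lambda>(\<phi>, \<psi>) v w. smooth_path F T v \<and> smooth_path F T w \<and>
     (\<forall>t\<in>{0..T}.
        regular_distr (v t) = propagator 1 t \<phi> - duhamel 1 (\<lambda>t' x. v t' x * (w t' x)\<^sup>2) t \<and>
        regular_distr (w t) = propagator \<alpha> t \<psi> - duhamel \<alpha> (\<lambda>t' x. (v t' x)\<^sup>2 * w t' x) t))"

text \<open>
  For low s and k the products in the integral equations have no pointwise meaning. The Duhamel
  integrals of (v,w) are therefore read as limits of those of smooth paths (v_n,w_n) converging to
  (v,w) in C([0,T];H^s) x C([0,T];H^k). A smooth solution qualifies with a constant sequence.
\<close>

definition integral_solution :: "complex set \<Rightarrow> real \<Rightarrow> real \<Rightarrow> real \<Rightarrow> real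
    \<Rightarrow> distr \<times> distr \<Rightarrow> (real \<Rightarrow> distr) \<times> (real \<Rightarrow> distr) \<Rightarrow> bool" where
  "integral_solution F \<alpha> s k T = (\<lambda>(\<phi>, \<psi>) (v, w).
     (\<exists>vn wn. (\<forall>n::nat. smooth_path F T (vn n) \<and> smooth_path F T (wn n))
        \<and> (\<lambda>n. vnorm (path_space T (sobolev F s)) (path_distr (vn n) - v)) \<longlonglongrightarrow> 0
        \<and> (\<lambda>n. vnorm (path_space T (sobolev F k)) (path_distr (wn n) - w)) \<longlonglongrightarrow> 0
        \<and> (\<forall>t\<in>{0..T}. \<forall>\<theta>. schwartz \<theta> \<longrightarrow>
             (\<lambda>n. duhamel 1 (\<lambda>t' x. vn n t' x * (wn n t' x)\<^sup>2) t \<theta>)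
                \<longlonglongrightarrow> propagator 1 t \<phi> \<theta> - v t \<theta> \<and>
             (\<lambda>n. duhamel \<alpha> (\<lambda>t' x. (vn n t' x)\<^sup>2 * wn n t' x) t \<theta>)
                \<longlonglongrightarrow> propagator \<alpha> t \<psi> \<theta> - w t \<theta>)))"

text \<open>
  The last clause says that S sends the data to ``the'' solution: rough solutions in the sense above
  need not be unique, and S has to agree with the smooth solution wherever there is one on [0,T].
\<close>

definition solution_map :: "complex set \<Rightarrow> real \<Rightarrow> real \<Rightarrow> real \<Rightarrow> real \<Rightarrow> real
    \<Rightarrow> (distr \<times> distr \<Rightarrow> (real \<Rightarrow> distr) \<times> (real \<Rightarrow> distr)) \<Rightarrow> bool" where
  "solution_map F \<alpha> s k r T S \<longleftrightarrow>
     (\<forall>d \<in> vball (prod_space (sobolev F s) (sobolev F k)) 0 r.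
        S d \<in> vecs (prod_space (path_space T (sobolev F s)) (path_space T (sobolev F k)))
        \<and> integral_solution F \<alpha> s k T d (S d)
        \<and> (\<forall>v w. smooth_solution F \<alpha> T d v w \<longrightarrow> S d = (path_distr v, path_distr w)))"

end

theory Submission
  imports Defs "HOL-Probability.Probability"
begin

text \<open>
  A map that is C3 at the origin has a third Frechet derivative there, a bounded trilinear map. Along
  a line \<tau> h its third order Taylor coefficient is therefore bounded by a constant times the third
  power of the norm of h, even after composition with any functional of norm one
  (\<open>C3_at_cubic_coefficient\<close>). For the solution mapping this coefficient can be computed. It is, up
  to the sign, the first nontrivial Picard iterate of the integral equations: the Duhamel integral of
  the cubic nonlinearity evaluated at the free evolutions of the data, called \<open>cubic_response\<close> below.
  The theorem holds because this iterate is not bounded from H^s x H^k to C([0,T]; H^s) when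
  k < - 1/2 or s - k > 2. The second component is covered by exchanging the roles of the two unknowns.

  To compute the coefficient one needs data for which the solution mapping is known to return an
  honest solution on all of [0,T]. Data with a compactly supported continuous Fourier transform are
  enough for the counterexamples. For small multiples of them the equations are solved on the
  Fourier side by a contraction argument (\<open>cubic_system_solution\<close>) among functions V(t, \<xi>) dominated by
  exp (- (2 - t/T) |\<xi>|) / (1 + \<xi>^2). Such functions are stable under convolution
  (\<open>norm_conv_le\<close>). The exponential rate decreases in time, and the integral over r in [0,t] of
  |\<xi>| exp (- (t - r) |\<xi>| / T) is at most T, so the derivative in the nonlinearity is harmless
  (\<open>norm_duhamel_hat_le\<close>) and smallness of the data, not of T, yields the contraction. The fixed
  point is a smooth solution, and it agrees with its cubic approximation up to fourth order in the
  size of the data (\<open>small_data_expansion\<close>). Hence a C3 solution mapping would bound the cubic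
  response (\<open>cubic_response_bounded\<close>).

  The response is large on nonnegative bumps of radius one. Its Fourier transform at the output
  frequency \<xi> is a factor \<i> \<xi> times the integral over time and over \<xi> = \<xi>1 + \<xi>2 + \<xi>3 of the product
  of the data with an oscillating factor, whose frequency is the resonance function
  a \<xi>1^3 + b \<xi>2^3 + b \<xi>3^3 - a \<xi>^3. Up to a time at which this factor is still close to one
  no cancellation takes place (\<open>cubic_response_lower_bound\<close>). If the first function has
  frequencies \<plusminus> 2 N and the second one \<plusminus> N, the output near 2 N is produced only by \<xi>2 + \<xi>3 close to 0.
  The resonance function is then O(N^2), and at time c N^(-2) normalized data produce a response of size
  N^(- 1 - 2 k). If the first function has frequency 0 and the second one frequencies 0 and \<plusminus> N, the
  resonance function is O(N^3), and the response at time c N^(-3) has size N^(s - k - 2). All bumps are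
  placed symmetrically, so that the data are real, and the argument is the same for the real and for the
  complex scalar field.

  Distributions are identified by their Fourier transforms throughout. This rests on the invariance
  of Schwartz space under the Fourier transform (\<open>schwartz_fourier\<close>), on Fourier inversion
  (\<open>inv_fourier_fourier\<close>) and on the uniqueness of a Fourier transform that is a function
  (\<open>has_fourier_unique\<close>), the latter two obtained by averaging with narrow Gaussians.
\<close>

section \<open>Seminormed spaces with explicit carriers\<close>

text \<open>
  Products, operator spaces and path spaces over seminormed spaces are again seminormed. This is
  what makes the threefold iterated operator space, in which a third derivative lives, accessible
  to the same small set of facts as the space of the data.
\<close>

locale seminormed =
  fixes X :: "'a::real_vector nspace"
  assumes vecs_subspace: "subspace (vecs X)"
    and vnorm_triangle: "\<lbrakk>x \<in> vecs X; y \<in> vecs X\<rbrakk> \<Longrightarrow> vnorm X (x + y) \<le> vnorm X x + vnorm X y"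
    and vnorm_scaleR: "x \<in> vecs X \<Longrightarrow> vnorm X (c *\<^sub>R x) = \<bar>c\<bar> * vnorm X x"
begin

lemma zero_vecs: "0 \<in> vecs X"
  and add_vecs: "\<lbrakk>x \<in> vecs X; y \<in> vecs X\<rbrakk> \<Longrightarrow> x + y \<in> vecs X"
  and diff_vecs: "\<lbrakk>x \<in> vecs X; y \<in> vecs X\<rbrakk> \<Longrightarrow> x - y \<in> vecs X"
  and scaleR_vecs: "x \<in> vecs X \<Longrightarrow> c *\<^sub>R x \<in> vecs X"
  using vecs_subspace subspace_0 subspace_add subspace_diff subspace_scale by auto

lemma vnorm_zero: "vnorm X 0 = 0"
  using vnorm_scaleR[of 0 0] zero_vecs by simp

lemma vnorm_minus: "x \<in> vecs X \<Longrightarrow> vnorm X (- x) = vnorm X x"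
  using vnorm_scaleR[of x "-1"] by simp

lemma vnorm_nonneg: "x \<in> vecs X \<Longrightarrow> 0 \<le> vnorm X x"
  using vnorm_triangle[of x "(-1) *\<^sub>R x"] vnorm_scaleR[of x "-1"] scaleR_vecs[of x "-1"] vnorm_zero
  by simp

lemma vnorm_reverse_triangle:
  assumes "x \<in> vecs X" "y \<in> vecs X"
  shows "\<bar>vnorm X x - vnorm X y\<bar> \<le> vnorm X (x - y)"
proof -
  have "vnorm X x \<le> vnorm X (x - y) + vnorm X y"
    using vnorm_triangle[of "x - y" y] diff_vecs assms by simp
  moreover have "vnorm X y \<le> vnorm X (y - x) + vnorm X x"
    using vnorm_triangle[of "y - x" x] diff_vecs assms by simp
  moreover have "vnorm X (y - x) = vnorm X (x - y)"
    using vnorm_minus[of "x - y"] diff_vecs assms by simp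
  ultimately show ?thesis by linarith
qed

end

lemma seminormed_prod_space:
  assumes "seminormed X" and "seminormed Y"
  shows "seminormed (prod_space X Y)"
proof -
  interpret X: seminormed X by fact
  interpret Y: seminormed Y by fact
  show ?thesis
  proof
    show "subspace (vecs (prod_space X Y))"
      by (auto simp: prod_space_def subspace_def zero_prod_def X.zero_vecs Y.zero_vecs X.add_vecs
          Y.add_vecs X.scaleR_vecs Y.scaleR_vecs)
  next
    fix p q assume "p \<in> vecs (prod_space X Y)" "q \<in> vecs (prod_space X Y)"
    then obtain x y x' y' where p: "p = (x, y)" and q: "q = (x', y')"
      and mem: "x \<in> vecs X" "y \<in> vecs Y" "x' \<in> vecs X" "y' \<in> vecs Y"
      by (auto simp: prod_space_def)
    have "sqrt ((vnorm X (x + x'))\<^sup>2 + (vnorm Y (y + y'))\<^sup>2)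
        \<le> sqrt ((vnorm X x + vnorm X x')\<^sup>2 + (vnorm Y y + vnorm Y y')\<^sup>2)"
      by (intro real_sqrt_le_mono add_mono power_mono X.vnorm_triangle Y.vnorm_triangle
          X.vnorm_nonneg Y.vnorm_nonneg X.add_vecs Y.add_vecs mem)
    also have "\<dots> \<le> sqrt ((vnorm X x)\<^sup>2 + (vnorm Y y)\<^sup>2) + sqrt ((vnorm X x')\<^sup>2 + (vnorm Y y')\<^sup>2)"
      by (rule real_sqrt_sum_squares_triangle_ineq)
    finally show "vnorm (prod_space X Y) (p + q) \<le> vnorm (prod_space X Y) p + vnorm (prod_space X Y) q"
      by (simp add: prod_space_def p q)
  next
    fix p c assume "p \<in> vecs (prod_space X Y)"
    then show "vnorm (prod_space X Y) (c *\<^sub>R p) = \<bar>c\<bar> * vnorm (prod_space X Y) p"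
      by (auto simp: prod_space_def X.vnorm_scaleR Y.vnorm_scaleR power_mult_distrib
          distrib_left[symmetric] real_sqrt_mult)
  qed
qed

lemma op_space_vecs_iff:
  "L \<in> vecs (op_space X Y) \<longleftrightarrow> (\<forall>x. x \<notin> vecs X \<longrightarrow> L x = 0) \<and> (\<forall>x\<in>vecs X. L x \<in> vecs Y)
     \<and> (\<forall>x\<in>vecs X. \<forall>y\<in>vecs X. L (x + y) = L x + L y)
     \<and> (\<forall>c. \<forall>x\<in>vecs X. L (c *\<^sub>R x) = c *\<^sub>R L x)
     \<and> (\<exists>B. \<forall>x\<in>vecs X. vnorm Y (L x) \<le> B * vnorm X x)"
  by (simp add: op_space_def)

lemma op_space_closed:
  assumes "L \<in> vecs (op_space X Y)" "x \<in> vecs X"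
  shows "L x \<in> vecs Y"
  using assms by (simp add: op_space_vecs_iff)

context
  fixes X :: "'a::real_vector nspace" and Y :: "'b::real_vector nspace"
  assumes X: "seminormed X" and Y: "seminormed Y"
begin

interpretation X: seminormed X by (rule X)
interpretation Y: seminormed Y by (rule Y)

text \<open>
  A supremum of reals only bounds its elements when they are bounded above. Here the bound in the
  definition of the carrier provides this.
\<close>

lemma vnorm_op_space_ge:
  assumes L: "L \<in> vecs (op_space X Y)" and x: "x \<in> vecs X" "vnorm X x \<le> 1"
  shows "vnorm Y (L x) \<le> vnorm (op_space X Y) L"
proof -
  obtain B where B: "\<And>x. x \<in> vecs X \<Longrightarrow> vnorm Y (L x) \<le> B * vnorm X x"
    using L unfolding op_space_vecs_iff by blast
  have "bdd_above ((\<lambda>x. vnorm Y (L x)) ` {x \<in> vecs X. vnorm X x \<le> 1})"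
  proof (rule bdd_aboveI2)
    fix z assume "z \<in> {x \<in> vecs X. vnorm X x \<le> 1}"
    then have "vnorm Y (L z) \<le> B * vnorm X z" "0 \<le> vnorm X z" "vnorm X z \<le> 1"
      using B X.vnorm_nonneg by auto
    then show "vnorm Y (L z) \<le> \<bar>B\<bar>"
      by (smt (verit) abs_ge_self mult_left_le mult_right_mono)
  qed
  then show ?thesis
    using x unfolding op_space_def by (auto intro!: cSUP_upper)
qed

lemma vnorm_op_space_upper:
  assumes L: "L \<in> vecs (op_space X Y)" and x: "x \<in> vecs X"
  shows "vnorm Y (L x) \<le> vnorm (op_space X Y) L * vnorm X x"
proof (cases "vnorm X x = 0")
  \<comment> \<open>A vector of seminorm zero cannot be scaled to the unit sphere.\<close>
  case True
  obtain B where "vnorm Y (L x) \<le> B * vnorm X x"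
    using L x unfolding op_space_vecs_iff by blast
  then show ?thesis using True by simp
next
  case False
  then have pos: "vnorm X x > 0" using X.vnorm_nonneg[OF x] by simp
  let ?u = "(1 / vnorm X x) *\<^sub>R x"
  have "vnorm Y (L ?u) \<le> vnorm (op_space X Y) L"
    using x pos by (intro vnorm_op_space_ge L) (simp_all add: X.scaleR_vecs X.vnorm_scaleR)
  moreover have "L ?u = (1 / vnorm X x) *\<^sub>R L x"
    using L x unfolding op_space_vecs_iff by blast
  ultimately show ?thesis
    using pos Y.vnorm_scaleR[OF op_space_closed[OF L x]] by (simp add: divide_simps)
qed

lemma vnorm_op_space_least:
  assumes "0 \<le> B" and "\<And>x. x \<in> vecs X \<Longrightarrow> vnorm Y (L x) \<le> B * vnorm X x"
  shows "vnorm (op_space X Y) L \<le> B"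
proof -
  have "vnorm Y (L x) \<le> B" if "x \<in> vecs X" "vnorm X x \<le> 1" for x
    using assms(2)[OF that(1)] that(2) assms(1) X.vnorm_nonneg[OF that(1)]
    by (smt (verit) mult_left_le)
  moreover have "{x \<in> vecs X. vnorm X x \<le> 1} \<noteq> {}"
    using X.zero_vecs X.vnorm_zero by force
  ultimately show ?thesis
    unfolding op_space_def by (auto intro!: cSUP_least)
qed

lemma vnorm_op_space_nonneg:
  assumes "L \<in> vecs (op_space X Y)"
  shows "0 \<le> vnorm (op_space X Y) L"
  using vnorm_op_space_ge[OF assms X.zero_vecs] Y.vnorm_nonneg[OF op_space_closed[OF assms X.zero_vecs]]
  by (simp add: X.vnorm_zero)

lemma seminormed_op_space: "seminormed (op_space X Y)"
proof
  have add: "L + L' \<in> vecs (op_space X Y)"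
    if L: "L \<in> vecs (op_space X Y)" and L': "L' \<in> vecs (op_space X Y)" for L L'
  proof -
    have "vnorm Y ((L + L') x) \<le> (vnorm (op_space X Y) L + vnorm (op_space X Y) L') * vnorm X x"
      if "x \<in> vecs X" for x
      using Y.vnorm_triangle[OF op_space_closed[OF L that] op_space_closed[OF L' that]]
        vnorm_op_space_upper[OF L that] vnorm_op_space_upper[OF L' that]
      by (simp add: distrib_right)
    then show ?thesis
      using L L' unfolding op_space_vecs_iff by (auto simp: Y.add_vecs scaleR_add_right)
  qed
  have scale: "c *\<^sub>R L \<in> vecs (op_space X Y)"
    if L: "L \<in> vecs (op_space X Y)" for L c
  proof -
    have "vnorm Y ((c *\<^sub>R L) x) \<le> (\<bar>c\<bar> * vnorm (op_space X Y) L) * vnorm X x"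
      if "x \<in> vecs X" for x
      using Y.vnorm_scaleR[OF op_space_closed[OF L that], of c] vnorm_op_space_upper[OF L that]
      by (simp add: scaleR_fun_def mult_left_mono mult.assoc)
    then show ?thesis
      using L unfolding op_space_vecs_iff
      by (auto simp: Y.scaleR_vecs scaleR_fun_def scaleR_add_right)
  qed
  have "(0 :: 'a \<Rightarrow> 'b) \<in> vecs (op_space X Y)"
    unfolding op_space_vecs_iff
    by (auto simp: Y.zero_vecs Y.vnorm_zero zero_fun_def X.vnorm_nonneg intro!: exI[of _ 0])
  then show "subspace (vecs (op_space X Y))"
    using add scale by (simp add: subspace_def)
  show "vnorm (op_space X Y) (L + L') \<le> vnorm (op_space X Y) L + vnorm (op_space X Y) L'"
    if L: "L \<in> vecs (op_space X Y)" and L': "L' \<in> vecs (op_space X Y)" for L L'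
  proof (rule vnorm_op_space_least)
    show "0 \<le> vnorm (op_space X Y) L + vnorm (op_space X Y) L'"
      using vnorm_op_space_nonneg L L' by simp
    show "vnorm Y ((L + L') x) \<le> (vnorm (op_space X Y) L + vnorm (op_space X Y) L') * vnorm X x"
      if "x \<in> vecs X" for x
      using Y.vnorm_triangle[OF op_space_closed[OF L that] op_space_closed[OF L' that]]
        vnorm_op_space_upper[OF L that] vnorm_op_space_upper[OF L' that]
      by (simp add: distrib_right)
  qed
  have le: "vnorm (op_space X Y) (c *\<^sub>R L) \<le> \<bar>c\<bar> * vnorm (op_space X Y) L"
    if L: "L \<in> vecs (op_space X Y)" for L c
  proof (rule vnorm_op_space_least)
    show "0 \<le> \<bar>c\<bar> * vnorm (op_space X Y) L"
      using vnorm_op_space_nonneg L by simp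
    show "vnorm Y ((c *\<^sub>R L) x) \<le> (\<bar>c\<bar> * vnorm (op_space X Y) L) * vnorm X x"
      if "x \<in> vecs X" for x
      using Y.vnorm_scaleR[OF op_space_closed[OF L that], of c] vnorm_op_space_upper[OF L that]
      by (simp add: scaleR_fun_def mult_left_mono mult.assoc)
  qed
  show "vnorm (op_space X Y) (c *\<^sub>R L) = \<bar>c\<bar> * vnorm (op_space X Y) L"
    if L: "L \<in> vecs (op_space X Y)" for L c
  proof (cases "c = 0")
    case True
    then show ?thesis using le[OF L, of 0] vnorm_op_space_nonneg[OF scale[OF L, of 0]] by simp
  next
    case False
    have "vnorm (op_space X Y) L \<le> \<bar>1 / c\<bar> * vnorm (op_space X Y) (c *\<^sub>R L)"
      using le[OF scale[OF L, of c], of "1 / c"] False by simp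
    then show ?thesis using le[OF L, of c] False by (simp add: divide_simps mult.commute)
  qed
qed

end

lemma path_space_vecs_iff:
  "u \<in> vecs (path_space T X) \<longleftrightarrow> (\<forall>t\<in>{0..T}. u t \<in> vecs X) \<and> (\<forall>t. t \<notin> {0..T} \<longrightarrow> u t = 0)
     \<and> (\<forall>t0\<in>{0..T}. ((\<lambda>t. vnorm X (u t - u t0)) \<longlongrightarrow> 0) (at t0 within {0..T}))"
  by (simp add: path_space_def)

text \<open>
  The norm of a path is a continuous function of time, hence bounded on the compact interval. So
  the supremum in the definition of the path norm is a genuine one.
\<close>

lemma path_space_upper:
  assumes X: "seminormed X" and T: "0 \<le> T" and u: "u \<in> vecs (path_space T X)" and t: "t \<in> {0..T}"
  shows "vnorm X (u t) \<le> vnorm (path_space T X) u"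
proof -
  interpret X: seminormed X by fact
  have mem: "u t \<in> vecs X" if "t \<in> {0..T}" for t using u that by (simp add: path_space_def)
  have "continuous_on {0..T} (\<lambda>t. vnorm X (u t))"
    unfolding continuous_on_def
  proof
    fix t0 assume t0: "t0 \<in> {0..T}"
    have "((\<lambda>t. vnorm X (u t - u t0)) \<longlongrightarrow> 0) (at t0 within {0..T})"
      using u t0 by (simp add: path_space_def)
    then have "((\<lambda>t. vnorm X (u t) - vnorm X (u t0)) \<longlongrightarrow> 0) (at t0 within {0..T})"
    proof (rule Lim_null_comparison[rotated])
      show "\<forall>\<^sub>F t in at t0 within {0..T}. norm (vnorm X (u t) - vnorm X (u t0)) \<le> vnorm X (u t - u t0)"
        using X.vnorm_reverse_triangle mem t0 by (auto simp: eventually_at_filter)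
    qed
    then show "((\<lambda>t. vnorm X (u t)) \<longlongrightarrow> vnorm X (u t0)) (at t0 within {0..T})"
      by (simp add: LIM_zero_iff)
  qed
  then have "compact ((\<lambda>t. vnorm X (u t)) ` {0..T})"
    by (rule compact_continuous_image) simp
  then have "bdd_above ((\<lambda>t. vnorm X (u t)) ` {0..T})"
    by (simp add: bounded_imp_bdd_above compact_imp_bounded)
  then show ?thesis
    using t unfolding path_space_def by (auto intro: cSUP_upper)
qed

lemma seminormed_path_space:
  assumes X: "seminormed X" and T: "0 \<le> T"
  shows "seminormed (path_space T X)"
proof -
  interpret X: seminormed X by fact
  have mem: "u t \<in> vecs X" if "u \<in> vecs (path_space T X)" "t \<in> {0..T}" for t u
    using that by (simp add: path_space_def)
  have lim: "((\<lambda>t. vnorm X (u t - u t0)) \<longlongrightarrow> 0) (at t0 within {0..T})"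
    if "u \<in> vecs (path_space T X)" "t0 \<in> {0..T}" for t0 u
    using that by (simp add: path_space_def)
  have off: "u t = 0" if "u \<in> vecs (path_space T X)" "t \<notin> {0..T}" for t u
    using that by (simp add: path_space_def)
  have add: "u + v \<in> vecs (path_space T X)"
    if u: "u \<in> vecs (path_space T X)" and v: "v \<in> vecs (path_space T X)" for u v
  proof -
    have "((\<lambda>t. vnorm X ((u + v) t - (u + v) t0)) \<longlongrightarrow> 0) (at t0 within {0..T})"
      if t0: "t0 \<in> {0..T}" for t0
    proof (rule Lim_null_comparison)
      show "((\<lambda>t. vnorm X (u t - u t0) + vnorm X (v t - v t0)) \<longlongrightarrow> 0) (at t0 within {0..T})"
        using tendsto_add[OF lim[OF u t0] lim[OF v t0]] by simp
      have "norm (vnorm X ((u + v) t - (u + v) t0)) \<le> vnorm X (u t - u t0) + vnorm X (v t - v t0)"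
        if t: "t \<in> {0..T}" for t
      proof -
        have eq: "(u + v) t - (u + v) t0 = (u t - u t0) + (v t - v t0)" by simp
        show ?thesis unfolding eq using mem u v t t0
          by (simp add: X.vnorm_triangle X.vnorm_nonneg X.diff_vecs X.add_vecs)
      qed
      then show "\<forall>\<^sub>F t in at t0 within {0..T}.
          norm (vnorm X ((u + v) t - (u + v) t0)) \<le> vnorm X (u t - u t0) + vnorm X (v t - v t0)"
        by (auto simp: eventually_at_filter)
    qed
    then show ?thesis
      unfolding path_space_vecs_iff using mem[OF u] mem[OF v] off[OF u] off[OF v] X.add_vecs
      by (simp del: atLeastAtMost_iff)
  qed
  have scale: "c *\<^sub>R u \<in> vecs (path_space T X)"
    if u: "u \<in> vecs (path_space T X)" for u c
  proof -
    have "((\<lambda>t. vnorm X ((c *\<^sub>R u) t - (c *\<^sub>R u) t0)) \<longlongrightarrow> 0) (at t0 within {0..T})"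
      if t0: "t0 \<in> {0..T}" for t0
    proof (rule Lim_null_comparison)
      show "((\<lambda>t. \<bar>c\<bar> * vnorm X (u t - u t0)) \<longlongrightarrow> 0) (at t0 within {0..T})"
        using tendsto_mult_left[OF lim[OF u t0], of "\<bar>c\<bar>"] by simp
      have "norm (vnorm X ((c *\<^sub>R u) t - (c *\<^sub>R u) t0)) \<le> \<bar>c\<bar> * vnorm X (u t - u t0)"
        if t: "t \<in> {0..T}" for t
      proof -
        have eq: "(c *\<^sub>R u) t - (c *\<^sub>R u) t0 = c *\<^sub>R (u t - u t0)"
          by (simp add: scaleR_fun_def scaleR_diff_right)
        show ?thesis unfolding eq using mem u t t0
          by (simp add: X.vnorm_scaleR X.vnorm_nonneg X.diff_vecs)
      qed
      then show "\<forall>\<^sub>F t in at t0 within {0..T}.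
          norm (vnorm X ((c *\<^sub>R u) t - (c *\<^sub>R u) t0)) \<le> \<bar>c\<bar> * vnorm X (u t - u t0)"
        by (auto simp: eventually_at_filter)
    qed
    then show ?thesis
      unfolding path_space_vecs_iff using mem[OF u] off[OF u] X.scaleR_vecs
      by (simp add: scaleR_fun_def del: atLeastAtMost_iff)
  qed
  have least: "vnorm (path_space T X) u \<le> B" if "\<And>t. t \<in> {0..T} \<Longrightarrow> vnorm X (u t) \<le> B" for u B
    using that T unfolding path_space_def by (auto intro!: cSUP_least)
  have le: "vnorm (path_space T X) (c *\<^sub>R u) \<le> \<bar>c\<bar> * vnorm (path_space T X) u"
    if u: "u \<in> vecs (path_space T X)" for u c
  proof (rule least)
    fix t assume t: "t \<in> {0..T}"
    show "vnorm X ((c *\<^sub>R u) t) \<le> \<bar>c\<bar> * vnorm (path_space T X) u"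
      using path_space_upper[OF X T u t] X.vnorm_scaleR[OF mem[OF u t]]
      by (simp add: scaleR_fun_def mult_left_mono)
  qed
  show ?thesis
  proof
    show "subspace (vecs (path_space T X))"
      using add scale by (simp add: subspace_def) (simp add: path_space_def X.zero_vecs X.vnorm_zero)
  next
    fix u v assume u: "u \<in> vecs (path_space T X)" and v: "v \<in> vecs (path_space T X)"
    show "vnorm (path_space T X) (u + v) \<le> vnorm (path_space T X) u + vnorm (path_space T X) v"
    proof (rule least)
      fix t assume t: "t \<in> {0..T}"
      show "vnorm X ((u + v) t) \<le> vnorm (path_space T X) u + vnorm (path_space T X) v"
        using path_space_upper[OF X T u t] path_space_upper[OF X T v t]
          X.vnorm_triangle[OF mem[OF u t] mem[OF v t]] by simp
    qed
  next
    fix u c assume u: "u \<in> vecs (path_space T X)"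
    show "vnorm (path_space T X) (c *\<^sub>R u) = \<bar>c\<bar> * vnorm (path_space T X) u"
    proof (cases "c = 0")
      case True
      have "0 \<le> vnorm (path_space T X) (0 *\<^sub>R u)"
        using path_space_upper[OF X T scale[OF u, of 0], of 0] T by (simp add: X.vnorm_zero)
      then show ?thesis using True le[OF u, of 0] by simp
    next
      case False
      have "vnorm (path_space T X) u \<le> \<bar>1 / c\<bar> * vnorm (path_space T X) (c *\<^sub>R u)"
        using le[OF scale[OF u, of c], of "1 / c"] False by simp
      then show ?thesis using le[OF u, of c] False by (simp add: divide_simps mult.commute)
    qed
  qed
qed

section \<open>The cubic Taylor coefficient of a C3 map\<close>

lemma vanishing_quadratic:
  fixes p q r K :: real
  assumes d: "d > 0" and bound: "\<And>h. \<lbrakk>0 < h; h < d\<rbrakk> \<Longrightarrow> \<bar>p * h + q * h\<^sup>2\<bar> \<le> K * h ^ 3"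
  shows "p = 0" "q = 0"
proof -
  have small: "\<forall>\<^sub>F h in at_right 0. 0 < h \<and> h < d"
    using d by (auto simp: eventually_at_right_field intro!: exI[of _ d])
  have "((\<lambda>h. p + q * h) \<longlongrightarrow> p + q * 0) (at_right 0)"
    by (intro tendsto_intros)
  moreover have "((\<lambda>h. p + q * h) \<longlongrightarrow> 0) (at_right 0)"
  proof (rule Lim_null_comparison)
    have "((\<lambda>h. K * h\<^sup>2) \<longlongrightarrow> K * 0\<^sup>2) (at_right (0::real))"
      by (intro tendsto_intros)
    then show "((\<lambda>h. K * h\<^sup>2) \<longlongrightarrow> 0) (at_right (0::real))" by simp
    show "\<forall>\<^sub>F h in at_right 0. norm (p + q * h) \<le> K * h\<^sup>2"
      using small
    proof eventually_elim
      case (elim h)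
      have "\<bar>(p + q * h) * h\<bar> \<le> (K * h\<^sup>2) * h"
        using bound[of h] elim by (simp add: power2_eq_square power3_eq_cube algebra_simps)
      then show ?case using elim by (simp add: abs_mult)
    qed
  qed
  ultimately show p: "p = 0"
    using tendsto_unique[of "at_right (0::real)"] by fastforce
  have "((\<lambda>h. q) \<longlongrightarrow> 0) (at_right (0::real))"
  proof (rule Lim_null_comparison)
    have "((\<lambda>h. K * h) \<longlongrightarrow> K * 0) (at_right (0::real))"
      by (intro tendsto_intros)
    then show "((\<lambda>h. K * h) \<longlongrightarrow> 0) (at_right (0::real))" by simp
    show "\<forall>\<^sub>F h in at_right 0. norm q \<le> K * h"
      using small
    proof eventually_elim
      case (elim h)
      have "\<bar>q\<bar> * h\<^sup>2 \<le> (K * h) * h\<^sup>2"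
        using bound[of h] elim p by (simp add: power2_eq_square power3_eq_cube algebra_simps abs_mult)
      then show ?case using elim by simp
    qed
  qed
  then show "q = 0"
    using tendsto_unique[of "at_right (0::real)" "\<lambda>h. q" 0 q] by simp
qed

text \<open>
  Subtracting the cubic reduces the claim to the case of a function D of size O(x^4), for which all
  derivatives at 0 up to the third one must vanish. Taylor's formula with remainder shows this: it
  first gives a quadratic polynomial of size O(h^3), which is zero, and then a third derivative at
  points tending to 0 of size O(h).
\<close>

lemma third_derivative_eq_cubic_coefficient:
  fixes g g1 g2 g3 :: "real \<Rightarrow> real"
  assumes d: "d > 0"
    and g1: "\<And>x. \<bar>x\<bar> < d \<Longrightarrow> (g has_real_derivative g1 x) (at x)"
    and g2: "\<And>x. \<bar>x\<bar> < d \<Longrightarrow> (g1 has_real_derivative g2 x) (at x)"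
    and g3: "\<And>x. \<bar>x\<bar> < d \<Longrightarrow> (g2 has_real_derivative g3 x) (at x)"
    and cont: "isCont g3 0"
    and bound: "\<And>x. \<bar>x\<bar> < d \<Longrightarrow> \<bar>g x - (a * x + b * x ^ 3)\<bar> \<le> K * x ^ 4"
  shows "g3 0 = 6 * b"
proof -
  define D where "D m = (if m = 0 then (\<lambda>x. g x - (a * x + b * x ^ 3))
     else if m = 1 then (\<lambda>x. g1 x - (a + 3 * b * x\<^sup>2))
     else if m = 2 then (\<lambda>x. g2 x - 6 * b * x) else (\<lambda>x. g3 x - 6 * b))" for m :: nat
  have D: "(D m has_real_derivative D (Suc m) x) (at x)" if "m < 3" "\<bar>x\<bar> < d" for m x
  proof -
    have "m = 0 \<or> m = 1 \<or> m = 2" using that(1) by linarith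
    then consider "m = 0" | "m = 1" | "m = 2" by blast
    then show ?thesis
    proof cases
      case 1
      then show ?thesis using g1[OF that(2)] unfolding D_def
        by (auto intro!: derivative_eq_intros)
    next
      case 2
      then show ?thesis using g2[OF that(2)] unfolding D_def
        by (auto intro!: derivative_eq_intros)
    next
      case 3
      then show ?thesis using g3[OF that(2)] unfolding D_def
        by (auto intro!: derivative_eq_intros)
    qed
  qed
  have D_sums: "(\<Sum>m<3. D m 0 / fact m * h ^ m) = D 0 0 + D 1 0 * h + D 2 0 / 2 * h\<^sup>2" for h
    by (simp add: eval_nat_numeral)
  have D00: "D 0 0 = 0" using bound[of 0] d by (simp add: D_def)
  have mac: "\<exists>t. 0 < t \<and> t < h \<and> D 0 h = D 1 0 * h + D 2 0 / 2 * h\<^sup>2 + D 3 t / 6 * h ^ 3"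
    if "0 < h" "h < d" for h
  proof -
    have "\<exists>t. 0 < t \<and> t < h \<and> D 0 h = (\<Sum>m<3. D m 0 / fact m * h ^ m) + D 3 t / fact 3 * h ^ 3"
      by (rule Maclaurin) (use that D in auto)
    then show ?thesis unfolding D_sums D00 by (simp add: eval_nat_numeral)
  qed
  have contD: "isCont (D 3) 0" using cont by (simp add: D_def)
  obtain e where e: "e > 0" and e1: "\<And>x. \<bar>x\<bar> < e \<Longrightarrow> \<bar>D 3 x - D 3 0\<bar> < 1"
    using contD[unfolded continuous_at_eps_delta, rule_format, of 1] by (auto simp: dist_real_def)
  have D0: "\<bar>D 0 x\<bar> \<le> K * x ^ 4" if "\<bar>x\<bar> < d" for x using bound[OF that] by (simp add: D_def)
  have "K \<ge> 0"
    using D0[of "d/2"] d by (smt (verit, best) field_sum_of_halves mult_neg_pos zero_less_power abs_ge_zero half_gt_zero)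
  let ?B = "K + (\<bar>D 3 0\<bar> + 1) / 6"
  have key: "\<bar>D 1 0 * h + D 2 0 / 2 * h\<^sup>2\<bar> \<le> ?B * h ^ 3" if h: "0 < h" "h < min (min d e) 1" for h
  proof -
    obtain t where t: "0 < t" "t < h"
      and eq: "D 0 h = D 1 0 * h + D 2 0 / 2 * h\<^sup>2 + D 3 t / 6 * h ^ 3"
      using mac[of h] h by auto
    have "\<bar>D 3 t\<bar> \<le> \<bar>D 3 0\<bar> + 1" using e1[of t] t h by linarith
    then have "\<bar>D 3 t / 6 * h ^ 3\<bar> \<le> (\<bar>D 3 0\<bar> + 1) / 6 * h ^ 3"
      using h by (simp add: abs_mult)
    moreover have "K * h ^ 4 \<le> K * h ^ 3"
      using h \<open>K \<ge> 0\<close> by (intro mult_left_mono power_decreasing) auto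
    ultimately have "\<bar>D 1 0 * h + D 2 0 / 2 * h\<^sup>2\<bar> \<le> K * h ^ 3 + (\<bar>D 3 0\<bar> + 1) / 6 * h ^ 3"
      using D0[of h] h unfolding eq by linarith
    then show ?thesis by (simp add: distrib_right)
  qed
  have D1: "D 1 0 = 0" and D2: "D 2 0 / 2 = 0"
    using vanishing_quadratic[of "min (min d e) 1" "D 1 0" "D 2 0 / 2" ?B] key d e by auto
  have "\<bar>D 3 0\<bar> \<le> \<epsilon>" if "\<epsilon> > 0" for \<epsilon>
  proof -
    obtain \<delta> where \<delta>: "\<delta> > 0" and close: "\<And>x. \<bar>x\<bar> < \<delta> \<Longrightarrow> \<bar>D 3 x - D 3 0\<bar> < \<epsilon> / 2"
      using contD[unfolded continuous_at_eps_delta, rule_format, of "\<epsilon> / 2"] \<open>\<epsilon> > 0\<close>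
      by (auto simp: dist_real_def)
    define h where "h = min (min d \<delta>) (\<epsilon> / (12 * (K + 1))) / 2"
    have h: "0 < h" "h < d" "h < \<delta>" using d \<delta> \<open>K \<ge> 0\<close> \<open>\<epsilon> > 0\<close> by (auto simp: h_def min_def)
    have "h \<le> \<epsilon> / (12 * (K + 1))" using h(1) unfolding h_def by linarith
    then have "12 * (h * (K + 1)) \<le> \<epsilon>" using \<open>K \<ge> 0\<close> by (simp add: field_simps)
    then have Kh: "6 * (K * h) \<le> \<epsilon> / 2" using h(1) by (simp add: algebra_simps)
    obtain t where t: "0 < t" "t < h" and eq: "D 0 h = D 3 t / 6 * h ^ 3"
      using mac[OF h(1,2)] D1 D2 by auto
    have "\<bar>D 3 t / 6\<bar> * h ^ 3 \<le> (K * h) * h ^ 3"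
      using D0[of h] h eq by (simp add: abs_mult power_eq_if algebra_simps)
    then have "\<bar>D 3 t / 6\<bar> \<le> K * h" using h by simp
    then show ?thesis using close[of t] t h Kh by linarith
  qed
  then have "D 3 0 = 0" by (metis abs_le_zero_iff dense_le linorder_not_le abs_ge_zero less_irrefl dense_ge)
  then show ?thesis by (simp add: D_def)
qed

definition bdd_functional :: "'b::real_vector nspace \<Rightarrow> ('b \<Rightarrow> real) \<Rightarrow> real \<Rightarrow> bool" where
  "bdd_functional Y l C \<longleftrightarrow> 0 \<le> C
     \<and> (\<forall>x\<in>vecs Y. \<forall>y\<in>vecs Y. l (x + y) = l x + l y)
     \<and> (\<forall>c. \<forall>x\<in>vecs Y. l (c *\<^sub>R x) = c * l x)
     \<and> (\<forall>x\<in>vecs Y. \<bar>l x\<bar> \<le> C * vnorm Y x)"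

lemma bdd_functional_diff:
  assumes "seminormed Y" "bdd_functional Y l C" "x \<in> vecs Y" "y \<in> vecs Y"
  shows "l (x - y) = l x - l y"
proof -
  interpret Y: seminormed Y by fact
  have "l ((x - y) + y) = l (x - y) + l y"
    using assms Y.diff_vecs unfolding bdd_functional_def by blast
  then show ?thesis by simp
qed

lemma bdd_functional_comp:
  assumes l: "bdd_functional X l C" and mem: "\<And>y. y \<in> vecs Y \<Longrightarrow> P y \<in> vecs X"
    and add: "\<And>y z. P (y + z) = P y + P z" and scale: "\<And>c y. P (c *\<^sub>R y) = c *\<^sub>R P y"
    and le: "\<And>y. y \<in> vecs Y \<Longrightarrow> vnorm X (P y) \<le> K * vnorm Y y" and K: "0 \<le> K"
  shows "bdd_functional Y (\<lambda>y. l (P y)) (C * K)"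
proof -
  have C: "0 \<le> C" using l by (simp add: bdd_functional_def)
  have "\<bar>l (P y)\<bar> \<le> C * K * vnorm Y y" if y: "y \<in> vecs Y" for y
  proof -
    have "\<bar>l (P y)\<bar> \<le> C * vnorm X (P y)" using l mem[OF y] unfolding bdd_functional_def by blast
    also have "\<dots> \<le> C * (K * vnorm Y y)" by (intro mult_left_mono le y C)
    finally show ?thesis by (simp add: mult.assoc)
  qed
  then show ?thesis
    using l mem C K unfolding bdd_functional_def by (simp add: add scale)
qed

lemma bdd_functional_op_space:
  assumes X: "seminormed X" and Y: "seminormed Y" and l: "bdd_functional Y l C" and h: "h \<in> vecs X"
  shows "bdd_functional (op_space X Y) (\<lambda>L. l (L h)) (C * vnorm X h)"
proof (rule bdd_functional_comp[OF l, where P = "\<lambda>L. L h"])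
  show "L h \<in> vecs Y" if "L \<in> vecs (op_space X Y)" for L using that h by (rule op_space_closed)
  show "vnorm Y (L h) \<le> vnorm X h * vnorm (op_space X Y) L" if "L \<in> vecs (op_space X Y)" for L
    using vnorm_op_space_upper[OF X Y that h] by (simp add: mult.commute)
qed (simp_all add: scaleR_fun_def seminormed.vnorm_nonneg[OF X h])

text \<open>
  The chain rule along a line through the origin. It turns a Frechet derivative with values in a
  seminormed space into an ordinary derivative of a real function of one variable.
\<close>

lemma has_frechet_line:
  assumes X: "seminormed X" and Y: "seminormed Y" and l: "bdd_functional Y l C" and h: "h \<in> vecs X"
    and f: "has_frechet X Y f L (\<tau> *\<^sub>R h)"
    and d: "d > 0" and mem: "\<And>x. \<bar>x - \<tau>\<bar> < d \<Longrightarrow> f (x *\<^sub>R h) \<in> vecs Y"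
  shows "((\<lambda>x. l (f (x *\<^sub>R h))) has_real_derivative l (L h)) (at \<tau>)"
proof -
  interpret X: seminormed X by fact
  interpret Y: seminormed Y by fact
  have L: "L \<in> vecs (op_space X Y)" using f by (simp add: has_frechet_def)
  have C: "C \<ge> 0" using l by (simp add: bdd_functional_def)
  have "\<exists>d>0. \<forall>x. norm (x - \<tau>) < d \<longrightarrow>
      norm (l (f (x *\<^sub>R h)) - l (f (\<tau> *\<^sub>R h)) - l (L h) * (x - \<tau>)) \<le> e * norm (x - \<tau>)" if e: "e > 0" for e
  proof -
    define n where "n = vnorm X h"
    have n: "n \<ge> 0" using X.vnorm_nonneg h by (simp add: n_def)
    define e' where "e' = e / ((C + 1) * (n + 1))"
    have e': "e' > 0" using e C n by (simp add: e'_def)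
    obtain d' where d': "d' > 0" and fr: "\<And>k. k \<in> vecs X \<Longrightarrow> vnorm X k < d' \<Longrightarrow>
        vnorm Y (f (\<tau> *\<^sub>R h + k) - f (\<tau> *\<^sub>R h) - L k) \<le> e' * vnorm X k"
      using f e' unfolding has_frechet_def by blast
    show ?thesis
    proof (intro exI[of _ "min d (d' / (n + 1))"] conjI allI impI)
      show "min d (d' / (n + 1)) > 0" using d d' n by simp
      fix x assume x: "norm (x - \<tau>) < min d (d' / (n + 1))"
      define k where "k = (x - \<tau>) *\<^sub>R h"
      have k: "k \<in> vecs X" using h X.scaleR_vecs by (simp add: k_def)
      have nk: "vnorm X k = \<bar>x - \<tau>\<bar> * n" using h X.vnorm_scaleR by (simp add: k_def n_def)
      have "\<bar>x - \<tau>\<bar> * (n + 1) < d'" using x n by (simp add: field_simps)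
      then have small: "vnorm X k < d'" using nk by (simp add: algebra_simps)
      have xk: "\<tau> *\<^sub>R h + k = x *\<^sub>R h" by (simp add: k_def algebra_simps)
      have m1: "f (x *\<^sub>R h) \<in> vecs Y" and m2: "f (\<tau> *\<^sub>R h) \<in> vecs Y" using mem x d by auto
      have Lk: "L k = (x - \<tau>) *\<^sub>R L h" using L h unfolding op_space_vecs_iff k_def by blast
      have mLk: "L k \<in> vecs Y" and mLh: "L h \<in> vecs Y" using op_space_closed[OF L] k h by auto
      have "l (L k) = (x - \<tau>) * l (L h)" using l mLh unfolding Lk bdd_functional_def by blast
      then have eq: "l (f (x *\<^sub>R h)) - l (f (\<tau> *\<^sub>R h)) - l (L h) * (x - \<tau>)
          = l (f (x *\<^sub>R h) - f (\<tau> *\<^sub>R h) - L k)"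
        using m1 m2 mLk Y.diff_vecs by (simp add: bdd_functional_diff[OF Y l])
      have "\<bar>l (f (x *\<^sub>R h) - f (\<tau> *\<^sub>R h) - L k)\<bar> \<le> C * vnorm Y (f (x *\<^sub>R h) - f (\<tau> *\<^sub>R h) - L k)"
        using l m1 m2 mLk Y.diff_vecs unfolding bdd_functional_def by blast
      also have "\<dots> \<le> C * (e' * (\<bar>x - \<tau>\<bar> * n))"
        using fr[OF k small] C unfolding xk nk by (rule mult_left_mono)
      also have "\<dots> = (e * \<bar>x - \<tau>\<bar>) * ((C / (C + 1)) * (n / (n + 1)))"
        using C n by (simp add: e'_def divide_simps)
      also have "\<dots> \<le> (e * \<bar>x - \<tau>\<bar>) * (1 * 1)"
        using e C n by (intro mult_left_mono mult_mono) auto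
      finally show "norm (l (f (x *\<^sub>R h)) - l (f (\<tau> *\<^sub>R h)) - l (L h) * (x - \<tau>)) \<le> e * norm (x - \<tau>)"
        using eq by simp
    qed
  qed
  then show ?thesis
    unfolding has_field_derivative_def has_derivative_at_alt by (auto intro: bounded_linear_mult_right)
qed

text \<open>
  Composing f with the line through h and with a functional l gives a real function whose third
  derivative at 0 is the third Frechet derivative at 0, evaluated at (h, h, h) and tested with l.
  The former is 6 b, and the latter is bounded because a Frechet derivative is a bounded
  multilinear map. The constant M depends only on f, which is what makes the estimate useful.
\<close>

lemma C3_at_cubic_coefficient:
  assumes X: "seminormed X" and Y: "seminormed Y" and f: "C3_at X Y f 0"
  obtains M where "M \<ge> 0" and "\<And>h l C a b K d. \<lbrakk>h \<in> vecs X; bdd_functional Y l C; d > 0;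
      \<And>x. \<bar>x\<bar> < d \<Longrightarrow> f (x *\<^sub>R h) \<in> vecs Y;
      \<And>x. \<bar>x\<bar> < d \<Longrightarrow> \<bar>l (f (x *\<^sub>R h)) - (a * x + b * x ^ 3)\<bar> \<le> K * x ^ 4\<rbrakk>
      \<Longrightarrow> \<bar>b\<bar> \<le> M * C * vnorm X h ^ 3"
proof -
  interpret X: seminormed X by fact
  interpret Y: seminormed Y by fact
  let ?Y1 = "op_space X Y" and ?Y2 = "op_space X (op_space X Y)"
  let ?Y3 = "op_space X (op_space X (op_space X Y))"
  note Y1 = seminormed_op_space[OF X Y]
  note Y2 = seminormed_op_space[OF X Y1]
  note Y3 = seminormed_op_space[OF X Y2]
  interpret Y3: seminormed ?Y3 by (rule Y3)
  obtain r f1 f2 f3 where r: "r > 0"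
    and F1: "\<And>x. x \<in> vball X 0 r \<Longrightarrow> has_frechet X Y f (f1 x) x"
    and F2: "\<And>x. x \<in> vball X 0 r \<Longrightarrow> has_frechet X ?Y1 f1 (f2 x) x"
    and F3: "\<And>x. x \<in> vball X 0 r \<Longrightarrow> has_frechet X ?Y2 f2 (f3 x) x"
    and cont: "vcontinuous_at X ?Y3 f3 0"
    using f unfolding C3_at_def by blast
  have ball: "x \<in> vecs X \<Longrightarrow> vnorm X x < r \<Longrightarrow> x \<in> vball X 0 r" for x by (simp add: vball_def)
  have m1: "f1 x \<in> vecs ?Y1" and m2: "f2 x \<in> vecs ?Y2" and m3: "f3 x \<in> vecs ?Y3"
    if "x \<in> vball X 0 r" for x
    using F1[OF that] F2[OF that] F3[OF that] by (auto simp: has_frechet_def)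
  have zb: "0 \<in> vball X 0 r" using r by (intro ball X.zero_vecs) (simp add: X.vnorm_zero)
  show ?thesis
  proof (rule that[of "vnorm ?Y3 (f3 0)"])
    show "vnorm ?Y3 (f3 0) \<ge> 0" by (intro Y3.vnorm_nonneg m3 zb)
    fix h l C a b K d
    assume h: "h \<in> vecs X" and l: "bdd_functional Y l C" and d: "d > (0::real)"
      and mem: "\<And>x. \<bar>x\<bar> < d \<Longrightarrow> f (x *\<^sub>R h) \<in> vecs Y"
      and bound: "\<And>x. \<bar>x\<bar> < d \<Longrightarrow> \<bar>l (f (x *\<^sub>R h)) - (a * x + b * x ^ 3)\<bar> \<le> K * x ^ 4"
    define n where "n = vnorm X h"
    have n: "n \<ge> 0" using X.vnorm_nonneg h by (simp add: n_def)
    define \<delta> where "\<delta> = min d (r / (n + 1))"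
    have \<delta>: "\<delta> > 0" using d r n by (simp add: \<delta>_def)
    have inb: "x *\<^sub>R h \<in> vball X 0 r" if "\<bar>x\<bar> < \<delta>" for x
    proof (rule ball)
      have "\<bar>x\<bar> * (n + 1) < r" using that n by (simp add: \<delta>_def field_simps)
      then show "vnorm X (x *\<^sub>R h) < r" 
        using X.vnorm_scaleR[OF h, of x] by (simp add: n_def algebra_simps)
    qed (simp add: X.scaleR_vecs h)
    \<comment> \<open>Evaluating at h once, twice and three times gives functionals on the spaces of f1, f2 and f3.\<close>
    note l1 = bdd_functional_op_space[OF X Y l h]
    note l2 = bdd_functional_op_space[OF X Y1 l1 h]
    note l3 = bdd_functional_op_space[OF X Y2 l2 h]
    have near: "\<exists>e>0. \<forall>y. \<bar>y - x\<bar> < e \<longrightarrow> \<bar>y\<bar> < \<delta>" if "\<bar>x\<bar> < \<delta>" for x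
      using that by (intro exI[of _ "\<delta> - \<bar>x\<bar>"]) auto
    have "l (f3 (0 *\<^sub>R h) h h h) = 6 * b"
    proof (rule third_derivative_eq_cubic_coefficient[OF \<delta>])
      fix x assume x: "\<bar>x\<bar> < \<delta>"
      obtain e where e: "e > 0" and ne: "\<And>y. \<bar>y - x\<bar> < e \<Longrightarrow> \<bar>y\<bar> < \<delta>"
        using near[OF x] by blast
      show "((\<lambda>x. l (f (x *\<^sub>R h))) has_real_derivative l (f1 (x *\<^sub>R h) h)) (at x)"
        by (rule has_frechet_line[OF X Y l h F1[OF inb[OF x]] e]) (use ne mem in \<open>auto simp: \<delta>_def\<close>)
      show "((\<lambda>x. l (f1 (x *\<^sub>R h) h)) has_real_derivative l (f2 (x *\<^sub>R h) h h)) (at x)"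
        by (rule has_frechet_line[OF X Y1 l1 h F2[OF inb[OF x]] e]) (use ne m1 inb in auto)
      show "((\<lambda>x. l (f2 (x *\<^sub>R h) h h)) has_real_derivative l (f3 (x *\<^sub>R h) h h h)) (at x)"
        by (rule has_frechet_line[OF X Y2 l2 h F3[OF inb[OF x]] e]) (use ne m2 inb in auto)
      show "\<bar>l (f (x *\<^sub>R h)) - (a * x + b * x ^ 3)\<bar> \<le> K * x ^ 4"
        using bound x by (simp add: \<delta>_def)
    next
      let ?C3 = "C * vnorm X h * vnorm X h * vnorm X h"
      have C3: "?C3 \<ge> 0" using l3 by (simp add: bdd_functional_def)
      show "isCont (\<lambda>x. l (f3 (x *\<^sub>R h) h h h)) 0"
        unfolding continuous_at_eps_delta
      proof (intro allI impI)
        fix e :: real assume e: "e > 0"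
        have "e / (?C3 + 1) > 0" using e C3 by simp
        then obtain d1 where d1: "d1 > 0" and close: "\<And>k. k \<in> vecs X \<Longrightarrow> vnorm X k < d1 \<Longrightarrow>
            vnorm ?Y3 (f3 (0 + k) - f3 0) < e / (?C3 + 1)"
          using cont unfolding vcontinuous_at_def by blast
        show "\<exists>d>0. \<forall>x'. dist x' 0 < d \<longrightarrow> dist (l (f3 (x' *\<^sub>R h) h h h)) (l (f3 (0 *\<^sub>R h) h h h)) < e"
        proof (intro exI[of _ "min \<delta> (d1 / (n + 1))"] conjI allI impI)
          show "min \<delta> (d1 / (n + 1)) > 0" using \<delta> d1 n by simp
          fix x :: real assume x: "dist x 0 < min \<delta> (d1 / (n + 1))"
          have "\<bar>x\<bar> * (n + 1) < d1" using x n by (simp add: field_simps)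
          then have "vnorm X (x *\<^sub>R h) < d1"
            using X.vnorm_scaleR[OF h, of x] by (simp add: n_def algebra_simps)
          then have cl: "vnorm ?Y3 (f3 (x *\<^sub>R h) - f3 0) < e / (?C3 + 1)"
            using close[of "x *\<^sub>R h"] h X.scaleR_vecs by simp
          have mx: "f3 (x *\<^sub>R h) \<in> vecs ?Y3" and m0: "f3 0 \<in> vecs ?Y3"
            using m3 inb x zb by auto
          have "\<bar>l (f3 (x *\<^sub>R h) h h h) - l (f3 0 h h h)\<bar> = \<bar>l ((f3 (x *\<^sub>R h) - f3 0) h h h)\<bar>"
            using bdd_functional_diff[OF Y3 l3 mx m0] by simp
          also have "\<dots> \<le> ?C3 * vnorm ?Y3 (f3 (x *\<^sub>R h) - f3 0)"
            using l3 Y3.diff_vecs[OF mx m0] unfolding bdd_functional_def by blast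
          also have "\<dots> \<le> ?C3 * (e / (?C3 + 1))"
            using cl C3 by (intro mult_left_mono) auto
          also have "\<dots> < e" using e C3 by (simp add: divide_simps)
          finally show "dist (l (f3 (x *\<^sub>R h) h h h)) (l (f3 (0 *\<^sub>R h) h h h)) < e"
            by (simp add: dist_real_def)
        qed
      qed
    qed
    moreover have "\<bar>l (f3 0 h h h)\<bar> \<le> (C * vnorm X h * vnorm X h * vnorm X h) * vnorm ?Y3 (f3 0)"
      using l3 m3[OF zb] unfolding bdd_functional_def by blast
    moreover have "0 \<le> (C * vnorm X h * vnorm X h * vnorm X h) * vnorm ?Y3 (f3 0)"
      using calculation(2) abs_ge_zero order_trans by blast
    ultimately have "\<bar>b\<bar> \<le> (C * vnorm X h * vnorm X h * vnorm X h) * vnorm ?Y3 (f3 0)"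
      by (simp add: abs_mult)
    then show "\<bar>b\<bar> \<le> vnorm ?Y3 (f3 0) * C * vnorm X h ^ 3"
      by (simp add: power3_eq_cube algebra_simps)
  qed
qed

section \<open>Schwartz functions and their Fourier transforms\<close>

lemma nderiv_0: "nderiv 0 f = f"
  by (simp add: nderiv_def)

lemma nderiv_Suc: "nderiv (Suc n) f = (\<lambda>x. vector_derivative (nderiv n f) (at x))"
  by (simp add: nderiv_def)

lemma nderiv_Suc_shift: "nderiv (Suc n) f = nderiv n (nderiv 1 f)"
  by (simp only: nderiv_def funpow_Suc_right o_apply One_nat_def funpow_0)

lemma nderiv_1_eqI: "(\<And>x. (f has_vector_derivative f' x) (at x)) \<Longrightarrow> nderiv 1 f = f'"
  by (auto simp: nderiv_Suc nderiv_0 fun_eq_iff intro: vector_derivative_at)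

text \<open>
  A class of functions whose weighted suprema are finite and which is closed under differentiation
  consists of Schwartz functions. This avoids all computations with higher derivatives: closure
  properties of Schwartz space follow by exhibiting a suitable class.
\<close>

lemma schwartz_coinduct:
  assumes "A \<phi>"
    and deriv: "\<And>f. A f \<Longrightarrow> \<exists>f'. A f' \<and> (\<forall>x. (f has_vector_derivative f' x) (at x))"
    and bdd: "\<And>f m. A f \<Longrightarrow> bounded (range (\<lambda>x. x ^ m *\<^sub>R f x))"
  shows "schwartz \<phi>"
proof -
  have A: "A (nderiv n \<phi>)" for n
  proof (induction n)
    case 0
    then show ?case using assms(1) by (simp add: nderiv_0)
  next
    case (Suc n)
    obtain f' where "A f'" "\<forall>x. (nderiv n \<phi> has_vector_derivative f' x) (at x)"
      using deriv[OF Suc] by blast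
    moreover from this have "nderiv (Suc n) \<phi> = f'"
      by (simp add: nderiv_Suc vector_derivative_at fun_eq_iff)
    ultimately show ?case by simp
  qed
  have "nderiv n \<phi> differentiable at x" for n x
    using deriv[OF A] by (meson differentiableI_vector)
  then show ?thesis
    using bdd[OF A] by (simp add: schwartz_def)
qed

lemma schwartz_has_deriv:
  assumes "schwartz \<phi>"
  shows "(\<phi> has_vector_derivative nderiv 1 \<phi> x) (at x)"
proof -
  have "nderiv 0 \<phi> differentiable at x" using assms unfolding schwartz_def by blast
  then show ?thesis by (simp add: nderiv_0 nderiv_Suc vector_derivative_works)
qed

lemma schwartz_nderiv_1: "schwartz \<phi> \<Longrightarrow> schwartz (nderiv 1 \<phi>)"
  unfolding schwartz_def nderiv_Suc_shift[symmetric] by blast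

lemma schwartz_bounded: "schwartz \<phi> \<Longrightarrow> bounded (range (\<lambda>x. x ^ m *\<^sub>R \<phi> x))"
  unfolding schwartz_def by (metis nderiv_0)

lemma schwartz_continuous: "schwartz \<phi> \<Longrightarrow> continuous_on A \<phi>"
  by (meson continuous_at_imp_continuous_on has_vector_derivative_continuous schwartz_has_deriv)

lemma schwartz_measurable [measurable_dest]: "schwartz \<phi> \<Longrightarrow> \<phi> \<in> borel_measurable borel"
  by (simp add: borel_measurable_continuous_onI schwartz_continuous)

lemma schwartz_lincomb:
  assumes "schwartz \<phi>" "schwartz \<psi>"
  shows "schwartz (\<lambda>x. a * \<phi> x + b * \<psi> x)"
proof (rule schwartz_coinduct[where A = "\<lambda>f. \<exists>\<phi> \<psi>. schwartz \<phi> \<and> schwartz \<psi> \<and> f = (\<lambda>x. a * \<phi> x + b * \<psi> x)"])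
  show "\<exists>\<phi>' \<psi>'. schwartz \<phi>' \<and> schwartz \<psi>' \<and> (\<lambda>x. a * \<phi> x + b * \<psi> x) = (\<lambda>x. a * \<phi>' x + b * \<psi>' x)"
    using assms by blast
next
  fix f assume "\<exists>\<phi> \<psi>. schwartz \<phi> \<and> schwartz \<psi> \<and> f = (\<lambda>x. a * \<phi> x + b * \<psi> x)"
  then obtain \<phi> \<psi> where \<phi>: "schwartz \<phi>" and \<psi>: "schwartz \<psi>" and f: "f = (\<lambda>x. a * \<phi> x + b * \<psi> x)"
    by blast
  show "\<exists>f'. (\<exists>\<phi> \<psi>. schwartz \<phi> \<and> schwartz \<psi> \<and> f' = (\<lambda>x. a * \<phi> x + b * \<psi> x))
      \<and> (\<forall>x. (f has_vector_derivative f' x) (at x))"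
  proof (rule exI[of _ "\<lambda>x. a * nderiv 1 \<phi> x + b * nderiv 1 \<psi> x"], intro conjI allI)
    show "(f has_vector_derivative a * nderiv 1 \<phi> x + b * nderiv 1 \<psi> x) (at x)" for x
      unfolding f
      by (intro has_vector_derivative_add has_vector_derivative_mult_right schwartz_has_deriv \<phi> \<psi>)
    show "\<exists>\<phi>' \<psi>'. schwartz \<phi>' \<and> schwartz \<psi>' \<and>
        (\<lambda>x. a * nderiv 1 \<phi> x + b * nderiv 1 \<psi> x) = (\<lambda>x. a * \<phi>' x + b * \<psi>' x)"
      by (intro exI[of _ "nderiv 1 \<phi>"] exI[of _ "nderiv 1 \<psi>"] conjI schwartz_nderiv_1 \<phi> \<psi> refl)
  qed
  fix m
  have "bounded (range (\<lambda>x. a * (x ^ m *\<^sub>R \<phi> x)))" "bounded (range (\<lambda>x. b * (x ^ m *\<^sub>R \<psi> x)))"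
    using bounded_linear_image[OF schwartz_bounded[OF \<phi>, of m] bounded_linear_mult_right, of a]
      bounded_linear_image[OF schwartz_bounded[OF \<psi>, of m] bounded_linear_mult_right, of b]
    by (simp_all add: image_image)
  then have "bounded (range (\<lambda>x. a * (x ^ m *\<^sub>R \<phi> x) + b * (x ^ m *\<^sub>R \<psi> x)))"
    by (rule bounded_plus_comp)
  then show "bounded (range (\<lambda>x. x ^ m *\<^sub>R f x))"
    by (simp add: f algebra_simps scaleR_conv_of_real)
qed

lemma schwartz_cmult: "schwartz \<phi> \<Longrightarrow> schwartz (\<lambda>x. a * \<phi> x)"
  using schwartz_lincomb[of \<phi> \<phi> a 0] by simp

text \<open>
  The derivative of x f is x f' + f, so the class to use is that of all functions x f + g.
\<close>

lemma schwartz_x_mult: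
  assumes "schwartz \<phi>"
  shows "schwartz (\<lambda>x. of_real x * \<phi> x)"
proof (rule schwartz_coinduct[where A = "\<lambda>f. \<exists>\<phi> \<psi>. schwartz \<phi> \<and> schwartz \<psi> \<and> f = (\<lambda>x. of_real x * \<phi> x + \<psi> x)"])
  have "schwartz (\<lambda>x. 0 * \<phi> x)" using assms by (rule schwartz_cmult)
  then show "\<exists>\<phi>' \<psi>. schwartz \<phi>' \<and> schwartz \<psi> \<and> (\<lambda>x. of_real x * \<phi> x) = (\<lambda>x. of_real x * \<phi>' x + \<psi> x)"
    using assms by (intro exI[of _ \<phi>] exI[of _ "\<lambda>x. 0 * \<phi> x"]) simp
next
  fix f assume "\<exists>\<phi> \<psi>. schwartz \<phi> \<and> schwartz \<psi> \<and> f = (\<lambda>x. of_real x * \<phi> x + \<psi> x)"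
  then obtain \<phi> \<psi> where \<phi>: "schwartz \<phi>" and \<psi>: "schwartz \<psi>" and f: "f = (\<lambda>x. of_real x * \<phi> x + \<psi> x)"
    by blast
  have s: "schwartz (\<lambda>x. 1 * \<phi> x + 1 * nderiv 1 \<psi> x)"
    by (intro schwartz_lincomb schwartz_nderiv_1 \<phi> \<psi>)
  have "(f has_vector_derivative of_real x * nderiv 1 \<phi> x + (1 * \<phi> x + 1 * nderiv 1 \<psi> x)) (at x)" for x
    unfolding f
    by (rule derivative_eq_intros schwartz_has_deriv[OF \<phi>] schwartz_has_deriv[OF \<psi>]
          has_vector_derivative_of_real DERIV_ident refl)+ simp
  then show "\<exists>f'. (\<exists>\<phi> \<psi>. schwartz \<phi> \<and> schwartz \<psi> \<and> f' = (\<lambda>x. of_real x * \<phi> x + \<psi> x))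
      \<and> (\<forall>x. (f has_vector_derivative f' x) (at x))"
    using s schwartz_nderiv_1[OF \<phi>]
    by (intro exI[of _ "\<lambda>x. of_real x * nderiv 1 \<phi> x + (1 * \<phi> x + 1 * nderiv 1 \<psi> x)"]) blast
  fix m
  have "bounded (range (\<lambda>x. (x ^ Suc m *\<^sub>R \<phi> x) + (x ^ m *\<^sub>R \<psi> x)))"
    by (intro bounded_plus_comp schwartz_bounded \<phi> \<psi>)
  then show "bounded (range (\<lambda>x. x ^ m *\<^sub>R f x))"
    by (simp add: f algebra_simps scaleR_conv_of_real)
qed

lemma schwartz_reflect:
  assumes "schwartz \<phi>"
  shows "schwartz (\<lambda>x. \<phi> (- x))"
proof (rule schwartz_coinduct[where A = "\<lambda>f. \<exists>\<phi>. schwartz \<phi> \<and> f = (\<lambda>x. \<phi> (- x))"])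
  fix f assume "\<exists>\<phi>. schwartz \<phi> \<and> f = (\<lambda>x. \<phi> (- x))"
  then obtain \<phi> where \<phi>: "schwartz \<phi>" and f: "f = (\<lambda>x. \<phi> (- x))" by blast
  have "(f has_vector_derivative (-1) * nderiv 1 \<phi> (- x)) (at x)" for x
  proof -
    have "((\<phi> \<circ> uminus) has_vector_derivative (-1) *\<^sub>R nderiv 1 \<phi> (- x)) (at x)"
      by (rule vector_diff_chain_at) (auto intro!: derivative_eq_intros schwartz_has_deriv \<phi> simp del: One_nat_def)
    then show ?thesis by (simp add: f o_def)
  qed
  moreover have "schwartz (\<lambda>x. (-1) * nderiv 1 \<phi> x)"
    by (intro schwartz_cmult schwartz_nderiv_1 \<phi>)
  ultimately show "\<exists>f'. (\<exists>\<phi>. schwartz \<phi> \<and> f' = (\<lambda>x. \<phi> (- x))) \<and> (\<forall>x. (f has_vector_derivative f' x) (at x))"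
    by blast
  fix m
  have "bounded (range (\<lambda>x. x ^ m *\<^sub>R \<phi> x))" by (rule schwartz_bounded[OF \<phi>])
  then obtain B where B: "\<And>x. norm (x ^ m *\<^sub>R \<phi> x) \<le> B" by (auto simp: bounded_iff)
  have "norm (x ^ m *\<^sub>R \<phi> (- x)) \<le> B" for x
    using B[of "- x"] by (simp add: power_abs)
  then show "bounded (range (\<lambda>x. x ^ m *\<^sub>R f x))"
    unfolding f bounded_iff by auto
qed (use assms in blast)

lemma integrable_inverse_one_plus_square: "integrable lborel (\<lambda>x::real. 1 / (1 + x\<^sup>2))"
  using integrable_inverse_1_plus_square by (simp add: set_integrable_def inverse_eq_divide)

text \<open>
  This is the form in which Schwartz functions are seen to be integrable and to vanish at infinity.
\<close>

lemma schwartz_decay: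
  assumes "schwartz \<phi>"
  obtains C where "C \<ge> 0" "\<And>x. norm (\<phi> x) \<le> C / (1 + x\<^sup>2)"
proof -
  obtain A where A: "\<And>x. norm (x ^ 0 *\<^sub>R \<phi> x) \<le> A"
    using schwartz_bounded[OF assms, of 0] unfolding bounded_iff by auto
  obtain B where B: "\<And>x. norm (x ^ 2 *\<^sub>R \<phi> x) \<le> B"
    using schwartz_bounded[OF assms, of 2] unfolding bounded_iff by auto
  have "norm (\<phi> x) \<le> (A + B) / (1 + x\<^sup>2)" for x
    using A[of x] B[of x] by (subst pos_le_divide_eq) (auto simp: add_pos_nonneg distrib_left mult.commute)
  moreover have "A + B \<ge> 0" using A[of 0] B[of 0] by (smt (verit) norm_ge_zero)
  ultimately show ?thesis using that by blast
qed

lemma schwartz_integrable: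
  assumes "schwartz \<phi>"
  shows "integrable lborel \<phi>"
proof -
  obtain C where C: "C \<ge> 0" "\<And>x. norm (\<phi> x) \<le> C / (1 + x\<^sup>2)" using schwartz_decay[OF assms] by blast
  have "integrable lborel (\<lambda>x::real. C * (1 / (1 + x\<^sup>2)))"
    by (intro integrable_mult_right integrable_inverse_one_plus_square)
  then show ?thesis
    by (rule Bochner_Integration.integrable_bound) (use assms C in auto)
qed

lemma continuous_on_cis_real [continuous_intros]:
  "continuous_on A f \<Longrightarrow> continuous_on A (\<lambda>x. cis (f x))"
  unfolding cis_conv_exp by (intro continuous_intros)

lemma measurable_cis [measurable]: "cis \<in> borel_measurable borel"
  by (intro borel_measurable_continuous_onI continuous_intros)

lemma integrable_bounded_mult:
  fixes f g :: "real \<Rightarrow> complex"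
  assumes f: "integrable lborel f" and [measurable]: "g \<in> borel_measurable borel"
    and B: "\<And>x. norm (g x) \<le> B"
  shows "integrable lborel (\<lambda>x. g x * f x)"
proof (rule Bochner_Integration.integrable_bound)
  show "integrable lborel (\<lambda>x. B * norm (f x))" using f by auto
  have "norm (g x * f x) \<le> norm (B * norm (f x))" for x
    using mult_right_mono[OF B[of x], of "norm (f x)"] abs_ge_self[of "B * norm (f x)"]
    unfolding norm_mult real_norm_def by (simp add: norm_mult abs_mult)
  then show "AE x in lborel. norm (g x * f x) \<le> norm (B * norm (f x))" by simp
qed (use f in measurable)

lemma integrable_cis_mult:
  fixes f :: "real \<Rightarrow> complex"
  assumes "integrable lborel f"
  shows "integrable lborel (\<lambda>x. cis (t * x) * f x)" "integrable lborel (\<lambda>x. cis (x * t) * f x)"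
    "integrable lborel (\<lambda>x. cis (- (x * t)) * f x)"
  by (intro integrable_bounded_mult[where B = 1] assms; simp)+

lemma schwartz_x_power: "schwartz \<phi> \<Longrightarrow> schwartz (\<lambda>x. of_real x ^ m * \<phi> x)"
proof (induction m)
  case (Suc m)
  then show ?case using schwartz_x_mult[OF Suc.IH] by (simp add: mult.assoc)
qed simp

lemma norm_cis_minus_linear_le: "norm (cis t - 1 - \<i> * of_real t) \<le> t\<^sup>2 / 2"
  using iexp_approx1[of t 1] by (simp add: cis_conv_exp power2_eq_square algebra_simps)

text \<open>
  The quadratic Taylor bound on cis makes the difference quotient converge with an explicit rate:
  the error is at most the integral of x^2 f times half the square of the increment.
\<close>

lemma fourier_has_deriv:
  assumes "schwartz \<phi>"
  shows "(fourier \<phi> has_vector_derivative fourier (\<lambda>x. - \<i> * (of_real x * \<phi> x)) \<xi>) (at \<xi>)"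
proof -
  let ?G = "fourier (\<lambda>x. - \<i> * (of_real x * \<phi> x)) \<xi>"
  note sx = schwartz_cmult[OF schwartz_x_mult[OF assms], of "- \<i>"]
  note i0 = integrable_cis_mult(3)[OF schwartz_integrable[OF assms]]
  note i1 = integrable_cis_mult(3)[OF schwartz_integrable[OF sx]]
  have i2: "integrable lborel (\<lambda>x. norm (of_real x ^ 2 * \<phi> x))"
    using schwartz_integrable[OF schwartz_x_power[OF assms, of 2]] by (rule integrable_norm)
  define M where "M = (LINT x|lborel. norm (of_real x ^ 2 * \<phi> x)) / 2"
  have M: "M \<ge> 0" unfolding M_def by simp
  have main: "norm (fourier \<phi> \<eta> - fourier \<phi> \<xi> - (\<eta> - \<xi>) *\<^sub>R ?G) \<le> M * \<bar>\<eta> - \<xi>\<bar>\<^sup>2" for \<eta>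
  proof -
    let ?d = "\<lambda>x. cis (- (x * \<eta>)) * \<phi> x - cis (- (x * \<xi>)) * \<phi> x
        - (\<eta> - \<xi>) *\<^sub>R (cis (- (x * \<xi>)) * (- \<i> * (of_real x * \<phi> x)))"
    have "norm (fourier \<phi> \<eta> - fourier \<phi> \<xi> - (\<eta> - \<xi>) *\<^sub>R ?G) = norm (LINT x|lborel. ?d x)"
      unfolding fourier_def using i0 i1 by simp
    also have "\<dots> \<le> (LINT x|lborel. norm (of_real x ^ 2 * \<phi> x) * (\<bar>\<eta> - \<xi>\<bar>\<^sup>2 / 2))"
    proof (rule Bochner_Integration.integral_norm_bound_integral)
      show "integrable lborel ?d" using i0 i1 by auto
      show "integrable lborel (\<lambda>x. norm (of_real x ^ 2 * \<phi> x) * (\<bar>\<eta> - \<xi>\<bar>\<^sup>2 / 2))"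
        using i2 by (rule integrable_mult_left)
      fix x :: real
      have eq: "?d x = cis (- (x * \<xi>)) * \<phi> x * (cis (- (x * (\<eta> - \<xi>))) - 1 - \<i> * of_real (- (x * (\<eta> - \<xi>))))"
        by (simp add: algebra_simps cis_mult[symmetric] cis_mult scaleR_conv_of_real)
      have "norm (?d x) \<le> norm (\<phi> x) * ((x * (\<eta> - \<xi>))\<^sup>2 / 2)"
        unfolding eq norm_mult norm_cis
        using mult_left_mono[OF norm_cis_minus_linear_le[of "- (x * (\<eta> - \<xi>))"], of "norm (\<phi> x)"] by simp
      also have "\<dots> = norm (of_real x ^ 2 * \<phi> x) * (\<bar>\<eta> - \<xi>\<bar>\<^sup>2 / 2)"
        by (simp add: norm_mult norm_power power_mult_distrib)
      finally show "norm (?d x) \<le> norm (of_real x ^ 2 * \<phi> x) * (\<bar>\<eta> - \<xi>\<bar>\<^sup>2 / 2)" .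
    qed
    also have "\<dots> = M * \<bar>\<eta> - \<xi>\<bar>\<^sup>2" by (simp add: M_def)
    finally show ?thesis .
  qed
  show ?thesis
    unfolding has_vector_derivative_def has_derivative_at_alt
  proof (intro conjI allI impI)
    show "bounded_linear (\<lambda>h. h *\<^sub>R ?G)" by (rule bounded_linear_scaleR_left)
    fix e :: real assume e: "e > 0"
    show "\<exists>d>0. \<forall>y. norm (y - \<xi>) < d \<longrightarrow>
        norm (fourier \<phi> y - fourier \<phi> \<xi> - (y - \<xi>) *\<^sub>R ?G) \<le> e * norm (y - \<xi>)"
    proof (intro exI[of _ "e / (M + 1)"] conjI allI impI)
      show "e / (M + 1) > 0" using e M by simp
      fix y assume "norm (y - \<xi>) < e / (M + 1)"
      then have "\<bar>y - \<xi>\<bar> * (M + 1) \<le> e" using M by (simp add: field_simps)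
      then have "M * \<bar>y - \<xi>\<bar> \<le> e" by (simp add: algebra_simps)
      then have "M * \<bar>y - \<xi>\<bar> * \<bar>y - \<xi>\<bar> \<le> e * \<bar>y - \<xi>\<bar>" by (rule mult_right_mono) simp
      then show "norm (fourier \<phi> y - fourier \<phi> \<xi> - (y - \<xi>) *\<^sub>R ?G) \<le> e * norm (y - \<xi>)"
        using main[of y] by (simp add: power2_eq_square mult.assoc)
    qed
  qed
qed

lemma integral_derivative_eq_0:
  fixes g g' :: "real \<Rightarrow> complex"
  assumes "\<And>x. (g has_vector_derivative g' x) (at x)" "continuous_on UNIV g'" "integrable lborel g'"
    and "(g \<longlongrightarrow> 0) at_top" "(g \<longlongrightarrow> 0) at_bot"
  shows "(LINT x|lborel. g' x) = 0"
proof -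
  have "(LBINT x=-\<infinity>..\<infinity>. g' x) = 0 - 0"
    by (rule interval_integral_FTC_integrable)
       (use assms in \<open>auto simp: ereal_tendsto_simps set_integrable_def continuous_on_eq_continuous_at\<close>)
  then show ?thesis by (simp add: interval_lebesgue_integral_def set_lebesgue_integral_def)
qed

lemma schwartz_tendsto_0:
  assumes "schwartz \<phi>"
  shows "(\<phi> \<longlongrightarrow> 0) at_top" "(\<phi> \<longlongrightarrow> 0) at_bot"
proof -
  obtain C where C: "\<And>x. norm (\<phi> x) \<le> C / (1 + x\<^sup>2)" using schwartz_decay[OF assms] by blast
  have "((\<lambda>x::real. C / (1 + x\<^sup>2)) \<longlongrightarrow> 0) at_top" "((\<lambda>x::real. C / (1 + x\<^sup>2)) \<longlongrightarrow> 0) at_bot"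
    by real_asymp+
  then show "(\<phi> \<longlongrightarrow> 0) at_top" "(\<phi> \<longlongrightarrow> 0) at_bot"
    using C by (auto intro: Lim_null_comparison[rotated])
qed

lemma fourier_nderiv:
  assumes "schwartz \<phi>"
  shows "fourier (nderiv 1 \<phi>) \<xi> = \<i> * of_real \<xi> * fourier \<phi> \<xi>"
proof -
  let ?g = "\<lambda>x. cis (- (x * \<xi>)) * \<phi> x"
  let ?g' = "\<lambda>x. cis (- (x * \<xi>)) * nderiv 1 \<phi> x - \<i> * of_real \<xi> * (cis (- (x * \<xi>)) * \<phi> x)"
  note i0 = integrable_cis_mult(3)[OF schwartz_integrable[OF assms]]
  note i1 = integrable_cis_mult(3)[OF schwartz_integrable[OF schwartz_nderiv_1[OF assms]]]
  have "(LINT x|lborel. ?g' x) = 0"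
  proof (rule integral_derivative_eq_0)
    show "(?g has_vector_derivative ?g' x) (at x)" for x
    proof -
      have "((\<lambda>x. cis (- (x * \<xi>))) has_vector_derivative (- \<xi>) *\<^sub>R (\<i> * cis (- (x * \<xi>)))) (at x)"
      proof -
        have "((\<lambda>z. exp (- (\<i> * of_real \<xi> * z))) has_field_derivative
            (- (\<i> * of_real \<xi>)) * exp (- (\<i> * of_real \<xi> * of_real x))) (at (of_real x))"
          by (auto intro!: derivative_eq_intros)
        note d = has_vector_derivative_real_field[OF this, of UNIV]
        have cis_eq: "cis (- (x * \<xi>)) = exp (- (\<i> * of_real \<xi> * of_real x))" for x
          by (simp add: cis_conv_exp mult_ac)
        have "(- \<xi>) *\<^sub>R (\<i> * exp (- (\<i> * of_real \<xi> * of_real x)))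
            = - (\<i> * of_real \<xi>) * exp (- (\<i> * of_real \<xi> * of_real x))"
          by (simp add: scaleR_conv_of_real)
        then show ?thesis unfolding cis_eq using d by (simp only:)
      qed
      from has_vector_derivative_mult[OF this schwartz_has_deriv[OF assms]]
      show ?thesis by (simp add: scaleR_conv_of_real algebra_simps)
    qed
    show "continuous_on UNIV ?g'"
      by (intro continuous_intros schwartz_continuous schwartz_nderiv_1 assms)
    show "integrable lborel ?g'" using i0 i1 by auto
    have n: "norm (?g x) = norm (\<phi> x)" for x by (simp add: norm_mult)
    show "(?g \<longlongrightarrow> 0) at_top" "(?g \<longlongrightarrow> 0) at_bot"
      by (rule tendsto_norm_zero_cancel, unfold n, rule tendsto_norm_zero, rule schwartz_tendsto_0[OF assms])+
  qed
  then show ?thesis unfolding fourier_def using i0 i1 by simp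
qed

lemma norm_fourier_le: "norm (fourier \<phi> \<xi>) \<le> (LINT x|lborel. norm (\<phi> x))"
  unfolding fourier_def using integral_norm_bound[of lborel "\<lambda>x. cis (- (x * \<xi>)) * \<phi> x"]
  by (simp add: norm_mult)

lemma fourier_cmult: "fourier (\<lambda>x. c * \<phi> x) \<xi> = c * fourier \<phi> \<xi>"
  by (simp add: fourier_def mult.left_commute[of _ c])

text \<open>
  Powers of the frequency times a Fourier transform are Fourier transforms of derivatives, and
  therefore bounded.
\<close>

lemma fourier_power_mult:
  assumes "schwartz \<phi>"
  shows "\<exists>\<psi>. schwartz \<psi> \<and> (\<forall>\<xi>. of_real \<xi> ^ m * fourier \<phi> \<xi> = fourier \<psi> \<xi>)"
proof (induction m)
  case 0
  then show ?case using assms by auto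
next
  case (Suc m)
  then obtain \<psi> where \<psi>: "schwartz \<psi>" "\<And>\<xi>. of_real \<xi> ^ m * fourier \<phi> \<xi> = fourier \<psi> \<xi>" by blast
  have "of_real \<xi> ^ Suc m * fourier \<phi> \<xi> = fourier (\<lambda>x. - \<i> * nderiv 1 \<psi> x) \<xi>" for \<xi>
    unfolding fourier_cmult fourier_nderiv[OF \<psi>(1)] \<psi>(2)[symmetric] by (simp add: mult.assoc)
  then show ?case using schwartz_cmult[OF schwartz_nderiv_1[OF \<psi>(1)]] by blast
qed

lemma schwartz_fourier:
  assumes "schwartz \<phi>"
  shows "schwartz (fourier \<phi>)"
proof (rule schwartz_coinduct[where A = "\<lambda>f. \<exists>\<phi>. schwartz \<phi> \<and> f = fourier \<phi>"])
  fix f assume "\<exists>\<phi>. schwartz \<phi> \<and> f = fourier \<phi>"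
  then obtain \<phi> where \<phi>: "schwartz \<phi>" and f: "f = fourier \<phi>" by blast
  show "\<exists>f'. (\<exists>\<phi>. schwartz \<phi> \<and> f' = fourier \<phi>) \<and> (\<forall>x. (f has_vector_derivative f' x) (at x))"
    unfolding f using fourier_has_deriv[OF \<phi>] schwartz_cmult[OF schwartz_x_mult[OF \<phi>], of "- \<i>"] by blast
  fix m
  obtain \<psi> where \<psi>: "\<And>\<xi>. of_real \<xi> ^ m * fourier \<phi> \<xi> = fourier \<psi> \<xi>"
    using fourier_power_mult[OF \<phi>] by blast
  have "norm (\<xi> ^ m *\<^sub>R f \<xi>) \<le> (LINT x|lborel. norm (\<psi> x))" for \<xi>
    using norm_fourier_le[of \<psi> \<xi>] \<psi>[of \<xi>] by (simp add: f scaleR_conv_of_real)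
  then show "bounded (range (\<lambda>x. x ^ m *\<^sub>R f x))" unfolding bounded_iff by auto
qed (use assms in blast)

lemma inv_fourier_eq: "inv_fourier \<phi> x = fourier \<phi> (- x) / (2 * pi)"
  by (simp add: inv_fourier_def fourier_def mult.commute)

lemma schwartz_inv_fourier: "schwartz \<phi> \<Longrightarrow> schwartz (inv_fourier \<phi>)"
  using schwartz_cmult[OF schwartz_reflect[OF schwartz_fourier], of \<phi> "1 / (2 * pi)"]
  by (simp add: inv_fourier_eq[abs_def])

section \<open>Gaussian regularization: Fourier inversion and uniqueness\<close>

text \<open>
  All interchanges of integrals below concern integrands dominated by a product of integrable
  functions of the two variables.
\<close>

lemma fubini_bound:
  fixes f :: "real \<Rightarrow> real \<Rightarrow> complex"
  assumes [measurable]: "case_prod f \<in> borel_measurable (borel \<Otimes>\<^sub>M borel)"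
    and A: "integrable lborel A" and B: "integrable lborel B"
    and le: "\<And>x y. norm (f x y) \<le> A x * (B y :: real)"
  shows fubini_bound_swap: "(LINT x|lborel. LINT y|lborel. f x y) = (LINT y|lborel. LINT x|lborel. f x y)"
    and fubini_bound_integrable: "integrable lborel (\<lambda>x. LINT y|lborel. f x y)"
proof -
  have 1: "integrable (lborel \<Otimes>\<^sub>M lborel) (case_prod f)"
  proof (rule lborel_pair.Fubini_integrable)
    show "case_prod f \<in> borel_measurable (lborel \<Otimes>\<^sub>M lborel)" by measurable
    have int: "integrable lborel (f x)" for x
    proof (rule Bochner_Integration.integrable_bound)
      show "integrable lborel (\<lambda>y. A x * B y)" using B by simp
      show "AE y in lborel. norm (f x y) \<le> norm (A x * B y)"
        using le[of x] by (auto intro: order_trans abs_ge_self)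
    qed measurable
    then show "AE x in lborel. integrable lborel (\<lambda>y. case (x, y) of (x, y) \<Rightarrow> f x y)" by simp
    show "integrable lborel (\<lambda>x. LINT y|lborel. norm (case (x, y) of (x, y) \<Rightarrow> f x y))"
    proof (rule Bochner_Integration.integrable_bound)
      show "integrable lborel (\<lambda>x. A x * (LINT y|lborel. B y))" using A by simp
      have "(LINT y|lborel. norm (f x y)) \<le> (LINT y|lborel. A x * B y)" for x
        using int B le by (intro integral_mono) auto
      then have "norm (LINT y|lborel. norm (f x y)) \<le> norm (A x * (LINT y|lborel. B y))" for x
        by (simp add: abs_le_iff order_trans[OF _ abs_ge_self])
      then show "AE x in lborel. norm (LINT y|lborel. norm (case (x, y) of (x, y) \<Rightarrow> f x y))
          \<le> norm (A x * (LINT y|lborel. B y))" by simp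
    qed measurable
  qed
  show "(LINT x|lborel. LINT y|lborel. f x y) = (LINT y|lborel. LINT x|lborel. f x y)"
    using lborel_pair.Fubini_integral[OF 1] by simp
  show "integrable lborel (\<lambda>x. LINT y|lborel. f x y)"
    using lborel_pair.integrable_fst[OF 1] by simp
qed

text \<open>
  A wide Gaussian has a narrow Gaussian of unit mass as its Fourier transform. The formula is the
  known characteristic function of the normal distribution, rescaled.
\<close>

lemma fourier_gaussian:
  assumes "n > 0"
  shows "(LINT x|lborel. cis (x * t) * exp (- (of_real (x / n))\<^sup>2 / 2)) = 2 * pi * n * std_normal_density (n * t)"
proof -
  have ft: "(LINT x|lborel. std_normal_density x *\<^sub>R cis (s * x)) = of_real (exp (- s\<^sup>2 / 2))" for s
  proof -
    have "char std_normal_distribution s = of_real (exp (- s\<^sup>2 / 2))"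
      by (simp add: char_std_normal_distribution)
    then show ?thesis
      unfolding char_def by (subst (asm) integral_density) (auto simp: cis_conv_exp normal_density_nonneg)
  qed
  let ?f = "\<lambda>x. cis (x * t) * exp (- (of_real (x / n))\<^sup>2 / 2)"
  have "(LINT x|lborel. ?f x) = n *\<^sub>R (LINT x|lborel. ?f (0 + n * x))"
    using lborel_integral_real_affine[of n ?f 0] assms by simp
  also have "(\<lambda>x. ?f (0 + n * x)) = (\<lambda>x. of_real (sqrt (2 * pi)) * (std_normal_density x *\<^sub>R cis ((n * t) * x)))"
    using assms by (auto simp: fun_eq_iff std_normal_density_def scaleR_conv_of_real exp_of_real[symmetric] mult_ac)
  also have "(LINT x|lborel. of_real (sqrt (2 * pi)) * (std_normal_density x *\<^sub>R cis ((n * t) * x)))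
      = of_real (sqrt (2 * pi)) * of_real (exp (- (n * t)\<^sup>2 / 2))"
    by (simp only: integral_mult_right_zero ft)
  also have "n *\<^sub>R \<dots> = 2 * pi * n * std_normal_density (n * t)"
  proof -
    have "sqrt (2 * pi) * exp (- (n * t)\<^sup>2 / 2) = 2 * pi * std_normal_density (n * t)"
      by (simp add: std_normal_density_def field_simps real_sqrt_mult)
    then show ?thesis
      by (simp add: scaleR_conv_of_real mult_ac flip: of_real_mult)
  qed
  finally show ?thesis .
qed

lemma integrable_gaussian:
  assumes "n > 0"
  shows "integrable lborel (\<lambda>x::real. exp (- (x / n)\<^sup>2 / 2))"
proof -
  have "integrable lborel (\<lambda>x. sqrt (2 * pi) * std_normal_density x)"
    by simp
  from lborel_integrable_real_affine[OF this, of "1 / n" 0] assms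
  show ?thesis by (simp add: std_normal_density_def)
qed

lemma gaussian_average_rescale:
  fixes f :: "real \<Rightarrow> complex"
  assumes "n > 0"
  shows "(LINT y|lborel. f y * (n * std_normal_density (n * (y - x))))
    = (LINT z|lborel. f (x + z / n) * std_normal_density z)"
  using lborel_integral_real_affine[of "1 / n" "\<lambda>y. f y * (n * std_normal_density (n * (y - x)))" x] assms
  by (simp add: scaleR_conv_of_real mult_ac)

text \<open>
  The Gaussian averages are written with the fixed measure and a moving argument, so that dominated
  convergence applies directly.
\<close>

lemma gaussian_average_tendsto:
  fixes g :: "real \<Rightarrow> complex"
  assumes [measurable]: "g \<in> borel_measurable borel" and B: "\<And>x. norm (g x) \<le> B" and cont: "isCont g x"
  shows "(\<lambda>n. LINT z|lborel. g (x + z / real (Suc n)) * std_normal_density z) \<longlonglongrightarrow> g x"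
proof -
  have "(\<lambda>n. LINT z|lborel. g (x + z / real (Suc n)) * std_normal_density z)
      \<longlonglongrightarrow> (LINT z|lborel. g x * std_normal_density z)"
  proof (rule integral_dominated_convergence[where w = "\<lambda>z. B * std_normal_density z"])
    show "integrable lborel (\<lambda>z. B * std_normal_density z)" by simp
    have "(\<lambda>n. g (x + z / real (Suc n)) * std_normal_density z) \<longlonglongrightarrow> g x * std_normal_density z" for z
    proof -
      have "(\<lambda>n. x + z / real (Suc n)) \<longlonglongrightarrow> x" by real_asymp
      then have "(\<lambda>n. g (x + z / real (Suc n))) \<longlonglongrightarrow> g x"
        using cont isCont_tendsto_compose by blast
      then show ?thesis by (intro tendsto_intros)
    qed
    then show "AE z in lborel. (\<lambda>n. g (x + z / real (Suc n)) * std_normal_density z) \<longlonglongrightarrow> g x * std_normal_density z"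
      by simp
    show "AE z in lborel. norm (g (x + z / real (Suc n)) * std_normal_density z) \<le> B * std_normal_density z" for n
      using B by (auto simp: norm_mult mult_right_mono)
  qed measurable
  moreover have "(LINT z|lborel. g x * std_normal_density z) = g x"
  proof -
    have "(LINT z|lborel. complex_of_real (std_normal_density z)) = 1"
      by (simp add: integral_normal_density)
    then show ?thesis by simp
  qed
  ultimately show ?thesis by simp
qed

text \<open>
  Fourier inversion. The double integral that composes the two transforms is not absolutely
  convergent. With an extra factor exp (- (\<xi>/n)^2 / 2) it is, and by Fubini the frequency integral
  becomes a Gaussian average of the function around x. As n grows, the regularized integral
  converges to the unregularized one, and the average converges to the value at x.
\<close>

lemma inv_fourier_fourier:
  assumes "schwartz \<phi>"
  shows "inv_fourier (fourier \<phi>) = \<phi>"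
proof
  fix x
  note int = schwartz_integrable[OF assms]
  note intF = schwartz_integrable[OF schwartz_fourier[OF assms]]
  note [measurable] = schwartz_measurable[OF assms] schwartz_measurable[OF schwartz_fourier[OF assms]]
  let ?e = "\<lambda>n \<xi>. exp (- (of_real (\<xi> / real (Suc n)))\<^sup>2 / 2) :: complex"
  have ne: "norm (?e n \<xi>) = exp (- (\<xi> / real (Suc n))\<^sup>2 / 2)" for n \<xi>
  proof -
    have "?e n \<xi> = of_real (exp (- (\<xi> / real (Suc n))\<^sup>2 / 2))" by (simp add: exp_of_real[symmetric])
    then show ?thesis by (metis abs_exp_cancel norm_of_real)
  qed
  let ?J = "\<lambda>n. LINT \<xi>|lborel. ?e n \<xi> * (cis (x * \<xi>) * fourier \<phi> \<xi>)"
  have L1: "?J \<longlonglongrightarrow> (LINT \<xi>|lborel. cis (x * \<xi>) * fourier \<phi> \<xi>)"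
  proof (rule integral_dominated_convergence[where w = "\<lambda>\<xi>. norm (fourier \<phi> \<xi>)"])
    show "integrable lborel (\<lambda>\<xi>. norm (fourier \<phi> \<xi>))" using intF by simp
    have "(\<lambda>n. ?e n \<xi> * (cis (x * \<xi>) * fourier \<phi> \<xi>)) \<longlonglongrightarrow> exp (- (of_real 0)\<^sup>2 / 2) * (cis (x * \<xi>) * fourier \<phi> \<xi>)" for \<xi>
    proof -
      have "(\<lambda>n. \<xi> / real (Suc n)) \<longlonglongrightarrow> 0" by real_asymp
      then show ?thesis by (intro tendsto_intros) simp_all
    qed
    then show "AE \<xi> in lborel. (\<lambda>n. ?e n \<xi> * (cis (x * \<xi>) * fourier \<phi> \<xi>)) \<longlonglongrightarrow> cis (x * \<xi>) * fourier \<phi> \<xi>"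
      by simp
    show "AE \<xi> in lborel. norm (?e n \<xi> * (cis (x * \<xi>) * fourier \<phi> \<xi>)) \<le> norm (fourier \<phi> \<xi>)" for n
      by (simp add: norm_mult ne mult_left_le_one_le)
  qed measurable
  have L2: "?J n = 2 * pi * (LINT z|lborel. \<phi> (x + z / real (Suc n)) * std_normal_density z)" for n
  proof -
    have "?J n = (LINT \<xi>|lborel. LINT y|lborel. ?e n \<xi> * cis (\<xi> * (x - y)) * \<phi> y)"
    proof (intro Bochner_Integration.integral_cong refl)
      fix \<xi>
      have "cis (x * \<xi>) * (cis (- (y * \<xi>)) * \<phi> y) = cis (\<xi> * (x - y)) * \<phi> y" for y
        by (simp only: mult.assoc[symmetric] cis_mult) (simp add: algebra_simps)
      then show "?e n \<xi> * (cis (x * \<xi>) * fourier \<phi> \<xi>) = (LINT y|lborel. ?e n \<xi> * cis (\<xi> * (x - y)) * \<phi> y)"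
        unfolding fourier_def by (simp only: integral_mult_right_zero[symmetric] mult.assoc)
    qed
    also have "\<dots> = (LINT y|lborel. LINT \<xi>|lborel. ?e n \<xi> * cis (\<xi> * (x - y)) * \<phi> y)"
      by (rule fubini_bound_swap[where A = "\<lambda>\<xi>. exp (- (\<xi> / real (Suc n))\<^sup>2 / 2)" and B = "\<lambda>y. norm (\<phi> y)"])
         (use int integrable_gaussian[of "real (Suc n)"] in \<open>auto simp: norm_mult ne\<close>)
    also have "\<dots> = (LINT y|lborel. \<phi> y * (2 * pi * real (Suc n) * std_normal_density (real (Suc n) * (y - x))))"
    proof (intro Bochner_Integration.integral_cong refl)
      fix y
      have "(LINT \<xi>|lborel. ?e n \<xi> * cis (\<xi> * (x - y)) * \<phi> y)
          = (LINT \<xi>|lborel. cis (\<xi> * (x - y)) * ?e n \<xi>) * \<phi> y"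
        by (simp add: mult_ac)
      also have "\<dots> = \<phi> y * (2 * pi * real (Suc n) * std_normal_density (real (Suc n) * (x - y)))"
        using fourier_gaussian[of "real (Suc n)" "x - y"] by (simp add: mult_ac)
      also have "std_normal_density (real (Suc n) * (x - y)) = std_normal_density (real (Suc n) * (y - x))"
        by (simp add: std_normal_density_def power_mult_distrib power2_commute)
      finally show "(LINT \<xi>|lborel. ?e n \<xi> * cis (\<xi> * (x - y)) * \<phi> y)
          = \<phi> y * (2 * pi * real (Suc n) * std_normal_density (real (Suc n) * (y - x)))" .
    qed
    also have "\<dots> = (LINT y|lborel. 2 * pi * (\<phi> y * (real (Suc n) * std_normal_density (real (Suc n) * (y - x)))))"
      by (simp only: of_real_mult mult_ac)
    also have "\<dots> = 2 * pi * (LINT y|lborel. \<phi> y * (real (Suc n) * std_normal_density (real (Suc n) * (y - x))))"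
      by (rule integral_mult_right_zero)
    also have "(LINT y|lborel. \<phi> y * (real (Suc n) * std_normal_density (real (Suc n) * (y - x))))
        = (LINT z|lborel. \<phi> (x + z / real (Suc n)) * std_normal_density z)"
      by (rule gaussian_average_rescale) simp
    finally show ?thesis .
  qed
  have L3: "(\<lambda>n. 2 * pi * (LINT z|lborel. \<phi> (x + z / real (Suc n)) * std_normal_density z)) \<longlonglongrightarrow> 2 * pi * \<phi> x"
  proof -
    obtain B where B: "\<And>x. norm (x ^ 0 *\<^sub>R \<phi> x) \<le> B"
      using schwartz_bounded[OF assms, of 0] unfolding bounded_iff by auto
    have "isCont \<phi> x" using schwartz_continuous[OF assms, of UNIV] by (simp add: continuous_on_eq_continuous_at)
    then show ?thesis using B by (intro tendsto_mult_left gaussian_average_tendsto[where B = B]) auto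
  qed
  have "(LINT \<xi>|lborel. cis (x * \<xi>) * fourier \<phi> \<xi>) = 2 * pi * \<phi> x"
    using L1[unfolded L2] L3 by (rule LIMSEQ_unique)
  then show "inv_fourier (fourier \<phi>) x = \<phi> x" by (simp add: inv_fourier_def)
qed

lemma power_le_fact_exp:
  fixes x :: real
  assumes "x \<ge> 0"
  shows "x ^ m \<le> fact m * exp x"
proof -
  have "(\<lambda>n. x ^ n /\<^sub>R fact n) sums exp x" by (rule exp_converges)
  then have "(\<Sum>n\<in>{m}. x ^ n /\<^sub>R fact n) \<le> exp x"
    using assms sum_le_suminf[of "\<lambda>n. x ^ n /\<^sub>R fact n" "{m}"] by (simp add: sums_iff)
  then show ?thesis by (simp add: field_simps)
qed

lemma power_mult_gaussian_le:
  fixes b c x :: real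
  assumes b: "b > 0"
  shows "\<bar>x\<bar> ^ m * exp (- (b * x\<^sup>2) + c * x) \<le> fact m * exp ((\<bar>c\<bar> + 1)\<^sup>2 / (4 * b))"
proof -
  have "0 \<le> b * (\<bar>x\<bar> - (\<bar>c\<bar> + 1) / (2 * b))\<^sup>2" using b by simp
  also have "\<dots> = b * x\<^sup>2 - (\<bar>c\<bar> + 1) * \<bar>x\<bar> + (\<bar>c\<bar> + 1)\<^sup>2 / (4 * b)"
    using b by (simp add: power2_diff field_simps) (simp add: power2_eq_square algebra_simps)
  finally have sq: "(\<bar>c\<bar> + 1) * \<bar>x\<bar> - b * x\<^sup>2 \<le> (\<bar>c\<bar> + 1)\<^sup>2 / (4 * b)" by simp
  have "c * x \<le> \<bar>c\<bar> * \<bar>x\<bar>" by (metis abs_ge_self abs_mult)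
  then have "\<bar>x\<bar> + (- (b * x\<^sup>2) + c * x) \<le> (\<bar>c\<bar> + 1)\<^sup>2 / (4 * b)"
    using sq by (simp add: distrib_right)
  then have "exp \<bar>x\<bar> * exp (- (b * x\<^sup>2) + c * x) \<le> exp ((\<bar>c\<bar> + 1)\<^sup>2 / (4 * b))"
    by (simp add: exp_add[symmetric])
  moreover have "\<bar>x\<bar> ^ m * exp (- (b * x\<^sup>2) + c * x) \<le> (fact m * exp \<bar>x\<bar>) * exp (- (b * x\<^sup>2) + c * x)"
    by (intro mult_right_mono power_le_fact_exp) auto
  ultimately show ?thesis
    by (smt (verit) mult.assoc mult_left_mono fact_ge_zero)
qed

text \<open>
  Polynomials times the given exponential form a class closed under differentiation.
\<close>

lemma schwartz_gaussian:
  fixes b c :: real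
  assumes b: "b > 0"
  shows "schwartz (\<lambda>x. of_real (exp (- (b * x\<^sup>2) + c * x)))"
proof -
  let ?e = "\<lambda>x. exp (- (b * x\<^sup>2) + c * x)"
  show ?thesis
  proof (rule schwartz_coinduct[where A = "\<lambda>f. \<exists>p. f = (\<lambda>x. poly p (of_real x) * of_real (?e x))"])
    show "\<exists>p. (\<lambda>x. of_real (?e x)) = (\<lambda>x. poly p (of_real x) * complex_of_real (?e x))"
      by (intro exI[of _ 1]) simp
  next
    fix f assume "\<exists>p. f = (\<lambda>x. poly p (of_real x) * complex_of_real (?e x))"
    then obtain p where f: "f = (\<lambda>x. poly p (of_real x) * complex_of_real (?e x))" by blast
    let ?q = "pderiv p + p * [:of_real c, of_real (- 2 * b):]"
    have "(f has_vector_derivative poly ?q (of_real x) * of_real (?e x)) (at x)" for x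
    proof -
      have 1: "((\<lambda>x. poly p (of_real x)) has_vector_derivative poly (pderiv p) (of_real x)) (at x)"
        by (rule has_vector_derivative_real_field[OF poly_DERIV])
      have "(?e has_real_derivative ?e x * (c - 2 * b * x)) (at x)"
        by (rule derivative_eq_intros refl | simp)+
      then have 2: "((\<lambda>x. complex_of_real (?e x)) has_vector_derivative of_real (?e x * (c - 2 * b * x))) (at x)"
        by (intro has_vector_derivative_of_real) (simp add: has_real_derivative_iff_has_vector_derivative)
      show ?thesis
        unfolding f using has_vector_derivative_mult[OF 1 2] by (simp add: algebra_simps)
    qed
    then show "\<exists>f'. (\<exists>p. f' = (\<lambda>x. poly p (of_real x) * complex_of_real (?e x)))
        \<and> (\<forall>x. (f has_vector_derivative f' x) (at x))" by blast
    fix m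
    have "bounded (range (\<lambda>x. x ^ m *\<^sub>R (poly p (of_real x) * complex_of_real (?e x))))"
    proof (induction p arbitrary: m)
      case 0
      then show ?case by (simp add: image_def)
    next
      case (pCons a p)
      have "norm (a * (x ^ m *\<^sub>R complex_of_real (?e x))) \<le> norm a * (fact m * exp ((\<bar>c\<bar> + 1)\<^sup>2 / (4 * b)))" for x
        using mult_left_mono[OF power_mult_gaussian_le[OF b, of x m c], of "norm a"]
        by (simp add: norm_mult power_abs mult.left_commute)
      then have 1: "bounded (range (\<lambda>x. a * (x ^ m *\<^sub>R complex_of_real (?e x))))"
        unfolding bounded_iff by blast
      have "bounded (range (\<lambda>x. a * (x ^ m *\<^sub>R complex_of_real (?e x))
          + x ^ Suc m *\<^sub>R (poly p (of_real x) * complex_of_real (?e x))))"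
        by (rule bounded_plus_comp[OF 1 pCons.IH])
      then show ?case by (simp add: algebra_simps scaleR_conv_of_real)
    qed
    then show "bounded (range (\<lambda>x. x ^ m *\<^sub>R f x))" unfolding f .
  qed
qed

lemma null_if_integrals_over_intervals_vanish:
  fixes H :: "real \<Rightarrow> complex"
  assumes H: "integrable lborel H"
    and null: "\<And>p q. p \<le> q \<Longrightarrow> (LINT x|lborel. indicator {p..q} x *\<^sub>R H x) = 0"
  shows "AE x in lborel. H x = 0"
proof -
  have total: "(LINT x|lborel. H x) = 0"
  proof -
    have "(\<lambda>n. LINT x|lborel. indicator {- real n..real n} x *\<^sub>R H x) \<longlonglongrightarrow> (LINT x|lborel. H x)"
    proof (rule integral_dominated_convergence[where w = "\<lambda>x. norm (H x)"])
      have "(\<lambda>n. indicat_real {- real n..real n} x *\<^sub>R H x) \<longlonglongrightarrow> H x" for x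
      proof (rule tendsto_eventually)
        obtain N where "\<bar>x\<bar> \<le> real N" using real_arch_simple by blast
        then show "\<forall>\<^sub>F n in sequentially. indicat_real {- real n..real n} x *\<^sub>R H x = H x"
          by (intro eventually_sequentiallyI[of N]) (auto simp: indicator_def)
      qed
      then show "AE x in lborel. (\<lambda>n. indicat_real {- real n..real n} x *\<^sub>R H x) \<longlonglongrightarrow> H x" by simp
    qed (use H in \<open>auto simp: indicator_def\<close>)
    then show ?thesis using null by (simp add: LIMSEQ_const_iff)
  qed
  have all: "(LINT x:A|lborel. H x) = 0" if "A \<in> sets borel" for A
    using that
  proof (induction rule: borel_set_induct)
    case empty
    then show ?case by (simp add: set_lebesgue_integral_def)
  next
    case (interval a b)
    then show ?case using null by (simp add: set_lebesgue_integral_def)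
  next
    case (compl A)
    have iA: "set_integrable lborel A H" using compl H by (auto simp: set_integrable_def intro!: integrable_mult_indicator)
    have "(LINT x:-A|lborel. H x) = (LINT x|lborel. H x - indicator A x *\<^sub>R H x)"
      unfolding set_lebesgue_integral_def
      by (intro Bochner_Integration.integral_cong) (auto simp: indicator_def)
    also have "\<dots> = (LINT x|lborel. H x) - (LINT x:A|lborel. H x)"
      using iA H unfolding set_lebesgue_integral_def set_integrable_def by simp
    finally show ?case using total compl by simp
  next
    case (union A)
    have "set_integrable lborel (\<Union>i. A i) H"
      using union H by (auto simp: set_integrable_def intro!: integrable_mult_indicator)
    then have "(LINT x:(\<Union>i. A i)|lborel. H x) = (\<Sum>i. LINT x:(A i)|lborel. H x)"
      using union by (intro lebesgue_integral_countable_add) (auto simp: disjoint_family_on_def)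
    then show ?case using union by simp
  qed
  have int: "integrable lborel (\<lambda>x. indicator A x *\<^sub>R H x)" if "A \<in> sets borel" for A
    using that H by (intro integrable_mult_indicator) auto
  have "(LINT x:A|lborel. Re (H x)) = 0" "(LINT x:A|lborel. Im (H x)) = 0" if "A \<in> sets borel" for A
    using integral_Re[OF int[OF that]] integral_Im[OF int[OF that]] all[OF that]
    by (simp_all add: set_lebesgue_integral_def)
  then have "AE x in lborel. Re (H x) = 0" "AE x in lborel. Im (H x) = 0"
    using H by (auto intro!: density_unique_real[where f' = "\<lambda>_. 0"] simp: set_lebesgue_integral_def)
  then show ?thesis by eventually_elim (simp add: complex_eq_iff)
qed

text \<open>
  The Gaussian averages of an indicator function of an interval converge to it away from the
  endpoints. By Fubini the integral of H against such an average is an average of integrals that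
  vanish by assumption, so the integral of H over the interval vanishes as well.
\<close>

lemma null_if_gaussian_averages_vanish:
  fixes H :: "real \<Rightarrow> complex"
  assumes H: "integrable lborel H"
    and null: "\<And>n y. (LINT x|lborel. H x * std_normal_density (real (Suc n) * (y - x))) = 0"
  shows "AE x in lborel. H x = 0"
proof (rule null_if_integrals_over_intervals_vanish[OF H])
  note [measurable] = borel_measurable_integrable[OF H, simplified]
  fix p q :: real
  let ?g = "\<lambda>x. complex_of_real (indicator {p..q} x)"
  let ?a = "\<lambda>n x. LINT z|lborel. ?g (x + z / real (Suc n)) * std_normal_density z"
  have na: "norm (?a n x) \<le> 1" for n x
  proof -
    have "norm (?a n x) \<le> (LINT z|lborel. norm (?g (x + z / real (Suc n)) * std_normal_density z))"
      by (rule integral_norm_bound)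
    also have "\<dots> \<le> (LINT z|lborel. std_normal_density z)"
      by (rule integral_mono_AE') (auto simp: norm_mult indicator_def)
    finally show ?thesis by (simp add: integral_normal_density)
  qed
  have "(LINT x|lborel. H x * ?a n x) = 0" for n
  proof -
    have "(LINT x|lborel. H x * ?a n x)
        = (LINT x|lborel. LINT y|lborel. H x * (?g y * (real (Suc n) * std_normal_density (real (Suc n) * (y - x)))))"
      using gaussian_average_rescale[of "real (Suc n)" ?g] by simp
    also have "\<dots> = (LINT y|lborel. LINT x|lborel. H x * (?g y * (real (Suc n) * std_normal_density (real (Suc n) * (y - x)))))"
    proof (rule fubini_bound_swap[where A = "\<lambda>x. norm (H x)" and B = "\<lambda>y. real (Suc n) * indicator {p..q} y"])
      show "integrable lborel (\<lambda>x. norm (H x))" using H by simp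
      have "integrable lborel (indicat_real {p..q})"
        by (rule integrable_real_indicator) (auto simp: emeasure_lborel_Icc_eq)
      then show "integrable lborel (\<lambda>y. real (Suc n) * indicat_real {p..q} y)"
        by (rule integrable_mult_right)
      fix x y
      have "std_normal_density z \<le> 1" for z
      proof -
        have "1 \<le> sqrt (2 * pi)" using pi_gt3 by (intro real_le_rsqrt) simp
        moreover have "exp (- z\<^sup>2 / 2) \<le> 1" by simp
        ultimately show ?thesis unfolding std_normal_density_def
          by (smt (verit) divide_le_eq_1 exp_gt_zero mult_le_one zero_le_divide_1_iff)
      qed
      then have "real (Suc n) * std_normal_density (real (Suc n) * (y - x)) \<le> real (Suc n)"
        by (meson mult_left_le of_nat_0_le_iff)
      then show "norm (H x * (?g y * (real (Suc n) * std_normal_density (real (Suc n) * (y - x)))))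
          \<le> norm (H x) * (real (Suc n) * indicat_real {p..q} y)"
        unfolding norm_mult norm_of_real
        by (intro mult_left_mono) (auto simp: indicator_def abs_mult simp del: of_nat_Suc)
    qed measurable
    also have "\<dots> = (LINT y|lborel. (?g y * real (Suc n)) * (LINT x|lborel. H x * std_normal_density (real (Suc n) * (y - x))))"
      by (simp only: integral_mult_right_zero[symmetric]) (simp add: mult_ac)
    also have "\<dots> = 0" unfolding null by simp
    finally show ?thesis .
  qed
  moreover have "(\<lambda>n. LINT x|lborel. H x * ?a n x) \<longlonglongrightarrow> (LINT x|lborel. H x * ?g x)"
  proof (rule integral_dominated_convergence[where w = "\<lambda>x. norm (H x)"])
    have "AE x in lborel. x \<noteq> p \<and> x \<noteq> q"
      using AE_lborel_singleton[of p] AE_lborel_singleton[of q] by eventually_elim simp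
    then show "AE x in lborel. (\<lambda>n. H x * ?a n x) \<longlonglongrightarrow> H x * ?g x"
    proof eventually_elim
      case (elim x)
      have "isCont ?g x"
      proof -
        have "\<forall>\<^sub>F y in nhds x. ?g y = ?g x"
        proof (cases "x \<in> {p..q}")
          case True
          then have "\<forall>\<^sub>F y in nhds x. y \<in> {p<..<q}" using elim by (intro eventually_nhds_in_open) auto
          then show ?thesis using True by (auto elim!: eventually_mono)
        next
          case False
          then have "\<forall>\<^sub>F y in nhds x. y \<in> - {p..q}" by (intro eventually_nhds_in_open) auto
          then show ?thesis using False by (auto elim!: eventually_mono)
        qed
        then show ?thesis
          by (subst isCont_cong[where g = "\<lambda>_. ?g x"]) auto
      qed
      then have "(\<lambda>n. ?a n x) \<longlonglongrightarrow> ?g x"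
        by (intro gaussian_average_tendsto[where B = 1]) (auto simp: indicator_def)
      then show ?case by (rule tendsto_mult_left)
    qed
    show "AE x in lborel. norm (H x * ?a n x) \<le> norm (H x)" for n
      using na by (auto simp: norm_mult intro!: mult_left_le)
  qed (use H in auto)
  ultimately have "(LINT x|lborel. H x * ?g x) = 0" by (simp add: LIMSEQ_const_iff)
  then show "(LINT x|lborel. indicat_real {p..q} x *\<^sub>R H x) = 0"
    by (simp add: scaleR_conv_of_real mult.commute)
qed

text \<open>
  The difference of two Fourier transforms of one distribution is annihilated by every Schwartz
  function, but need not be integrable. Multiplied with a fixed Gaussian e it is, and a Gaussian
  average of the product is again a pairing with a Schwartz function, because a product of two
  Gaussians is a Gaussian up to a constant.
\<close>

lemma has_fourier_unique:
  assumes f: "has_fourier u f" and g: "has_fourier u g"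
  shows "AE \<xi> in lborel. f \<xi> = g \<xi>"
proof -
  have [measurable]: "f \<in> borel_measurable borel" "g \<in> borel_measurable borel"
    using f g by (auto simp: has_fourier_def)
  define e where "e x = complex_of_real (exp (- (1 / 2 * x\<^sup>2) + 0 * x))" for x
  have test: "integrable lborel (\<lambda>x. (f x - g x) * \<phi> x)" "(LINT x|lborel. (f x - g x) * \<phi> x) = 0"
    if "schwartz \<phi>" for \<phi>
    using f g that unfolding has_fourier_def by (auto simp: left_diff_distrib)
  have "AE x in lborel. (f x - g x) * e x = 0"
  proof (rule null_if_gaussian_averages_vanish)
    show "integrable lborel (\<lambda>x. (f x - g x) * e x)"
      unfolding e_def by (intro test schwartz_gaussian) simp
    fix n :: nat and y :: real
    define N where "N = real (Suc n)"
    define K where "K = exp (- (N\<^sup>2 * y\<^sup>2 / 2)) / sqrt (2 * pi)"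
    define \<phi> where "\<phi> x = of_real K * complex_of_real (exp (- ((1 + N\<^sup>2) / 2 * x\<^sup>2) + (N\<^sup>2 * y) * x))" for x
    have "schwartz \<phi>" unfolding \<phi>_def by (intro schwartz_cmult schwartz_gaussian) (simp add: add_pos_nonneg)
    moreover have "e x * std_normal_density (N * (y - x)) = \<phi> x" for x
    proof -
      have "- (1 / 2 * x\<^sup>2) + - (N * (y - x))\<^sup>2 / 2
          = - (N\<^sup>2 * y\<^sup>2 / 2) + (- ((1 + N\<^sup>2) / 2 * x\<^sup>2) + (N\<^sup>2 * y) * x)"
        by (simp add: power2_eq_square field_simps)
      then have "exp (- (1 / 2 * x\<^sup>2)) * exp (- (N * (y - x))\<^sup>2 / 2)
          = exp (- (N\<^sup>2 * y\<^sup>2 / 2)) * exp (- ((1 + N\<^sup>2) / 2 * x\<^sup>2) + (N\<^sup>2 * y) * x)"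
        by (simp only: exp_add[symmetric])
      then show ?thesis
        by (simp add: e_def \<phi>_def K_def std_normal_density_def flip: of_real_mult)
    qed
    ultimately show "(LINT x|lborel. (f x - g x) * e x * std_normal_density (real (Suc n) * (y - x))) = 0"
      using test(2)[of \<phi>] unfolding N_def[symmetric] by (simp add: mult.assoc)
  qed
  then show ?thesis by eventually_elim (simp add: e_def)
qed

lemma fourier_distr_AE:
  assumes "has_fourier u f"
  shows "AE \<xi> in lborel. fourier_distr u \<xi> = f \<xi>"
  using has_fourier_unique[OF someI[of "has_fourier u", OF assms] assms] by (simp add: fourier_distr_def)

lemma has_fourier_fourier_distr: "has_fourier u f \<Longrightarrow> has_fourier u (fourier_distr u)"
  unfolding fourier_distr_def by (rule someI[of "has_fourier u"])

section \<open>Sobolev spaces\<close>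

text \<open>
  The Cauchy-Schwarz inequality: the integral of (a t - b)^2 is a nonnegative quadratic polynomial
  in t.
\<close>

lemma integral_Cauchy_Schwarz:
  fixes a b :: "'a \<Rightarrow> real"
  assumes [measurable]: "a \<in> borel_measurable M" "b \<in> borel_measurable M"
    and a2: "integrable M (\<lambda>x. (a x)\<^sup>2)" and b2: "integrable M (\<lambda>x. (b x)\<^sup>2)"
  shows integrable_mult_of_squares: "integrable M (\<lambda>x. a x * b x)"
    and abs_integral_mult_le: "\<bar>LINT x|M. a x * b x\<bar> \<le> sqrt (LINT x|M. (a x)\<^sup>2) * sqrt (LINT x|M. (b x)\<^sup>2)"
proof -
  show ab: "integrable M (\<lambda>x. a x * b x)"
  proof (rule Bochner_Integration.integrable_bound)
    show "integrable M (\<lambda>x. (a x)\<^sup>2 + (b x)\<^sup>2)" using a2 b2 by simp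
    have "\<bar>a x * b x\<bar> \<le> (a x)\<^sup>2 + (b x)\<^sup>2" for x
    proof -
      have "0 \<le> (\<bar>a x\<bar> - \<bar>b x\<bar>)\<^sup>2" by simp
      then have "2 * \<bar>a x * b x\<bar> \<le> (a x)\<^sup>2 + (b x)\<^sup>2" by (simp add: power2_diff abs_mult)
      then show ?thesis by linarith
    qed
    then show "AE x in M. norm (a x * b x) \<le> norm ((a x)\<^sup>2 + (b x)\<^sup>2)" by simp
  qed measurable
  let ?A = "LINT x|M. (a x)\<^sup>2" and ?B = "LINT x|M. a x * b x" and ?C = "LINT x|M. (b x)\<^sup>2"
  have quad: "0 \<le> ?A * t\<^sup>2 - 2 * ?B * t + ?C" for t
  proof -
    have "0 \<le> (LINT x|M. (a x * t - b x)\<^sup>2)" by simp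
    also have "(\<lambda>x. (a x * t - b x)\<^sup>2) = (\<lambda>x. (a x)\<^sup>2 * t\<^sup>2 - a x * b x * (2 * t) + (b x)\<^sup>2)"
      by (auto simp: fun_eq_iff power2_diff power_mult_distrib mult_ac)
    also have "(LINT x|M. \<dots> x) = ?A * t\<^sup>2 - ?B * (2 * t) + ?C"
      using a2 b2 ab by simp
    finally show ?thesis by (simp add: mult_ac)
  qed
  have A: "?A \<ge> 0" and C: "?C \<ge> 0" by simp_all
  have "?B\<^sup>2 \<le> ?A * ?C"
  proof (cases "?A = 0")
    case True
    have "?B = 0"
    proof (rule ccontr)
      assume "?B \<noteq> 0"
      then show False using quad[of "(?C + 1) / (2 * ?B)"] True C by simp
    qed
    then show ?thesis using True by simp
  next
    case False
    then have "?A > 0" using A by (metis le_neq_trans)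
    then show ?thesis using quad[of "?B / ?A"] by (simp add: power2_eq_square field_simps)
  qed
  then show "\<bar>?B\<bar> \<le> sqrt ?A * sqrt ?C"
    by (metis real_sqrt_abs real_sqrt_le_mono real_sqrt_mult)
qed

lemma integral_Minkowski:
  fixes a b :: "'a \<Rightarrow> real"
  assumes [measurable]: "a \<in> borel_measurable M" "b \<in> borel_measurable M"
    and a2: "integrable M (\<lambda>x. (a x)\<^sup>2)" and b2: "integrable M (\<lambda>x. (b x)\<^sup>2)"
  shows integrable_square_add: "integrable M (\<lambda>x. (a x + b x)\<^sup>2)"
    and sqrt_integral_square_add_le: "sqrt (LINT x|M. (a x + b x)\<^sup>2) \<le> sqrt (LINT x|M. (a x)\<^sup>2) + sqrt (LINT x|M. (b x)\<^sup>2)"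
proof -
  note ab = integrable_mult_of_squares[OF assms]
  have eq: "(\<lambda>x. (a x + b x)\<^sup>2) = (\<lambda>x. (a x)\<^sup>2 + (b x)\<^sup>2 + 2 * (a x * b x))"
    by (auto simp: fun_eq_iff power2_sum mult_ac)
  show "integrable M (\<lambda>x. (a x + b x)\<^sup>2)" unfolding eq using a2 b2 ab by simp
  have "(LINT x|M. (a x + b x)\<^sup>2) = (LINT x|M. (a x)\<^sup>2) + (LINT x|M. (b x)\<^sup>2) + 2 * (LINT x|M. a x * b x)"
    unfolding eq using a2 b2 ab by simp
  also have "\<dots> \<le> (LINT x|M. (a x)\<^sup>2) + (LINT x|M. (b x)\<^sup>2) + 2 * (sqrt (LINT x|M. (a x)\<^sup>2) * sqrt (LINT x|M. (b x)\<^sup>2))"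
    using abs_integral_mult_le[OF assms] by linarith
  also have "\<dots> = (sqrt (LINT x|M. (a x)\<^sup>2) + sqrt (LINT x|M. (b x)\<^sup>2))\<^sup>2"
    by (simp add: power2_sum)
  finally show "sqrt (LINT x|M. (a x + b x)\<^sup>2) \<le> sqrt (LINT x|M. (a x)\<^sup>2) + sqrt (LINT x|M. (b x)\<^sup>2)"
    by (intro real_le_lsqrt) auto
qed

lemma schwartz_norm_term:
  assumes "schwartz \<phi>"
  shows "0 \<le> (SUP x. norm (x ^ m *\<^sub>R nderiv n \<phi> x))"
    and "norm (x ^ m *\<^sub>R nderiv n \<phi> x) \<le> (SUP x. norm (x ^ m *\<^sub>R nderiv n \<phi> x))"
proof -
  have "bounded (range (\<lambda>x. x ^ m *\<^sub>R nderiv n \<phi> x))" using assms by (simp add: schwartz_def)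
  then have bdd: "bdd_above (range (\<lambda>x. norm (x ^ m *\<^sub>R nderiv n \<phi> x)))"
    unfolding bounded_iff bdd_above_def by auto
  show *: "norm (x ^ m *\<^sub>R nderiv n \<phi> x) \<le> (SUP x. norm (x ^ m *\<^sub>R nderiv n \<phi> x))" for x
    by (rule cSUP_upper[OF _ bdd]) simp
  show "0 \<le> (SUP x. norm (x ^ m *\<^sub>R nderiv n \<phi> x))"
    using *[of 0] norm_ge_zero order_trans by blast
qed

lemma schwartz_norm_mono:
  assumes "schwartz \<phi>" "M \<le> N"
  shows "schwartz_norm M \<phi> \<le> schwartz_norm N \<phi>"
proof -
  let ?t = "\<lambda>m n. SUP x. norm (x ^ m *\<^sub>R nderiv n \<phi> x)"
  have "(\<Sum>m\<le>M. \<Sum>n\<le>M. ?t m n) \<le> (\<Sum>m\<le>M. \<Sum>n\<le>N. ?t m n)"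
    using assms by (intro sum_mono sum_mono2 schwartz_norm_term) auto
  also have "\<dots> \<le> (\<Sum>m\<le>N. \<Sum>n\<le>N. ?t m n)"
    using assms by (intro sum_mono2 sum_nonneg schwartz_norm_term) auto
  finally show ?thesis by (simp add: schwartz_norm_def)
qed

lemma schwartz_norm_nonneg: "schwartz \<phi> \<Longrightarrow> 0 \<le> schwartz_norm N \<phi>"
  unfolding schwartz_norm_def by (intro sum_nonneg schwartz_norm_term)

lemma norm_le_schwartz_norm:
  assumes "schwartz \<phi>" "m \<le> N"
  shows "norm (x ^ m *\<^sub>R \<phi> x) \<le> schwartz_norm N \<phi>"
proof -
  let ?t = "\<lambda>m n. SUP x. norm (x ^ m *\<^sub>R nderiv n \<phi> x)"
  have "norm (x ^ m *\<^sub>R \<phi> x) \<le> ?t m 0"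
    using schwartz_norm_term(2)[OF assms(1), of x m 0] by (simp add: nderiv_0)
  also have "\<dots> \<le> (\<Sum>n\<le>N. ?t m n)"
    by (rule member_le_sum) (use schwartz_norm_term[OF assms(1)] in auto)
  also have "\<dots> \<le> (\<Sum>m\<le>N. \<Sum>n\<le>N. ?t m n)"
    by (rule member_le_sum[of m "{..N}" "\<lambda>m. \<Sum>n\<le>N. ?t m n"]) (use schwartz_norm_term[OF assms(1)] assms(2) in \<open>auto intro!: sum_nonneg\<close>)
  finally show ?thesis by (simp add: schwartz_norm_def)
qed

lemma integral_norm_le_schwartz_norm:
  assumes "schwartz \<phi>"
  shows "(LINT x|lborel. norm (\<phi> x)) \<le> 2 * (LINT x|lborel. 1 / (1 + x\<^sup>2)) * schwartz_norm 2 \<phi>"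
proof -
  let ?S = "schwartz_norm 2 \<phi>"
  have "(LINT x|lborel. norm (\<phi> x)) \<le> (LINT x|lborel. (2 * ?S) * (1 / (1 + x\<^sup>2)))"
  proof (rule integral_mono)
    show "integrable lborel (\<lambda>x. norm (\<phi> x))" using schwartz_integrable[OF assms] by simp
    show "integrable lborel (\<lambda>x. (2 * ?S) * (1 / (1 + x\<^sup>2)))"
      by (intro integrable_mult_right integrable_inverse_one_plus_square)
    fix x
    have "norm (\<phi> x) \<le> ?S" "x\<^sup>2 * norm (\<phi> x) \<le> ?S"
      using norm_le_schwartz_norm[OF assms, of 0 2 x] norm_le_schwartz_norm[OF assms, of 2 2 x] by auto
    then have "norm (\<phi> x) * (1 + x\<^sup>2) \<le> 2 * ?S" by (simp add: distrib_left mult.commute)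
    then show "norm (\<phi> x) \<le> (2 * ?S) * (1 / (1 + x\<^sup>2))"
      by (simp add: pos_le_divide_eq add_pos_nonneg)
  qed
  also have "\<dots> = (2 * ?S) * (LINT x|lborel. 1 / (1 + x\<^sup>2))"
    by (rule integral_mult_right_zero)
  finally show ?thesis by (simp add: mult_ac)
qed

lemma sobolev_vecs_iff:
  "u \<in> vecs (sobolev F s) \<longleftrightarrow> tempered u
     \<and> (\<forall>\<phi>. schwartz \<phi> \<longrightarrow> range \<phi> \<subseteq> \<real> \<longrightarrow> u \<phi> \<in> F)
     \<and> (\<exists>f. has_fourier u f \<and> integrable lborel (\<lambda>\<xi>. (1 + \<xi>\<^sup>2) powr s * (norm (f \<xi>))\<^sup>2))"
  by (simp add: sobolev_def)

lemma powr_one_plus_square_measurable [measurable]: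
  "(\<lambda>\<xi>::real. (1 + \<xi>\<^sup>2) powr s) \<in> borel_measurable borel"
  by measurable

lemma has_fourier_measurable: "has_fourier u f \<Longrightarrow> f \<in> borel_measurable borel"
  by (simp add: has_fourier_def)

text \<open>
  The norm is defined through an arbitrarily chosen Fourier transform. Uniqueness up to null sets
  makes it computable from any other one.
\<close>

lemma sobolev_norm_eq:
  assumes "has_fourier u f"
  shows "vnorm (sobolev F s) u = sqrt (LINT \<xi>|lborel. (1 + \<xi>\<^sup>2) powr s * (norm (f \<xi>))\<^sup>2)"
proof -
  note [measurable] = has_fourier_measurable[OF assms] has_fourier_measurable[OF has_fourier_fourier_distr[OF assms]]
  have "(LINT \<xi>|lborel. (1 + \<xi>\<^sup>2) powr s * (norm (fourier_distr u \<xi>))\<^sup>2)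
      = (LINT \<xi>|lborel. (1 + \<xi>\<^sup>2) powr s * (norm (f \<xi>))\<^sup>2)"
    by (rule integral_cong_AE) (use fourier_distr_AE[OF assms] in auto)
  then show ?thesis by (simp add: sobolev_def)
qed

lemma has_fourier_lincomb:
  assumes f: "has_fourier u f" and g: "has_fourier v g" and w: "\<And>\<phi>. schwartz \<phi> \<Longrightarrow> w \<phi> = a * u \<phi> + b * v \<phi>"
  shows "has_fourier w (\<lambda>\<xi>. a * f \<xi> + b * g \<xi>)"
  using f g w schwartz_fourier unfolding has_fourier_def
  by (auto simp: distrib_right mult.assoc)

lemma has_fourier_add: "has_fourier u f \<Longrightarrow> has_fourier v g \<Longrightarrow> has_fourier (u + v) (\<lambda>\<xi>. f \<xi> + g \<xi>)"
  using has_fourier_lincomb[of u f v g "u + v" 1 1] by simp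

lemma has_fourier_diff: "has_fourier u f \<Longrightarrow> has_fourier v g \<Longrightarrow> has_fourier (u - v) (\<lambda>\<xi>. f \<xi> - g \<xi>)"
  using has_fourier_lincomb[of u f v g "u - v" 1 "-1"] by simp

lemma has_fourier_scaleR: "has_fourier u f \<Longrightarrow> has_fourier (c *\<^sub>R u) (\<lambda>\<xi>. of_real c * f \<xi>)"
  using has_fourier_lincomb[of u f u f "c *\<^sub>R u" "of_real c" 0] by (simp add: scaleR_fun_def scaleR_conv_of_real)

lemma tempered_lincomb:
  assumes u: "tempered u" and v: "tempered v"
  shows "tempered (c *\<^sub>R u + d *\<^sub>R v)"
proof -
  obtain C M where C: "\<And>\<phi>. schwartz \<phi> \<Longrightarrow> norm (u \<phi>) \<le> C * schwartz_norm M \<phi>"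
    using u unfolding tempered_def by blast
  obtain D N where D: "\<And>\<phi>. schwartz \<phi> \<Longrightarrow> norm (v \<phi>) \<le> D * schwartz_norm N \<phi>"
    using v unfolding tempered_def by blast
  let ?K = "max M N"
  have "norm ((c *\<^sub>R u + d *\<^sub>R v) \<phi>) \<le> (\<bar>c\<bar> * \<bar>C\<bar> + \<bar>d\<bar> * \<bar>D\<bar>) * schwartz_norm ?K \<phi>" if \<phi>: "schwartz \<phi>" for \<phi>
  proof -
    have "norm (u \<phi>) \<le> \<bar>C\<bar> * schwartz_norm ?K \<phi>"
      using C[OF \<phi>] schwartz_norm_mono[OF \<phi>, of M ?K] schwartz_norm_nonneg[OF \<phi>]
      by (smt (verit, best) abs_ge_self max.cobounded1 mult_left_mono mult_right_mono abs_ge_zero)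
    moreover have "norm (v \<phi>) \<le> \<bar>D\<bar> * schwartz_norm ?K \<phi>"
      using D[OF \<phi>] schwartz_norm_mono[OF \<phi>, of N ?K] schwartz_norm_nonneg[OF \<phi>]
      by (smt (verit, best) abs_ge_self max.cobounded2 mult_left_mono mult_right_mono abs_ge_zero)
    ultimately have "\<bar>c\<bar> * norm (u \<phi>) + \<bar>d\<bar> * norm (v \<phi>)
        \<le> \<bar>c\<bar> * (\<bar>C\<bar> * schwartz_norm ?K \<phi>) + \<bar>d\<bar> * (\<bar>D\<bar> * schwartz_norm ?K \<phi>)"
      by (intro add_mono mult_left_mono) auto
    then show ?thesis
      using norm_triangle_ineq[of "c *\<^sub>R u \<phi>" "d *\<^sub>R v \<phi>"]
      by (simp add: scaleR_fun_def distrib_right mult.assoc)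
  qed
  moreover have "\<forall>\<phi>. \<not> schwartz \<phi> \<longrightarrow> (c *\<^sub>R u + d *\<^sub>R v) \<phi> = 0"
    using u v by (simp add: tempered_def scaleR_fun_def)
  moreover have "\<forall>a b \<phi> \<psi>. schwartz \<phi> \<longrightarrow> schwartz \<psi> \<longrightarrow>
      (c *\<^sub>R u + d *\<^sub>R v) (\<lambda>x. a * \<phi> x + b * \<psi> x) = a * (c *\<^sub>R u + d *\<^sub>R v) \<phi> + b * (c *\<^sub>R u + d *\<^sub>R v) \<psi>"
    using u v by (simp add: tempered_def scaleR_fun_def scaleR_conv_of_real algebra_simps)
  ultimately show ?thesis unfolding tempered_def by blast
qed

lemma sobolev_fourier_distr:
  assumes "u \<in> vecs (sobolev F s)"
  shows "has_fourier u (fourier_distr u)"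
    and "integrable lborel (\<lambda>\<xi>. (1 + \<xi>\<^sup>2) powr s * (norm (fourier_distr u \<xi>))\<^sup>2)"
proof -
  obtain f where f: "has_fourier u f" and int: "integrable lborel (\<lambda>\<xi>. (1 + \<xi>\<^sup>2) powr s * (norm (f \<xi>))\<^sup>2)"
    using assms unfolding sobolev_vecs_iff by blast
  show "has_fourier u (fourier_distr u)" by (rule has_fourier_fourier_distr[OF f])
  note [measurable] = has_fourier_measurable[OF f] has_fourier_measurable[OF has_fourier_fourier_distr[OF f]]
  show "integrable lborel (\<lambda>\<xi>. (1 + \<xi>\<^sup>2) powr s * (norm (fourier_distr u \<xi>))\<^sup>2)"
    using int by (rule integrable_cong_AE_imp) (use fourier_distr_AE[OF f] in auto)
qed

lemma weighted_square_eq: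
  "(1 + \<xi>\<^sup>2) powr s * (norm (z :: complex))\<^sup>2 = ((1 + \<xi>\<^sup>2) powr (s / 2) * norm z)\<^sup>2" for \<xi> :: real
proof -
  have "((1 + \<xi>\<^sup>2) powr (s / 2))\<^sup>2 = (1 + \<xi>\<^sup>2) powr s"
    by (simp add: power2_eq_square powr_add[symmetric])
  then show ?thesis by (simp add: power_mult_distrib)
qed

definition sobolev_size :: "real \<Rightarrow> (real \<Rightarrow> complex) \<Rightarrow> real" where
  "sobolev_size s f = sqrt (LINT \<xi>|lborel. (1 + \<xi>\<^sup>2) powr s * (norm (f \<xi>))\<^sup>2)"

lemma sobolev_size_nonneg: "0 \<le> sobolev_size s f"
  by (simp add: sobolev_size_def)

lemma sobolev_size_add:
  assumes [measurable]: "f \<in> borel_measurable borel" "g \<in> borel_measurable borel"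
    and f: "integrable lborel (\<lambda>\<xi>. (1 + \<xi>\<^sup>2) powr s * (norm (f \<xi>))\<^sup>2)"
    and g: "integrable lborel (\<lambda>\<xi>. (1 + \<xi>\<^sup>2) powr s * (norm (g \<xi>))\<^sup>2)"
  shows integrable_sobolev_add: "integrable lborel (\<lambda>\<xi>. (1 + \<xi>\<^sup>2) powr s * (norm (f \<xi> + g \<xi>))\<^sup>2)"
    and sobolev_size_add_le: "sobolev_size s (\<lambda>\<xi>. f \<xi> + g \<xi>) \<le> sobolev_size s f + sobolev_size s g"
proof -
  let ?w = "\<lambda>\<xi>::real. (1 + \<xi>\<^sup>2) powr (s / 2)"
  note f2 = f[unfolded weighted_square_eq] and g2 = g[unfolded weighted_square_eq]
  have le: "(?w \<xi> * norm (f \<xi> + g \<xi>))\<^sup>2 \<le> (?w \<xi> * norm (f \<xi>) + ?w \<xi> * norm (g \<xi>))\<^sup>2" for \<xi>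
    using norm_triangle_ineq[of "f \<xi>" "g \<xi>"]
    by (intro power_mono) (simp_all add: distrib_left[symmetric] mult_left_mono)
  have int1: "integrable lborel (\<lambda>\<xi>. (?w \<xi> * norm (f \<xi>) + ?w \<xi> * norm (g \<xi>))\<^sup>2)"
    using f2 g2 by (intro integrable_square_add) measurable
  have int2: "integrable lborel (\<lambda>\<xi>. (?w \<xi> * norm (f \<xi> + g \<xi>))\<^sup>2)"
    using int1 by (rule Bochner_Integration.integrable_bound) (use le in auto)
  then show "integrable lborel (\<lambda>\<xi>. (1 + \<xi>\<^sup>2) powr s * (norm (f \<xi> + g \<xi>))\<^sup>2)"
    unfolding weighted_square_eq .
  have "sobolev_size s (\<lambda>\<xi>. f \<xi> + g \<xi>) \<le> sqrt (LINT \<xi>|lborel. (?w \<xi> * norm (f \<xi>) + ?w \<xi> * norm (g \<xi>))\<^sup>2)"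
    unfolding sobolev_size_def weighted_square_eq
    using int1 int2 le by (intro real_sqrt_le_mono integral_mono) auto
  also have "\<dots> \<le> sobolev_size s f + sobolev_size s g"
    unfolding sobolev_size_def weighted_square_eq
    using f2 g2 by (intro sqrt_integral_square_add_le) measurable
  finally show "sobolev_size s (\<lambda>\<xi>. f \<xi> + g \<xi>) \<le> sobolev_size s f + sobolev_size s g" .
qed

lemma seminormed_sobolev:
  assumes F: "F = \<real> \<or> F = UNIV"
  shows "seminormed (sobolev F s)"
proof -
  have sum: "u + v \<in> vecs (sobolev F s) \<and> vnorm (sobolev F s) (u + v) \<le> vnorm (sobolev F s) u + vnorm (sobolev F s) v"
    if u: "u \<in> vecs (sobolev F s)" and v: "v \<in> vecs (sobolev F s)" for u v
  proof -
    let ?f = "fourier_distr u" and ?g = "fourier_distr v"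
    note f = sobolev_fourier_distr[OF u] and g = sobolev_fourier_distr[OF v]
    note fg = has_fourier_add[OF f(1) g(1)]
    note size = sobolev_size_add[OF has_fourier_measurable[OF f(1)] has_fourier_measurable[OF g(1)] f(2) g(2)]
    have "vnorm (sobolev F s) (u + v) \<le> vnorm (sobolev F s) u + vnorm (sobolev F s) v"
      using size(2) unfolding sobolev_norm_eq[OF fg] sobolev_norm_eq[OF f(1)] sobolev_norm_eq[OF g(1)] sobolev_size_def .
    moreover have "u + v \<in> vecs (sobolev F s)"
    proof -
      have "tempered (u + v)" using tempered_lincomb[of u v 1 1] u v by (simp add: sobolev_vecs_iff)
      moreover have "\<forall>\<phi>. schwartz \<phi> \<longrightarrow> range \<phi> \<subseteq> \<real> \<longrightarrow> (u + v) \<phi> \<in> F"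
        using F u v by (auto simp: sobolev_vecs_iff)
      ultimately show ?thesis
        unfolding sobolev_vecs_iff using fg size(1) by auto
    qed
    ultimately show ?thesis by blast
  qed
  have scale: "c *\<^sub>R u \<in> vecs (sobolev F s) \<and> vnorm (sobolev F s) (c *\<^sub>R u) = \<bar>c\<bar> * vnorm (sobolev F s) u"
    if u: "u \<in> vecs (sobolev F s)" for u c
  proof -
    let ?f = "fourier_distr u"
    note f = sobolev_fourier_distr[OF u]
    note cf = has_fourier_scaleR[OF f(1), of c]
    have eq: "(\<lambda>\<xi>. (1 + \<xi>\<^sup>2) powr s * (norm (of_real c * ?f \<xi>))\<^sup>2) = (\<lambda>\<xi>. c\<^sup>2 * ((1 + \<xi>\<^sup>2) powr s * (norm (?f \<xi>))\<^sup>2))"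
      by (auto simp: fun_eq_iff norm_mult power_mult_distrib)
    have "tempered (c *\<^sub>R u)" using tempered_lincomb[of u u c 0] u by (simp add: sobolev_vecs_iff)
    moreover have "\<forall>\<phi>. schwartz \<phi> \<longrightarrow> range \<phi> \<subseteq> \<real> \<longrightarrow> (c *\<^sub>R u) \<phi> \<in> F"
      using F u by (auto simp: sobolev_vecs_iff scaleR_fun_def scaleR_conv_of_real)
    moreover have "integrable lborel (\<lambda>\<xi>. (1 + \<xi>\<^sup>2) powr s * (norm (of_real c * ?f \<xi>))\<^sup>2)"
      unfolding eq using f(2) by (rule integrable_mult_right)
    ultimately have "c *\<^sub>R u \<in> vecs (sobolev F s)"
      unfolding sobolev_vecs_iff using cf by blast
    moreover have "vnorm (sobolev F s) (c *\<^sub>R u) = \<bar>c\<bar> * vnorm (sobolev F s) u"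
      unfolding sobolev_norm_eq[OF cf] sobolev_norm_eq[OF f(1)] eq integral_mult_right_zero
      by (simp add: real_sqrt_mult)
    ultimately show ?thesis by blast
  qed
  show ?thesis
  proof
    have t0: "tempered 0" unfolding tempered_def by (auto intro!: exI[of _ 0])
    have h0: "has_fourier 0 (\<lambda>_. 0)" by (simp add: has_fourier_def)
    have "(0 :: distr) \<in> vecs (sobolev F s)"
      unfolding sobolev_vecs_iff using t0 h0 F by (auto intro!: exI[of _ "\<lambda>_. 0"])
    then show "subspace (vecs (sobolev F s))" using sum scale by (simp add: subspace_def)
  qed (use sum scale in auto)
qed

section \<open>Distributions with integrable Fourier transform\<close>

lemma inv_fourier_measurable [measurable]:
  assumes [measurable]: "f \<in> borel_measurable borel"
  shows "inv_fourier f \<in> borel_measurable borel"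
  unfolding inv_fourier_def by measurable

lemma norm_inv_fourier_le: "norm (inv_fourier f x) \<le> (LINT \<xi>|lborel. norm (f \<xi>))"
proof -
  have "norm (LINT \<xi>|lborel. cis (x * \<xi>) * f \<xi>) \<le> (LINT \<xi>|lborel. norm (f \<xi>))"
    using integral_norm_bound[of lborel "\<lambda>\<xi>. cis (x * \<xi>) * f \<xi>"] by (simp add: norm_mult)
  moreover have "norm (inv_fourier f x) \<le> norm (LINT \<xi>|lborel. cis (x * \<xi>) * f \<xi>)"
  proof -
    have "1 \<le> 2 * pi" using pi_gt3 by simp
    then show ?thesis unfolding inv_fourier_def
      by (simp add: norm_divide divide_le_eq mult_left_le norm_mult mult_le_cancel_left1)
  qed
  ultimately show ?thesis by linarith
qed

text \<open>
  Fubini's theorem applies because f and the test function are both integrable.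
\<close>

lemma inv_fourier_distr_eq_regular:
  assumes f: "integrable lborel f"
  shows "inv_fourier_distr f = regular_distr (inv_fourier f)"
proof
  fix \<theta>
  show "inv_fourier_distr f \<theta> = regular_distr (inv_fourier f) \<theta>"
  proof (cases "schwartz \<theta>")
    case True
    note [measurable] = schwartz_measurable[OF True] borel_measurable_integrable[OF f, simplified]
    have "(LINT \<xi>|lborel. f \<xi> * inv_fourier \<theta> \<xi>)
        = (LINT \<xi>|lborel. LINT x|lborel. f \<xi> * (cis (\<xi> * x) * \<theta> x) / (2 * pi))"
      by (simp add: inv_fourier_def)
    also have "\<dots> = (LINT x|lborel. LINT \<xi>|lborel. f \<xi> * (cis (\<xi> * x) * \<theta> x) / (2 * pi))"
    proof (rule fubini_bound_swap[where A = "\<lambda>\<xi>. norm (f \<xi>)" and B = "\<lambda>x. norm (\<theta> x)"])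
      fix \<xi> x
      have "1 \<le> 2 * pi" using pi_gt3 by simp
      moreover have "\<not> norm (f \<xi>) * norm (\<theta> x) < 0" by (simp add: not_less)
      ultimately show "norm (f \<xi> * (cis (\<xi> * x) * \<theta> x) / (2 * pi)) \<le> norm (f \<xi>) * norm (\<theta> x)"
        by (simp add: norm_divide norm_mult divide_le_eq mult_left_le mult_le_cancel_left1)
    qed (use f schwartz_integrable[OF True] in auto)
    also have "\<dots> = (LINT x|lborel. inv_fourier f x * \<theta> x)"
    proof (intro Bochner_Integration.integral_cong refl)
      fix x
      have "(LINT \<xi>|lborel. f \<xi> * (cis (\<xi> * x) * \<theta> x) / (2 * pi))
          = (LINT \<xi>|lborel. (cis (x * \<xi>) * f \<xi>) * (\<theta> x / (2 * pi)))"
        by (intro Bochner_Integration.integral_cong refl) (simp add: mult_ac)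
      then show "(LINT \<xi>|lborel. f \<xi> * (cis (\<xi> * x) * \<theta> x) / (2 * pi)) = inv_fourier f x * \<theta> x"
        by (simp add: inv_fourier_def)
    qed
    finally show ?thesis using True by (simp add: inv_fourier_distr_def regular_distr_def)
  qed (simp add: inv_fourier_distr_def regular_distr_def)
qed

lemma integrable_mult_schwartz:
  assumes f: "integrable lborel f" and \<phi>: "schwartz \<phi>"
  shows "integrable lborel (\<lambda>\<xi>. f \<xi> * \<phi> \<xi>)"
proof -
  note [measurable] = schwartz_measurable[OF \<phi>]
  have "integrable lborel (\<lambda>\<xi>. \<phi> \<xi> * f \<xi>)"
    using norm_le_schwartz_norm[OF \<phi>, of 0 0] by (intro integrable_bounded_mult f) auto
  then show ?thesis by (simp add: mult.commute)
qed

lemma has_fourier_inv_fourier_distr: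
  assumes f: "integrable lborel f"
  shows "has_fourier (inv_fourier_distr f) f"
  unfolding has_fourier_def
  using borel_measurable_integrable[OF f] integrable_mult_schwartz[OF f]
  by (auto simp: inv_fourier_distr_def schwartz_fourier inv_fourier_fourier)

lemma tempered_inv_fourier_distr:
  assumes f: "integrable lborel f"
  shows "tempered (inv_fourier_distr f)"
proof -
  let ?M = "LINT \<xi>|lborel. norm (f \<xi>)" and ?I = "2 * (LINT x|lborel. 1 / (1 + x\<^sup>2)) :: real"
  have lin: "inv_fourier_distr f (\<lambda>x. a * \<phi> x + b * \<psi> x) = a * inv_fourier_distr f \<phi> + b * inv_fourier_distr f \<psi>"
    if \<phi>: "schwartz \<phi>" and \<psi>: "schwartz \<psi>" for a b \<phi> \<psi>
  proof -
    have "inv_fourier (\<lambda>x. a * \<phi> x + b * \<psi> x) \<xi> = a * inv_fourier \<phi> \<xi> + b * inv_fourier \<psi> \<xi>" for \<xi>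
    proof -
      have "(LINT x|lborel. cis (\<xi> * x) * (a * \<phi> x + b * \<psi> x))
          = (LINT x|lborel. a * (cis (\<xi> * x) * \<phi> x) + b * (cis (\<xi> * x) * \<psi> x))"
        by (intro Bochner_Integration.integral_cong refl) (simp add: algebra_simps)
      also have "\<dots> = a * (LINT x|lborel. cis (\<xi> * x) * \<phi> x) + b * (LINT x|lborel. cis (\<xi> * x) * \<psi> x)"
        using integrable_cis_mult(1)[OF schwartz_integrable[OF \<phi>]] integrable_cis_mult(1)[OF schwartz_integrable[OF \<psi>]]
        by simp
      finally show ?thesis by (simp add: inv_fourier_def add_divide_distrib)
    qed
    then have "inv_fourier_distr f (\<lambda>x. a * \<phi> x + b * \<psi> x)
        = (LINT \<xi>|lborel. a * (f \<xi> * inv_fourier \<phi> \<xi>) + b * (f \<xi> * inv_fourier \<psi> \<xi>))"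
      using schwartz_lincomb[OF \<phi> \<psi>] by (simp add: inv_fourier_distr_def algebra_simps)
    also have "\<dots> = a * inv_fourier_distr f \<phi> + b * inv_fourier_distr f \<psi>"
      using integrable_mult_schwartz[OF f schwartz_inv_fourier[OF \<phi>]]
        integrable_mult_schwartz[OF f schwartz_inv_fourier[OF \<psi>]] \<phi> \<psi>
      by (simp add: inv_fourier_distr_def)
    finally show ?thesis .
  qed
  have "norm (inv_fourier_distr f \<phi>) \<le> (?M * ?I) * schwartz_norm 2 \<phi>" if \<phi>: "schwartz \<phi>" for \<phi>
  proof -
    have "norm (inv_fourier_distr f \<phi>) \<le> (LINT \<xi>|lborel. norm (f \<xi> * inv_fourier \<phi> \<xi>))"
      using \<phi> by (simp add: inv_fourier_distr_def integral_norm_bound)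
    also have "\<dots> \<le> (LINT \<xi>|lborel. norm (f \<xi>) * (?I * schwartz_norm 2 \<phi>))"
    proof (rule integral_mono)
      show "integrable lborel (\<lambda>\<xi>. norm (f \<xi> * inv_fourier \<phi> \<xi>))"
        by (intro integrable_norm integrable_mult_schwartz f schwartz_inv_fourier \<phi>)
      show "integrable lborel (\<lambda>\<xi>. norm (f \<xi>) * (?I * schwartz_norm 2 \<phi>))" using f by simp
      fix \<xi>
      show "norm (f \<xi> * inv_fourier \<phi> \<xi>) \<le> norm (f \<xi>) * (?I * schwartz_norm 2 \<phi>)"
        unfolding norm_mult
        by (intro mult_left_mono order_trans[OF norm_inv_fourier_le] integral_norm_le_schwartz_norm \<phi>) simp
    qed
    also have "\<dots> = (?M * ?I) * schwartz_norm 2 \<phi>" by simp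
    finally show ?thesis .
  qed
  moreover have "\<forall>\<phi>. \<not> schwartz \<phi> \<longrightarrow> inv_fourier_distr f \<phi> = 0" by (simp add: inv_fourier_distr_def)
  ultimately show ?thesis unfolding tempered_def using lin by blast
qed

text \<open>These are the Fourier transforms of real distributions.\<close>

definition hermitian :: "(real \<Rightarrow> complex) \<Rightarrow> bool" where
  "hermitian f \<longleftrightarrow> (\<forall>\<xi>. f (- \<xi>) = cnj (f \<xi>))"

lemma cnj_inv_fourier: "cnj (inv_fourier f x) = inv_fourier (\<lambda>\<xi>. cnj (f (- \<xi>))) x"
proof -
  have "cnj (LINT \<xi>|lborel. cis (x * \<xi>) * f \<xi>) = (LINT \<xi>|lborel. cnj (cis (x * \<xi>) * f \<xi>))"
    by (rule Bochner_Integration.integral_cnj[symmetric])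
  also have "\<dots> = (LINT \<xi>|lborel. cis (- (x * \<xi>)) * cnj (f \<xi>))"
    by (simp only: complex_cnj_mult cis_cnj)
  also have "\<dots> = (LINT \<xi>|lborel. cis (x * \<xi>) * cnj (f (- \<xi>)))"
    using lborel_integral_real_affine[of "-1" "\<lambda>\<xi>. cis (- (x * \<xi>)) * cnj (f \<xi>)" 0] by simp
  finally show ?thesis by (simp add: inv_fourier_def)
qed

lemma hermitian_imp_inv_fourier_real: "hermitian f \<Longrightarrow> inv_fourier f x \<in> \<real>"
  using cnj_inv_fourier[of f x] by (simp add: hermitian_def Reals_cnj_iff)

text \<open>
  The symmetry of f makes the distribution real. Data and solutions constructed through such f
  belong to the space of real distributions and to that of complex ones at the same time.
\<close>

lemma inv_fourier_distr_sobolev: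
  assumes f: "integrable lborel f" and h: "hermitian f" and F: "F = \<real> \<or> F = UNIV"
    and w: "integrable lborel (\<lambda>\<xi>. (1 + \<xi>\<^sup>2) powr s * (norm (f \<xi>))\<^sup>2)"
  shows "inv_fourier_distr f \<in> vecs (sobolev F s)"
proof -
  have "inv_fourier_distr f \<phi> \<in> \<real>" if "schwartz \<phi>" "range \<phi> \<subseteq> \<real>" for \<phi>
  proof -
    have "cnj (inv_fourier f x * \<phi> x) = inv_fourier f x * \<phi> x" for x
    proof -
      have "\<phi> x \<in> \<real>" using that(2) by auto
      then show ?thesis using hermitian_imp_inv_fourier_real[OF h, of x] by (simp add: Reals_cnj_iff)
    qed
    then have "cnj (LINT x|lborel. inv_fourier f x * \<phi> x) = (LINT x|lborel. inv_fourier f x * \<phi> x)"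
      by (simp only: Bochner_Integration.integral_cnj[symmetric])
    then show ?thesis
      using that by (simp add: inv_fourier_distr_eq_regular[OF f] regular_distr_def Reals_cnj_iff)
  qed
  then show ?thesis
    unfolding sobolev_vecs_iff
    using F w tempered_inv_fourier_distr[OF f] has_fourier_inv_fourier_distr[OF f] by auto
qed

lemma has_fourier_distr_deriv:
  assumes "has_fourier u f"
  shows "has_fourier (distr_deriv u) (\<lambda>\<xi>. \<i> * of_real \<xi> * f \<xi>)"
proof -
  have u: "u (fourier \<phi>) = (LINT \<xi>|lborel. f \<xi> * \<phi> \<xi>)" "integrable lborel (\<lambda>\<xi>. f \<xi> * \<phi> \<xi>)"
    if "schwartz \<phi>" for \<phi>
    using assms that by (auto simp: has_fourier_def)
  note [measurable] = has_fourier_measurable[OF assms]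
  show ?thesis
    unfolding has_fourier_def
  proof (intro conjI allI impI)
    fix \<phi> assume \<phi>: "schwartz \<phi>"
    note s1 = schwartz_cmult[OF schwartz_x_mult[OF \<phi>], of "\<i>"]
    have eq: "\<i> * of_real \<xi> * f \<xi> * \<phi> \<xi> = f \<xi> * (\<i> * (of_real \<xi> * \<phi> \<xi>))" for \<xi> by (simp add: mult_ac)
    show "integrable lborel (\<lambda>\<xi>. \<i> * of_real \<xi> * f \<xi> * \<phi> \<xi>)"
      unfolding eq using s1 by (rule u(2))
    note s2 = schwartz_cmult[OF schwartz_x_mult[OF \<phi>], of "- \<i>"]
    have "nderiv 1 (fourier \<phi>) = fourier (\<lambda>x. - \<i> * (of_real x * \<phi> x))"
      by (rule nderiv_1_eqI[OF fourier_has_deriv[OF \<phi>]])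
    then have "distr_deriv u (fourier \<phi>) = - (LINT \<xi>|lborel. f \<xi> * (- \<i> * (of_real \<xi> * \<phi> \<xi>)))"
      unfolding distr_deriv_def using schwartz_fourier[OF \<phi>] u(1)[OF s2] by simp
    also have "\<dots> = (LINT \<xi>|lborel. \<i> * of_real \<xi> * f \<xi> * \<phi> \<xi>)"
      unfolding eq by simp
    finally show "distr_deriv u (fourier \<phi>) = (LINT \<xi>|lborel. \<i> * of_real \<xi> * f \<xi> * \<phi> \<xi>)" .
  qed measurable
qed

text \<open>
  The propagator refers to a chosen Fourier transform, but integration does not see the choice.
\<close>

lemma propagator_eq:
  assumes "has_fourier u f"
  shows "propagator \<alpha> t u = inv_fourier_distr (\<lambda>\<xi>. cis (t * \<alpha> * \<xi> ^ 3) * f \<xi>)"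
proof
  fix \<theta>
  note [measurable] = has_fourier_measurable[OF assms] has_fourier_measurable[OF has_fourier_fourier_distr[OF assms]]
  show "propagator \<alpha> t u \<theta> = inv_fourier_distr (\<lambda>\<xi>. cis (t * \<alpha> * \<xi> ^ 3) * f \<xi>) \<theta>"
  proof (cases "schwartz \<theta>")
    case True
    note [measurable] = schwartz_measurable[OF True]
    have "(LINT \<xi>|lborel. cis (t * \<alpha> * \<xi> ^ 3) * fourier_distr u \<xi> * inv_fourier \<theta> \<xi>)
        = (LINT \<xi>|lborel. cis (t * \<alpha> * \<xi> ^ 3) * f \<xi> * inv_fourier \<theta> \<xi>)"
      by (rule integral_cong_AE) (use fourier_distr_AE[OF assms] in auto)
    then show ?thesis
      using True by (simp add: propagator_def fourier_multiplier_def inv_fourier_distr_def)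
  qed (simp add: propagator_def fourier_multiplier_def inv_fourier_distr_def)
qed

section \<open>Exponentially decaying functions on the Fourier side\<close>

text \<open>
  Functions dominated by such a weight form a convolution algebra. The exponential alone is not
  enough for that: the factor 1 / (1 + \<xi>^2) makes the convolution integrals converge.
\<close>

definition decay_weight :: "real \<Rightarrow> real \<Rightarrow> real" where
  "decay_weight \<sigma> \<xi> = exp (- \<sigma> * \<bar>\<xi>\<bar>) / (1 + \<xi>\<^sup>2)"

lemma one_plus_square_pos: "0 < 1 + (\<xi>::real)\<^sup>2"
  by (simp add: add_pos_nonneg)

lemma decay_weight_pos: "0 < decay_weight \<sigma> \<xi>"
  by (simp add: decay_weight_def one_plus_square_pos)

lemma decay_weight_nonneg: "0 \<le> decay_weight \<sigma> \<xi>"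
  using decay_weight_pos less_imp_le by blast

lemma decay_bound_nonneg:
  assumes "\<And>\<xi>. norm (f \<xi>) \<le> A * decay_weight \<sigma> \<xi>"
  shows "0 \<le> A"
proof -
  have "0 \<le> A * decay_weight \<sigma> 0" using assms[of 0] norm_ge_zero order_trans by blast
  then show ?thesis using decay_weight_pos[of \<sigma> 0] by (simp add: zero_le_mult_iff not_le)
qed

lemma decay_weight_mono: "\<sigma> \<le> \<tau> \<Longrightarrow> decay_weight \<tau> \<xi> \<le> decay_weight \<sigma> \<xi>"
  unfolding decay_weight_def by (intro divide_right_mono) (auto simp: mult_right_mono)

lemma decay_weight_le: "0 \<le> \<sigma> \<Longrightarrow> decay_weight \<sigma> \<xi> \<le> 1 / (1 + \<xi>\<^sup>2)"
  unfolding decay_weight_def by (intro divide_right_mono) auto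

lemma decay_weight_le_1: "0 \<le> \<sigma> \<Longrightarrow> decay_weight \<sigma> \<xi> \<le> 1"
  by (rule order_trans[OF decay_weight_le]) (auto simp: one_plus_square_pos)

lemma decay_weight_measurable [measurable]: "decay_weight \<sigma> \<in> borel_measurable borel"
  unfolding decay_weight_def by measurable

lemma integral_inverse_one_plus_square: "(LINT x|lborel. 1 / (1 + (x::real)\<^sup>2)) = pi"
  using LBINT_inverse_1_plus_square
  by (simp add: interval_lebesgue_integral_def set_lebesgue_integral_def inverse_eq_divide)

lemma one_plus_square_add_le: "1 + (\<xi>::real)\<^sup>2 \<le> 2 * (1 + (\<xi> - \<eta>)\<^sup>2) + 2 * (1 + \<eta>\<^sup>2)"
proof -
  have "0 \<le> (\<xi> - 2 * \<eta>)\<^sup>2" by simp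
  then show ?thesis by (simp add: power2_eq_square algebra_simps)
qed

lemma Peetre_inequality: "1 + (\<xi>::real)\<^sup>2 \<le> 2 * (1 + (\<xi> - \<eta>)\<^sup>2) * (1 + \<eta>\<^sup>2)"
proof -
  have "0 \<le> (\<xi> - 2 * \<eta>)\<^sup>2" "0 \<le> (\<xi> - \<eta>)\<^sup>2 * \<eta>\<^sup>2" by simp_all
  then show ?thesis by (simp add: power2_eq_square algebra_simps)
qed

text \<open>
  At least one of the two frequencies is of the size of their sum, so one factor of the weight can be
  taken out and the other one remains available for integration. The constants are independent of
  the exponential rate.
\<close>

lemma decay_weight_mult_le:
  assumes "0 \<le> \<sigma>"
  shows "decay_weight \<sigma> (\<xi> - \<eta>) * decay_weight \<sigma> \<eta>
    \<le> decay_weight \<sigma> \<xi> * (2 * (1 / (1 + (\<xi> - \<eta>)\<^sup>2)) + 2 * (1 / (1 + \<eta>\<^sup>2)))"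
proof -
  let ?A = "1 + (\<xi> - \<eta>)\<^sup>2" and ?B = "1 + \<eta>\<^sup>2" and ?C = "1 + \<xi>\<^sup>2"
  have pos: "?A > 0" "?B > 0" "?C > 0" by (rule one_plus_square_pos)+
  have "exp (- \<sigma> * \<bar>\<xi> - \<eta>\<bar>) * exp (- \<sigma> * \<bar>\<eta>\<bar>) \<le> exp (- \<sigma> * \<bar>\<xi>\<bar>)"
  proof -
    have "\<sigma> * \<bar>\<xi>\<bar> \<le> \<sigma> * (\<bar>\<xi> - \<eta>\<bar> + \<bar>\<eta>\<bar>)" using assms by (intro mult_left_mono) auto
    then show ?thesis by (simp add: exp_add[symmetric] algebra_simps)
  qed
  moreover have "1 / (?A * ?B) \<le> (1 / ?C) * (2 * (1 / ?A) + 2 * (1 / ?B))"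
  proof -
    have "(1 / ?C) * (2 * (1 / ?A) + 2 * (1 / ?B)) = (2 * ?A + 2 * ?B) / ?C * (1 / (?A * ?B))"
      using pos by (simp add: divide_simps)
    moreover have "1 \<le> (2 * ?A + 2 * ?B) / ?C"
      using one_plus_square_add_le[of \<xi> \<eta>] pos by (subst pos_le_divide_eq) auto
    then have "1 * (1 / (?A * ?B)) \<le> (2 * ?A + 2 * ?B) / ?C * (1 / (?A * ?B))"
      using pos by (intro mult_right_mono) (auto intro!: less_imp_le mult_pos_pos)
    ultimately show ?thesis by simp
  qed
  ultimately have "exp (- \<sigma> * \<bar>\<xi> - \<eta>\<bar>) * exp (- \<sigma> * \<bar>\<eta>\<bar>) * (1 / (?A * ?B))
      \<le> exp (- \<sigma> * \<bar>\<xi>\<bar>) * ((1 / ?C) * (2 * (1 / ?A) + 2 * (1 / ?B)))"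
    using pos by (intro mult_mono) (auto intro!: less_imp_le mult_pos_pos)
  then show ?thesis by (simp add: decay_weight_def)
qed

lemma integrable_decay_bound:
  fixes f :: "real \<Rightarrow> complex"
  assumes [measurable]: "f \<in> borel_measurable borel" and "\<And>\<xi>. norm (f \<xi>) \<le> A * decay_weight \<sigma> \<xi>" and "0 \<le> \<sigma>"
  shows "integrable lborel f"
proof (rule Bochner_Integration.integrable_bound)
  show "integrable lborel (\<lambda>\<xi>::real. \<bar>A\<bar> * (1 / (1 + \<xi>\<^sup>2)))"
    by (intro integrable_mult_right integrable_inverse_one_plus_square)
  have "norm (f \<xi>) \<le> \<bar>A\<bar> * (1 / (1 + \<xi>\<^sup>2))" for \<xi>
  proof -
    have "norm (f \<xi>) \<le> \<bar>A\<bar> * decay_weight \<sigma> \<xi>"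
      using assms(2)[of \<xi>] decay_weight_nonneg[of \<sigma> \<xi>] by (smt (verit) mult_right_mono)
    also have "\<dots> \<le> \<bar>A\<bar> * (1 / (1 + \<xi>\<^sup>2))"
      by (intro mult_left_mono decay_weight_le assms) simp
    finally show ?thesis .
  qed
  then show "AE \<xi> in lborel. norm (f \<xi>) \<le> norm (\<bar>A\<bar> * (1 / (1 + \<xi>\<^sup>2)))"
    by (simp add: abs_mult)
qed measurable

lemma integrable_inverse_one_plus_square_shift: "integrable lborel (\<lambda>\<eta>::real. 1 / (1 + (\<xi> - \<eta>)\<^sup>2))"
  and integral_inverse_one_plus_square_shift: "(LINT \<eta>|lborel. 1 / (1 + (\<xi> - \<eta>)\<^sup>2)) = pi"
proof -
  show "integrable lborel (\<lambda>\<eta>::real. 1 / (1 + (\<xi> - \<eta>)\<^sup>2))"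
    using lborel_integrable_real_affine[OF integrable_inverse_one_plus_square, of "-1" \<xi>] by simp
  show "(LINT \<eta>|lborel. 1 / (1 + (\<xi> - \<eta>)\<^sup>2)) = pi"
    using lborel_integral_real_affine[of "-1" "\<lambda>x. 1 / (1 + x\<^sup>2)" \<xi>] integral_inverse_one_plus_square by simp
qed

text \<open>
  The normalization is the one for which the inverse Fourier transform turns convolutions into
  pointwise products.
\<close>

definition conv :: "(real \<Rightarrow> complex) \<Rightarrow> (real \<Rightarrow> complex) \<Rightarrow> real \<Rightarrow> complex" where
  "conv f g \<xi> = (LINT \<eta>|lborel. f (\<xi> - \<eta>) * g \<eta>) / (2 * pi)"

lemma conv_measurable [measurable]:
  assumes [measurable]: "f \<in> borel_measurable borel" "g \<in> borel_measurable borel"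
  shows "conv f g \<in> borel_measurable borel"
  unfolding conv_def[abs_def] by measurable

lemma integrable_conv:
  fixes f g :: "real \<Rightarrow> complex"
  assumes [measurable]: "f \<in> borel_measurable borel" "g \<in> borel_measurable borel"
    and f: "\<And>\<xi>. norm (f \<xi>) \<le> A" and g: "integrable lborel g"
  shows "integrable lborel (\<lambda>\<eta>. f (\<xi> - \<eta>) * g \<eta>)"
  by (rule integrable_bounded_mult[OF g]) (use f in measurable)

lemma norm_conv_le:
  assumes [measurable]: "f \<in> borel_measurable borel" "g \<in> borel_measurable borel"
    and f: "\<And>\<xi>. norm (f \<xi>) \<le> A * decay_weight \<sigma> \<xi>" and g: "\<And>\<xi>. norm (g \<xi>) \<le> B * decay_weight \<sigma> \<xi>"
    and \<sigma>: "0 \<le> \<sigma>"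
  shows "norm (conv f g \<xi>) \<le> 2 * A * B * decay_weight \<sigma> \<xi>"
proof -
  let ?k = "\<lambda>\<eta>. 1 / (1 + (\<xi> - \<eta>)\<^sup>2) + 1 / (1 + \<eta>\<^sup>2)"
  let ?m = "\<lambda>\<eta>. (2 * A * B * decay_weight \<sigma> \<xi>) * ?k \<eta>"
  have A: "0 \<le> A" and B: "0 \<le> B"
    using decay_bound_nonneg[OF f] decay_bound_nonneg[OF g] by auto
  have int: "integrable lborel ?m"
    by (intro integrable_mult_right Bochner_Integration.integrable_add integrable_inverse_one_plus_square
        integrable_inverse_one_plus_square_shift)
  have le: "norm (f (\<xi> - \<eta>) * g \<eta>) \<le> ?m \<eta>" for \<eta>
  proof -
    have "norm (f (\<xi> - \<eta>) * g \<eta>) \<le> (A * decay_weight \<sigma> (\<xi> - \<eta>)) * (B * decay_weight \<sigma> \<eta>)"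
      unfolding norm_mult using f g A by (intro mult_mono) (auto simp: decay_weight_nonneg)
    also have "\<dots> = (A * B) * (decay_weight \<sigma> (\<xi> - \<eta>) * decay_weight \<sigma> \<eta>)" by simp
    also have "\<dots> \<le> (A * B) * (decay_weight \<sigma> \<xi> * (2 * (1 / (1 + (\<xi> - \<eta>)\<^sup>2)) + 2 * (1 / (1 + \<eta>\<^sup>2))))"
      using A B by (intro mult_left_mono decay_weight_mult_le \<sigma>) simp
    finally show ?thesis by (simp add: algebra_simps)
  qed
  have "norm (LINT \<eta>|lborel. f (\<xi> - \<eta>) * g \<eta>) \<le> (LINT \<eta>|lborel. norm (f (\<xi> - \<eta>) * g \<eta>))"
    by (rule integral_norm_bound)
  also have "\<dots> \<le> (LINT \<eta>|lborel. ?m \<eta>)"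
    by (rule integral_mono'[OF int le order_trans[OF norm_ge_zero le]])
  also have "\<dots> = (2 * A * B * decay_weight \<sigma> \<xi>) * (2 * pi)"
    using integrable_inverse_one_plus_square integrable_inverse_one_plus_square_shift[of \<xi>]
    by (simp only: integral_mult_right_zero Bochner_Integration.integral_add
        integral_inverse_one_plus_square integral_inverse_one_plus_square_shift) simp
  finally show ?thesis by (simp add: conv_def norm_divide divide_le_eq pi_gt_zero)
qed

lemma continuous_on_conv:
  fixes F G :: "'a::metric_space \<Rightarrow> real \<Rightarrow> complex"
  assumes F: "continuous_on UNIV (\<lambda>(t, \<xi>). F t \<xi>)" and G: "continuous_on UNIV (\<lambda>(t, \<xi>). G t \<xi>)"
    and A: "\<And>t \<xi>. norm (F t \<xi>) \<le> A" and B: "\<And>t \<xi>. norm (G t \<xi>) \<le> B * (1 / (1 + \<xi>\<^sup>2))"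
  shows "continuous_on UNIV (\<lambda>(t, \<xi>). conv (F t) (G t) \<xi>)"
proof -
  have cF: "continuous_on UNIV (\<lambda>x. F (f x) (g x))" if "continuous_on UNIV f" "continuous_on UNIV g" for f g :: "real \<Rightarrow> _"
    using continuous_on_compose2[OF F continuous_on_Pair[OF that]] by simp
  have cG: "continuous_on UNIV (\<lambda>x. G (f x) (g x))" if "continuous_on UNIV f" "continuous_on UNIV g" for f g :: "real \<Rightarrow> _"
    using continuous_on_compose2[OF G continuous_on_Pair[OF that]] by simp
  have A0: "A \<ge> 0" using A order_trans[OF norm_ge_zero] by blast
  have "(\<lambda>n. conv (F (s n)) (G (s n)) (x n)) \<longlonglongrightarrow> conv (F t) (G t) \<xi>"
    if lim: "s \<longlonglongrightarrow> t" "x \<longlonglongrightarrow> \<xi>" for s x t \<xi>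
    unfolding conv_def
  proof (intro tendsto_divide tendsto_const integral_dominated_convergence[where w = "\<lambda>\<eta>. A * (B * (1 / (1 + \<eta>\<^sup>2)))"])
    show "integrable lborel (\<lambda>\<eta>. A * (B * (1 / (1 + \<eta>\<^sup>2))))"
      by (intro integrable_mult_right integrable_inverse_one_plus_square)
    have "(\<lambda>n. F (s n) (x n - \<eta>) * G (s n) \<eta>) \<longlonglongrightarrow> F t (\<xi> - \<eta>) * G t \<eta>" for \<eta>
    proof (rule tendsto_mult)
      have "(\<lambda>n. (\<lambda>(t, \<xi>). F t \<xi>) (s n, x n - \<eta>)) \<longlonglongrightarrow> (\<lambda>(t, \<xi>). F t \<xi>) (t, \<xi> - \<eta>)"
        using F by (intro continuous_on_tendsto_compose[OF F]) (auto intro!: tendsto_intros lim)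
      then show "(\<lambda>n. F (s n) (x n - \<eta>)) \<longlonglongrightarrow> F t (\<xi> - \<eta>)" by simp
      have "(\<lambda>n. (\<lambda>(t, \<xi>). G t \<xi>) (s n, \<eta>)) \<longlonglongrightarrow> (\<lambda>(t, \<xi>). G t \<xi>) (t, \<eta>)"
        by (intro continuous_on_tendsto_compose[OF G]) (auto intro!: tendsto_intros lim)
      then show "(\<lambda>n. G (s n) \<eta>) \<longlonglongrightarrow> G t \<eta>" by simp
    qed
    then show "AE \<eta> in lborel. (\<lambda>n. F (s n) (x n - \<eta>) * G (s n) \<eta>) \<longlonglongrightarrow> F t (\<xi> - \<eta>) * G t \<eta>" by simp
    show "AE \<eta> in lborel. norm (F (s n) (x n - \<eta>) * G (s n) \<eta>) \<le> A * (B * (1 / (1 + \<eta>\<^sup>2)))" for n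
      unfolding norm_mult using A B A0 by (intro AE_I2 mult_mono) auto
    show "(\<lambda>\<eta>. F t (\<xi> - \<eta>) * G t \<eta>) \<in> borel_measurable lborel" 
      by simp (intro borel_measurable_continuous_onI continuous_intros cF cG)
    show "(\<lambda>\<eta>. F (s n) (x n - \<eta>) * G (s n) \<eta>) \<in> borel_measurable lborel" for n
      by simp (intro borel_measurable_continuous_onI continuous_intros cF cG)
  qed simp
  from this[OF tendsto_fst tendsto_snd] show ?thesis
    unfolding continuous_on_sequentially by (fastforce simp: o_def case_prod_unfold)
qed

text \<open>The rate 1 is the smallest one that occurs along the solutions constructed below.\<close>

definition rapid :: "(real \<Rightarrow> complex) \<Rightarrow> bool" where
  "rapid f \<longleftrightarrow> continuous_on UNIV f \<and> (\<exists>C. \<forall>\<xi>. norm (f \<xi>) \<le> C * decay_weight 1 \<xi>)"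

lemma rapidE:
  assumes "rapid f"
  obtains C where "C \<ge> 0" "\<And>\<xi>. norm (f \<xi>) \<le> C * decay_weight 1 \<xi>" "continuous_on UNIV f" "f \<in> borel_measurable borel"
proof -
  obtain C where C: "\<And>\<xi>. norm (f \<xi>) \<le> C * decay_weight 1 \<xi>" and c: "continuous_on UNIV f"
    using assms unfolding rapid_def by blast
  show ?thesis using that decay_bound_nonneg[OF C] C c borel_measurable_continuous_onI by blast
qed

lemma rapid_measurable: "rapid f \<Longrightarrow> f \<in> borel_measurable borel"
  by (meson rapidE)

lemma rapid_integrable: "rapid f \<Longrightarrow> integrable lborel f"
  by (meson rapidE integrable_decay_bound zero_le_one)

lemma rapid_bounded:
  assumes "rapid f"
  obtains B where "B \<ge> 0" "\<And>\<xi>. norm (f \<xi>) \<le> B" "\<And>\<xi>. norm (f \<xi>) \<le> B * (1 / (1 + \<xi>\<^sup>2))"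
proof -
  obtain C where C: "C \<ge> 0" "\<And>\<xi>. norm (f \<xi>) \<le> C * decay_weight 1 \<xi>"
    and "continuous_on UNIV f" "f \<in> borel_measurable borel" using rapidE[OF assms] by metis
  have "norm (f \<xi>) \<le> C" for \<xi>
    using C(2)[of \<xi>] mult_left_mono[OF decay_weight_le_1[of 1 \<xi>] C(1)] by simp
  moreover have "norm (f \<xi>) \<le> C * (1 / (1 + \<xi>\<^sup>2))" for \<xi>
    using C(2)[of \<xi>] mult_left_mono[OF decay_weight_le[of 1 \<xi>] C(1)] by simp
  ultimately show ?thesis using that C(1) by blast
qed

lemma rapid_conv:
  assumes f: "rapid f" and g: "rapid g"
  shows "rapid (conv f g)"
proof -
  obtain A where A0: "A \<ge> 0" and A: "\<And>\<xi>. norm (f \<xi>) \<le> A * decay_weight 1 \<xi>"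
    and cf: "continuous_on UNIV f" and [measurable]: "f \<in> borel_measurable borel" using rapidE[OF f] by metis
  obtain B where B0: "B \<ge> 0" and B: "\<And>\<xi>. norm (g \<xi>) \<le> B * decay_weight 1 \<xi>"
    and cg: "continuous_on UNIV g" and [measurable]: "g \<in> borel_measurable borel" using rapidE[OF g] by metis
  obtain A' where A'0: "A' \<ge> 0" and A'1: "\<And>\<xi>. norm (f \<xi>) \<le> A'" and A': "\<And>\<xi>. norm (f \<xi>) \<le> A' * (1 / (1 + \<xi>\<^sup>2))"
    using rapid_bounded[OF f] by metis
  obtain B' where B'0: "B' \<ge> 0" and B'1: "\<And>\<xi>. norm (g \<xi>) \<le> B'" and B': "\<And>\<xi>. norm (g \<xi>) \<le> B' * (1 / (1 + \<xi>\<^sup>2))"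
    using rapid_bounded[OF g] by metis
  have "continuous_on UNIV (\<lambda>(t::real, \<xi>). conv f g \<xi>)"
    by (rule continuous_on_conv[where A = A' and B = B'])
       (auto simp: case_prod_unfold A'1 B'[simplified] intro!: continuous_on_compose2[OF cf] continuous_on_compose2[OF cg] continuous_intros)
  then have "continuous_on UNIV (\<lambda>\<xi>. (\<lambda>(t::real, \<xi>). conv f g \<xi>) (0, \<xi>))"
    by (rule continuous_on_compose2) (auto intro!: continuous_intros)
  then show ?thesis
    unfolding rapid_def using norm_conv_le[OF _ _ A B] by (auto simp: )
qed

lemma integrable_exp_neg_abs: "integrable lborel (\<lambda>\<eta>::real. exp (- \<bar>\<eta>\<bar>))"
proof (rule Bochner_Integration.integrable_bound)
  show "integrable lborel (\<lambda>\<eta>::real. 3 * (1 / (1 + \<eta>\<^sup>2)))"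
    by (intro integrable_mult_right integrable_inverse_one_plus_square)
  have "exp (- \<bar>\<eta>\<bar>) \<le> 3 * (1 / (1 + \<eta>\<^sup>2))" for \<eta> :: real
  proof -
    have "\<eta>\<^sup>2 \<le> 2 * exp \<bar>\<eta>\<bar>" using power_le_fact_exp[of "\<bar>\<eta>\<bar>" 2] by simp
    moreover have "1 \<le> exp \<bar>\<eta>\<bar>" by simp
    ultimately have "1 + \<eta>\<^sup>2 \<le> 3 * exp \<bar>\<eta>\<bar>" by linarith
    then have "exp (- \<bar>\<eta>\<bar>) * (1 + \<eta>\<^sup>2) \<le> exp (- \<bar>\<eta>\<bar>) * (3 * exp \<bar>\<eta>\<bar>)" by (rule mult_left_mono) simp
    also have "\<dots> = 3" by (simp add: exp_minus)
    finally show ?thesis by (simp add: pos_le_divide_eq one_plus_square_pos)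
  qed
  then show "AE \<eta> in lborel. norm (exp (- \<bar>\<eta>\<bar>)) \<le> norm (3 * (1 / (1 + \<eta>\<^sup>2)) :: real)" for \<eta> :: real
    by simp
qed measurable

text \<open>
  Fubini's theorem asks for a bound of f (\<xi> - \<eta>) g \<eta> by a product of a function of \<xi> and one of \<eta>.
  Peetre's inequality moves the polynomial weight from \<xi> - \<eta> to \<xi> at the expense of 1 + \<eta>^2, and the
  exponential decay of g pays for this.
\<close>

lemma inv_fourier_mult:
  assumes f: "rapid f" and g: "rapid g"
  shows "inv_fourier f x * inv_fourier g x = inv_fourier (conv f g) x"
proof -
  obtain A where A0: "A \<ge> 0" and A1: "\<And>\<xi>. norm (f \<xi>) \<le> A" and A: "\<And>\<xi>. norm (f \<xi>) \<le> A * (1 / (1 + \<xi>\<^sup>2))"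
    using rapid_bounded[OF f] by metis
  obtain B where B0: "B \<ge> 0" and B: "\<And>\<xi>. norm (g \<xi>) \<le> B * decay_weight 1 \<xi>"
    and cg: "continuous_on UNIV g" and [measurable]: "g \<in> borel_measurable borel" using rapidE[OF g] by metis
  note [measurable] = rapid_measurable[OF f] rapid_measurable[OF g]
  let ?h = "\<lambda>\<xi> \<eta>. cis (x * \<xi>) * (f (\<xi> - \<eta>) * g \<eta>)"
  have "(LINT \<xi>|lborel. cis (x * \<xi>) * conv f g \<xi>) = (LINT \<xi>|lborel. LINT \<eta>|lborel. ?h \<xi> \<eta>) / (2 * pi)"
    unfolding conv_def by (simp add: mult.assoc)
  also have "(LINT \<xi>|lborel. LINT \<eta>|lborel. ?h \<xi> \<eta>) = (LINT \<eta>|lborel. LINT \<xi>|lborel. ?h \<xi> \<eta>)"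
  proof (rule fubini_bound_swap[where A = "\<lambda>\<xi>. (2 * A * B) * (1 / (1 + \<xi>\<^sup>2))" and B = "\<lambda>\<eta>. exp (- \<bar>\<eta>\<bar>)"])
    show "integrable lborel (\<lambda>\<xi>. (2 * A * B) * (1 / (1 + \<xi>\<^sup>2)))"
      by (intro integrable_mult_right integrable_inverse_one_plus_square)
    fix \<xi> \<eta> :: real
    let ?a = "1 + (\<xi> - \<eta>)\<^sup>2" and ?b = "1 + \<eta>\<^sup>2" and ?c = "1 + \<xi>\<^sup>2"
    have pos: "?a > 0" "?b > 0" "?c > 0" by (rule one_plus_square_pos)+
    have ng: "norm (g \<eta>) \<le> B * (exp (- \<bar>\<eta>\<bar>) / ?b)" using B[of \<eta>] by (simp add: decay_weight_def)
    have "norm (?h \<xi> \<eta>) = norm (f (\<xi> - \<eta>)) * norm (g \<eta>)" by (simp add: norm_mult)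
    also have "\<dots> \<le> (A * (1 / ?a)) * (B * (exp (- \<bar>\<eta>\<bar>) / ?b))"
      using A0 pos by (intro mult_mono[OF A ng]) auto
    also have "\<dots> = (A * B) * exp (- \<bar>\<eta>\<bar>) * (1 / (?a * ?b))" by simp
    also have "\<dots> \<le> (A * B) * exp (- \<bar>\<eta>\<bar>) * (2 / ?c)"
    proof (rule mult_left_mono)
      have "1 / (?a * ?b) = ?c / (?c * (?a * ?b))" using pos by simp
      also have "\<dots> \<le> (2 * (?a * ?b)) / (?c * (?a * ?b))"
        using Peetre_inequality[of \<xi> \<eta>] pos unfolding mult.assoc by (intro divide_right_mono) simp_all
      also have "\<dots> = 2 / ?c" using pos by simp
      finally show "1 / (?a * ?b) \<le> 2 / ?c" .
    qed (use A0 B0 in simp)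
    finally show "norm (?h \<xi> \<eta>) \<le> (2 * A * B) * (1 / ?c) * exp (- \<bar>\<eta>\<bar>)" by (simp add: mult_ac)
  qed (use integrable_exp_neg_abs in measurable)
  also have "(LINT \<eta>|lborel. LINT \<xi>|lborel. ?h \<xi> \<eta>)
      = (LINT \<eta>|lborel. (cis (x * \<eta>) * g \<eta>) * (LINT \<zeta>|lborel. cis (x * \<zeta>) * f \<zeta>))"
  proof (intro Bochner_Integration.integral_cong refl)
    fix \<eta>
    have "(LINT \<xi>|lborel. ?h \<xi> \<eta>) = (LINT \<zeta>|lborel. ?h (\<eta> + 1 * \<zeta>) \<eta>)"
      using lborel_integral_real_affine[of 1 "\<lambda>\<xi>. ?h \<xi> \<eta>" \<eta>] by simp
    also have "(\<lambda>\<zeta>. ?h (\<eta> + 1 * \<zeta>) \<eta>) = (\<lambda>\<zeta>. (cis (x * \<eta>) * g \<eta>) * (cis (x * \<zeta>) * f \<zeta>))"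
      by (auto simp: fun_eq_iff distrib_left cis_mult[symmetric] mult_ac)
    finally show "(LINT \<xi>|lborel. ?h \<xi> \<eta>) = (cis (x * \<eta>) * g \<eta>) * (LINT \<zeta>|lborel. cis (x * \<zeta>) * f \<zeta>)"
      by (simp only: integral_mult_right_zero)
  qed
  also have "\<dots> = (LINT \<eta>|lborel. cis (x * \<eta>) * g \<eta>) * (LINT \<zeta>|lborel. cis (x * \<zeta>) * f \<zeta>)"
    by (rule integral_mult_left_zero)
  finally show ?thesis by (simp add: inv_fourier_def)
qed

lemma rapid_hermitian_dual: "rapid f \<Longrightarrow> rapid (\<lambda>\<xi>. cnj (f (- \<xi>)))"
  unfolding rapid_def
proof (elim conjE exE, intro conjI exI allI)
  fix C \<xi>
  assume "continuous_on UNIV f"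
  then have "continuous_on UNIV (\<lambda>\<xi>. f (- \<xi>))"
    by (rule continuous_on_compose2) (auto intro: continuous_on_minus continuous_on_id)
  then show "continuous_on UNIV (\<lambda>\<xi>. cnj (f (- \<xi>)))"
    by (rule continuous_on_cnj)
  assume "\<forall>\<xi>. norm (f \<xi>) \<le> C * decay_weight 1 \<xi>"
  then have "norm (f (- \<xi>)) \<le> C * decay_weight 1 (- \<xi>)" by blast
  then show "norm (cnj (f (- \<xi>))) \<le> C * decay_weight 1 \<xi>" by (simp add: decay_weight_def)
qed

text \<open>
  The Gaussian means of p increase to the integral of p. On the Fourier side they are Gaussian
  averages of k near 0 and hence bounded by the supremum of k.
\<close>

lemma integrable_nonneg_inv_fourier:
  assumes k: "rapid k" and p: "\<And>x. inv_fourier k x = of_real (p x)" "\<And>x. 0 \<le> p x"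
  shows "integrable lborel p"
proof -
  obtain B where B0: "B \<ge> 0" and B: "\<And>\<xi>. norm (k \<xi>) \<le> B" and B1: "\<And>\<xi>. norm (k \<xi>) \<le> B * (1 / (1 + \<xi>\<^sup>2))"
    using rapid_bounded[OF k] by metis
  note [measurable] = rapid_measurable[OF k]
  have "p = (\<lambda>x. Re (inv_fourier k x))" using p(1) by (auto simp: fun_eq_iff)
  then have pm [measurable]: "p \<in> borel_measurable borel" by simp
  have pb: "p x \<le> (LINT \<xi>|lborel. norm (k \<xi>))" for x
    using norm_inv_fourier_le[of k x] p by simp
  let ?e = "\<lambda>n x. exp (- (x / real (Suc n))\<^sup>2 / 2)"
  have ei: "integrable lborel (?e n)" for n using integrable_gaussian[of "real (Suc n)"] by simp
  have int: "integrable lborel (\<lambda>x. p x * ?e n x)" for n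
  proof (rule Bochner_Integration.integrable_bound)
    show "integrable lborel (\<lambda>x. (LINT \<xi>|lborel. norm (k \<xi>)) * ?e n x)"
      using ei by (rule integrable_mult_right)
    show "AE x in lborel. norm (p x * ?e n x) \<le> norm ((LINT \<xi>|lborel. norm (k \<xi>)) * ?e n x)"
      using pb p(2) by (auto simp: abs_mult intro!: mult_right_mono)
  qed measurable
  have bound: "(LINT x|lborel. p x * ?e n x) \<le> B" for n
  proof -
    define N where "N = real (Suc n)"
    have N: "N > 0" by (simp add: N_def)
    let ?E = "\<lambda>x. exp (- (of_real (x / N))\<^sup>2 / 2) :: complex"
    have E: "?E x = of_real (exp (- (x / N)\<^sup>2 / 2))" for x by (simp add: exp_of_real[symmetric])
    have nE: "norm (?E x) = exp (- (x / N)\<^sup>2 / 2)" for x unfolding E by simp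
    have "of_real (LINT x|lborel. p x * ?e n x) = (LINT x|lborel. inv_fourier k x * ?E x)"
    proof -
      have "complex_of_real (p x) * ?E x = of_real (p x * ?e n x)" for x
        unfolding E of_real_mult by (simp only: N_def)
      then show ?thesis by (simp only: p(1) integral_complex_of_real)
    qed
    also have "\<dots> = (LINT x|lborel. LINT \<xi>|lborel. (?E x * (cis (x * \<xi>) * k \<xi>)) / (2 * pi))"
      by (simp add: inv_fourier_def mult.commute)
    also have "\<dots> = (LINT \<xi>|lborel. LINT x|lborel. (?E x * (cis (x * \<xi>) * k \<xi>)) / (2 * pi))"
    proof (rule fubini_bound_swap[where A = "\<lambda>x. exp (- (x / N)\<^sup>2 / 2)" and B = "\<lambda>\<xi>. norm (k \<xi>)"])
      fix x \<xi>
      have "1 \<le> 2 * pi" using pi_gt3 by simp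
      moreover have "\<not> exp (- (x / N)\<^sup>2 / 2) * norm (k \<xi>) < 0" by (simp add: not_less)
      ultimately show "norm ((?E x * (cis (x * \<xi>) * k \<xi>)) / (2 * pi)) \<le> exp (- (x / N)\<^sup>2 / 2) * norm (k \<xi>)"
        by (simp only: norm_divide norm_mult nE norm_cis) (simp add: divide_le_eq mult_le_cancel_left1)
    qed (use integrable_gaussian[OF N] rapid_integrable[OF k] in auto)
    also have "\<dots> = (LINT \<xi>|lborel. k \<xi> * (N * std_normal_density (N * (\<xi> - 0))))"
    proof (intro Bochner_Integration.integral_cong refl)
      fix \<xi>
      have "(LINT x|lborel. (?E x * (cis (x * \<xi>) * k \<xi>)) / (2 * pi))
          = (LINT x|lborel. cis (x * \<xi>) * ?E x) * (k \<xi> / (2 * pi))"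
        by (simp only: integral_mult_left_zero[symmetric]) (simp add: mult_ac)
      then show "(LINT x|lborel. (?E x * (cis (x * \<xi>) * k \<xi>)) / (2 * pi)) = k \<xi> * (N * std_normal_density (N * (\<xi> - 0)))"
        unfolding fourier_gaussian[OF N] by simp
    qed
    also have "\<dots> = (LINT z|lborel. k (0 + z / N) * std_normal_density z)"
      by (rule gaussian_average_rescale[OF N])
    finally have eq: "of_real (LINT x|lborel. p x * ?e n x) = (LINT z|lborel. k (0 + z / N) * std_normal_density z)" .
    have "norm (complex_of_real (LINT x|lborel. p x * ?e n x)) \<le> (LINT z|lborel. norm (k (0 + z / N) * std_normal_density z))"
      unfolding eq by (rule integral_norm_bound)
    also have "\<dots> \<le> (LINT z|lborel. B * std_normal_density z)"
      using B B0 by (intro integral_mono') (auto simp: norm_mult intro!: mult_right_mono)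
    also have "\<dots> = B" by (simp add: integral_normal_density)
    finally show ?thesis by simp
  qed
  have mono: "?e n x \<le> ?e m x" if "n \<le> m" for n m x
  proof -
    have "(x / real (Suc m))\<^sup>2 \<le> (x / real (Suc n))\<^sup>2"
      using that by (simp add: power_divide) (intro divide_left_mono power_mono, auto)
    then show ?thesis by simp
  qed
  have inc: "incseq (\<lambda>n. LINT x|lborel. p x * ?e n x)"
    by (rule incseq_SucI, rule integral_mono[OF int int], rule mult_left_mono[OF mono p(2)]) simp
  obtain L where L: "(\<lambda>n. LINT x|lborel. p x * ?e n x) \<longlonglongrightarrow> L"
    using incseq_convergent[OF inc, of B] bound by blast
  show ?thesis
  proof (rule integrable_monotone_convergence[OF int])
    show "AE x in lborel. mono (\<lambda>n. p x * ?e n x)"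
      using mono p(2) by (auto simp: mono_def intro!: mult_left_mono)
    have "(\<lambda>n. p x * ?e n x) \<longlonglongrightarrow> p x" for x
    proof -
      have "(\<lambda>n. ?e n x) \<longlonglongrightarrow> exp (- 0\<^sup>2 / 2)"
      proof -
        have "(\<lambda>n. x / real (Suc n)) \<longlonglongrightarrow> 0" by real_asymp
        then show ?thesis by (intro tendsto_intros) simp_all
      qed
      then have "(\<lambda>n. p x * ?e n x) \<longlonglongrightarrow> p x * exp (- 0\<^sup>2 / 2)" by (rule tendsto_mult_left)
      then show ?thesis by simp
    qed
    then show "AE x in lborel. (\<lambda>n. p x * ?e n x) \<longlonglongrightarrow> p x" by simp
    show "(\<lambda>n. LINT x|lborel. p x * ?e n x) \<longlonglongrightarrow> L" by (rule L)
  qed measurable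
qed

text \<open>
  This replaces Plancherel's theorem: the square of the modulus is a nonnegative function whose
  Fourier transform is a convolution of two rapidly decaying functions.
\<close>

lemma inv_fourier_square_integrable:
  assumes f: "rapid f"
  shows "integrable lborel (\<lambda>x. (norm (inv_fourier f x))\<^sup>2)"
proof (rule integrable_nonneg_inv_fourier)
  show "rapid (conv f (\<lambda>\<xi>. cnj (f (- \<xi>))))" by (intro rapid_conv rapid_hermitian_dual f)
  show "inv_fourier (conv f (\<lambda>\<xi>. cnj (f (- \<xi>)))) x = of_real ((norm (inv_fourier f x))\<^sup>2)" for x
    by (simp only: inv_fourier_mult[symmetric, OF f rapid_hermitian_dual[OF f]] cnj_inv_fourier[symmetric]
        complex_norm_square)
qed simp

lemma sobolev_weight_decay_le:
  obtains C where "C \<ge> 0" "\<And>\<xi>::real. (1 + \<xi>\<^sup>2) powr s * (decay_weight 1 \<xi>)\<^sup>2 \<le> C * (1 / (1 + \<xi>\<^sup>2))"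
proof -
  obtain n :: nat where n: "s \<le> real n" using real_arch_simple by blast
  have "(1 + \<xi>\<^sup>2) powr s * (decay_weight 1 \<xi>)\<^sup>2 \<le> (fact (2 * n) * exp 1) * (1 / (1 + \<xi>\<^sup>2))" for \<xi> :: real
  proof -
    have pos: "1 + \<xi>\<^sup>2 > 0" by (rule one_plus_square_pos)
    have "(1 + \<xi>\<^sup>2) powr s \<le> (1 + \<xi>\<^sup>2) powr (real n)" using n by (intro powr_mono) auto
    also have "\<dots> = (1 + \<xi>\<^sup>2) ^ n" using pos by (simp add: powr_realpow)
    also have "\<dots> \<le> ((1 + \<bar>\<xi>\<bar>)\<^sup>2) ^ n" by (intro power_mono) (auto simp: power2_sum)
    also have "\<dots> = (1 + \<bar>\<xi>\<bar>) ^ (2 * n)" by (simp add: power_mult)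
    also have "\<dots> \<le> fact (2 * n) * exp (1 + \<bar>\<xi>\<bar>)" by (intro power_le_fact_exp) simp
    finally have "(1 + \<xi>\<^sup>2) powr s * (decay_weight 1 \<xi>)\<^sup>2 \<le> fact (2 * n) * exp (1 + \<bar>\<xi>\<bar>) * (decay_weight 1 \<xi>)\<^sup>2"
      by (rule mult_right_mono) simp
    also have "\<dots> = (fact (2 * n) * exp 1) * (exp (- \<bar>\<xi>\<bar>) / ((1 + \<xi>\<^sup>2) * (1 + \<xi>\<^sup>2)))"
    proof -
      have "exp (1 + \<bar>\<xi>\<bar>) * (exp (- \<bar>\<xi>\<bar>) * exp (- \<bar>\<xi>\<bar>)) = exp 1 * exp (- \<bar>\<xi>\<bar>)"
        by (simp add: exp_add[symmetric])
      then show ?thesis by (simp add: decay_weight_def power2_eq_square mult.assoc) 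
    qed
    also have "\<dots> \<le> (fact (2 * n) * exp 1) * (1 / (1 + \<xi>\<^sup>2))"
    proof (intro mult_left_mono)
      have "exp (- \<bar>\<xi>\<bar>) / ((1 + \<xi>\<^sup>2) * (1 + \<xi>\<^sup>2)) \<le> 1 / ((1 + \<xi>\<^sup>2) * 1)"
        using pos by (intro frac_le mult_mono) auto
      then show "exp (- \<bar>\<xi>\<bar>) / ((1 + \<xi>\<^sup>2) * (1 + \<xi>\<^sup>2)) \<le> 1 / (1 + \<xi>\<^sup>2)" by simp
    qed simp
    finally show ?thesis .
  qed
  then show ?thesis using that[of "fact (2 * n) * exp 1"] by simp
qed

lemma rapid_sobolev_integrable:
  assumes f: "rapid f"
  shows "integrable lborel (\<lambda>\<xi>. (1 + \<xi>\<^sup>2) powr s * (norm (f \<xi>))\<^sup>2)"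
proof -
  obtain A where A0: "A \<ge> 0" and A: "\<And>\<xi>. norm (f \<xi>) \<le> A * decay_weight 1 \<xi>"
    and cf: "continuous_on UNIV f" and [measurable]: "f \<in> borel_measurable borel" using rapidE[OF f] by metis
  obtain C where C: "C \<ge> 0" "\<And>\<xi>::real. (1 + \<xi>\<^sup>2) powr s * (decay_weight 1 \<xi>)\<^sup>2 \<le> C * (1 / (1 + \<xi>\<^sup>2))"
    using sobolev_weight_decay_le by metis
  show ?thesis
  proof (rule Bochner_Integration.integrable_bound)
    show "integrable lborel (\<lambda>\<xi>::real. (A\<^sup>2 * C) * (1 / (1 + \<xi>\<^sup>2)))"
      by (intro integrable_mult_right integrable_inverse_one_plus_square)
    have "(1 + \<xi>\<^sup>2) powr s * (norm (f \<xi>))\<^sup>2 \<le> (A\<^sup>2 * C) * (1 / (1 + \<xi>\<^sup>2))" for \<xi>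
    proof -
      have "(1 + \<xi>\<^sup>2) powr s * (norm (f \<xi>))\<^sup>2 \<le> (1 + \<xi>\<^sup>2) powr s * (A * decay_weight 1 \<xi>)\<^sup>2"
        by (intro mult_left_mono power_mono A) auto
      also have "\<dots> = A\<^sup>2 * ((1 + \<xi>\<^sup>2) powr s * (decay_weight 1 \<xi>)\<^sup>2)" by (simp add: power_mult_distrib)
      also have "\<dots> \<le> A\<^sup>2 * (C * (1 / (1 + \<xi>\<^sup>2)))" by (intro mult_left_mono C) simp
      finally show ?thesis by simp
    qed
    then show "AE \<xi> in lborel. norm ((1 + \<xi>\<^sup>2) powr s * (norm (f \<xi>))\<^sup>2) \<le> norm ((A\<^sup>2 * C) * (1 / (1 + \<xi>\<^sup>2)))"
      using C(1) by (simp add: abs_mult)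
  qed measurable
qed

lemma rapid_sobolev:
  assumes f: "rapid f" and h: "hermitian f" and F: "F = \<real> \<or> F = UNIV"
  shows "regular_distr (inv_fourier f) \<in> vecs (sobolev F s)"
  using inv_fourier_distr_sobolev[OF rapid_integrable[OF f] h F rapid_sobolev_integrable[OF f]]
  by (simp add: inv_fourier_distr_eq_regular[OF rapid_integrable[OF f]])

lemma rapid_has_fourier:
  assumes f: "rapid f"
  shows "has_fourier (regular_distr (inv_fourier f)) f"
  using has_fourier_inv_fourier_distr[OF rapid_integrable[OF f]]
  by (simp add: inv_fourier_distr_eq_regular[OF rapid_integrable[OF f]])

section \<open>A cubic fixed point problem\<close>

text \<open>
  Linearity is stated for differences, the form in which the contraction argument uses it.
  Homogeneity serves to scale a small parameter out of the cubic terms.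
\<close>

locale trilinear =
  fixes D :: "'b::real_normed_vector \<Rightarrow> 'b \<Rightarrow> 'b \<Rightarrow> 'b" and K :: real
  assumes K_pos: "0 < K"
    and diff1: "D (x - x') y z = D x y z - D x' y z"
    and diff2: "D x (y - y') z = D x y z - D x y' z"
    and diff3: "D x y (z - z') = D x y z - D x y z'"
    and scale1: "D (c *\<^sub>R x) y z = c *\<^sub>R D x y z"
    and scale2: "D x (c *\<^sub>R y) z = c *\<^sub>R D x y z"
    and scale3: "D x y (c *\<^sub>R z) = c *\<^sub>R D x y z"
    and norm_le: "norm (D x y z) \<le> K * (norm x * norm y * norm z)"
begin

lemma norm_le_ball:
  assumes "norm x \<le> A" "norm y \<le> B" "norm z \<le> C"
  shows "norm (D x y z) \<le> K * (A * B * C)"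
proof -
  have "0 \<le> A" "0 \<le> B" using assms norm_ge_zero order_trans by blast+
  then have "norm x * norm y * norm z \<le> A * B * C" using assms by (intro mult_mono) auto
  then show ?thesis using norm_le[of x y z] K_pos by (smt (verit) mult_left_mono)
qed

lemma norm_diff_le:
  assumes "norm x \<le> R" "norm y \<le> R" "norm x' \<le> R" "norm y' \<le> R"
  shows "norm (D x y y - D x' y' y') \<le> K * R\<^sup>2 * (norm (x - x') + 2 * norm (y - y'))"
proof -
  have eq: "D x y y - D x' y' y' = D (x - x') y y + D x' (y - y') y + D x' y' (y - y')"
    by (simp add: diff1 diff2 diff3)
  have "norm (D x y y - D x' y' y') \<le> norm (D (x - x') y y) + norm (D x' (y - y') y) + norm (D x' y' (y - y'))"
    unfolding eq using norm_triangle_ineq[of "D (x - x') y y + D x' (y - y') y" "D x' y' (y - y')"]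
      norm_triangle_ineq[of "D (x - x') y y" "D x' (y - y') y"] by linarith
  also have "\<dots> \<le> K * (norm (x - x') * R * R) + K * (R * norm (y - y') * R) + K * (R * R * norm (y - y'))"
    by (intro add_mono norm_le_ball assms order_refl)
  also have "\<dots> = K * R\<^sup>2 * (norm (x - x') + 2 * norm (y - y'))"
    by (simp add: power2_eq_square algebra_simps)
  finally show ?thesis .
qed

end

lemma norm_Pair_sum_le: "norm a + norm b \<le> 2 * norm (a, b)"
proof -
  have "norm a \<le> norm (a, b)" "norm b \<le> norm (a, b)"
    by (simp_all add: norm_Pair)
  then show ?thesis by simp
qed

text \<open>
  The map (x, y) \<mapsto> (p - D1 x y y, q - D2 y x x) contracts the ball of radius R = 2 \<delta> by the factor 1/2:
  the two components together have Lipschitz constant at most 3 K R^2 \<le> 1/4 in the sum of the norms,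
  which is at most twice the norm of the pair. The fixed point differs from (p, q) by O(\<delta>^3), so replacing it by
  (p, q) inside the cubic terms costs O(\<delta>^5). The closed set H carries a symmetry of the equation
  over to the solution.
\<close>

lemma cubic_system_solution:
  fixes D1 D2 :: "'b::{real_normed_vector, complete_space} \<Rightarrow> 'b \<Rightarrow> 'b \<Rightarrow> 'b"
  assumes D1: "trilinear D1 K" and D2: "trilinear D2 K"
    and H: "closed H" and inv: "\<forall>x\<in>H. \<forall>y\<in>H. p - D1 x y y \<in> H \<and> q - D2 y x x \<in> H" and zero: "0 \<in> H"
    and p: "norm p \<le> \<delta>" and q: "norm q \<le> \<delta>" and small: "48 * K * \<delta>\<^sup>2 \<le> 1"
  shows "\<exists>x\<in>H. \<exists>y\<in>H. x = p - D1 x y y \<and> y = q - D2 y x x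
    \<and> norm (x - (p - D1 p q q)) \<le> 96 * K\<^sup>2 * \<delta> ^ 5 \<and> norm (y - (q - D2 q p p)) \<le> 96 * K\<^sup>2 * \<delta> ^ 5"
proof -
  interpret D1: trilinear D1 K by fact
  interpret D2: trilinear D2 K by fact
  have \<delta>: "\<delta> \<ge> 0" using p norm_ge_zero order_trans by blast
  define R where "R = 2 * \<delta>"
  have R: "R \<ge> 0" and KR: "12 * (K * R\<^sup>2) \<le> 1" using \<delta> small by (auto simp: R_def power2_eq_square)
  define B where "B = (H \<inter> cball 0 R) \<times> (H \<inter> cball 0 R)"
  define \<Phi> where "\<Phi> = (\<lambda>(x, y). (p - D1 x y y, q - D2 y x x))"
  have KR0: "K * R\<^sup>2 \<ge> 0" using D1.K_pos by simp
  have KR3: "K * (R * R * R) \<le> R / 12"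
    using mult_right_mono[OF KR R] by (simp add: power2_eq_square mult_ac)
  have "closed B" unfolding B_def by (intro closed_Times closed_Int H closed_cball)
  have "\<exists>!z. z \<in> B \<and> \<Phi> z = z"
  proof (rule Banach_fix[OF complete_eq_closed[THEN iffD2, OF \<open>closed B\<close>]])
    show "B \<noteq> {}" using zero R unfolding B_def by auto
    show "(0::real) \<le> 1 / 2" "(1 / 2 :: real) < 1" by simp_all
    show "\<Phi> ` B \<subseteq> B"
    proof
      fix z assume "z \<in> \<Phi> ` B"
      then obtain x y where xy: "x \<in> H" "y \<in> H" "norm x \<le> R" "norm y \<le> R" and z: "z = (p - D1 x y y, q - D2 y x x)"
        unfolding B_def \<Phi>_def by auto
      have "norm (p - D1 x y y) \<le> R"
        using norm_triangle_ineq4[of p "D1 x y y"] p D1.norm_le_ball[OF xy(3,4,4)] KR3 R by (simp add: R_def)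
      moreover have "norm (q - D2 y x x) \<le> R"
        using norm_triangle_ineq4[of q "D2 y x x"] q D2.norm_le_ball[OF xy(4,3,3)] KR3 R by (simp add: R_def)
      ultimately show "z \<in> B" unfolding z B_def using inv xy by auto
    qed
    fix z z' assume "z \<in> B" "z' \<in> B"
    then obtain x y x' y' where z: "z = (x, y)" "z' = (x', y')"
      and n: "norm x \<le> R" "norm y \<le> R" "norm x' \<le> R" "norm y' \<le> R"
      unfolding B_def by auto
    have "dist (\<Phi> z) (\<Phi> z') = norm (D1 x' y' y' - D1 x y y, D2 y' x' x' - D2 y x x)"
      unfolding z \<Phi>_def dist_norm by simp
    also have "\<dots> \<le> norm (D1 x' y' y' - D1 x y y) + norm (D2 y' x' x' - D2 y x x)"
      by (rule norm_Pair_le)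
    also have "\<dots> \<le> K * R\<^sup>2 * (norm (x' - x) + 2 * norm (y' - y)) + K * R\<^sup>2 * (norm (y' - y) + 2 * norm (x' - x))"
      by (intro add_mono D1.norm_diff_le D2.norm_diff_le n)
    also have "\<dots> = 3 * (K * R\<^sup>2) * (norm (x - x') + norm (y - y'))"
      by (simp add: algebra_simps norm_minus_commute)
    also have "\<dots> \<le> 3 * (K * R\<^sup>2) * (2 * dist z z')"
      using norm_Pair_sum_le[of "x - x'" "y - y'"] KR0 by (intro mult_left_mono) (auto simp: z dist_norm)
    also have "\<dots> = (6 * (K * R\<^sup>2)) * dist z z'" by simp
    also have "\<dots> \<le> 1 / 2 * dist z z'"
      using KR by (intro mult_right_mono) auto
    finally show "dist (\<Phi> z) (\<Phi> z') \<le> 1 / 2 * dist z z'" .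
  qed
  then obtain x y where "(x, y) \<in> B" and fix_xy: "\<Phi> (x, y) = (x, y)" by auto
  then have H_xy: "x \<in> H" "y \<in> H" and n: "norm x \<le> R" "norm y \<le> R" unfolding B_def by auto
  have x: "x = p - D1 x y y" and y: "y = q - D2 y x x" using fix_xy unfolding \<Phi>_def by auto
  have pq: "norm p \<le> R" "norm q \<le> R" using p q \<delta> by (auto simp: R_def)
  have xp: "norm (x - p) \<le> K * (R * R * R)"
    using D1.norm_le_ball[OF n(1,2,2)] x by (metis diff_diff_eq2 add_diff_cancel_left' diff_add_cancel norm_minus_commute)
  have yq: "norm (y - q) \<le> K * (R * R * R)"
    using D2.norm_le_ball[OF n(2,1,1)] y by (metis diff_diff_eq2 add_diff_cancel_left' diff_add_cancel norm_minus_commute)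
  have final: "K * R\<^sup>2 * (a + 2 * b) \<le> 96 * K\<^sup>2 * \<delta> ^ 5" if "a \<le> K * (R * R * R)" "b \<le> K * (R * R * R)" for a b
  proof -
    have "K * R\<^sup>2 * (a + 2 * b) \<le> K * R\<^sup>2 * (3 * (K * (R * R * R)))"
      using that KR0 by (intro mult_left_mono) auto
    also have "\<dots> = 96 * K\<^sup>2 * \<delta> ^ 5" by (simp add: R_def eval_nat_numeral)
    finally show ?thesis .
  qed
  have "norm (x - (p - D1 p q q)) = norm (D1 x y y - D1 p q q)"
    by (subst (1) x) (simp add: norm_minus_commute)
  also have "\<dots> \<le> 96 * K\<^sup>2 * \<delta> ^ 5"
    by (rule order_trans[OF D1.norm_diff_le[OF n pq] final[OF xp yq]])
  finally have 1: "norm (x - (p - D1 p q q)) \<le> 96 * K\<^sup>2 * \<delta> ^ 5" .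
  have "norm (y - (q - D2 q p p)) = norm (D2 y x x - D2 q p p)"
    by (subst (1) y) (simp add: norm_minus_commute)
  also have "\<dots> \<le> 96 * K\<^sup>2 * \<delta> ^ 5"
    by (rule order_trans[OF D2.norm_diff_le[OF n(2,1) pq(2,1)] final[OF yq xp]])
  finally have 2: "norm (y - (q - D2 q p p)) \<le> 96 * K\<^sup>2 * \<delta> ^ 5" .
  show ?thesis using H_xy x y 1 2 by blast
qed

section \<open>Paths dominated by a shrinking exponential weight\<close>

text \<open>
  Time is frozen outside [0,T], so that paths are functions on the whole plane and continuity and
  boundedness need no restriction to a strip.
\<close>

definition clamp_time :: "real \<Rightarrow> real \<Rightarrow> real" where
  "clamp_time T t = max 0 (min T t)"

text \<open>
  The exponential rate decreases from 2 at time 0 to 1 at time T. This loss of decay in the course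
  of time pays for the derivative in the nonlinearity.
\<close>

definition path_weight :: "real \<Rightarrow> real \<Rightarrow> real \<Rightarrow> real" where
  "path_weight T t = decay_weight (2 - clamp_time T t / T)"

definition dominated_path :: "real \<Rightarrow> real \<Rightarrow> (real \<Rightarrow> real \<Rightarrow> complex) \<Rightarrow> bool" where
  "dominated_path T A V \<longleftrightarrow> continuous_on UNIV (\<lambda>(t, \<xi>). V t \<xi>) \<and> (\<forall>t \<xi>. norm (V t \<xi>) \<le> A * path_weight T t \<xi>)"

text \<open>
  The Fourier transform of the Duhamel integral of a path with Fourier transform V.
\<close>

definition duhamel_hat :: "real \<Rightarrow> real \<Rightarrow> (real \<Rightarrow> real \<Rightarrow> complex) \<Rightarrow> real \<Rightarrow> real \<Rightarrow> complex" where
  "duhamel_hat a T V t \<xi> = (LINT r|lborel. indicator {0..clamp_time T t} r *\<^sub>R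
     (cis ((clamp_time T t - r) * a * \<xi> ^ 3) * (\<i> * of_real \<xi> * V r \<xi>)))"

lemma clamp_time_id: "t \<in> {0..T} \<Longrightarrow> clamp_time T t = t"
  by (simp add: clamp_time_def)

lemma continuous_on_clamp_time: "continuous_on A (clamp_time T)"
  unfolding clamp_time_def by (intro continuous_intros)

context
  fixes T :: real
  assumes T: "0 < T"
begin

lemma clamp_time_bounds: "0 \<le> clamp_time T t" "clamp_time T t \<le> T"
  using T by (auto simp: clamp_time_def)

lemma rate_bounds: "1 \<le> 2 - clamp_time T t / T" "2 - clamp_time T t / T \<le> 2"
  using clamp_time_bounds[of t] T by (auto simp: field_simps)

lemma path_weight_pos: "0 < path_weight T t \<xi>"
  by (simp add: path_weight_def decay_weight_pos)

lemma path_weight_le: "path_weight T t \<xi> \<le> decay_weight 1 \<xi>"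
  unfolding path_weight_def by (rule decay_weight_mono) (rule rate_bounds)

lemma path_weight_ge: "decay_weight 2 \<xi> \<le> path_weight T t \<xi>"
  unfolding path_weight_def by (rule decay_weight_mono) (rule rate_bounds)

lemma abs_mult_path_weight_le: "\<bar>\<xi>\<bar> * path_weight T t \<xi> \<le> 1"
proof -
  have "\<bar>\<xi>\<bar> * path_weight T t \<xi> \<le> \<bar>\<xi>\<bar> * (1 / (1 + \<xi>\<^sup>2))"
    by (intro mult_left_mono order_trans[OF path_weight_le decay_weight_le]) auto
  also have "\<dots> \<le> 1"
  proof -
    have "0 \<le> (\<bar>\<xi>\<bar> - 1)\<^sup>2" by simp
    then have "\<bar>\<xi>\<bar> \<le> 1 + \<xi>\<^sup>2" by (simp add: power2_diff)
    then show ?thesis by (simp add: divide_le_eq one_plus_square_pos)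
  qed
  finally show ?thesis .
qed

lemma continuous_on_path_weight: "continuous_on UNIV (\<lambda>(t, \<xi>). path_weight T t \<xi>)"
proof -
  have c: "continuous_on UNIV (\<lambda>x::real \<times> real. clamp_time T (fst x))"
    by (rule continuous_on_compose2[OF continuous_on_clamp_time[of UNIV]]) (auto intro!: continuous_intros)
  show ?thesis
    unfolding path_weight_def decay_weight_def case_prod_unfold
    using T one_plus_square_pos by (intro continuous_intros c) (auto simp: less_imp_neq[symmetric])
qed

lemma dominated_pathD:
  assumes "dominated_path T A V"
  shows "continuous_on UNIV (\<lambda>(t, \<xi>). V t \<xi>)" "norm (V t \<xi>) \<le> A * path_weight T t \<xi>" "0 \<le> A"
proof -
  show "continuous_on UNIV (\<lambda>(t, \<xi>). V t \<xi>)" and V: "norm (V t \<xi>) \<le> A * path_weight T t \<xi>" for t \<xi>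
    using assms by (auto simp: dominated_path_def)
  then show "0 \<le> A" by (intro decay_bound_nonneg[of "V 0"]) (simp add: path_weight_def)
qed

lemma dominated_path_continuous:
  assumes V: "dominated_path T A V" and "continuous_on S f" "continuous_on S g"
  shows "continuous_on S (\<lambda>x. V (f x) (g x))"
  using continuous_on_compose2[OF dominated_pathD(1)[OF V] continuous_on_Pair[OF assms(2,3)]] by simp

lemma dominated_path_rapid:
  assumes V: "dominated_path T A V"
  shows "rapid (V t)"
proof -
  have "norm (V t \<xi>) \<le> A * decay_weight 1 \<xi>" for \<xi>
    using dominated_pathD(2)[OF V, of t \<xi>] mult_left_mono[OF path_weight_le dominated_pathD(3)[OF V], of t \<xi>]
    by linarith
  then show ?thesis
    unfolding rapid_def using dominated_path_continuous[OF V, of UNIV "\<lambda>_. t" "\<lambda>\<xi>. \<xi>"] by auto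
qed

lemma dominated_path_measurable [measurable]:
  assumes "dominated_path T A V"
  shows "(\<lambda>(t, \<xi>). V t \<xi>) \<in> borel_measurable (borel \<Otimes>\<^sub>M borel)"
  using borel_measurable_continuous_onI[OF dominated_pathD(1)[OF assms]] by (simp add: borel_prod)

lemma dominated_path_conv:
  assumes V: "dominated_path T A V" and W: "dominated_path T B W"
  shows "dominated_path T (2 * A * B) (\<lambda>t. conv (V t) (W t))"
  unfolding dominated_path_def
proof (intro conjI allI)
  have n1: "norm (V t \<xi>) \<le> A" for t \<xi>
    using dominated_pathD[OF V] path_weight_le[of t \<xi>] decay_weight_le_1[of 1 \<xi>]
    by (smt (verit) mult_left_le mult_left_mono)
  have n2: "norm (W t \<xi>) \<le> B * (1 / (1 + \<xi>\<^sup>2))" for t \<xi>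
    by (rule order_trans[OF dominated_pathD(2)[OF W] mult_left_mono[OF order_trans[OF path_weight_le decay_weight_le]]])
       (use dominated_pathD(3)[OF W] in auto)
  show "continuous_on UNIV (\<lambda>(t, \<xi>). conv (V t) (W t) \<xi>)"
    by (rule continuous_on_conv[OF dominated_pathD(1)[OF V] dominated_pathD(1)[OF W] n1 n2])
  fix t \<xi>
  show "norm (conv (V t) (W t) \<xi>) \<le> 2 * A * B * path_weight T t \<xi>"
    unfolding path_weight_def
    using dominated_pathD(2)[OF V] dominated_pathD(2)[OF W] rate_bounds(1)[of t]
    by (intro norm_conv_le) (auto simp: path_weight_def intro!: rapid_measurable dominated_path_rapid[OF V] dominated_path_rapid[OF W])
qed

lemma duhamel_integrand_bound:
  assumes V: "dominated_path T A V"
  shows "norm (cis x * (\<i> * of_real \<xi> * V r \<xi>)) \<le> A"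
proof -
  have "norm (cis x * (\<i> * of_real \<xi> * V r \<xi>)) = \<bar>\<xi>\<bar> * norm (V r \<xi>)" by (simp add: norm_mult)
  also have "\<dots> \<le> \<bar>\<xi>\<bar> * (A * path_weight T r \<xi>)"
    by (intro mult_left_mono dominated_pathD[OF V]) simp
  also have "\<dots> = A * (\<bar>\<xi>\<bar> * path_weight T r \<xi>)" by simp
  also have "\<dots> \<le> A * 1" by (intro mult_left_mono abs_mult_path_weight_le dominated_pathD(3)[OF V])
  finally show ?thesis by simp
qed

lemma integrable_indicator_Icc: "integrable lborel (indicator {a..b} :: real \<Rightarrow> real)"
  by (rule integrable_real_indicator) (auto simp: emeasure_lborel_Icc_eq)

lemma duhamel_integrable:
  assumes V: "dominated_path T A V"
  shows "integrable lborel (\<lambda>r. indicator {0..c} r *\<^sub>R (cis ((c' - r) * a * \<xi> ^ 3) * (\<i> * of_real \<xi> * V r \<xi>)))"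
proof (rule Bochner_Integration.integrable_bound)
  show "integrable lborel (\<lambda>r. A * indicat_real {0..c} r)"
    by (intro integrable_mult_right integrable_indicator_Icc)
  show "AE r in lborel. norm (indicator {0..c} r *\<^sub>R (cis ((c' - r) * a * \<xi> ^ 3) * (\<i> * of_real \<xi> * V r \<xi>)))
      \<le> norm (A * indicat_real {0..c} r)"
    using duhamel_integrand_bound[OF V] dominated_pathD(3)[OF V] by (auto simp: indicator_def)
  have [measurable]: "(\<lambda>r. V r \<xi>) \<in> borel_measurable borel"
    by (intro borel_measurable_continuous_onI dominated_path_continuous[OF V] continuous_intros)
  show "(\<lambda>r. indicator {0..c} r *\<^sub>R (cis ((c' - r) * a * \<xi> ^ 3) * (\<i> * of_real \<xi> * V r \<xi>))) \<in> borel_measurable lborel"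
    by measurable
qed

text \<open>
  The weight at time r is the one at time t times exp (- (t - r) |\<xi>| / T). The factor |\<xi>| from the
  derivative is integrated against this exponential, and the integral over [0,t] is at most T for
  every \<xi>.
\<close>

lemma norm_duhamel_hat_le:
  assumes V: "dominated_path T A V"
  shows "norm (duhamel_hat a T V t \<xi>) \<le> (T * A) * path_weight T t \<xi>"
proof -
  define c where "c = clamp_time T t"
  have c: "0 \<le> c" "c \<le> T" using clamp_time_bounds by (auto simp: c_def)
  define k where "k = A * exp (- 2 * \<bar>\<xi>\<bar>) / (1 + \<xi>\<^sup>2)"
  let ?G = "\<lambda>r. T * k * exp (r * \<bar>\<xi>\<bar> / T)"
  let ?g = "\<lambda>r. A * (\<bar>\<xi>\<bar> * decay_weight (2 - r / T) \<xi>)"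
  have k: "0 \<le> k" using dominated_pathD(3)[OF V] by (simp add: k_def)
  have g: "?g r = k * (\<bar>\<xi>\<bar> * exp (r * \<bar>\<xi>\<bar> / T))" for r
    by (simp add: k_def decay_weight_def exp_add[symmetric] algebra_simps mult_exp_exp)
  have FTC: "(LINT r|lborel. ?g r * indicator {0..c} r) = ?G c - ?G 0"
  proof (rule integral_FTC_Icc_real[OF c(1)])
    fix r
    show "(?G has_real_derivative ?g r) (at r)"
      unfolding g using T by (auto intro!: derivative_eq_intros simp: field_simps)
    show "isCont ?g r" unfolding g using T by (intro continuous_intros) auto
  qed
  have int: "integrable lborel (\<lambda>r. ?g r * indicator {0..c} r)"
  proof -
    have "continuous_on {0..c} ?g" unfolding g using T by (intro continuous_intros) auto
    from borel_integrable_compact[OF compact_Icc this] show ?thesis by (simp add: mult.commute)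
  qed
  have "norm (duhamel_hat a T V t \<xi>) \<le> (LINT r|lborel. norm (indicator {0..c} r *\<^sub>R
     (cis ((c - r) * a * \<xi> ^ 3) * (\<i> * of_real \<xi> * V r \<xi>))))"
    unfolding duhamel_hat_def c_def by (rule integral_norm_bound)
  also have "\<dots> \<le> (LINT r|lborel. ?g r * indicator {0..c} r)"
  proof (rule integral_mono')
    show "integrable lborel (\<lambda>r. ?g r * indicator {0..c} r)" by (rule int)
    fix r
    show "0 \<le> ?g r * indicator {0..c} r" using dominated_pathD(3)[OF V] by (simp add: decay_weight_nonneg)
    show "norm (indicator {0..c} r *\<^sub>R (cis ((c - r) * a * \<xi> ^ 3) * (\<i> * of_real \<xi> * V r \<xi>))) \<le> ?g r * indicator {0..c} r"
    proof (cases "r \<in> {0..c}")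
      case True
      then have "clamp_time T r = r" using c by (intro clamp_time_id) auto
      then have "norm (V r \<xi>) \<le> A * decay_weight (2 - r / T) \<xi>"
        using dominated_pathD(2)[OF V, of r \<xi>] by (simp add: path_weight_def)
      then have "\<bar>\<xi>\<bar> * norm (V r \<xi>) \<le> \<bar>\<xi>\<bar> * (A * decay_weight (2 - r / T) \<xi>)" by (rule mult_left_mono) simp
      then show ?thesis using True by (simp add: norm_mult mult_ac)
    qed simp
  qed
  also have "\<dots> \<le> ?G c" unfolding FTC using T k by simp
  also have "\<dots> = (T * A) * path_weight T t \<xi>"
    by (simp add: k_def path_weight_def c_def[symmetric] decay_weight_def exp_add[symmetric] algebra_simps mult_exp_exp)
  finally show ?thesis .
qed

lemma dominated_path_duhamel_hat:
  assumes V: "dominated_path T A V"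
  shows "dominated_path T (T * A) (duhamel_hat a T V)"
  unfolding dominated_path_def
proof (intro conjI allI norm_duhamel_hat_le[OF V])
  have "(\<lambda>n. duhamel_hat a T V (s n) (x n)) \<longlonglongrightarrow> duhamel_hat a T V t \<xi>"
    if lim: "s \<longlonglongrightarrow> t" "x \<longlonglongrightarrow> \<xi>" for s x t \<xi>
    unfolding duhamel_hat_def
  proof (rule integral_dominated_convergence[where w = "\<lambda>r. A * indicat_real {0..T} r"])
    show "integrable lborel (\<lambda>r. A * indicat_real {0..T} r)"
      by (intro integrable_mult_right integrable_indicator_Icc)
    have cl: "(\<lambda>n. clamp_time T (s n)) \<longlonglongrightarrow> clamp_time T t"
      using continuous_on_tendsto_compose[OF continuous_on_clamp_time[of UNIV] lim(1)] by simp
    have "AE r in lborel. r \<noteq> clamp_time T t" by (rule AE_lborel_singleton)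
    then show "AE r in lborel. (\<lambda>n. indicator {0..clamp_time T (s n)} r *\<^sub>R
        (cis ((clamp_time T (s n) - r) * a * x n ^ 3) * (\<i> * of_real (x n) * V r (x n))))
        \<longlonglongrightarrow> indicator {0..clamp_time T t} r *\<^sub>R (cis ((clamp_time T t - r) * a * \<xi> ^ 3) * (\<i> * of_real \<xi> * V r \<xi>))"
    proof eventually_elim
      case (elim r)
      have "\<forall>\<^sub>F n in sequentially. indicat_real {0..clamp_time T (s n)} r = indicat_real {0..clamp_time T t} r"
      proof (cases "r < clamp_time T t")
        case True
        show ?thesis
          by (rule eventually_mono[OF order_tendstoD(1)[OF cl True]]) (use True in \<open>auto simp: indicator_def\<close>)
      next
        case False
        then have "clamp_time T t < r" using elim by simp
        show ?thesis
          by (rule eventually_mono[OF order_tendstoD(2)[OF cl \<open>clamp_time T t < r\<close>]])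
             (use \<open>clamp_time T t < r\<close> in \<open>auto simp: indicator_def\<close>)
      qed
      then have i: "(\<lambda>n. indicat_real {0..clamp_time T (s n)} r) \<longlonglongrightarrow> indicat_real {0..clamp_time T t} r"
        by (rule tendsto_eventually)
      have "(\<lambda>n. (\<lambda>(t, \<xi>). V t \<xi>) (r, x n)) \<longlonglongrightarrow> (\<lambda>(t, \<xi>). V t \<xi>) (r, \<xi>)"
        by (rule continuous_on_tendsto_compose[OF dominated_pathD(1)[OF V]]) (auto intro!: tendsto_intros lim)
      then have v: "(\<lambda>n. V r (x n)) \<longlonglongrightarrow> V r \<xi>" by simp
      have e: "(\<lambda>n. cis ((clamp_time T (s n) - r) * a * x n ^ 3)) \<longlonglongrightarrow> cis ((clamp_time T t - r) * a * \<xi> ^ 3)"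
        unfolding cis_conv_exp by (intro tendsto_intros cl lim)
      show ?case by (intro tendsto_intros i v e lim)
    qed
    show "AE r in lborel. norm (indicator {0..clamp_time T (s n)} r *\<^sub>R
        (cis ((clamp_time T (s n) - r) * a * x n ^ 3) * (\<i> * of_real (x n) * V r (x n)))) \<le> A * indicat_real {0..T} r" for n
      using duhamel_integrand_bound[OF V] dominated_pathD(3)[OF V] clamp_time_bounds[of "s n"]
      by (auto simp: indicator_def)
  qed (use duhamel_integrable[OF V] in auto)
  from this[OF tendsto_fst tendsto_snd] show "continuous_on UNIV (\<lambda>(t, \<xi>). duhamel_hat a T V t \<xi>)"
    unfolding continuous_on_sequentially by (fastforce simp: o_def case_prod_unfold)
qed

end

section \<open>The Banach space of dominated paths\<close>

text \<open>
  A path dominated by the weight is encoded by its quotient by the weight, a bounded continuous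
  function on the plane. The least admissible constant in the domination then is the supremum norm,
  and completeness is that of the space of bounded continuous functions.
\<close>

type_synonym profile = "(real \<times> real) \<Rightarrow>\<^sub>C complex"

definition hat :: "real \<Rightarrow> profile \<Rightarrow> real \<Rightarrow> real \<Rightarrow> complex" where
  "hat T u t \<xi> = of_real (path_weight T t \<xi>) * apply_bcontfun u (t, \<xi>)"

definition pack :: "real \<Rightarrow> (real \<Rightarrow> real \<Rightarrow> complex) \<Rightarrow> profile" where
  "pack T V = Bcontfun (\<lambda>(t, \<xi>). V t \<xi> / of_real (path_weight T t \<xi>))"

text \<open>
  The Fourier transform of the Duhamel integral of a product of three functions, on the level of
  profiles.
\<close>

definition cubic_term :: "real \<Rightarrow> real \<Rightarrow> profile \<Rightarrow> profile \<Rightarrow> profile \<Rightarrow> profile" where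
  "cubic_term T a u v w =
     pack T (duhamel_hat a T (\<lambda>t. conv (hat T u t) (conv (hat T v t) (hat T w t))))"

definition free_evolution :: "real \<Rightarrow> real \<Rightarrow> (real \<Rightarrow> complex) \<Rightarrow> real \<Rightarrow> real \<Rightarrow> complex" where
  "free_evolution a T \<Phi> t \<xi> = cis (clamp_time T t * a * \<xi> ^ 3) * \<Phi> \<xi>"

text \<open>
  The first nontrivial Picard iterate. For data \<tau> times (\<Phi>, \<Psi>) the solution is \<tau> times the free evolution
  minus \<tau>^3 times this function, up to O(\<tau>^4).
\<close>

definition cubic_response :: "real \<Rightarrow> real \<Rightarrow> real \<Rightarrow> (real \<Rightarrow> complex) \<Rightarrow> (real \<Rightarrow> complex) \<Rightarrow> real \<Rightarrow> real \<Rightarrow> complex" where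
  "cubic_response T a b \<Phi> \<Psi> = duhamel_hat a T
     (\<lambda>t. conv (free_evolution a T \<Phi> t) (conv (free_evolution b T \<Psi> t) (free_evolution b T \<Psi> t)))"

definition physical_path :: "real \<Rightarrow> (real \<Rightarrow> real \<Rightarrow> complex) \<Rightarrow> real \<Rightarrow> real \<Rightarrow> complex" where
  "physical_path T V t = (if t \<in> {0..T} then inv_fourier (V t) else (\<lambda>_. 0))"

lemma conv_diff_left:
  assumes "rapid f" "rapid f'" "rapid g"
  shows "conv (\<lambda>\<xi>. f \<xi> - f' \<xi>) g = (\<lambda>\<xi>. conv f g \<xi> - conv f' g \<xi>)"
proof -
  have int: "integrable lborel (\<lambda>\<eta>. h (\<xi> - \<eta>) * g \<eta>)" if h: "rapid h" for h \<xi>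
  proof -
    obtain B where B: "\<And>\<xi>. norm (h \<xi>) \<le> B" using rapid_bounded[OF h] by metis
    show ?thesis using h assms by (intro integrable_conv[OF _ _ B] rapid_measurable rapid_integrable)
  qed
  show ?thesis
    unfolding conv_def[abs_def] using int[OF assms(1)] int[OF assms(2)] by (simp add: left_diff_distrib diff_divide_distrib)
qed

lemma conv_diff_right:
  assumes "rapid f" "rapid g" "rapid g'"
  shows "conv f (\<lambda>\<xi>. g \<xi> - g' \<xi>) = (\<lambda>\<xi>. conv f g \<xi> - conv f g' \<xi>)"
proof -
  obtain B where B: "\<And>\<xi>. norm (f \<xi>) \<le> B" using rapid_bounded[OF assms(1)] by metis
  have int: "integrable lborel (\<lambda>\<eta>. f (\<xi> - \<eta>) * h \<eta>)" if "rapid h" for h \<xi>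
    using that assms by (intro integrable_conv[OF _ _ B] rapid_measurable rapid_integrable)
  show ?thesis
    unfolding conv_def[abs_def] using int[OF assms(2)] int[OF assms(3)] by (simp add: right_diff_distrib diff_divide_distrib)
qed

lemma conv_scale:
  "conv (\<lambda>\<xi>. c * f \<xi>) g = (\<lambda>\<xi>. c * conv f g \<xi>)" "conv f (\<lambda>\<xi>. c * g \<xi>) = (\<lambda>\<xi>. c * conv f g \<xi>)"
  by (simp_all add: conv_def[abs_def] mult.assoc mult.left_commute[of _ c])

text \<open>
  Hermitian symmetry is preserved by every operation in the Picard iteration, because the equation
  maps real functions to real functions.
\<close>

lemma hermitian_conv:
  assumes f: "hermitian f" and g: "hermitian g"
  shows "hermitian (conv f g)"
  unfolding hermitian_def
proof
  fix \<xi>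
  have "(LINT \<eta>|lborel. f (- \<xi> - \<eta>) * g \<eta>) = (LINT \<eta>|lborel. f (- \<xi> - (0 + - 1 * \<eta>)) * g (0 + - 1 * \<eta>))"
    using lborel_integral_real_affine[of "-1" "\<lambda>\<eta>. f (- \<xi> - \<eta>) * g \<eta>" 0] by simp
  also have "\<dots> = (LINT \<eta>|lborel. cnj (f (\<xi> - \<eta>) * g \<eta>))"
  proof (intro Bochner_Integration.integral_cong refl)
    fix \<eta>
    have "f (- \<xi> - (0 + - 1 * \<eta>)) = cnj (f (\<xi> - \<eta>))" "g (0 + - 1 * \<eta>) = cnj (g \<eta>)"
      using f[unfolded hermitian_def, rule_format, of "\<xi> - \<eta>"] g[unfolded hermitian_def, rule_format, of \<eta>]
      by simp_all
    then show "f (- \<xi> - (0 + - 1 * \<eta>)) * g (0 + - 1 * \<eta>) = cnj (f (\<xi> - \<eta>) * g \<eta>)" by simp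
  qed
  also have "\<dots> = cnj (LINT \<eta>|lborel. f (\<xi> - \<eta>) * g \<eta>)"
    by (rule Bochner_Integration.integral_cnj)
  finally show "conv f g (- \<xi>) = cnj (conv f g \<xi>)" by (simp add: conv_def)
qed

lemma hermitian_duhamel_hat:
  assumes V: "\<And>t. hermitian (V t)"
  shows "hermitian (duhamel_hat a T V t)"
  unfolding hermitian_def
proof
  fix \<xi>
  have "duhamel_hat a T V t (- \<xi>) = (LINT r|lborel. cnj (indicator {0..clamp_time T t} r *\<^sub>R
     (cis ((clamp_time T t - r) * a * \<xi> ^ 3) * (\<i> * of_real \<xi> * V r \<xi>))))"
    unfolding duhamel_hat_def
  proof (intro Bochner_Integration.integral_cong refl)
    fix r
    have "V r (- \<xi>) = cnj (V r \<xi>)" using V by (simp add: hermitian_def)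
    then show "indicator {0..clamp_time T t} r *\<^sub>R
        (cis ((clamp_time T t - r) * a * (- \<xi>) ^ 3) * (\<i> * of_real (- \<xi>) * V r (- \<xi>)))
      = cnj (indicator {0..clamp_time T t} r *\<^sub>R (cis ((clamp_time T t - r) * a * \<xi> ^ 3) * (\<i> * of_real \<xi> * V r \<xi>)))"
      by (simp add: cis_cnj scaleR_conv_of_real)
  qed
  also have "\<dots> = cnj (duhamel_hat a T V t \<xi>)"
    unfolding duhamel_hat_def by (rule Bochner_Integration.integral_cnj)
  finally show "duhamel_hat a T V t (- \<xi>) = cnj (duhamel_hat a T V t \<xi>)" .
qed

lemma hermitian_free_evolution:
  assumes "hermitian \<Phi>"
  shows "hermitian (free_evolution a T \<Phi> t)"
  using assms by (simp add: hermitian_def free_evolution_def cis_cnj)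

context
  fixes T :: real
  assumes T: "0 < T"
begin

lemma duhamel_hat_diff:
  assumes V: "dominated_path T A V" and W: "dominated_path T B W"
  shows "duhamel_hat a T (\<lambda>t \<xi>. V t \<xi> - W t \<xi>) t \<xi> = duhamel_hat a T V t \<xi> - duhamel_hat a T W t \<xi>"
proof -
  let ?k = "\<lambda>V r. indicat_real {0..clamp_time T t} r *\<^sub>R
     (cis ((clamp_time T t - r) * a * \<xi> ^ 3) * (\<i> * of_real \<xi> * V r \<xi>))"
  have "duhamel_hat a T (\<lambda>t \<xi>. V t \<xi> - W t \<xi>) t \<xi> = (LINT r|lborel. ?k V r - ?k W r)"
    unfolding duhamel_hat_def
    by (intro Bochner_Integration.integral_cong refl) (simp add: right_diff_distrib scaleR_diff_right)
  then show ?thesis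
    unfolding duhamel_hat_def
    using Bochner_Integration.integral_diff[OF duhamel_integrable[OF T V] duhamel_integrable[OF T W]] by simp
qed

lemma duhamel_hat_scale:
  "duhamel_hat a T (\<lambda>t \<xi>. c * V t \<xi>) t \<xi> = c * duhamel_hat a T V t \<xi>"
  unfolding duhamel_hat_def
  by (subst integral_mult_right_zero[symmetric])
     (intro Bochner_Integration.integral_cong refl, simp add: scaleR_conv_of_real mult_ac)

lemma dominated_path_hat: "dominated_path T (norm u) (hat T u)"
  unfolding dominated_path_def
proof (intro conjI allI)
  have "continuous_on UNIV (\<lambda>z. complex_of_real (case z of (t, \<xi>) \<Rightarrow> path_weight T t \<xi>) * apply_bcontfun u z)"
    by (intro continuous_intros continuous_on_path_weight[OF T] continuous_on_apply_bcontfun)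
  then show "continuous_on UNIV (\<lambda>(t, \<xi>). hat T u t \<xi>)"
    by (simp add: hat_def case_prod_unfold)
  show "norm (hat T u t \<xi>) \<le> norm u * path_weight T t \<xi>" for t \<xi>
    using norm_bounded[of u "(t, \<xi>)"] path_weight_pos[OF T, of t \<xi>]
    by (simp add: hat_def norm_mult mult.commute mult_left_mono)
qed

lemma apply_pack:
  assumes V: "dominated_path T A V"
  shows "apply_bcontfun (pack T V) (t, \<xi>) = V t \<xi> / of_real (path_weight T t \<xi>)"
    and norm_apply_pack: "norm (apply_bcontfun (pack T V) z) \<le> A"
proof -
  let ?f = "\<lambda>(t, \<xi>). V t \<xi> / of_real (path_weight T t \<xi>)"
  have c: "continuous_on UNIV ?f"
    using dominated_pathD(1)[OF T V] continuous_on_path_weight[OF T] path_weight_pos[OF T]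
    unfolding case_prod_unfold by (intro continuous_intros) (auto simp: less_imp_neq[symmetric])
  have b: "norm (?f z) \<le> A" for z
  proof -
    obtain t \<xi> where z: "z = (t, \<xi>)" by (cases z)
    show ?thesis
      using dominated_pathD(2)[OF T V, of t \<xi>] path_weight_pos[OF T, of t \<xi>]
      by (simp add: z norm_divide divide_le_eq)
  qed
  have eq: "apply_bcontfun (pack T V) = ?f"
    unfolding pack_def by (intro Bcontfun_inverse bcontfun_normI[OF c b])
  show "apply_bcontfun (pack T V) (t, \<xi>) = V t \<xi> / of_real (path_weight T t \<xi>)" by (simp add: eq)
  show "norm (apply_bcontfun (pack T V) z) \<le> A" unfolding eq by (rule b)
qed

lemma hat_pack:
  assumes V: "dominated_path T A V"
  shows "hat T (pack T V) = V"
  using path_weight_pos[OF T] by (auto simp: fun_eq_iff hat_def apply_pack[OF V] less_imp_neq[symmetric])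

lemma norm_pack_le: "dominated_path T A V \<Longrightarrow> norm (pack T V) \<le> A"
  by (intro norm_bound norm_apply_pack)

lemma hat_diff: "hat T (u - v) = (\<lambda>t \<xi>. hat T u t \<xi> - hat T v t \<xi>)"
  by (simp add: hat_def fun_eq_iff right_diff_distrib)

lemma hat_scaleR: "hat T (c *\<^sub>R u) = (\<lambda>t \<xi>. of_real c * hat T u t \<xi>)"
  by (simp add: hat_def fun_eq_iff scaleR_conv_of_real)

lemma hat_inject:
  assumes "hat T u = hat T v"
  shows "u = v"
proof (rule bcontfun_eqI)
  fix z :: "real \<times> real"
  obtain t \<xi> where "z = (t, \<xi>)" by (cases z)
  then show "apply_bcontfun u z = apply_bcontfun v z"
    using fun_cong[OF fun_cong[OF assms], of t \<xi>] path_weight_pos[OF T, of t \<xi>] by (simp add: hat_def)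
qed

lemma dominated_path_cubic:
  assumes "dominated_path T A U" "dominated_path T B V" "dominated_path T C W"
  shows "dominated_path T (T * (2 * A * (2 * B * C))) (duhamel_hat a T (\<lambda>t. conv (U t) (conv (V t) (W t))))"
  using assms by (intro dominated_path_duhamel_hat[OF T] dominated_path_conv[OF T])

lemma hat_cubic_term:
  "hat T (cubic_term T a u v w) = duhamel_hat a T (\<lambda>t. conv (hat T u t) (conv (hat T v t) (hat T w t)))"
  unfolding cubic_term_def by (rule hat_pack[OF dominated_path_cubic]) (rule dominated_path_hat)+

text \<open>
  The factors 2 in the constant 4 T come from the two convolutions, and T from the Duhamel integral.
\<close>

lemma trilinear_cubic_term: "trilinear (cubic_term T a) (4 * T)"
proof
  note r = dominated_path_rapid[OF T dominated_path_hat]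
  note dc = dominated_path_conv[OF T dominated_path_hat dominated_path_conv[OF T dominated_path_hat dominated_path_hat]]
  fix x x' y z :: profile and c :: real
  show "cubic_term T a (x - x') y z = cubic_term T a x y z - cubic_term T a x' y z"
    by (rule hat_inject, unfold hat_diff hat_cubic_term)
       (simp add: conv_diff_left r rapid_conv duhamel_hat_diff[OF dc dc] fun_eq_iff)
  show "cubic_term T a x (y - x') z = cubic_term T a x y z - cubic_term T a x x' z"
    by (rule hat_inject, unfold hat_diff hat_cubic_term)
       (simp add: conv_diff_left conv_diff_right r rapid_conv duhamel_hat_diff[OF dc dc] fun_eq_iff)
  show "cubic_term T a x y (z - x') = cubic_term T a x y z - cubic_term T a x y x'"
    by (rule hat_inject, unfold hat_diff hat_cubic_term)
       (simp add: conv_diff_right r rapid_conv duhamel_hat_diff[OF dc dc] fun_eq_iff)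
  show "cubic_term T a (c *\<^sub>R x) y z = c *\<^sub>R cubic_term T a x y z"
    "cubic_term T a x (c *\<^sub>R y) z = c *\<^sub>R cubic_term T a x y z"
    "cubic_term T a x y (c *\<^sub>R z) = c *\<^sub>R cubic_term T a x y z"
    by (rule hat_inject, unfold hat_scaleR hat_cubic_term, simp add: conv_scale duhamel_hat_scale fun_eq_iff)+
  have "norm (cubic_term T a x y z) \<le> T * (2 * norm x * (2 * norm y * norm z))"
    unfolding cubic_term_def by (intro norm_pack_le dominated_path_cubic dominated_path_hat)
  then show "norm (cubic_term T a x y z) \<le> 4 * T * (norm x * norm y * norm z)" by (simp add: mult_ac)
qed (use T in simp)

lemma closed_hermitian_profiles: "closed {u. \<forall>t. hermitian (hat T u t)}"
proof -
  have c: "continuous_on UNIV (\<lambda>u. hat T u t \<xi>)" for t \<xi>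
    unfolding continuous_on_iff
  proof (intro ballI allI impI)
    fix u :: profile and e :: real assume e: "0 < e"
    have w: "0 < path_weight T t \<xi>" by (rule path_weight_pos[OF T])
    show "\<exists>d>0. \<forall>v\<in>UNIV. dist v u < d \<longrightarrow> dist (hat T v t \<xi>) (hat T u t \<xi>) < e"
    proof (intro exI[of _ "e / path_weight T t \<xi>"] conjI ballI impI)
      show "0 < e / path_weight T t \<xi>" using e w by simp
      fix v :: profile assume "dist v u < e / path_weight T t \<xi>"
      then have "path_weight T t \<xi> * norm (v - u) < e" using w by (simp add: dist_norm field_simps)
      moreover have "norm (hat T (v - u) t \<xi>) \<le> norm (v - u) * path_weight T t \<xi>"
        by (rule dominated_pathD(2)[OF T dominated_path_hat])
      ultimately show "dist (hat T v t \<xi>) (hat T u t \<xi>) < e"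
        by (simp add: hat_diff dist_norm mult.commute)
    qed
  qed
  have "closed {u. \<forall>t \<xi>. hat T u t (- \<xi>) = cnj (hat T u t \<xi>)}"
    by (intro closed_Collect_all closed_Collect_eq c continuous_on_cnj)
  then show ?thesis by (simp add: hermitian_def)
qed

lemma dominated_path_free_evolution:
  assumes c: "continuous_on UNIV \<Phi>" and b: "\<And>\<xi>. norm (\<Phi> \<xi>) \<le> A * decay_weight 2 \<xi>"
  shows "dominated_path T A (free_evolution a T \<Phi>)"
  unfolding dominated_path_def
proof (intro conjI allI)
  have c1: "continuous_on UNIV (\<lambda>x::real \<times> real. clamp_time T (fst x))"
    by (rule continuous_on_compose2[OF continuous_on_clamp_time[of UNIV]]) (auto intro!: continuous_intros)
  have c2: "continuous_on UNIV (\<lambda>x::real \<times> real. \<Phi> (snd x))"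
    by (rule continuous_on_compose2[OF c]) (auto intro!: continuous_intros)
  show "continuous_on UNIV (\<lambda>(t, \<xi>). free_evolution a T \<Phi> t \<xi>)"
    unfolding free_evolution_def case_prod_unfold by (intro continuous_intros c1 c2)
  fix t \<xi>
  have "0 \<le> A" by (rule decay_bound_nonneg[OF b])
  then show "norm (free_evolution a T \<Phi> t \<xi>) \<le> A * path_weight T t \<xi>"
    using b[of \<xi>] mult_left_mono[OF path_weight_ge[OF T, of \<xi> t], of A]
    by (simp add: free_evolution_def norm_mult)
qed

section \<open>Smooth solutions from their Fourier transforms\<close>

lemma path_distr_physical:
  assumes V: "dominated_path T A V"
  shows "path_distr (physical_path T V) t = (if t \<in> {0..T} then inv_fourier_distr (V t) else 0)"
proof (cases "t \<in> {0..T}")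
  case True
  then show ?thesis
    by (simp del: atLeastAtMost_iff add: path_distr_def physical_path_def inv_fourier_distr_eq_regular[OF rapid_integrable[OF dominated_path_rapid[OF T V]]])
next
  case False
  then have "physical_path T V t = (\<lambda>_. 0)" by (simp add: physical_path_def del: atLeastAtMost_iff)
  then have "path_distr (physical_path T V) t = 0" unfolding path_distr_def regular_distr_def by (auto simp: fun_eq_iff)
  then show ?thesis using False by (simp del: atLeastAtMost_iff)
qed

text \<open>
  The domination is uniform in time and exponential, so it absorbs the weight of any Sobolev norm,
  and dominated convergence gives continuity in time.
\<close>

lemma smooth_path_physical:
  assumes V: "dominated_path T A V" and h: "\<And>t. hermitian (V t)" and F: "F = \<real> \<or> F = UNIV"
  shows "smooth_path F T (physical_path T V)"
proof -
  note r = dominated_path_rapid[OF T V]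
  have "path_distr (physical_path T V) \<in> vecs (path_space T (sobolev F \<sigma>))" for \<sigma>
    unfolding path_space_vecs_iff
  proof (intro conjI ballI allI impI)
    fix t assume "t \<in> {0..T}"
    then show "path_distr (physical_path T V) t \<in> vecs (sobolev F \<sigma>)"
      using rapid_sobolev[OF r h F] by (simp add: path_distr_def physical_path_def)
  next
    fix t assume "t \<notin> {0..T}"
    then show "path_distr (physical_path T V) t = 0"
      unfolding path_distr_physical[OF V] by (simp del: atLeastAtMost_iff)
  next
    fix t0 assume t0: "t0 \<in> {0..T}"
    have norm_eq: "vnorm (sobolev F \<sigma>) (path_distr (physical_path T V) t - path_distr (physical_path T V) t0)
        = sqrt (LINT \<xi>|lborel. (1 + \<xi>\<^sup>2) powr \<sigma> * (norm (V t \<xi> - V t0 \<xi>))\<^sup>2)" if "t \<in> {0..T}" for t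
      using that t0 unfolding path_distr_def physical_path_def
      by (simp add: sobolev_norm_eq[OF has_fourier_diff[OF rapid_has_fourier[OF r] rapid_has_fourier[OF r]]])
    obtain C where C: "C \<ge> 0" "\<And>\<xi>::real. (1 + \<xi>\<^sup>2) powr \<sigma> * (decay_weight 1 \<xi>)\<^sup>2 \<le> C * (1 / (1 + \<xi>\<^sup>2))"
      using sobolev_weight_decay_le by metis
    note [measurable] = rapid_measurable[OF r]
    have "(\<lambda>n. vnorm (sobolev F \<sigma>) (path_distr (physical_path T V) (s n) - path_distr (physical_path T V) t0)) \<longlonglongrightarrow> 0"
      if s: "\<And>n. s n \<in> {0..T}" "s \<longlonglongrightarrow> t0" for s
    proof -
      have "(\<lambda>n. LINT \<xi>|lborel. (1 + \<xi>\<^sup>2) powr \<sigma> * (norm (V (s n) \<xi> - V t0 \<xi>))\<^sup>2)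
          \<longlonglongrightarrow> (LINT \<xi>|lborel. (1 + \<xi>\<^sup>2) powr \<sigma> * (norm (V t0 \<xi> - V t0 \<xi>))\<^sup>2)"
      proof (rule integral_dominated_convergence[where w = "\<lambda>\<xi>. (4 * A\<^sup>2 * C) * (1 / (1 + \<xi>\<^sup>2))"])
        show "integrable lborel (\<lambda>\<xi>. (4 * A\<^sup>2 * C) * (1 / (1 + \<xi>\<^sup>2)))"
          by (intro integrable_mult_right integrable_inverse_one_plus_square)
        have "(\<lambda>n. V (s n) \<xi>) \<longlonglongrightarrow> V t0 \<xi>" for \<xi>
          using continuous_on_tendsto_compose[OF dominated_pathD(1)[OF T V] tendsto_Pair[OF s(2) tendsto_const[of \<xi>]]]
          by simp
        then show "AE \<xi> in lborel. (\<lambda>n. (1 + \<xi>\<^sup>2) powr \<sigma> * (norm (V (s n) \<xi> - V t0 \<xi>))\<^sup>2)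
            \<longlonglongrightarrow> (1 + \<xi>\<^sup>2) powr \<sigma> * (norm (V t0 \<xi> - V t0 \<xi>))\<^sup>2"
          by (intro AE_I2 tendsto_mult_left tendsto_power tendsto_norm tendsto_diff tendsto_const)
        have "(1 + \<xi>\<^sup>2) powr \<sigma> * (norm (V t \<xi> - V t0 \<xi>))\<^sup>2 \<le> (4 * A\<^sup>2 * C) * (1 / (1 + \<xi>\<^sup>2))" for t \<xi>
        proof -
          have "norm (V t \<xi>) \<le> A * decay_weight 1 \<xi>" for t
            using dominated_pathD(2)[OF T V, of t \<xi>] mult_left_mono[OF path_weight_le[OF T] dominated_pathD(3)[OF T V], of t \<xi>]
            by linarith
          from this[of t] this[of t0] have "norm (V t \<xi> - V t0 \<xi>) \<le> 2 * A * decay_weight 1 \<xi>"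
            using norm_triangle_ineq4[of "V t \<xi>" "V t0 \<xi>"] by linarith
          then have "(1 + \<xi>\<^sup>2) powr \<sigma> * (norm (V t \<xi> - V t0 \<xi>))\<^sup>2 \<le> (1 + \<xi>\<^sup>2) powr \<sigma> * (2 * A * decay_weight 1 \<xi>)\<^sup>2"
            by (intro mult_left_mono power_mono) auto
          also have "\<dots> = (4 * A\<^sup>2) * ((1 + \<xi>\<^sup>2) powr \<sigma> * (decay_weight 1 \<xi>)\<^sup>2)"
            by (simp add: power_mult_distrib)
          also have "\<dots> \<le> (4 * A\<^sup>2) * (C * (1 / (1 + \<xi>\<^sup>2)))" by (intro mult_left_mono C) simp
          finally show ?thesis by simp
        qed
        then show "AE \<xi> in lborel. norm ((1 + \<xi>\<^sup>2) powr \<sigma> * (norm (V (s n) \<xi> - V t0 \<xi>))\<^sup>2)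
            \<le> (4 * A\<^sup>2 * C) * (1 / (1 + \<xi>\<^sup>2))" for n
          by simp
      qed measurable
      then have "(\<lambda>n. sqrt (LINT \<xi>|lborel. (1 + \<xi>\<^sup>2) powr \<sigma> * (norm (V (s n) \<xi> - V t0 \<xi>))\<^sup>2)) \<longlonglongrightarrow> sqrt 0"
        by (intro tendsto_real_sqrt) simp
      then show ?thesis using s(1) by (simp add: norm_eq del: atLeastAtMost_iff)
    qed
    then show "((\<lambda>t. vnorm (sobolev F \<sigma>) (path_distr (physical_path T V) t - path_distr (physical_path T V) t0)) \<longlongrightarrow> 0)
        (at t0 within {0..T})"
      unfolding tendsto_at_iff_sequentially by (auto simp: o_def simp del: atLeastAtMost_iff)
  qed
  then show ?thesis
    unfolding smooth_path_def
    using inv_fourier_measurable[OF rapid_measurable[OF r]] inv_fourier_square_integrable[OF r]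
    by (auto simp: physical_path_def)
qed

text \<open>
  Tested with a Schwartz function, the Duhamel integral is a double integral over time and
  frequency, and Fubini moves the time integral inside.
\<close>

lemma duhamel_eq_inv_fourier_distr:
  assumes N: "dominated_path T A N" and g: "\<And>r. r \<in> {0..T} \<Longrightarrow> g r = inv_fourier (N r)" and t: "t \<in> {0..T}"
  shows "duhamel a g t = inv_fourier_distr (duhamel_hat a T N t)"
proof
  fix \<theta>
  note r = dominated_path_rapid[OF T N]
  let ?P = "\<lambda>r \<xi>. cis ((t - r) * a * \<xi> ^ 3) * (\<i> * of_real \<xi> * N r \<xi>)"
  have prp: "propagator a (t - r') (distr_deriv (regular_distr (g r'))) = inv_fourier_distr (?P r')"
    if "r' \<in> {0..t}" for r'
  proof -
    have "regular_distr (g r') = regular_distr (inv_fourier (N r'))" using that t g[of r'] by simp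
    then show ?thesis
      using propagator_eq[OF has_fourier_distr_deriv[OF rapid_has_fourier[OF r[of r']]], of a "t - r'"] by simp
  qed
  show "duhamel a g t \<theta> = inv_fourier_distr (duhamel_hat a T N t) \<theta>"
  proof (cases "schwartz \<theta>")
    case True
    define \<kappa> where "\<kappa> = inv_fourier \<theta>"
    have \<kappa>: "schwartz \<kappa>" unfolding \<kappa>_def by (rule schwartz_inv_fourier[OF True])
    note [measurable] = schwartz_measurable[OF \<kappa>]
    let ?h = "\<lambda>r \<xi>. (indicator {0..t} r *\<^sub>R ?P r \<xi>) * \<kappa> \<xi>"
    have [measurable]: "(\<lambda>(r, \<xi>). N r \<xi>) \<in> borel_measurable (borel \<Otimes>\<^sub>M borel)"
      by (rule dominated_path_measurable[OF T N])
    have meas: "case_prod ?h \<in> borel_measurable (borel \<Otimes>\<^sub>M borel)"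
    proof -
      have "(\<lambda>z. N (fst z) (snd z)) \<in> borel_measurable (borel \<Otimes>\<^sub>M borel)"
        using dominated_path_measurable[OF T N] by (simp add: case_prod_unfold)
      then show ?thesis unfolding case_prod_unfold by measurable
    qed
    have A: "integrable lborel (\<lambda>r. A * indicat_real {0..t} r)"
      by (intro integrable_mult_right integrable_indicator_Icc[OF T])
    have B: "integrable lborel (\<lambda>\<xi>. norm (\<kappa> \<xi>))" using schwartz_integrable[OF \<kappa>] by simp
    have le: "norm (?h r \<xi>) \<le> (A * indicat_real {0..t} r) * norm (\<kappa> \<xi>)" for r \<xi>
      unfolding norm_mult norm_scaleR
      using duhamel_integrand_bound[OF T N, of "(t - r) * a * \<xi> ^ 3" \<xi> r]
      by (intro mult_right_mono) (auto simp: indicator_def norm_mult)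
    have inner: "(LINT \<xi>|lborel. ?h r \<xi>) = indicator {0..t} r *\<^sub>R propagator a (t - r) (distr_deriv (regular_distr (g r))) \<theta>" for r
    proof (cases "r \<in> {0..t}")
      case True
      then show ?thesis
        using \<open>schwartz \<theta>\<close> by (simp add: prp inv_fourier_distr_def \<kappa>_def)
    qed simp
    have "duhamel a g t \<theta> = (LINT r:{0..t}|lborel. propagator a (t - r) (distr_deriv (regular_distr (g r))) \<theta>)"
      unfolding duhamel_def
      by (rule set_borel_integral_eq_integral(2)[symmetric])
         (use fubini_bound_integrable[OF meas A B le] in \<open>simp only: set_integrable_def inner\<close>)
    also have "\<dots> = (LINT r|lborel. LINT \<xi>|lborel. ?h r \<xi>)"
      by (simp only: set_lebesgue_integral_def inner)
    also have "\<dots> = (LINT \<xi>|lborel. LINT r|lborel. ?h r \<xi>)"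
      by (rule fubini_bound_swap[OF meas A B le])
    also have "\<dots> = (LINT \<xi>|lborel. duhamel_hat a T N t \<xi> * \<kappa> \<xi>)"
      unfolding duhamel_hat_def clamp_time_id[OF t] by (simp only: integral_mult_left_zero)
    finally show ?thesis using True by (simp add: inv_fourier_distr_def \<kappa>_def)
  next
    case False
    have "propagator a (t - r) (distr_deriv (regular_distr (g r))) \<theta> = 0" for r
      using False by (simp add: propagator_def fourier_multiplier_def inv_fourier_distr_def)
    then show ?thesis using False by (simp add: duhamel_def inv_fourier_distr_def)
  qed
qed

lemma inv_fourier_distr_diff:
  assumes "rapid f" "rapid g"
  shows "inv_fourier_distr (\<lambda>\<xi>. f \<xi> - g \<xi>) = inv_fourier_distr f - inv_fourier_distr g"
  using integrable_mult_schwartz[OF rapid_integrable[OF assms(1)] schwartz_inv_fourier]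
    integrable_mult_schwartz[OF rapid_integrable[OF assms(2)] schwartz_inv_fourier]
  by (auto simp: fun_eq_iff inv_fourier_distr_def left_diff_distrib)

text \<open>
  Both equations of the system have this form, for a = 1 and for a = \<alpha> with the roles of V and W
  exchanged. The factors of the nonlinearity g appear in a different order in the two equations,
  so g is only assumed to be equal to the product pointwise.
\<close>

lemma integral_equation_physical:
  assumes V: "dominated_path T A V" and W: "dominated_path T B W"
    and \<Phi>: "continuous_on UNIV \<Phi>" "\<And>\<xi>. norm (\<Phi> \<xi>) \<le> C * decay_weight 2 \<xi>"
    and eq: "\<And>t \<xi>. V t \<xi> = free_evolution a T \<Phi> t \<xi> - duhamel_hat a T (\<lambda>t. conv (V t) (conv (W t) (W t))) t \<xi>"
    and g: "\<And>r x. r \<in> {0..T} \<Longrightarrow> g r x = physical_path T V r x * (physical_path T W r x)\<^sup>2" and t: "t \<in> {0..T}"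
  shows "regular_distr (physical_path T V t) = propagator a t (inv_fourier_distr \<Phi>) - duhamel a g t"
proof -
  let ?N = "\<lambda>t. conv (V t) (conv (W t) (W t))"
  note rV = dominated_path_rapid[OF T V] and rW = dominated_path_rapid[OF T W]
  note dN = dominated_path_conv[OF T V dominated_path_conv[OF T W W]]
  note dF = dominated_path_free_evolution[OF \<Phi>, of a]
  note dD = dominated_path_duhamel_hat[OF T dN, of a]
  have "g r = inv_fourier (?N r)" if "r \<in> {0..T}" for r
    using that g[OF that] inv_fourier_mult[OF rW rW] inv_fourier_mult[OF rV rapid_conv[OF rW rW]]
    by (auto simp: physical_path_def power2_eq_square fun_eq_iff simp del: atLeastAtMost_iff)
  then have d: "duhamel a g t = inv_fourier_distr (duhamel_hat a T ?N t)"
    by (intro duhamel_eq_inv_fourier_distr[OF dN _ t])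
  have r\<Phi>: "integrable lborel \<Phi>"
    by (rule integrable_decay_bound[OF borel_measurable_continuous_onI[OF \<Phi>(1)] \<Phi>(2)]) simp
  have p: "propagator a t (inv_fourier_distr \<Phi>) = inv_fourier_distr (free_evolution a T \<Phi> t)"
    unfolding propagator_eq[OF has_fourier_inv_fourier_distr[OF r\<Phi>]]
    by (simp add: free_evolution_def[abs_def] clamp_time_id[OF t])
  have "regular_distr (physical_path T V t) = inv_fourier_distr (V t)"
    using path_distr_physical[OF V, of t] t by (simp add: path_distr_def)
  also have "V t = (\<lambda>\<xi>. free_evolution a T \<Phi> t \<xi> - duhamel_hat a T ?N t \<xi>)"
    using eq by (simp add: fun_eq_iff)
  also have "inv_fourier_distr \<dots> = propagator a t (inv_fourier_distr \<Phi>) - duhamel a g t"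
    unfolding p d by (intro inv_fourier_distr_diff dominated_path_rapid[OF T dF] dominated_path_rapid[OF T dD])
  finally show ?thesis .
qed

text \<open>
  The fixed point exists on the whole of [0,T] for small data. The reason for the restriction to
  data of exponential decay on the Fourier side is that the derivative in the nonlinearity is then
  controlled by the loss of exponential rate, with no dispersive estimates. The fixed point differs
  from the cubic approximation by O(\<epsilon>^5), and \<epsilon>^4 is what the comparison with a C3 map asks for.
\<close>

lemma small_data_expansion:
  assumes F: "F = \<real> \<or> F = UNIV"
    and \<Phi>: "continuous_on UNIV \<Phi>" "\<And>\<xi>. norm (\<Phi> \<xi>) \<le> A * decay_weight 2 \<xi>" "hermitian \<Phi>"
    and \<Psi>: "continuous_on UNIV \<Psi>" "\<And>\<xi>. norm (\<Psi> \<xi>) \<le> A * decay_weight 2 \<xi>" "hermitian \<Psi>"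
  obtains \<epsilon>\<^sub>0 K where "0 < \<epsilon>\<^sub>0" "\<And>\<epsilon>. \<bar>\<epsilon>\<bar> \<le> \<epsilon>\<^sub>0 \<Longrightarrow> \<exists>v w V W.
      smooth_solution F \<alpha> T (inv_fourier_distr (\<lambda>\<xi>. of_real \<epsilon> * \<Phi> \<xi>), inv_fourier_distr (\<lambda>\<xi>. of_real \<epsilon> * \<Psi> \<xi>)) v w
      \<and> (\<forall>t\<in>{0..T}. has_fourier (path_distr v t) (V t) \<and> has_fourier (path_distr w t) (W t))
      \<and> (\<forall>t. rapid (V t) \<and> rapid (W t))
      \<and> (\<forall>t \<xi>. norm (V t \<xi> - (of_real \<epsilon> * free_evolution 1 T \<Phi> t \<xi> - of_real (\<epsilon> ^ 3) * cubic_response T 1 \<alpha> \<Phi> \<Psi> t \<xi>)) \<le> K * \<epsilon> ^ 4)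
      \<and> (\<forall>t \<xi>. norm (W t \<xi> - (of_real \<epsilon> * free_evolution \<alpha> T \<Psi> t \<xi> - of_real (\<epsilon> ^ 3) * cubic_response T \<alpha> 1 \<Psi> \<Phi> t \<xi>)) \<le> K * \<epsilon> ^ 4)"
proof -
  have A: "0 \<le> A" by (rule decay_bound_nonneg[OF \<Phi>(2)])
  define p0 where "p0 = pack T (free_evolution 1 T \<Phi>)"
  define q0 where "q0 = pack T (free_evolution \<alpha> T \<Psi>)"
  note dp = dominated_path_free_evolution[OF \<Phi>(1,2), of 1] and dq = dominated_path_free_evolution[OF \<Psi>(1,2), of \<alpha>]
  have hp: "hat T p0 = free_evolution 1 T \<Phi>" and hq: "hat T q0 = free_evolution \<alpha> T \<Psi>"
    unfolding p0_def q0_def by (rule hat_pack[OF dp] hat_pack[OF dq])+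
  have np: "norm p0 \<le> A" and nq: "norm q0 \<le> A"
    unfolding p0_def q0_def by (rule norm_pack_le[OF dp] norm_pack_le[OF dq])+
  define \<epsilon>\<^sub>0 where "\<epsilon>\<^sub>0 = 1 / (1 + 192 * T * A\<^sup>2)"
  define K where "K = 96 * (4 * T)\<^sup>2 * A ^ 5"
  have den: "1 + 192 * T * A\<^sup>2 \<ge> 1" using T by simp
  have \<epsilon>0: "0 < \<epsilon>\<^sub>0" "\<epsilon>\<^sub>0 \<le> 1" using den by (auto simp: \<epsilon>\<^sub>0_def)
  note tri1 = trilinear_cubic_term[of 1] and tri2 = trilinear_cubic_term[of \<alpha>]
  interpret D1: trilinear "cubic_term T 1" "4 * T" by (rule tri1)
  interpret D2: trilinear "cubic_term T \<alpha>" "4 * T" by (rule tri2)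
  let ?H = "{u. \<forall>t. hermitian (hat T u t)}"
  show ?thesis
  proof (rule that[OF \<epsilon>0(1)])
    fix \<epsilon> :: real assume \<epsilon>: "\<bar>\<epsilon>\<bar> \<le> \<epsilon>\<^sub>0"
    define p where "p = \<epsilon> *\<^sub>R p0"
    define q where "q = \<epsilon> *\<^sub>R q0"
    let ?\<Phi> = "\<lambda>\<xi>. of_real \<epsilon> * \<Phi> \<xi>" and ?\<Psi> = "\<lambda>\<xi>. of_real \<epsilon> * \<Psi> \<xi>"
    have p: "hat T p = free_evolution 1 T ?\<Phi>" and q: "hat T q = free_evolution \<alpha> T ?\<Psi>"
      unfolding p_def q_def hat_scaleR hp hq by (simp_all add: free_evolution_def fun_eq_iff)
    have h\<Phi>: "hermitian ?\<Phi>" and h\<Psi>: "hermitian ?\<Psi>" using \<Phi>(3) \<Psi>(3) by (simp_all add: hermitian_def)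
    have small: "48 * (4 * T) * (\<bar>\<epsilon>\<bar> * A)\<^sup>2 \<le> 1"
    proof -
      have e2: "\<bar>\<epsilon>\<bar>\<^sup>2 \<le> \<epsilon>\<^sub>0" using power_decreasing[of 1 2 "\<bar>\<epsilon>\<bar>"] \<epsilon> \<epsilon>0 by simp
      have "48 * (4 * T) * (\<bar>\<epsilon>\<bar> * A)\<^sup>2 = 192 * T * A\<^sup>2 * \<bar>\<epsilon>\<bar>\<^sup>2" by (simp add: power_mult_distrib)
      also have "\<dots> \<le> 192 * T * A\<^sup>2 * \<epsilon>\<^sub>0" using e2 T by (intro mult_left_mono) auto
      also have "\<dots> \<le> 1" using den by (simp add: \<epsilon>\<^sub>0_def divide_le_eq)
      finally show ?thesis .
    qed
    have inv: "p - cubic_term T 1 x y y \<in> ?H \<and> q - cubic_term T \<alpha> y x x \<in> ?H" if "x \<in> ?H" "y \<in> ?H" for x y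
    proof -
      have "hermitian (hat T (p - cubic_term T 1 x y y) t)" "hermitian (hat T (q - cubic_term T \<alpha> y x x) t)" for t
        using hermitian_free_evolution[OF h\<Phi>, of 1 T t] hermitian_free_evolution[OF h\<Psi>, of \<alpha> T t] that
          hermitian_duhamel_hat[of "\<lambda>t. conv (hat T x t) (conv (hat T y t) (hat T y t))" 1 T t]
          hermitian_duhamel_hat[of "\<lambda>t. conv (hat T y t) (conv (hat T x t) (hat T x t))" \<alpha> T t]
        by (simp_all add: hat_diff hat_cubic_term p q hermitian_conv) (simp_all add: hermitian_def)
      then show ?thesis by blast
    qed
    have zero: "0 \<in> ?H" by (simp add: hat_def hermitian_def)
    have npq: "norm p \<le> \<bar>\<epsilon>\<bar> * A" "norm q \<le> \<bar>\<epsilon>\<bar> * A"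
      unfolding p_def q_def using np nq by (auto intro: mult_left_mono)
    obtain x y where xy: "x \<in> ?H" "y \<in> ?H" "x = p - cubic_term T 1 x y y" "y = q - cubic_term T \<alpha> y x x"
      "norm (x - (p - cubic_term T 1 p q q)) \<le> 96 * (4 * T)\<^sup>2 * (\<bar>\<epsilon>\<bar> * A) ^ 5"
      "norm (y - (q - cubic_term T \<alpha> q p p)) \<le> 96 * (4 * T)\<^sup>2 * (\<bar>\<epsilon>\<bar> * A) ^ 5"
      using cubic_system_solution[OF tri1 tri2 closed_hermitian_profiles _ zero npq small] inv by blast
    define V where "V = hat T x"
    define W where "W = hat T y"
    note dV = dominated_path_hat[of x, folded V_def] and dW = dominated_path_hat[of y, folded W_def]
    have hV: "hermitian (V t)" and hW: "hermitian (W t)" for t using xy(1,2) by (auto simp: V_def W_def)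
    have eqV: "V t \<xi> = free_evolution 1 T ?\<Phi> t \<xi> - duhamel_hat 1 T (\<lambda>t. conv (V t) (conv (W t) (W t))) t \<xi>" for t \<xi>
    proof -
      have "V t \<xi> = hat T (p - cubic_term T 1 x y y) t \<xi>"
        unfolding V_def by (rule arg_cong[OF xy(3), of "\<lambda>u. hat T u t \<xi>"])
      then show ?thesis by (simp only: hat_diff hat_cubic_term p V_def W_def)
    qed
    have eqW: "W t \<xi> = free_evolution \<alpha> T ?\<Psi> t \<xi> - duhamel_hat \<alpha> T (\<lambda>t. conv (W t) (conv (V t) (V t))) t \<xi>" for t \<xi>
    proof -
      have "W t \<xi> = hat T (q - cubic_term T \<alpha> y x x) t \<xi>"
        unfolding W_def by (rule arg_cong[OF xy(4), of "\<lambda>u. hat T u t \<xi>"])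
      then show ?thesis by (simp only: hat_diff hat_cubic_term q V_def W_def)
    qed
    have c\<Phi>: "continuous_on UNIV ?\<Phi>" and c\<Psi>: "continuous_on UNIV ?\<Psi>"
      by (intro continuous_intros \<Phi>(1) \<Psi>(1))+
    have b\<Phi>: "norm (?\<Phi> \<xi>) \<le> (\<bar>\<epsilon>\<bar> * A) * decay_weight 2 \<xi>" and b\<Psi>: "norm (?\<Psi> \<xi>) \<le> (\<bar>\<epsilon>\<bar> * A) * decay_weight 2 \<xi>" for \<xi>
      using mult_left_mono[OF \<Phi>(2)[of \<xi>], of "\<bar>\<epsilon>\<bar>"] mult_left_mono[OF \<Psi>(2)[of \<xi>], of "\<bar>\<epsilon>\<bar>"]
      by (simp_all add: norm_mult mult.assoc)
    have sol: "smooth_solution F \<alpha> T (inv_fourier_distr ?\<Phi>, inv_fourier_distr ?\<Psi>) (physical_path T V) (physical_path T W)"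
      unfolding smooth_solution_def prod.case
    proof (intro conjI ballI)
      show "smooth_path F T (physical_path T V)" by (rule smooth_path_physical[OF dV hV F])
      show "smooth_path F T (physical_path T W)" by (rule smooth_path_physical[OF dW hW F])
      fix t assume t: "t \<in> {0..T}"
      show "regular_distr (physical_path T V t) = propagator 1 t (inv_fourier_distr ?\<Phi>)
          - duhamel 1 (\<lambda>t' x. physical_path T V t' x * (physical_path T W t' x)\<^sup>2) t"
        by (rule integral_equation_physical[OF dV dW c\<Phi> b\<Phi> eqV refl t])
      show "regular_distr (physical_path T W t) = propagator \<alpha> t (inv_fourier_distr ?\<Psi>)
          - duhamel \<alpha> (\<lambda>t' x. (physical_path T V t' x)\<^sup>2 * physical_path T W t' x) t"
        by (rule integral_equation_physical[OF dW dV c\<Psi> b\<Psi> eqW mult.commute t])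
    qed
    have four: "has_fourier (path_distr (physical_path T V) t) (V t)" "has_fourier (path_distr (physical_path T W) t) (W t)"
      if "t \<in> {0..T}" for t
      using that has_fourier_inv_fourier_distr[OF rapid_integrable[OF dominated_path_rapid[OF T dV]], of t]
        has_fourier_inv_fourier_distr[OF rapid_integrable[OF dominated_path_rapid[OF T dW]], of t]
      by (simp_all add: path_distr_physical[OF dV] path_distr_physical[OF dW] del: atLeastAtMost_iff)
    have e5: "96 * (4 * T)\<^sup>2 * (\<bar>\<epsilon>\<bar> * A) ^ 5 \<le> K * \<epsilon> ^ 4"
    proof -
      have "\<bar>\<epsilon>\<bar> ^ 5 \<le> \<bar>\<epsilon>\<bar> ^ 4" using \<epsilon> \<epsilon>0 by (intro power_decreasing) auto
      then have "K * \<bar>\<epsilon>\<bar> ^ 5 \<le> K * \<bar>\<epsilon>\<bar> ^ 4" using A by (intro mult_left_mono) (auto simp: K_def)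
      then show ?thesis by (simp add: K_def power_mult_distrib mult_ac)
    qed
    have hat_small: "norm (hat T u t \<xi>) \<le> norm u" for u t \<xi>
    proof -
      have "norm (hat T u t \<xi>) \<le> norm u * path_weight T t \<xi>" by (rule dominated_pathD(2)[OF T dominated_path_hat])
      also have "\<dots> \<le> norm u * 1"
        by (intro mult_left_mono order_trans[OF path_weight_le[OF T] decay_weight_le_1]) auto
      finally show ?thesis by simp
    qed
    have D1s: "cubic_term T 1 p q q = \<epsilon> ^ 3 *\<^sub>R cubic_term T 1 p0 q0 q0"
      unfolding p_def q_def by (simp add: D1.scale1 D1.scale2 D1.scale3 power3_eq_cube mult.assoc)
    have D2s: "cubic_term T \<alpha> q p p = \<epsilon> ^ 3 *\<^sub>R cubic_term T \<alpha> q0 p0 p0"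
      unfolding p_def q_def by (simp add: D2.scale1 D2.scale2 D2.scale3 power3_eq_cube mult.assoc)
    have expV: "norm (V t \<xi> - (of_real \<epsilon> * free_evolution 1 T \<Phi> t \<xi> - of_real (\<epsilon> ^ 3) * cubic_response T 1 \<alpha> \<Phi> \<Psi> t \<xi>)) \<le> K * \<epsilon> ^ 4" for t \<xi>
    proof -
      have "V t \<xi> - (of_real \<epsilon> * free_evolution 1 T \<Phi> t \<xi> - of_real (\<epsilon> ^ 3) * cubic_response T 1 \<alpha> \<Phi> \<Psi> t \<xi>)
          = hat T (x - (p - cubic_term T 1 p q q)) t \<xi>"
        unfolding D1s unfolding p_def hat_diff hat_scaleR hat_cubic_term hp hq cubic_response_def V_def ..
      then show ?thesis
        using order_trans[OF order_trans[OF hat_small xy(5)] e5] by simp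
    qed
    have expW: "norm (W t \<xi> - (of_real \<epsilon> * free_evolution \<alpha> T \<Psi> t \<xi> - of_real (\<epsilon> ^ 3) * cubic_response T \<alpha> 1 \<Psi> \<Phi> t \<xi>)) \<le> K * \<epsilon> ^ 4" for t \<xi>
    proof -
      have "W t \<xi> - (of_real \<epsilon> * free_evolution \<alpha> T \<Psi> t \<xi> - of_real (\<epsilon> ^ 3) * cubic_response T \<alpha> 1 \<Psi> \<Phi> t \<xi>)
          = hat T (y - (q - cubic_term T \<alpha> q p p)) t \<xi>"
        unfolding D2s unfolding q_def hat_diff hat_scaleR hat_cubic_term hp hq cubic_response_def W_def ..
      then show ?thesis
        using order_trans[OF order_trans[OF hat_small xy(6)] e5] by simp
    qed
    show "\<exists>v w V W.
      smooth_solution F \<alpha> T (inv_fourier_distr ?\<Phi>, inv_fourier_distr ?\<Psi>) v w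
      \<and> (\<forall>t\<in>{0..T}. has_fourier (path_distr v t) (V t) \<and> has_fourier (path_distr w t) (W t))
      \<and> (\<forall>t. rapid (V t) \<and> rapid (W t))
      \<and> (\<forall>t \<xi>. norm (V t \<xi> - (of_real \<epsilon> * free_evolution 1 T \<Phi> t \<xi> - of_real (\<epsilon> ^ 3) * cubic_response T 1 \<alpha> \<Phi> \<Psi> t \<xi>)) \<le> K * \<epsilon> ^ 4)
      \<and> (\<forall>t \<xi>. norm (W t \<xi> - (of_real \<epsilon> * free_evolution \<alpha> T \<Psi> t \<xi> - of_real (\<epsilon> ^ 3) * cubic_response T \<alpha> 1 \<Psi> \<Phi> t \<xi>)) \<le> K * \<epsilon> ^ 4)"
      using sol four expV expW dominated_path_rapid[OF T dV] dominated_path_rapid[OF T dW] by blast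
  qed
qed

end

section \<open>Boundedness of the cubic response\<close>

lemma sobolev_duality:
  assumes [measurable]: "\<kappa> \<in> borel_measurable borel" "f \<in> borel_measurable borel"
    and \<kappa>: "integrable lborel (\<lambda>\<xi>. (1 + \<xi>\<^sup>2) powr (- s) * (norm (\<kappa> \<xi>))\<^sup>2)"
    and f: "integrable lborel (\<lambda>\<xi>. (1 + \<xi>\<^sup>2) powr s * (norm (f \<xi>))\<^sup>2)"
  shows "integrable lborel (\<lambda>\<xi>. \<kappa> \<xi> * f \<xi>)"
    and "norm (LINT \<xi>|lborel. \<kappa> \<xi> * f \<xi>) \<le> sobolev_size (- s) \<kappa> * sobolev_size s f"
proof -
  let ?a = "\<lambda>\<xi>. (1 + \<xi>\<^sup>2) powr (- s / 2) * norm (\<kappa> \<xi>)" and ?b = "\<lambda>\<xi>. (1 + \<xi>\<^sup>2) powr (s / 2) * norm (f \<xi>)"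
  have ab: "?a \<xi> * ?b \<xi> = norm (\<kappa> \<xi> * f \<xi>)" for \<xi>
  proof -
    have "(1 + \<xi>\<^sup>2) powr (- s / 2) * (1 + \<xi>\<^sup>2) powr (s / 2) = (1 + \<xi>\<^sup>2) powr 0"
      by (simp only: powr_add[symmetric]) simp
    also have "\<dots> = 1" using one_plus_square_pos[of \<xi>] by simp
    finally show ?thesis by (simp add: norm_mult mult_ac)
  qed
  note a2 = \<kappa>[unfolded weighted_square_eq] and b2 = f[unfolded weighted_square_eq]
  have ma: "?a \<in> borel_measurable lborel" and mb: "?b \<in> borel_measurable lborel" by measurable
  have int: "integrable lborel (\<lambda>\<xi>. norm (\<kappa> \<xi> * f \<xi>))"
    using integrable_mult_of_squares[OF ma mb a2 b2] unfolding ab .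
  show i: "integrable lborel (\<lambda>\<xi>. \<kappa> \<xi> * f \<xi>)"
    using int by (rule Bochner_Integration.integrable_norm_cancel) measurable
  have "norm (LINT \<xi>|lborel. \<kappa> \<xi> * f \<xi>) \<le> \<bar>LINT \<xi>|lborel. ?a \<xi> * ?b \<xi>\<bar>"
    unfolding ab using integral_norm_bound[of lborel "\<lambda>\<xi>. \<kappa> \<xi> * f \<xi>"] by linarith
  also have "\<dots> \<le> sobolev_size (- s) \<kappa> * sobolev_size s f"
    unfolding sobolev_size_def weighted_square_eq by (rule abs_integral_mult_le[OF ma mb a2 b2])
  finally show "norm (LINT \<xi>|lborel. \<kappa> \<xi> * f \<xi>) \<le> sobolev_size (- s) \<kappa> * sobolev_size s f" .
qed

lemma fourier_test_AE:
  assumes "has_fourier u f" "\<kappa> \<in> borel_measurable borel"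
  shows "(LINT \<xi>|lborel. \<kappa> \<xi> * fourier_distr u \<xi>) = (LINT \<xi>|lborel. \<kappa> \<xi> * f \<xi>)"
proof -
  note [measurable] = has_fourier_measurable[OF assms(1)] has_fourier_measurable[OF has_fourier_fourier_distr[OF assms(1)]] assms(2)
  show ?thesis by (rule integral_cong_AE) (use fourier_distr_AE[OF assms(1)] in auto)
qed

text \<open>
  The real part makes the functional real-valued, as required on spaces that are regarded as real
  vector spaces for either choice of F.
\<close>

lemma bdd_functional_sobolev:
  assumes \<kappa>: "rapid \<kappa>"
  shows "bdd_functional (sobolev F s) (\<lambda>u. Re (LINT \<xi>|lborel. \<kappa> \<xi> * fourier_distr u \<xi>)) (sobolev_size (- s) \<kappa>)"
proof -
  note m\<kappa> = rapid_measurable[OF \<kappa>]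
  note int = sobolev_duality(1)[OF m\<kappa> has_fourier_measurable[OF sobolev_fourier_distr(1)]
      rapid_sobolev_integrable[OF \<kappa>] sobolev_fourier_distr(2)]
  note le = sobolev_duality(2)[OF m\<kappa> has_fourier_measurable[OF sobolev_fourier_distr(1)]
      rapid_sobolev_integrable[OF \<kappa>] sobolev_fourier_distr(2)]
  show ?thesis
    unfolding bdd_functional_def
  proof (intro conjI ballI allI)
    show "0 \<le> sobolev_size (- s) \<kappa>" by (rule sobolev_size_nonneg)
  next
    fix u v assume u: "u \<in> vecs (sobolev F s)" and v: "v \<in> vecs (sobolev F s)"
    have "(LINT \<xi>|lborel. \<kappa> \<xi> * fourier_distr (u + v) \<xi>) = (LINT \<xi>|lborel. \<kappa> \<xi> * (fourier_distr u \<xi> + fourier_distr v \<xi>))"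
      by (intro fourier_test_AE has_fourier_add sobolev_fourier_distr(1)[OF u] sobolev_fourier_distr(1)[OF v] m\<kappa>)
    also have "\<dots> = (LINT \<xi>|lborel. \<kappa> \<xi> * fourier_distr u \<xi>) + (LINT \<xi>|lborel. \<kappa> \<xi> * fourier_distr v \<xi>)"
      using int[OF u u] int[OF v v] by (simp add: distrib_left)
    finally show "Re (LINT \<xi>|lborel. \<kappa> \<xi> * fourier_distr (u + v) \<xi>)
        = Re (LINT \<xi>|lborel. \<kappa> \<xi> * fourier_distr u \<xi>) + Re (LINT \<xi>|lborel. \<kappa> \<xi> * fourier_distr v \<xi>)" by simp
  next
    fix c u assume u: "u \<in> vecs (sobolev F s)"
    have "(LINT \<xi>|lborel. \<kappa> \<xi> * fourier_distr (c *\<^sub>R u) \<xi>) = (LINT \<xi>|lborel. \<kappa> \<xi> * (of_real c * fourier_distr u \<xi>))"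
      by (intro fourier_test_AE has_fourier_scaleR sobolev_fourier_distr(1)[OF u] m\<kappa>)
    then show "Re (LINT \<xi>|lborel. \<kappa> \<xi> * fourier_distr (c *\<^sub>R u) \<xi>) = c * Re (LINT \<xi>|lborel. \<kappa> \<xi> * fourier_distr u \<xi>)"
      by (simp add: mult.left_commute[of _ "of_real c"])
  next
    fix u assume u: "u \<in> vecs (sobolev F s)"
    show "\<bar>Re (LINT \<xi>|lborel. \<kappa> \<xi> * fourier_distr u \<xi>)\<bar> \<le> sobolev_size (- s) \<kappa> * vnorm (sobolev F s) u"
      using order_trans[OF abs_Re_le_cmod le[OF u u]] by (simp add: sobolev_size_def sobolev_def)
  qed
qed

lemma bdd_functional_path_space:
  assumes X: "seminormed X" and l: "bdd_functional X l C" and t: "t \<in> {0..T}"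
  shows "bdd_functional (path_space T X) (\<lambda>u. l (u t)) C"
proof -
  have "bdd_functional (path_space T X) (\<lambda>u. l (u t)) (C * 1)"
    by (rule bdd_functional_comp[OF l, where P = "\<lambda>u. u t"])
       (use t path_space_upper[OF X] in \<open>auto simp: path_space_vecs_iff scaleR_fun_def\<close>)
  then show ?thesis by simp
qed

lemma vnorm_prod_space_ge:
  "vnorm X x \<le> vnorm (prod_space X Y) (x, y)" "vnorm Y y \<le> vnorm (prod_space X Y) (x, y)"
  by (auto simp: prod_space_def intro: order_trans[OF abs_ge_self real_sqrt_sum_squares_ge1]
      order_trans[OF abs_ge_self real_sqrt_sum_squares_ge2])

lemma bdd_functional_prod_space:
  shows "bdd_functional X l C \<Longrightarrow> bdd_functional (prod_space X Y) (\<lambda>p. l (fst p)) C"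
    and "bdd_functional Y l C \<Longrightarrow> bdd_functional (prod_space X Y) (\<lambda>p. l (snd p)) C"
proof -
  have mem: "fst p \<in> vecs X" "snd p \<in> vecs Y" if "p \<in> vecs (prod_space X Y)" for p
    using that by (auto simp: prod_space_def)
  have le: "vnorm X (fst p) \<le> vnorm (prod_space X Y) p" "vnorm Y (snd p) \<le> vnorm (prod_space X Y) p" for p
    using vnorm_prod_space_ge[where x = "fst p" and y = "snd p"] by simp_all
  show "bdd_functional (prod_space X Y) (\<lambda>p. l (fst p)) C" if "bdd_functional X l C"
    using bdd_functional_comp[OF that, where P = fst and Y = "prod_space X Y" and K = 1] mem le by simp
  show "bdd_functional (prod_space X Y) (\<lambda>p. l (snd p)) C" if "bdd_functional Y l C"
    using bdd_functional_comp[OF that, where P = snd and Y = "prod_space X Y" and K = 1] mem le by simp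
qed

text \<open>
  Fourier transforms of the data for which smooth solutions are constructed.
\<close>

definition admissible :: "(real \<Rightarrow> complex) \<Rightarrow> bool" where
  "admissible \<Phi> \<longleftrightarrow> continuous_on UNIV \<Phi> \<and> hermitian \<Phi> \<and> (\<exists>A. \<forall>\<xi>. norm (\<Phi> \<xi>) \<le> A * decay_weight 2 \<xi>)"

lemma admissible_rapid:
  assumes "admissible \<Phi>"
  shows "rapid \<Phi>"
proof -
  obtain A where A: "\<And>\<xi>. norm (\<Phi> \<xi>) \<le> A * decay_weight 2 \<xi>" using assms unfolding admissible_def by blast
  have "norm (\<Phi> \<xi>) \<le> A * decay_weight 1 \<xi>" for \<xi>
    by (rule order_trans[OF A mult_left_mono[OF decay_weight_mono decay_bound_nonneg[OF A]]]) simp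
  then show ?thesis using assms unfolding rapid_def admissible_def by blast
qed

lemma inv_fourier_distr_scaleR: "c *\<^sub>R inv_fourier_distr f = inv_fourier_distr (\<lambda>\<xi>. of_real c * f \<xi>)"
  by (auto simp: fun_eq_iff scaleR_fun_def inv_fourier_distr_def scaleR_conv_of_real mult.assoc)

lemma cubic_response_dominated:
  assumes T: "0 < T" and \<Phi>: "admissible \<Phi>" and \<Psi>: "admissible \<Psi>"
  shows "\<exists>A. dominated_path T A (cubic_response T a b \<Phi> \<Psi>)"
proof -
  obtain A where A: "\<And>\<xi>. norm (\<Phi> \<xi>) \<le> A * decay_weight 2 \<xi>" using \<Phi> unfolding admissible_def by blast
  obtain B where B: "\<And>\<xi>. norm (\<Psi> \<xi>) \<le> B * decay_weight 2 \<xi>" using \<Psi> unfolding admissible_def by blast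
  have c: "continuous_on UNIV \<Phi>" "continuous_on UNIV \<Psi>" using \<Phi> \<Psi> by (auto simp: admissible_def)
  show ?thesis
    unfolding cubic_response_def
    by (rule exI, rule dominated_path_cubic[OF T dominated_path_free_evolution[OF T c(1) A]
        dominated_path_free_evolution[OF T c(2) B] dominated_path_free_evolution[OF T c(2) B]])
qed

definition bounded_cubic_response :: "real \<Rightarrow> real \<Rightarrow> real \<Rightarrow> real \<Rightarrow> real \<Rightarrow> bool" where
  "bounded_cubic_response T a b s k \<longleftrightarrow> (\<exists>M. \<forall>\<Phi> \<Psi> \<kappa> t. admissible \<Phi> \<longrightarrow> admissible \<Psi> \<longrightarrow> rapid \<kappa> \<longrightarrow> t \<in> {0..T} \<longrightarrow>
      \<bar>Re (LINT \<xi>|lborel. \<kappa> \<xi> * cubic_response T a b \<Phi> \<Psi> t \<xi>)\<bar>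
        \<le> M * sobolev_size (- s) \<kappa> * sqrt ((sobolev_size s \<Phi>)\<^sup>2 + (sobolev_size k \<Psi>)\<^sup>2) ^ 3)"

text \<open>
  For admissible data and a small parameter x the solution map at x times the data must return the
  smooth solution, whose expansion in x has the cubic response as its cubic coefficient. A C3 map
  bounds this coefficient by the third power of the norm of the data, uniformly over all bounded
  functionals on the solution space, here the evaluation at time t followed by a test with \<kappa>.
\<close>

lemma cubic_response_bounded:
  assumes T: "0 < T" and r: "0 < r" and F: "F = \<real> \<or> F = UNIV"
    and S: "solution_map F \<alpha> s k r T S"
    and C3: "C3_at (prod_space (sobolev F s) (sobolev F k))
                 (prod_space (path_space T (sobolev F s)) (path_space T (sobolev F k))) S 0"
  shows "bounded_cubic_response T 1 \<alpha> s k" and "bounded_cubic_response T \<alpha> 1 k s"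
proof -
  let ?X = "prod_space (sobolev F s) (sobolev F k)"
  let ?Y = "prod_space (path_space T (sobolev F s)) (path_space T (sobolev F k))"
  note Xs = seminormed_sobolev[OF F, of s] and Xk = seminormed_sobolev[OF F, of k]
  have X: "seminormed ?X" by (intro seminormed_prod_space Xs Xk)
  have Y: "seminormed ?Y" using T by (intro seminormed_prod_space seminormed_path_space Xs Xk) auto
  interpret X: seminormed ?X by (rule X)
  obtain M where M: "\<And>h l C a b K d. \<lbrakk>h \<in> vecs ?X; bdd_functional ?Y l C; d > 0;
      \<And>x. \<bar>x\<bar> < d \<Longrightarrow> S (x *\<^sub>R h) \<in> vecs ?Y;
      \<And>x. \<bar>x\<bar> < d \<Longrightarrow> \<bar>l (S (x *\<^sub>R h)) - (a * x + b * x ^ 3)\<bar> \<le> K * x ^ 4\<rbrakk>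
      \<Longrightarrow> \<bar>b\<bar> \<le> M * C * vnorm ?X h ^ 3"
    by (rule C3_at_cubic_coefficient[OF X Y C3]) blast
  have main: "\<bar>Re (LINT \<xi>|lborel. \<kappa> \<xi> * cubic_response T 1 \<alpha> \<Phi> \<Psi> t \<xi>)\<bar>
        \<le> M * sobolev_size (- s) \<kappa> * sqrt ((sobolev_size s \<Phi>)\<^sup>2 + (sobolev_size k \<Psi>)\<^sup>2) ^ 3
      \<and> \<bar>Re (LINT \<xi>|lborel. \<kappa> \<xi> * cubic_response T \<alpha> 1 \<Psi> \<Phi> t \<xi>)\<bar>
        \<le> M * sobolev_size (- k) \<kappa> * sqrt ((sobolev_size s \<Phi>)\<^sup>2 + (sobolev_size k \<Psi>)\<^sup>2) ^ 3"
    if \<Phi>: "admissible \<Phi>" and \<Psi>: "admissible \<Psi>" and \<kappa>: "rapid \<kappa>" and t: "t \<in> {0..T}" for \<Phi> \<Psi> \<kappa> t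
  proof -
    note r\<Phi> = admissible_rapid[OF \<Phi>] and r\<Psi> = admissible_rapid[OF \<Psi>]
    define h where "h = (inv_fourier_distr \<Phi>, inv_fourier_distr \<Psi>)"
    have "inv_fourier_distr \<Phi> \<in> vecs (sobolev F s)" "inv_fourier_distr \<Psi> \<in> vecs (sobolev F k)"
      using \<Phi> \<Psi> by (auto simp: admissible_def intro!: inv_fourier_distr_sobolev rapid_integrable r\<Phi> r\<Psi> rapid_sobolev_integrable F)
    then have h: "h \<in> vecs ?X" by (simp add: h_def prod_space_def)
    have nh: "vnorm ?X h = sqrt ((sobolev_size s \<Phi>)\<^sup>2 + (sobolev_size k \<Psi>)\<^sup>2)"
      by (simp add: h_def prod_space_def sobolev_size_def
          sobolev_norm_eq[OF has_fourier_inv_fourier_distr[OF rapid_integrable[OF r\<Phi>]]]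
          sobolev_norm_eq[OF has_fourier_inv_fourier_distr[OF rapid_integrable[OF r\<Psi>]]])
    obtain A1 where A1: "\<And>\<xi>. norm (\<Phi> \<xi>) \<le> A1 * decay_weight 2 \<xi>" using \<Phi> unfolding admissible_def by blast
    obtain A2 where A2: "\<And>\<xi>. norm (\<Psi> \<xi>) \<le> A2 * decay_weight 2 \<xi>" using \<Psi> unfolding admissible_def by blast
    have A1': "norm (\<Phi> \<xi>) \<le> (A1 + A2) * decay_weight 2 \<xi>" and A2': "norm (\<Psi> \<xi>) \<le> (A1 + A2) * decay_weight 2 \<xi>" for \<xi>
      using A1[of \<xi>] A2[of \<xi>] decay_bound_nonneg[OF A1] decay_bound_nonneg[OF A2] decay_weight_nonneg[of 2 \<xi>]
      by (simp_all add: distrib_right add_increasing add_increasing2)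
    have c\<Phi>: "continuous_on UNIV \<Phi>" "hermitian \<Phi>" and c\<Psi>: "continuous_on UNIV \<Psi>" "hermitian \<Psi>"
      using \<Phi> \<Psi> by (auto simp: admissible_def)
    obtain \<epsilon>\<^sub>0 K where \<epsilon>0: "0 < \<epsilon>\<^sub>0" and sol: "\<And>\<epsilon>. \<bar>\<epsilon>\<bar> \<le> \<epsilon>\<^sub>0 \<Longrightarrow> \<exists>v w V W.
      smooth_solution F \<alpha> T (inv_fourier_distr (\<lambda>\<xi>. of_real \<epsilon> * \<Phi> \<xi>), inv_fourier_distr (\<lambda>\<xi>. of_real \<epsilon> * \<Psi> \<xi>)) v w
      \<and> (\<forall>t\<in>{0..T}. has_fourier (path_distr v t) (V t) \<and> has_fourier (path_distr w t) (W t))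
      \<and> (\<forall>t. rapid (V t) \<and> rapid (W t))
      \<and> (\<forall>t \<xi>. norm (V t \<xi> - (of_real \<epsilon> * free_evolution 1 T \<Phi> t \<xi> - of_real (\<epsilon> ^ 3) * cubic_response T 1 \<alpha> \<Phi> \<Psi> t \<xi>)) \<le> K * \<epsilon> ^ 4)
      \<and> (\<forall>t \<xi>. norm (W t \<xi> - (of_real \<epsilon> * free_evolution \<alpha> T \<Psi> t \<xi> - of_real (\<epsilon> ^ 3) * cubic_response T \<alpha> 1 \<Psi> \<Phi> t \<xi>)) \<le> K * \<epsilon> ^ 4)"
      using small_data_expansion[OF T F c\<Phi>(1) A1' c\<Phi>(2) c\<Psi>(1) A2' c\<Psi>(2), where \<alpha> = \<alpha>] by metis
    define n where "n = vnorm ?X h"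
    have n: "n \<ge> 0" using X.vnorm_nonneg[OF h] by (simp add: n_def)
    define d where "d = min \<epsilon>\<^sub>0 (r / (n + 1))"
    have d: "d > 0" using \<epsilon>0 r n by (simp add: d_def)
    have ball: "x *\<^sub>R h \<in> vball ?X 0 r" if x: "\<bar>x\<bar> < d" for x
    proof -
      have "\<bar>x\<bar> * (n + 1) < r" using x n by (simp add: d_def field_simps)
      then show ?thesis
        using X.vnorm_scaleR[OF h, of x] X.scaleR_vecs[OF h] by (simp add: vball_def n_def algebra_simps)
    qed
    have SY: "S (x *\<^sub>R h) \<in> vecs ?Y" if "\<bar>x\<bar> < d" for x
      using S ball[OF that] unfolding solution_map_def by blast
    have xh: "x *\<^sub>R h = (inv_fourier_distr (\<lambda>\<xi>. of_real x * \<Phi> \<xi>), inv_fourier_distr (\<lambda>\<xi>. of_real x * \<Psi> \<xi>))" for x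
      by (simp add: h_def inv_fourier_distr_scaleR)
    obtain B1 where B1: "dominated_path T B1 (cubic_response T 1 \<alpha> \<Phi> \<Psi>)" using cubic_response_dominated[OF T \<Phi> \<Psi>] by blast
    obtain B2 where B2: "dominated_path T B2 (cubic_response T \<alpha> 1 \<Psi> \<Phi>)" using cubic_response_dominated[OF T \<Psi> \<Phi>] by blast
    note m\<kappa> = rapid_measurable[OF \<kappa>]
    obtain B where B: "\<And>\<xi>. norm (\<kappa> \<xi>) \<le> B" using rapid_bounded[OF \<kappa>] by metis
    have int: "integrable lborel (\<lambda>\<xi>. \<kappa> \<xi> * f \<xi>)" if "rapid f" for f
      using B by (intro integrable_bounded_mult rapid_integrable that m\<kappa>)
    note rf = dominated_path_rapid[OF T dominated_path_free_evolution[OF T c\<Phi>(1) A1]]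
      dominated_path_rapid[OF T dominated_path_free_evolution[OF T c\<Psi>(1) A2]]
    have test: "\<bar>Re (LINT \<xi>|lborel. \<kappa> \<xi> * V \<xi>) - (Re (LINT \<xi>|lborel. \<kappa> \<xi> * f \<xi>) * x + (- Re (LINT \<xi>|lborel. \<kappa> \<xi> * g \<xi>)) * x ^ 3)\<bar>
        \<le> ((LINT \<xi>|lborel. norm (\<kappa> \<xi>)) * K) * x ^ 4"
      if V: "rapid V" and f: "rapid f" and g: "rapid g"
        and e: "\<And>\<xi>. norm (V \<xi> - (of_real x * f \<xi> - of_real (x ^ 3) * g \<xi>)) \<le> K * x ^ 4" for V f g x
    proof -
      let ?D = "\<lambda>\<xi>. \<kappa> \<xi> * (V \<xi> - (of_real x * f \<xi> - of_real (x ^ 3) * g \<xi>))"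
      have D: "?D = (\<lambda>\<xi>. \<kappa> \<xi> * V \<xi> - (of_real x * (\<kappa> \<xi> * f \<xi>) - of_real (x ^ 3) * (\<kappa> \<xi> * g \<xi>)))"
        by (simp add: fun_eq_iff algebra_simps)
      have eq: "(LINT \<xi>|lborel. ?D \<xi>) = (LINT \<xi>|lborel. \<kappa> \<xi> * V \<xi>)
          - (of_real x * (LINT \<xi>|lborel. \<kappa> \<xi> * f \<xi>) - of_real (x ^ 3) * (LINT \<xi>|lborel. \<kappa> \<xi> * g \<xi>))"
        unfolding D using int[OF V] int[OF f] int[OF g] by simp
      have iD: "integrable lborel ?D" unfolding D using int[OF V] int[OF f] int[OF g] by simp
      have "norm (LINT \<xi>|lborel. ?D \<xi>) \<le> (LINT \<xi>|lborel. norm (\<kappa> \<xi>) * (K * x ^ 4))"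
      proof (rule Bochner_Integration.integral_norm_bound_integral[OF iD])
        show "integrable lborel (\<lambda>\<xi>. norm (\<kappa> \<xi>) * (K * x ^ 4))" using rapid_integrable[OF \<kappa>] by simp
        show "norm (?D \<xi>) \<le> norm (\<kappa> \<xi>) * (K * x ^ 4)" for \<xi>
          unfolding norm_mult[of "\<kappa> \<xi>"] by (intro mult_left_mono e) simp
      qed
      then have "\<bar>Re (LINT \<xi>|lborel. ?D \<xi>)\<bar> \<le> ((LINT \<xi>|lborel. norm (\<kappa> \<xi>)) * K) * x ^ 4"
        using abs_Re_le_cmod order_trans by (fastforce simp: mult.assoc)
      then show ?thesis unfolding eq by (simp add: algebra_simps)
    qed
    let ?l1 = "\<lambda>p. Re (LINT \<xi>|lborel. \<kappa> \<xi> * fourier_distr (fst p t) \<xi>)"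
    let ?l2 = "\<lambda>p. Re (LINT \<xi>|lborel. \<kappa> \<xi> * fourier_distr (snd p t) \<xi>)"
    have l1: "bdd_functional ?Y ?l1 (sobolev_size (- s) \<kappa>)"
      by (rule bdd_functional_prod_space(1)[OF bdd_functional_path_space[OF Xs bdd_functional_sobolev[OF \<kappa>] t]])
    have l2: "bdd_functional ?Y ?l2 (sobolev_size (- k) \<kappa>)"
      by (rule bdd_functional_prod_space(2)[OF bdd_functional_path_space[OF Xk bdd_functional_sobolev[OF \<kappa>] t]])
    let ?K = "(LINT \<xi>|lborel. norm (\<kappa> \<xi>)) * K"
    have exp: "\<bar>?l1 (S (x *\<^sub>R h)) - (Re (LINT \<xi>|lborel. \<kappa> \<xi> * free_evolution 1 T \<Phi> t \<xi>) * x
            + (- Re (LINT \<xi>|lborel. \<kappa> \<xi> * cubic_response T 1 \<alpha> \<Phi> \<Psi> t \<xi>)) * x ^ 3)\<bar> \<le> ?K * x ^ 4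
        \<and> \<bar>?l2 (S (x *\<^sub>R h)) - (Re (LINT \<xi>|lborel. \<kappa> \<xi> * free_evolution \<alpha> T \<Psi> t \<xi>) * x
            + (- Re (LINT \<xi>|lborel. \<kappa> \<xi> * cubic_response T \<alpha> 1 \<Psi> \<Phi> t \<xi>)) * x ^ 3)\<bar> \<le> ?K * x ^ 4"
      if x: "\<bar>x\<bar> < d" for x
    proof -
      have "\<bar>x\<bar> \<le> \<epsilon>\<^sub>0" using x by (simp add: d_def)
      then obtain v w V W where sm: "smooth_solution F \<alpha> T (x *\<^sub>R h) v w"
        and fV: "has_fourier (path_distr v t) (V t)" and fW: "has_fourier (path_distr w t) (W t)"
        and rV: "rapid (V t)" and rW: "rapid (W t)"
        and eV: "\<And>\<xi>. norm (V t \<xi> - (of_real x * free_evolution 1 T \<Phi> t \<xi> - of_real (x ^ 3) * cubic_response T 1 \<alpha> \<Phi> \<Psi> t \<xi>)) \<le> K * x ^ 4"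
        and eW: "\<And>\<xi>. norm (W t \<xi> - (of_real x * free_evolution \<alpha> T \<Psi> t \<xi> - of_real (x ^ 3) * cubic_response T \<alpha> 1 \<Psi> \<Phi> t \<xi>)) \<le> K * x ^ 4"
        unfolding xh using sol[of x] t by blast
      have "S (x *\<^sub>R h) = (path_distr v, path_distr w)"
        using S ball[OF x] sm unfolding solution_map_def by blast
      then have "?l1 (S (x *\<^sub>R h)) = Re (LINT \<xi>|lborel. \<kappa> \<xi> * V t \<xi>)" "?l2 (S (x *\<^sub>R h)) = Re (LINT \<xi>|lborel. \<kappa> \<xi> * W t \<xi>)"
        by (simp_all add: fourier_test_AE[OF fV m\<kappa>] fourier_test_AE[OF fW m\<kappa>])
      then show ?thesis
        using test[OF rV rf(1) dominated_path_rapid[OF T B1] eV] test[OF rW rf(2) dominated_path_rapid[OF T B2] eW]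
        by simp
    qed
    show ?thesis
      using M[OF h l1 d SY conjunct1[OF exp]] M[OF h l2 d SY conjunct2[OF exp]] unfolding nh by simp
  qed
  show "bounded_cubic_response T 1 \<alpha> s k"
    unfolding bounded_cubic_response_def using main by blast
  have "\<bar>Re (LINT \<xi>|lborel. \<kappa> \<xi> * cubic_response T \<alpha> 1 \<Psi> \<Phi> t \<xi>)\<bar>
        \<le> M * sobolev_size (- k) \<kappa> * sqrt ((sobolev_size k \<Psi>)\<^sup>2 + (sobolev_size s \<Phi>)\<^sup>2) ^ 3"
    if "admissible \<Psi>" "admissible \<Phi>" "rapid \<kappa>" "t \<in> {0..T}" for \<Phi> \<Psi> \<kappa> t
    using main[OF that(2,1,3,4)] add.commute[of "(sobolev_size s \<Phi>)\<^sup>2" "(sobolev_size k \<Psi>)\<^sup>2"] by (simp only:)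
  then show "bounded_cubic_response T \<alpha> 1 k s"
    unfolding bounded_cubic_response_def by blast
qed

section \<open>Lower bounds for the cubic response\<close>

definition real_conv :: "(real \<Rightarrow> real) \<Rightarrow> (real \<Rightarrow> real) \<Rightarrow> real \<Rightarrow> real" where
  "real_conv f g \<xi> = (LINT \<eta>|lborel. f (\<xi> - \<eta>) * g \<eta>) / (2 * pi)"

lemma conv_of_real: "conv (\<lambda>\<xi>. of_real (f \<xi>)) (\<lambda>\<xi>. of_real (g \<xi>)) = (\<lambda>\<xi>. of_real (real_conv f g \<xi>))"
  by (simp add: fun_eq_iff conv_def real_conv_def flip: of_real_mult)

lemma integrable_rapid_conv:
  assumes f: "rapid f" and g: "rapid g"
  shows "integrable lborel (\<lambda>\<eta>. f (\<xi> - \<eta>) * g \<eta>)"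
proof -
  obtain B where B: "\<And>\<xi>. norm (f \<xi>) \<le> B" using rapid_bounded[OF f] by metis
  show ?thesis by (intro integrable_conv[OF _ _ B] rapid_measurable rapid_integrable f g)
qed

lemma integrable_real_conv:
  assumes "rapid (\<lambda>\<xi>. of_real (f \<xi>))" "rapid (\<lambda>\<xi>. of_real (g \<xi>))"
  shows "integrable lborel (\<lambda>\<eta>. f (\<xi> - \<eta>) * g \<eta>)"
  using integrable_Re[OF integrable_rapid_conv[OF assms, of \<xi>]] by simp

lemma real_conv_nonneg: "(\<And>x. 0 \<le> f x) \<Longrightarrow> (\<And>x. 0 \<le> g x) \<Longrightarrow> 0 \<le> real_conv f g \<xi>"
  by (simp add: real_conv_def)

lemma integral_Icc_ge:
  fixes h :: "real \<Rightarrow> real"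
  assumes int: "integrable lborel h" and nonneg: "\<And>x. 0 \<le> h x"
    and le: "\<And>x. \<bar>x - p\<bar> \<le> \<sigma> \<Longrightarrow> c \<le> h x" and \<sigma>: "0 \<le> \<sigma>"
  shows "c * (2 * \<sigma>) \<le> (LINT x|lborel. h x)"
proof -
  have "c * (2 * \<sigma>) = (LINT x|lborel. c * indicat_real {p - \<sigma>..p + \<sigma>} x)"
    using \<sigma> by simp
  also have "\<dots> \<le> (LINT x|lborel. h x)"
  proof (rule integral_mono[OF _ int])
    show "integrable lborel (\<lambda>x. c * indicat_real {p - \<sigma>..p + \<sigma>} x)"
      by (intro integrable_mult_right integrable_indicator_Icc[OF zero_less_one])
    show "c * indicat_real {p - \<sigma>..p + \<sigma>} x \<le> h x" for x
      using le[of x] nonneg[of x] by (auto simp: indicator_def abs_le_iff)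
  qed
  finally show ?thesis .
qed

text \<open>
  The interval around q has length 1/2, which leaves A B / 2 for the integral. The radii 1/2 and 1/4
  are such that the lemma can be applied twice: its conclusion holds on a neighbourhood of radius
  1/4, which is what is needed of the second factor.
\<close>

lemma real_conv_ge:
  assumes int: "integrable lborel (\<lambda>\<eta>. f (\<xi> - \<eta>) * g \<eta>)"
    and f0: "\<And>x. 0 \<le> f x" and g0: "\<And>x. 0 \<le> g x"
    and f: "\<And>x. \<bar>x - p\<bar> \<le> 1 / 2 \<Longrightarrow> A \<le> f x" and g: "\<And>x. \<bar>x - q\<bar> \<le> 1 / 4 \<Longrightarrow> B \<le> g x"
    and A: "0 \<le> A" and B: "0 \<le> B" and \<xi>: "\<bar>\<xi> - (p + q)\<bar> \<le> 1 / 4"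
  shows "A * B / (4 * pi) \<le> real_conv f g \<xi>"
proof -
  have "A * B * (2 * (1 / 4)) \<le> (LINT \<eta>|lborel. f (\<xi> - \<eta>) * g \<eta>)"
  proof (rule integral_Icc_ge[OF int, of q])
    show "0 \<le> f (\<xi> - \<eta>) * g \<eta>" for \<eta> using f0 g0 by simp
    show "A * B \<le> f (\<xi> - \<eta>) * g \<eta>" if "\<bar>\<eta> - q\<bar> \<le> 1 / 4" for \<eta>
    proof (intro mult_mono f g f0 B that)
      show "\<bar>\<xi> - \<eta> - p\<bar> \<le> 1 / 2" using that \<xi> by linarith
    qed
  qed simp
  then show ?thesis by (simp add: real_conv_def field_simps)
qed

lemma norm_cis_minus_one_le: "norm (cis x - 1) \<le> \<bar>x\<bar>"
  using iexp_approx1[of x 0] by (simp add: cis_conv_exp)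

text \<open>
  A pointwise relative error of 1/2 is inherited by the integral. This is applied once for each of
  the two nested convolutions, with the phase collected in the constant c.
\<close>

lemma conv_near_real_conv:
  assumes f: "rapid f" and g: "rapid g" and f0: "rapid (\<lambda>\<xi>. of_real (f0 \<xi>))" and g0: "rapid (\<lambda>\<xi>. of_real (g0 \<xi>))"
    and close: "\<And>\<eta>. norm (c * (f (\<xi> - \<eta>) * g \<eta>) - of_real (f0 (\<xi> - \<eta>) * g0 \<eta>)) \<le> f0 (\<xi> - \<eta>) * g0 \<eta> / 2"
  shows "norm (c * conv f g \<xi> - of_real (real_conv f0 g0 \<xi>)) \<le> real_conv f0 g0 \<xi> / 2"
proof -
  let ?d = "\<lambda>\<eta>. c * (f (\<xi> - \<eta>) * g \<eta>) - of_real (f0 (\<xi> - \<eta>) * g0 \<eta>)"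
  note i1 = integrable_rapid_conv[OF f g, of \<xi>] and i2 = integrable_real_conv[OF f0 g0, of \<xi>]
  have i: "integrable lborel ?d" by (intro Bochner_Integration.integrable_diff integrable_mult_right i1 integrable_of_real i2)
  have "c * conv f g \<xi> - of_real (real_conv f0 g0 \<xi>) = (LINT \<eta>|lborel. ?d \<eta>) / (2 * pi)"
    using i1 i2 by (simp add: conv_def real_conv_def diff_divide_distrib del: of_real_mult)
  moreover have "norm (LINT \<eta>|lborel. ?d \<eta>) \<le> (LINT \<eta>|lborel. f0 (\<xi> - \<eta>) * g0 \<eta> / 2)"
    by (rule Bochner_Integration.integral_norm_bound_integral[OF i]) (use i2 close in auto)
  then have "norm (LINT \<eta>|lborel. ?d \<eta>) / (2 * pi) \<le> (LINT \<eta>|lborel. f0 (\<xi> - \<eta>) * g0 \<eta> / 2) / (2 * pi)"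
    by (rule divide_right_mono) simp
  ultimately show ?thesis
    by (simp add: norm_divide real_conv_def del: of_real_mult)
qed

text \<open>
  The phase condition says that on the frequencies that occur no oscillation develops up to time t.
  Then the response stays close to that of the problem without dispersion, \<i> \<xi> times the time t
  times the double convolution of the nonnegative data. The test function removes the factor \<i> and
  the remaining phase of the free evolution at the output frequency, so that all contributions add
  up with the same sign.
\<close>

lemma cubic_response_lower_bound:
  assumes T: "0 < T" and t: "t \<in> {0..T}"
    and \<phi>: "admissible (\<lambda>\<xi>. of_real (\<phi> \<xi>))" "\<And>\<xi>. 0 \<le> \<phi> \<xi>" and \<psi>: "admissible (\<lambda>\<xi>. of_real (\<psi> \<xi>))" "\<And>\<xi>. 0 \<le> \<psi> \<xi>"
    and \<tau>: "rapid (\<lambda>\<xi>. of_real (\<tau> \<xi>))" "\<And>\<xi>. 0 \<le> \<tau> \<xi>" "\<And>\<xi>. \<tau> \<xi> \<noteq> 0 \<Longrightarrow> 0 \<le> \<xi>"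
    and phase: "\<And>\<xi> \<eta> \<zeta>. \<lbrakk>\<tau> \<xi> \<noteq> 0; \<phi> (\<xi> - \<eta>) \<noteq> 0; \<psi> (\<eta> - \<zeta>) \<noteq> 0; \<psi> \<zeta> \<noteq> 0\<rbrakk>
      \<Longrightarrow> t * \<bar>a * (\<xi> - \<eta>) ^ 3 + b * (\<eta> - \<zeta>) ^ 3 + b * \<zeta> ^ 3 - a * \<xi> ^ 3\<bar> \<le> 1 / 2"
    and low: "\<And>\<xi>. \<bar>\<xi> - n\<bar> \<le> 1 / 4 \<Longrightarrow> A \<le> \<tau> \<xi> \<and> L \<le> \<xi> \<and> B \<le> real_conv \<phi> (real_conv \<psi> \<psi>) \<xi>"
    and ALB: "0 \<le> A" "0 \<le> L" "0 \<le> B"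
  shows "t / 4 * (A * L * B) \<le> Re (LINT \<xi>|lborel. (- \<i> * cis (- (t * a * \<xi> ^ 3)) * of_real (\<tau> \<xi>)) *
      cubic_response T a b (\<lambda>\<xi>. of_real (\<phi> \<xi>)) (\<lambda>\<xi>. of_real (\<psi> \<xi>)) t \<xi>)"
proof -
  let ?\<Phi> = "\<lambda>\<xi>. complex_of_real (\<phi> \<xi>)" and ?\<Psi> = "\<lambda>\<xi>. complex_of_real (\<psi> \<xi>)"
  let ?N0 = "real_conv \<phi> (real_conv \<psi> \<psi>)"
  let ?\<kappa> = "\<lambda>\<xi>. - \<i> * cis (- (t * a * \<xi> ^ 3)) * complex_of_real (\<tau> \<xi>)"
  define N where "N r = conv (free_evolution a T ?\<Phi> r) (conv (free_evolution b T ?\<Psi> r) (free_evolution b T ?\<Psi> r))" for r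
  note r\<phi> = admissible_rapid[OF \<phi>(1)] and r\<psi> = admissible_rapid[OF \<psi>(1)]
  have r\<psi>\<psi>: "rapid (\<lambda>\<xi>. of_real (real_conv \<psi> \<psi> \<xi>))" using rapid_conv[OF r\<psi> r\<psi>] unfolding conv_of_real .
  have rN0: "rapid (\<lambda>\<xi>. of_real (?N0 \<xi>))" using rapid_conv[OF r\<phi> r\<psi>\<psi>] unfolding conv_of_real .
  have g0: "0 \<le> real_conv \<psi> \<psi> \<xi>" for \<xi> by (rule real_conv_nonneg[OF \<psi>(2) \<psi>(2)])
  have N0: "0 \<le> ?N0 \<xi>" for \<xi> by (rule real_conv_nonneg[OF \<phi>(2) g0])
  obtain A1 where A1: "\<And>\<xi>. norm (?\<Phi> \<xi>) \<le> A1 * decay_weight 2 \<xi>" using \<phi>(1) unfolding admissible_def by blast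
  obtain A2 where A2: "\<And>\<xi>. norm (?\<Psi> \<xi>) \<le> A2 * decay_weight 2 \<xi>" using \<psi>(1) unfolding admissible_def by blast
  have c\<phi>: "continuous_on UNIV ?\<Phi>" and c\<psi>: "continuous_on UNIV ?\<Psi>" using \<phi>(1) \<psi>(1) by (auto simp: admissible_def)
  note d\<phi> = dominated_path_free_evolution[OF T c\<phi> A1, of a] and d\<psi> = dominated_path_free_evolution[OF T c\<psi> A2, of b]
  note dN = dominated_path_conv[OF T d\<phi> dominated_path_conv[OF T d\<psi> d\<psi>], folded N_def]
  \<comment> \<open>Seen from the output frequency, the integrand at time r differs from a nonnegative number only by the
    phase factor of the resonance function, which is within 1/2 of 1.\<close>
  have close: "norm (cis (- (r * a * \<xi> ^ 3)) * N r \<xi> - of_real (?N0 \<xi>)) \<le> ?N0 \<xi> / 2"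
    if r: "r \<in> {0..t}" and \<tau>\<xi>: "\<tau> \<xi> \<noteq> 0" for r \<xi>
    unfolding N_def
  proof (rule conv_near_real_conv)
    have rT: "clamp_time T r = r" using r t by (intro clamp_time_id) auto
    show "rapid (free_evolution a T ?\<Phi> r)" by (rule dominated_path_rapid[OF T d\<phi>])
    show "rapid (conv (free_evolution b T ?\<Psi> r) (free_evolution b T ?\<Psi> r))"
      by (intro rapid_conv dominated_path_rapid[OF T d\<psi>])
    show "rapid ?\<Phi>" by (rule r\<phi>)
    show "rapid (\<lambda>\<xi>. of_real (real_conv \<psi> \<psi> \<xi>))" by (rule r\<psi>\<psi>)
    fix \<eta>
    let ?c = "cis (- (r * a * \<xi> ^ 3) + r * a * (\<xi> - \<eta>) ^ 3)"
    let ?G = "conv (free_evolution b T ?\<Psi> r) (free_evolution b T ?\<Psi> r)"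
    have eq: "cis (- (r * a * \<xi> ^ 3)) * (free_evolution a T ?\<Phi> r (\<xi> - \<eta>) * ?G \<eta>) - of_real (\<phi> (\<xi> - \<eta>) * real_conv \<psi> \<psi> \<eta>)
        = of_real (\<phi> (\<xi> - \<eta>)) * (?c * ?G \<eta> - of_real (real_conv \<psi> \<psi> \<eta>))"
    proof -
      have "?c = cis (- (r * a * \<xi> ^ 3)) * cis (r * a * (\<xi> - \<eta>) ^ 3)" by (rule cis_mult[symmetric])
      then show ?thesis by (simp only: free_evolution_def rT right_diff_distrib of_real_mult mult_ac)
    qed
    show "norm (cis (- (r * a * \<xi> ^ 3)) * (free_evolution a T ?\<Phi> r (\<xi> - \<eta>) * ?G \<eta>) - of_real (\<phi> (\<xi> - \<eta>) * real_conv \<psi> \<psi> \<eta>))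
        \<le> \<phi> (\<xi> - \<eta>) * real_conv \<psi> \<psi> \<eta> / 2"
    proof (cases "\<phi> (\<xi> - \<eta>) = 0")
      case True
      then show ?thesis unfolding eq by simp
    next
      case False
      have "norm (?c * ?G \<eta> - of_real (real_conv \<psi> \<psi> \<eta>)) \<le> real_conv \<psi> \<psi> \<eta> / 2"
      proof (rule conv_near_real_conv[OF dominated_path_rapid[OF T d\<psi>] dominated_path_rapid[OF T d\<psi>] r\<psi> r\<psi>])
        fix \<zeta>
        let ?\<theta> = "r * (a * (\<xi> - \<eta>) ^ 3 + b * (\<eta> - \<zeta>) ^ 3 + b * \<zeta> ^ 3 - a * \<xi> ^ 3)"
        have th: "?\<theta> = - (r * a * \<xi> ^ 3) + r * a * (\<xi> - \<eta>) ^ 3 + r * b * (\<eta> - \<zeta>) ^ 3 + r * b * \<zeta> ^ 3"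
          by (simp add: algebra_simps)
        have eq2: "?c * (free_evolution b T ?\<Psi> r (\<eta> - \<zeta>) * free_evolution b T ?\<Psi> r \<zeta>) - of_real (\<psi> (\<eta> - \<zeta>) * \<psi> \<zeta>)
            = of_real (\<psi> (\<eta> - \<zeta>) * \<psi> \<zeta>) * (cis ?\<theta> - 1)"
        proof -
          have "cis ?\<theta> = ?c * cis (r * b * (\<eta> - \<zeta>) ^ 3) * cis (r * b * \<zeta> ^ 3)"
            unfolding th by (simp only: cis_mult)
          then show ?thesis
            by (simp only: free_evolution_def rT right_diff_distrib of_real_mult mult_ac mult_1_left)
        qed
        have p0: "0 \<le> \<psi> (\<eta> - \<zeta>) * \<psi> \<zeta>" using \<psi>(2) by simp
        show "norm (?c * (free_evolution b T ?\<Psi> r (\<eta> - \<zeta>) * free_evolution b T ?\<Psi> r \<zeta>) - of_real (\<psi> (\<eta> - \<zeta>) * \<psi> \<zeta>))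
            \<le> \<psi> (\<eta> - \<zeta>) * \<psi> \<zeta> / 2"
        proof (cases "\<psi> (\<eta> - \<zeta>) * \<psi> \<zeta> = 0")
          case True
          then show ?thesis unfolding eq2 by auto
        next
          case nz: False
          have "norm (cis ?\<theta> - 1) \<le> \<bar>?\<theta>\<bar>" by (rule norm_cis_minus_one_le)
          also have "\<dots> = r * \<bar>a * (\<xi> - \<eta>) ^ 3 + b * (\<eta> - \<zeta>) ^ 3 + b * \<zeta> ^ 3 - a * \<xi> ^ 3\<bar>" using r by (simp add: abs_mult)
          also have "\<dots> \<le> t * \<bar>a * (\<xi> - \<eta>) ^ 3 + b * (\<eta> - \<zeta>) ^ 3 + b * \<zeta> ^ 3 - a * \<xi> ^ 3\<bar>" using r by (intro mult_right_mono) auto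
          also have "\<dots> \<le> 1 / 2" using phase[OF \<tau>\<xi> False] nz by simp
          finally have "(\<psi> (\<eta> - \<zeta>) * \<psi> \<zeta>) * norm (cis ?\<theta> - 1) \<le> (\<psi> (\<eta> - \<zeta>) * \<psi> \<zeta>) * (1 / 2)"
            using p0 by (rule mult_left_mono)
          then show ?thesis unfolding eq2 norm_mult[of "of_real _"] using p0 by (simp only: norm_of_real)
        qed
      qed
      then have "\<phi> (\<xi> - \<eta>) * norm (?c * ?G \<eta> - of_real (real_conv \<psi> \<psi> \<eta>)) \<le> \<phi> (\<xi> - \<eta>) * (real_conv \<psi> \<psi> \<eta> / 2)"
        using \<phi>(2) by (rule mult_left_mono)
      then show ?thesis unfolding eq norm_mult[of "of_real _"] using \<phi>(2) by simp
    qed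
  qed
  have pointwise: "t / 2 * (\<tau> \<xi> * \<xi> * ?N0 \<xi>) \<le> Re (?\<kappa> \<xi> * cubic_response T a b ?\<Phi> ?\<Psi> t \<xi>)" for \<xi>
  proof (cases "\<tau> \<xi> = 0")
    case True
    then show ?thesis by simp
  next
    case False
    have w: "0 \<le> \<tau> \<xi> * \<xi>" using \<tau>(2,3) False by simp
    let ?h = "\<lambda>r. indicat_real {0..t} r *\<^sub>R (cis ((t - r) * a * \<xi> ^ 3) * (\<i> * of_real \<xi> * N r \<xi>))"
    have ih: "integrable lborel ?h" by (rule duhamel_integrable[OF T dN])
    have "cubic_response T a b ?\<Phi> ?\<Psi> t \<xi> = (LINT r|lborel. ?h r)"
      by (simp add: cubic_response_def duhamel_hat_def clamp_time_id[OF t] N_def)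
    then have e1: "?\<kappa> \<xi> * cubic_response T a b ?\<Phi> ?\<Psi> t \<xi> = (LINT r|lborel. ?\<kappa> \<xi> * ?h r)"
      by (simp only: integral_mult_right_zero)
    have "Re (?\<kappa> \<xi> * cubic_response T a b ?\<Phi> ?\<Psi> t \<xi>) = (LINT r|lborel. Re (?\<kappa> \<xi> * ?h r))"
      unfolding e1 by (rule integral_Re[symmetric, OF integrable_mult_right[OF ih]])
    moreover have "(LINT r|lborel. (\<tau> \<xi> * \<xi> * ?N0 \<xi> / 2) * indicat_real {0..t} r) \<le> (LINT r|lborel. Re (?\<kappa> \<xi> * ?h r))"
    proof (rule integral_mono)
      show "integrable lborel (\<lambda>r. (\<tau> \<xi> * \<xi> * ?N0 \<xi> / 2) * indicat_real {0..t} r)"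
        by (intro integrable_mult_right integrable_indicator_Icc[OF T])
      show "integrable lborel (\<lambda>r. Re (?\<kappa> \<xi> * ?h r))" using ih by (intro integrable_Re integrable_mult_right)
      fix r
      show "(\<tau> \<xi> * \<xi> * ?N0 \<xi> / 2) * indicat_real {0..t} r \<le> Re (?\<kappa> \<xi> * ?h r)"
      proof (cases "r \<in> {0..t}")
        case True
        have "cis (- (t * a * \<xi> ^ 3)) * cis ((t - r) * a * \<xi> ^ 3) = cis (- (r * a * \<xi> ^ 3))"
          by (simp add: cis_mult algebra_simps)
        then have "?\<kappa> \<xi> * ?h r = of_real (\<tau> \<xi> * \<xi>) * (cis (- (r * a * \<xi> ^ 3)) * N r \<xi>)"
          using True by (simp add: mult_ac)
        then have "Re (?\<kappa> \<xi> * ?h r) = (\<tau> \<xi> * \<xi>) * Re (cis (- (r * a * \<xi> ^ 3)) * N r \<xi>)"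
          by (simp only: Re_complex_of_real times_complex.sel Im_complex_of_real)
        moreover have "?N0 \<xi> / 2 \<le> Re (cis (- (r * a * \<xi> ^ 3)) * N r \<xi>)"
        proof -
          have "\<bar>Re (cis (- (r * a * \<xi> ^ 3)) * N r \<xi> - of_real (?N0 \<xi>))\<bar> \<le> ?N0 \<xi> / 2"
            by (rule order_trans[OF abs_Re_le_cmod close[OF True False]])
          then have "\<bar>Re (cis (- (r * a * \<xi> ^ 3)) * N r \<xi>) - ?N0 \<xi>\<bar> \<le> ?N0 \<xi> / 2"
            by (simp only: minus_complex.sel Re_complex_of_real)
          then show ?thesis by linarith
        qed
        then have "(\<tau> \<xi> * \<xi>) * (?N0 \<xi> / 2) \<le> (\<tau> \<xi> * \<xi>) * Re (cis (- (r * a * \<xi> ^ 3)) * N r \<xi>)"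
          using w by (rule mult_left_mono)
        ultimately show ?thesis using True by simp
      qed simp
    qed
    ultimately have "(LINT r|lborel. (\<tau> \<xi> * \<xi> * ?N0 \<xi> / 2) * indicat_real {0..t} r)
        \<le> Re (?\<kappa> \<xi> * cubic_response T a b ?\<Phi> ?\<Psi> t \<xi>)" by (simp only:)
    moreover have "(LINT r|lborel. (\<tau> \<xi> * \<xi> * ?N0 \<xi> / 2) * indicat_real {0..t} r) = t / 2 * (\<tau> \<xi> * \<xi> * ?N0 \<xi>)"
      using t by simp
    ultimately show ?thesis by linarith
  qed
  have \<tau>b: "\<exists>C. \<forall>\<xi>. \<bar>\<tau> \<xi> * \<xi>\<bar> \<le> C"
  proof -
    obtain C where C: "0 \<le> C" "\<And>\<xi>. norm (complex_of_real (\<tau> \<xi>)) \<le> C * decay_weight 1 \<xi>" using rapidE[OF \<tau>(1)] by metis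
    have "\<bar>\<tau> \<xi> * \<xi>\<bar> \<le> C" for \<xi>
    proof -
      have "\<bar>\<tau> \<xi> * \<xi>\<bar> \<le> (C * decay_weight 1 \<xi>) * \<bar>\<xi>\<bar>"
        unfolding abs_mult using C(2)[of \<xi>] by (intro mult_right_mono) auto
      also have "\<dots> = C * (\<bar>\<xi>\<bar> * path_weight T T \<xi>)"
        using T by (simp add: path_weight_def clamp_time_def)
      also have "\<dots> \<le> C * 1" by (intro mult_left_mono abs_mult_path_weight_le[OF T] C)
      finally show ?thesis by simp
    qed
    then show ?thesis by blast
  qed
  obtain C where C: "\<And>\<xi>. \<bar>\<tau> \<xi> * \<xi>\<bar> \<le> C" using \<tau>b by blast
  have m\<tau> [measurable]: "\<tau> \<in> borel_measurable borel"
    using measurable_compose[OF rapid_measurable[OF \<tau>(1)] borel_measurable_Re] by simp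
  have int1: "integrable lborel (\<lambda>\<xi>. \<tau> \<xi> * \<xi> * ?N0 \<xi>)"
  proof -
    have "integrable lborel (\<lambda>\<xi>. complex_of_real (\<tau> \<xi> * \<xi>) * complex_of_real (?N0 \<xi>))"
      by (rule integrable_bounded_mult[OF rapid_integrable[OF rN0], of _ C]) (use C in \<open>auto simp del: of_real_mult\<close>)
    from integrable_Re[OF this] show ?thesis by simp
  qed
  obtain D where D: "dominated_path T D (cubic_response T a b ?\<Phi> ?\<Psi>)" using cubic_response_dominated[OF T \<phi>(1) \<psi>(1)] by blast
  have int2: "integrable lborel (\<lambda>\<xi>. ?\<kappa> \<xi> * cubic_response T a b ?\<Phi> ?\<Psi> t \<xi>)"
  proof -
    obtain B' where B': "\<And>\<xi>. norm (complex_of_real (\<tau> \<xi>)) \<le> B'" using rapid_bounded[OF \<tau>(1)] by metis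
    show ?thesis
      by (rule integrable_bounded_mult[OF rapid_integrable[OF dominated_path_rapid[OF T D]], of _ B'])
         (use B' in \<open>auto simp: norm_mult\<close>)
  qed
  have "(A * L * B) * (2 * (1 / 4)) \<le> (LINT \<xi>|lborel. \<tau> \<xi> * \<xi> * ?N0 \<xi>)"
  proof (rule integral_Icc_ge[OF int1, of n])
    show "0 \<le> \<tau> \<xi> * \<xi> * ?N0 \<xi>" for \<xi> using \<tau>(2,3)[of \<xi>] N0[of \<xi>] by (cases "\<tau> \<xi> = 0") auto
    show "A * L * B \<le> \<tau> \<xi> * \<xi> * ?N0 \<xi>" if "\<bar>\<xi> - n\<bar> \<le> 1 / 4" for \<xi>
      using low[OF that] ALB \<tau>(2)[of \<xi>] by (intro mult_mono) auto
  qed simp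
  then have "t / 4 * (A * L * B) \<le> (LINT \<xi>|lborel. t / 2 * (\<tau> \<xi> * \<xi> * ?N0 \<xi>))"
    using t mult_left_mono[of "(A * L * B) * (2 * (1 / 4))" "LINT \<xi>|lborel. \<tau> \<xi> * \<xi> * ?N0 \<xi>" "t / 2"] by simp
  also have "\<dots> \<le> (LINT \<xi>|lborel. Re (?\<kappa> \<xi> * cubic_response T a b ?\<Phi> ?\<Psi> t \<xi>))"
    by (rule integral_mono[OF integrable_mult_right[OF int1] integrable_Re[OF int2] pointwise])
  also have "\<dots> = Re (LINT \<xi>|lborel. ?\<kappa> \<xi> * cubic_response T a b ?\<Phi> ?\<Psi> t \<xi>)"
    by (rule integral_Re[OF int2])
  finally show ?thesis .
qed

section \<open>Data concentrated at high frequencies\<close>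

definition tent :: "real \<Rightarrow> real" where
  "tent x = max 0 (1 - \<bar>x\<bar>)"

text \<open>
  The bumps are placed symmetrically, because the Fourier transform of a real function has an even
  modulus.
\<close>

definition bumps :: "real \<Rightarrow> real \<Rightarrow> real" where
  "bumps m \<xi> = tent (\<xi> - m) + tent (\<xi> + m)"

lemma tent_nonneg: "0 \<le> tent x" and tent_le_1: "tent x \<le> 1" and tent_minus: "tent (- x) = tent x"
  and tent_eq_0: "1 \<le> \<bar>x\<bar> \<Longrightarrow> tent x = 0" and tent_ge: "\<bar>x\<bar> \<le> 1 / 2 \<Longrightarrow> 1 / 2 \<le> tent x"
  by (auto simp: tent_def)

lemma tent_nz: "tent x \<noteq> 0 \<Longrightarrow> \<bar>x\<bar> < 1"
  by (auto simp: tent_def max_def split: if_splits)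

lemma continuous_on_tent: "continuous_on A f \<Longrightarrow> continuous_on A (\<lambda>x. tent (f x))"
  unfolding tent_def by (intro continuous_intros)

lemma bumps_nonneg: "0 \<le> bumps m \<xi>" and bumps_minus: "bumps m (- \<xi>) = bumps m \<xi>"
  and bumps_le_2: "bumps m \<xi> \<le> 2"
  using tent_minus[of "\<xi> - m"] tent_minus[of "\<xi> + m"] tent_nonneg[of "\<xi> - m"] tent_nonneg[of "\<xi> + m"]
    tent_le_1[of "\<xi> - m"] tent_le_1[of "\<xi> + m"]
  by (simp_all add: bumps_def minus_diff_commute)

lemma continuous_on_bumps: "continuous_on A (bumps m)"
  unfolding bumps_def[abs_def] by (intro continuous_intros continuous_on_tent)

lemma bumps_nz: "bumps m \<xi> \<noteq> 0 \<Longrightarrow> \<bar>\<xi> - m\<bar> < 1 \<or> \<bar>\<xi> + m\<bar> < 1"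
proof -
  assume "bumps m \<xi> \<noteq> 0"
  then have "tent (\<xi> - m) \<noteq> 0 \<or> tent (\<xi> + m) \<noteq> 0" by (auto simp: bumps_def)
  then show ?thesis using tent_nz by blast
qed

lemma bumps_ge: "\<bar>\<xi> - m\<bar> \<le> 1 / 2 \<Longrightarrow> 1 / 2 \<le> bumps m \<xi>" "\<bar>\<xi> + m\<bar> \<le> 1 / 2 \<Longrightarrow> 1 / 2 \<le> bumps m \<xi>"
  using tent_ge[of "\<xi> - m"] tent_ge[of "\<xi> + m"] tent_nonneg[of "\<xi> - m"] tent_nonneg[of "\<xi> + m"]
  by (auto simp: bumps_def)

lemma compact_support_decay:
  fixes f :: "real \<Rightarrow> complex"
  assumes B: "\<And>\<xi>. norm (f \<xi>) \<le> B" and R: "\<And>\<xi>. R < \<bar>\<xi>\<bar> \<Longrightarrow> f \<xi> = 0"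
  shows "\<exists>A. \<forall>\<xi>. norm (f \<xi>) \<le> A * decay_weight 2 \<xi>"
proof (intro exI allI)
  fix \<xi>
  have B0: "0 \<le> B" using B norm_ge_zero order_trans by blast
  show "norm (f \<xi>) \<le> (B / decay_weight 2 R) * decay_weight 2 \<xi>"
  proof (cases "R < \<bar>\<xi>\<bar>")
    case True
    then show ?thesis using R B0 decay_weight_nonneg by simp
  next
    case False
    then have "\<bar>\<xi>\<bar> \<le> R" by simp
    then have "decay_weight 2 R \<le> decay_weight 2 \<xi>"
      unfolding decay_weight_def using one_plus_square_pos
      by (intro frac_le) (auto simp: abs_le_square_iff[symmetric])
    then have "B * 1 \<le> B * (decay_weight 2 \<xi> / decay_weight 2 R)"
      using B0 decay_weight_pos[of 2 R] by (intro mult_left_mono) (auto simp: le_divide_eq)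
    then show ?thesis using B[of \<xi>] by simp
  qed
qed

lemma admissible_real_even:
  assumes c: "continuous_on UNIV \<phi>" and even: "\<And>\<xi>. \<phi> (- \<xi>) = \<phi> \<xi>"
    and B: "\<And>\<xi>. \<bar>\<phi> \<xi>\<bar> \<le> B" and R: "\<And>\<xi>. R < \<bar>\<xi>\<bar> \<Longrightarrow> \<phi> \<xi> = 0"
  shows "admissible (\<lambda>\<xi>. of_real (\<phi> \<xi>))"
  unfolding admissible_def
proof (intro conjI)
  show "continuous_on UNIV (\<lambda>\<xi>. complex_of_real (\<phi> \<xi>))" by (intro continuous_intros c)
  show "hermitian (\<lambda>\<xi>. complex_of_real (\<phi> \<xi>))" using even by (simp add: hermitian_def)
  show "\<exists>A. \<forall>\<xi>. norm (complex_of_real (\<phi> \<xi>)) \<le> A * decay_weight 2 \<xi>"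
    by (rule compact_support_decay[of _ B R]) (use B R in auto)
qed

lemma admissible_bumps: "admissible (\<lambda>\<xi>. of_real (c * bumps m \<xi>))"
proof (rule admissible_real_even)
  show "continuous_on UNIV (\<lambda>\<xi>. c * bumps m \<xi>)" by (intro continuous_intros continuous_on_bumps)
  show "c * bumps m (- \<xi>) = c * bumps m \<xi>" for \<xi> by (simp add: bumps_minus)
  show "\<bar>c * bumps m \<xi>\<bar> \<le> \<bar>c\<bar> * 2" for \<xi>
    unfolding abs_mult using bumps_nonneg[of m \<xi>] bumps_le_2[of m \<xi>] by (intro mult_left_mono) auto
  show "c * bumps m \<xi> = 0" if "\<bar>m\<bar> + 1 < \<bar>\<xi>\<bar>" for \<xi>
    using bumps_nz[of m \<xi>] that by auto
qed

lemma admissible_tent: "admissible (\<lambda>\<xi>. of_real (tent \<xi>))"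
proof (rule admissible_real_even)
  show "continuous_on UNIV tent" using continuous_on_tent[OF continuous_on_id] by simp
  show "\<bar>tent \<xi>\<bar> \<le> 1" for \<xi> using tent_nonneg tent_le_1 by (simp add: abs_le_iff order_trans[of _ 0])
  show "tent \<xi> = 0" if "1 < \<bar>\<xi>\<bar>" for \<xi> using that by (simp add: tent_eq_0)
qed (rule tent_minus)

lemma admissible_add:
  assumes f: "admissible f" and g: "admissible g"
  shows "admissible (\<lambda>\<xi>. f \<xi> + g \<xi>)"
proof -
  obtain A where A: "\<And>\<xi>. norm (f \<xi>) \<le> A * decay_weight 2 \<xi>" using f unfolding admissible_def by blast
  obtain B where B: "\<And>\<xi>. norm (g \<xi>) \<le> B * decay_weight 2 \<xi>" using g unfolding admissible_def by blast
  have "norm (f \<xi> + g \<xi>) \<le> (A + B) * decay_weight 2 \<xi>" for \<xi>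
    using norm_triangle_ineq[of "f \<xi>" "g \<xi>"] A[of \<xi>] B[of \<xi>] by (simp add: distrib_right)
  moreover have "hermitian (\<lambda>\<xi>. f \<xi> + g \<xi>)" "continuous_on UNIV (\<lambda>\<xi>. f \<xi> + g \<xi>)"
    using f g by (auto simp: admissible_def hermitian_def intro: continuous_on_add)
  ultimately show ?thesis unfolding admissible_def by blast
qed

lemma powr_le_powr_abs:
  assumes "1 / 4 \<le> (\<rho>::real)" "\<rho> \<le> 10"
  shows "\<rho> powr s \<le> 10 powr \<bar>s\<bar>"
proof (cases "0 \<le> s")
  case True
  then show ?thesis using assms by (simp add: powr_mono2)
next
  case False
  have "\<rho> powr s = (1 / \<rho>) powr (- s)" using assms by (simp add: powr_minus_divide powr_divide)
  also have "\<dots> \<le> 10 powr (- s)" using assms False by (intro powr_mono2) (auto simp: divide_le_eq)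
  finally show ?thesis using False by simp
qed

text \<open>
  On the support of the bumps the quotient of 1 + \<xi>^2 by N^2 lies between 1/4 and 10, so the weight
  of the Sobolev norm cancels the power of N up to a constant depending on s alone.
\<close>

lemma sobolev_size_bumps_le:
  assumes N: "3 \<le> N" and m: "m = N \<or> m = 2 * N"
    and f: "\<And>\<xi>. norm (f \<xi>) \<le> N powr (- s) * bumps m \<xi>"
  shows "sobolev_size s f \<le> sqrt (4 * 10 powr \<bar>s\<bar>)"
proof -
  let ?I = "\<lambda>\<xi>. indicat_real {m - 1..m + 1} \<xi> + indicat_real {- m - 1..- m + 1} \<xi>"
  have le: "(1 + \<xi>\<^sup>2) powr s * (norm (f \<xi>))\<^sup>2 \<le> 10 powr \<bar>s\<bar> * ?I \<xi>" for \<xi>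
  proof (cases "bumps m \<xi> = 0")
    case True
    then have "norm (f \<xi>) = 0" using f[of \<xi>] by simp
    then show ?thesis by simp
  next
    case False
    have "N - 1 \<le> \<bar>\<xi>\<bar>" "\<bar>\<xi>\<bar> \<le> 2 * N + 1" using bumps_nz[OF False] m N by auto
    then have x: "N / 2 \<le> \<bar>\<xi>\<bar>" "\<bar>\<xi>\<bar> \<le> 3 * N" using N by auto
    have "(N / 2)\<^sup>2 \<le> \<xi>\<^sup>2" "\<xi>\<^sup>2 \<le> (3 * N)\<^sup>2"
      using power_mono[OF x(1), of 2] power_mono[OF x(2), of 2] N by auto
    then have xx: "N\<^sup>2 / 4 \<le> \<xi>\<^sup>2" "\<xi>\<^sup>2 \<le> 9 * N\<^sup>2" by (auto simp: power_divide power_mult_distrib)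
    have N2: "1 \<le> N\<^sup>2" using N by (simp add: one_le_power)
    then have "0 < N\<^sup>2" by linarith
    with N2 have \<rho>: "1 / 4 \<le> (1 + \<xi>\<^sup>2) / N\<^sup>2" "(1 + \<xi>\<^sup>2) / N\<^sup>2 \<le> 10"
      using xx by (simp_all add: pos_le_divide_eq pos_divide_le_eq)
    have "(1 + \<xi>\<^sup>2) powr s * (N powr (- s))\<^sup>2 = ((1 + \<xi>\<^sup>2) / N\<^sup>2) powr s"
    proof -
      have "(N\<^sup>2) powr s = (N powr s)\<^sup>2"
        using N by (simp add: power2_eq_square powr_mult)
      then show ?thesis
        using N by (simp add: powr_divide powr_minus_divide power_divide)
    qed
    also have "\<dots> \<le> 10 powr \<bar>s\<bar>" by (rule powr_le_powr_abs[OF \<rho>])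
    finally have w: "(1 + \<xi>\<^sup>2) powr s * (N powr (- s))\<^sup>2 \<le> 10 powr \<bar>s\<bar>" .
    have b: "(bumps m \<xi>)\<^sup>2 \<le> ?I \<xi>"
    proof -
      have "tent (\<xi> - m) * tent (\<xi> + m) = 0"
        using tent_nz[of "\<xi> - m"] tent_nz[of "\<xi> + m"] m N by (cases "tent (\<xi> - m) = 0"; cases "tent (\<xi> + m) = 0") auto
      then have "(bumps m \<xi>)\<^sup>2 = (tent (\<xi> - m))\<^sup>2 + (tent (\<xi> + m))\<^sup>2"
        by (simp add: bumps_def power2_sum)
      moreover have "(tent (\<xi> - m))\<^sup>2 \<le> indicat_real {m - 1..m + 1} \<xi>"
        using tent_nz[of "\<xi> - m"] tent_le_1[of "\<xi> - m"] tent_nonneg[of "\<xi> - m"]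
        by (cases "tent (\<xi> - m) = 0") (auto simp: indicator_def power_le_one)
      moreover have "(tent (\<xi> + m))\<^sup>2 \<le> indicat_real {- m - 1..- m + 1} \<xi>"
        using tent_nz[of "\<xi> + m"] tent_le_1[of "\<xi> + m"] tent_nonneg[of "\<xi> + m"]
        by (cases "tent (\<xi> + m) = 0") (auto simp: indicator_def power_le_one)
      ultimately show ?thesis by linarith
    qed
    have "(1 + \<xi>\<^sup>2) powr s * (norm (f \<xi>))\<^sup>2 \<le> (1 + \<xi>\<^sup>2) powr s * (N powr (- s) * bumps m \<xi>)\<^sup>2"
      by (intro mult_left_mono power_mono f) auto
    also have "\<dots> = ((1 + \<xi>\<^sup>2) powr s * (N powr (- s))\<^sup>2) * (bumps m \<xi>)\<^sup>2" by (simp add: power_mult_distrib)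
    also have "\<dots> \<le> 10 powr \<bar>s\<bar> * ?I \<xi>" by (intro mult_mono w b) auto
    finally show ?thesis .
  qed
  have "(LINT \<xi>|lborel. (1 + \<xi>\<^sup>2) powr s * (norm (f \<xi>))\<^sup>2) \<le> (LINT \<xi>|lborel. 10 powr \<bar>s\<bar> * ?I \<xi>)"
    by (rule integral_mono'[OF _ le])
       (auto intro!: integrable_mult_right Bochner_Integration.integrable_add integrable_indicator_Icc[OF zero_less_one])
  also have "\<dots> = 10 powr \<bar>s\<bar> * ((LINT \<xi>|lborel. indicat_real {m - 1..m + 1} \<xi>) + (LINT \<xi>|lborel. indicat_real {- m - 1..- m + 1} \<xi>))"
    using integrable_indicator_Icc[OF zero_less_one, of "m - 1" "m + 1"] integrable_indicator_Icc[OF zero_less_one, of "- m - 1" "- m + 1"]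
    by (simp only: integral_mult_right_zero Bochner_Integration.integral_add)
  also have "\<dots> = 4 * 10 powr \<bar>s\<bar>" by simp
  finally show ?thesis unfolding sobolev_size_def by (rule real_sqrt_le_mono)
qed

lemma rapid_test_function:
  assumes c: "continuous_on UNIV \<tau>" and B: "\<And>\<xi>. \<bar>\<tau> \<xi>\<bar> \<le> B" and R: "\<And>\<xi>. R < \<bar>\<xi>\<bar> \<Longrightarrow> \<tau> \<xi> = 0"
  shows "rapid (\<lambda>\<xi>. of_real (\<tau> \<xi>))" and "rapid (\<lambda>\<xi>. - \<i> * cis (- (x * \<xi> ^ 3)) * of_real (\<tau> \<xi>))"
proof -
  have r: "rapid f" if cf: "continuous_on UNIV f" and f: "\<And>\<xi>. norm (f \<xi>) = \<bar>\<tau> \<xi>\<bar>" for f :: "real \<Rightarrow> complex"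
  proof -
    have "\<exists>A. \<forall>\<xi>. norm (f \<xi>) \<le> A * decay_weight 2 \<xi>"
    proof (rule compact_support_decay)
      show "norm (f \<xi>) \<le> B" for \<xi> unfolding f by (rule B)
      show "f \<xi> = 0" if "R < \<bar>\<xi>\<bar>" for \<xi> using f[of \<xi>] R[OF that] by simp
    qed
    then obtain A where A: "\<And>\<xi>. norm (f \<xi>) \<le> A * decay_weight 2 \<xi>" by blast
    have "norm (f \<xi>) \<le> A * decay_weight 1 \<xi>" for \<xi>
      by (rule order_trans[OF A mult_left_mono[OF decay_weight_mono decay_bound_nonneg[OF A]]]) simp
    then show ?thesis using cf unfolding rapid_def by blast
  qed
  show "rapid (\<lambda>\<xi>. of_real (\<tau> \<xi>))" by (rule r) (auto intro!: continuous_intros c)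
  show "rapid (\<lambda>\<xi>. - \<i> * cis (- (x * \<xi> ^ 3)) * of_real (\<tau> \<xi>))"
    by (rule r) (auto intro!: continuous_intros c simp: norm_mult)
qed

lemma not_bounded_powr:
  assumes "\<And>N::real. 3 \<le> N \<Longrightarrow> c * N powr p \<le> U" and c: "0 < c" and p: "0 < p"
  shows False
proof -
  define Y where "Y = max 1 (U / c + 1)"
  define N where "N = max 3 (Y powr (1 / p))"
  have "Y = (Y powr (1 / p)) powr p" using p by (simp add: powr_powr Y_def)
  also have "\<dots> \<le> N powr p" using p by (intro powr_mono2) (auto simp: N_def)
  finally have "Y \<le> N powr p" .
  then have "U / c + 1 \<le> N powr p" by (simp add: Y_def)
  then have "c * (U / c + 1) \<le> c * N powr p" using c by (intro mult_left_mono) auto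
  then have "U + c \<le> c * N powr p" using c by (simp add: distrib_left)
  then show False using assms(1)[of N] c by (simp add: N_def)
qed

lemma abs_cube_diff_le:
  fixes x y :: real
  assumes "\<bar>x\<bar> \<le> R" "\<bar>y\<bar> \<le> R" "\<bar>x - y\<bar> \<le> 2"
  shows "\<bar>x ^ 3 - y ^ 3\<bar> \<le> 6 * R\<^sup>2"
proof -
  have R: "0 \<le> R" using assms(1) by linarith
  have "x ^ 3 - y ^ 3 = (x - y) * (x * x + x * y + y * y)" by (simp add: power3_eq_cube algebra_simps)
  moreover have "\<bar>x * x + x * y + y * y\<bar> \<le> 3 * R\<^sup>2"
  proof -
    have "\<bar>u * v\<bar> \<le> R\<^sup>2" if "\<bar>u\<bar> \<le> R" "\<bar>v\<bar> \<le> R" for u v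
      using that R by (simp add: abs_mult power2_eq_square mult_mono)
    then have "\<bar>x * x\<bar> \<le> R\<^sup>2" "\<bar>x * y\<bar> \<le> R\<^sup>2" "\<bar>y * y\<bar> \<le> R\<^sup>2" using assms by blast+
    then show ?thesis by linarith
  qed
  ultimately have "\<bar>x ^ 3 - y ^ 3\<bar> \<le> 2 * (3 * R\<^sup>2)"
    using assms(3) by (simp only: abs_mult) (intro mult_mono, auto)
  then show ?thesis by simp
qed

lemma abs_cube_le:
  fixes x :: real
  assumes "\<bar>x\<bar> \<le> R"
  shows "\<bar>x ^ 3\<bar> \<le> R ^ 3"
  using power_mono[OF assms, of 3] by (simp add: power_abs)

section \<open>Unboundedness of the cubic response\<close>

text \<open>
  A bounded response is tested with N^s times a tent of radius 1 around m, a function whose norm dual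
  to that of order s is bounded in N. Together with the lower bound for the response this gives an
  inequality between powers of N. The factor N comes from the derivative: its symbol has
  modulus at least N/2 on the frequencies in question.
\<close>

lemma bounded_cubic_response_imp:
  assumes T: "0 < T" and bdd: "bounded_cubic_response T a b s k"
  obtains M where "\<And>\<phi> \<psi> t N m B x y. \<lbrakk>3 \<le> N; m = N \<or> m = 2 * N; t \<in> {0..T};
      admissible (\<lambda>\<xi>. of_real (\<phi> \<xi>)); \<And>\<xi>. 0 \<le> \<phi> \<xi>; admissible (\<lambda>\<xi>. of_real (\<psi> \<xi>)); \<And>\<xi>. 0 \<le> \<psi> \<xi>;
      \<And>\<xi> \<eta> \<zeta>. \<lbrakk>\<bar>\<xi> - m\<bar> < 1; \<phi> (\<xi> - \<eta>) \<noteq> 0; \<psi> (\<eta> - \<zeta>) \<noteq> 0; \<psi> \<zeta> \<noteq> 0\<rbrakk>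
        \<Longrightarrow> t * \<bar>a * (\<xi> - \<eta>) ^ 3 + b * (\<eta> - \<zeta>) ^ 3 + b * \<zeta> ^ 3 - a * \<xi> ^ 3\<bar> \<le> 1 / 2;
      0 \<le> B; \<And>\<xi>. \<bar>\<xi> - m\<bar> \<le> 1 / 4 \<Longrightarrow> B \<le> real_conv \<phi> (real_conv \<psi> \<psi>) \<xi>;
      sobolev_size s (\<lambda>\<xi>. of_real (\<phi> \<xi>)) \<le> x; sobolev_size k (\<lambda>\<xi>. of_real (\<psi> \<xi>)) \<le> y\<rbrakk>
    \<Longrightarrow> t * (N powr s * N * B) / 16 \<le> M * sqrt (x\<^sup>2 + y\<^sup>2) ^ 3"
proof -
  obtain M where M: "\<And>\<Phi> \<Psi> \<kappa> t. \<lbrakk>admissible \<Phi>; admissible \<Psi>; rapid \<kappa>; t \<in> {0..T}\<rbrakk> \<Longrightarrow>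
      \<bar>Re (LINT \<xi>|lborel. \<kappa> \<xi> * cubic_response T a b \<Phi> \<Psi> t \<xi>)\<bar>
        \<le> M * sobolev_size (- s) \<kappa> * sqrt ((sobolev_size s \<Phi>)\<^sup>2 + (sobolev_size k \<Psi>)\<^sup>2) ^ 3"
    using bdd unfolding bounded_cubic_response_def by blast
  define D where "D = sqrt (4 * 10 powr \<bar>s\<bar>)"
  show ?thesis
  proof (rule that[of "\<bar>M\<bar> * D"])
    fix \<phi> \<psi> :: "real \<Rightarrow> real" and t N m B x y :: real
    assume N: "3 \<le> N" and m: "m = N \<or> m = 2 * N" and t: "t \<in> {0..T}"
      and \<phi>: "admissible (\<lambda>\<xi>. of_real (\<phi> \<xi>))" "\<And>\<xi>. 0 \<le> \<phi> \<xi>"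
      and \<psi>: "admissible (\<lambda>\<xi>. of_real (\<psi> \<xi>))" "\<And>\<xi>. 0 \<le> \<psi> \<xi>"
      and phase: "\<And>\<xi> \<eta> \<zeta>. \<lbrakk>\<bar>\<xi> - m\<bar> < 1; \<phi> (\<xi> - \<eta>) \<noteq> 0; \<psi> (\<eta> - \<zeta>) \<noteq> 0; \<psi> \<zeta> \<noteq> 0\<rbrakk>
        \<Longrightarrow> t * \<bar>a * (\<xi> - \<eta>) ^ 3 + b * (\<eta> - \<zeta>) ^ 3 + b * \<zeta> ^ 3 - a * \<xi> ^ 3\<bar> \<le> 1 / 2"
      and B: "0 \<le> B" "\<And>\<xi>. \<bar>\<xi> - m\<bar> \<le> 1 / 4 \<Longrightarrow> B \<le> real_conv \<phi> (real_conv \<psi> \<psi>) \<xi>"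
      and x: "sobolev_size s (\<lambda>\<xi>. of_real (\<phi> \<xi>)) \<le> x" and y: "sobolev_size k (\<lambda>\<xi>. of_real (\<psi> \<xi>)) \<le> y"
    define \<tau> where "\<tau> \<xi> = N powr s * tent (\<xi> - m)" for \<xi>
    let ?\<kappa> = "\<lambda>\<xi>. - \<i> * cis (- (t * a * \<xi> ^ 3)) * complex_of_real (\<tau> \<xi>)"
    let ?R = "Re (LINT \<xi>|lborel. ?\<kappa> \<xi> * cubic_response T a b (\<lambda>\<xi>. of_real (\<phi> \<xi>)) (\<lambda>\<xi>. of_real (\<psi> \<xi>)) t \<xi>)"
    have mN: "N \<le> m" using m N by auto
    have \<tau>0: "0 \<le> \<tau> \<xi>" for \<xi> by (simp add: \<tau>_def tent_nonneg)
    have \<tau>_nz: "\<bar>\<xi> - m\<bar> < 1" if "\<tau> \<xi> \<noteq> 0" for \<xi> using that tent_nz by (simp add: \<tau>_def)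
    have c\<tau>: "continuous_on UNIV \<tau>" unfolding \<tau>_def[abs_def] by (intro continuous_intros continuous_on_tent)
    have b\<tau>: "\<bar>\<tau> \<xi>\<bar> \<le> N powr s" for \<xi>
      using tent_nonneg[of "\<xi> - m"] tent_le_1[of "\<xi> - m"] by (simp add: \<tau>_def abs_mult mult_left_le)
    have s\<tau>: "\<tau> \<xi> = 0" if "\<bar>m\<bar> + 1 < \<bar>\<xi>\<bar>" for \<xi> using that by (simp add: \<tau>_def tent_eq_0)
    have rapid_\<tau>: "rapid (\<lambda>\<xi>. of_real (\<tau> \<xi>))" "rapid ?\<kappa>"
      by (rule rapid_test_function[OF c\<tau> b\<tau> s\<tau>], assumption)+
    have "t / 4 * ((N powr s / 2) * (N / 2) * B) \<le> ?R"
    proof (rule cubic_response_lower_bound[OF T t \<phi> \<psi> rapid_\<tau>(1) \<tau>0 _ phase])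
      show "0 \<le> \<xi>" if "\<tau> \<xi> \<noteq> 0" for \<xi> using \<tau>_nz[OF that] mN N by linarith
      show "N powr s / 2 \<le> \<tau> \<xi> \<and> N / 2 \<le> \<xi> \<and> B \<le> real_conv \<phi> (real_conv \<psi> \<psi>) \<xi>" if "\<bar>\<xi> - m\<bar> \<le> 1 / 4" for \<xi>
      proof -
        have "N / 2 \<le> \<xi>" using that N mN by linarith
        then show ?thesis
          using B(2)[OF that] mult_left_mono[OF tent_ge[of "\<xi> - m"], of "N powr s"] that by (simp add: \<tau>_def)
      qed
    qed (use \<tau>_nz N B in auto)
    also have "?R \<le> M * sobolev_size (- s) ?\<kappa>
        * sqrt ((sobolev_size s (\<lambda>\<xi>. of_real (\<phi> \<xi>)))\<^sup>2 + (sobolev_size k (\<lambda>\<xi>. of_real (\<psi> \<xi>)))\<^sup>2) ^ 3"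
      using M[OF \<phi>(1) \<psi>(1) rapid_\<tau>(2) t] by linarith
    also have "\<dots> \<le> \<bar>M\<bar> * D * sqrt (x\<^sup>2 + y\<^sup>2) ^ 3"
    proof (rule mult_mono)
      have "norm (?\<kappa> \<xi>) \<le> N powr (- (- s)) * bumps m \<xi>" for \<xi>
        using tent_nonneg[of "\<xi> - m"] tent_nonneg[of "\<xi> + m"]
        by (simp add: norm_mult \<tau>_def bumps_def mult_left_mono)
      from sobolev_size_bumps_le[OF N m this] have "sobolev_size (- s) ?\<kappa> \<le> D" by (simp add: D_def)
      then show "M * sobolev_size (- s) ?\<kappa> \<le> \<bar>M\<bar> * D"
        using sobolev_size_nonneg[of "- s" ?\<kappa>] by (intro mult_mono) auto
      show "sqrt ((sobolev_size s (\<lambda>\<xi>. of_real (\<phi> \<xi>)))\<^sup>2 + (sobolev_size k (\<lambda>\<xi>. of_real (\<psi> \<xi>)))\<^sup>2) ^ 3 \<le> sqrt (x\<^sup>2 + y\<^sup>2) ^ 3"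
        using x y sobolev_size_nonneg by (intro power_mono real_sqrt_le_mono add_mono) auto
    qed (simp_all add: D_def)
    finally show "t * (N powr s * N * B) / 16 \<le> \<bar>M\<bar> * D * sqrt (x\<^sup>2 + y\<^sup>2) ^ 3" by simp
  qed
qed

text \<open>
  Let the first function live at \<plusminus> 2 N and the second at \<plusminus> N. An output at 2 N in which the first function
  enters at 2 N requires the two frequencies of the second function to be nearly opposite. The
  resonance function then is a sum of differences of cubes of almost equal numbers, of size O(N^2)
  instead of O(N^3). At time t = c / N^2 the response in the normalized data is of size
  N^(-2) N N^(-2 k), which tends to infinity when k < - 1/2.
\<close>

lemma cubic_response_unbounded_low_regularity:
  assumes T: "0 < T" and k: "k < - 1 / 2"
  shows "\<not> bounded_cubic_response T a b s k"
proof
  assume "bounded_cubic_response T a b s k"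
  then obtain M where M: "\<And>\<phi> \<psi> t N m B x y. \<lbrakk>3 \<le> N; m = N \<or> m = 2 * N; t \<in> {0..T};
      admissible (\<lambda>\<xi>. of_real (\<phi> \<xi>)); \<And>\<xi>. 0 \<le> \<phi> \<xi>; admissible (\<lambda>\<xi>. of_real (\<psi> \<xi>)); \<And>\<xi>. 0 \<le> \<psi> \<xi>;
      \<And>\<xi> \<eta> \<zeta>. \<lbrakk>\<bar>\<xi> - m\<bar> < 1; \<phi> (\<xi> - \<eta>) \<noteq> 0; \<psi> (\<eta> - \<zeta>) \<noteq> 0; \<psi> \<zeta> \<noteq> 0\<rbrakk>
        \<Longrightarrow> t * \<bar>a * (\<xi> - \<eta>) ^ 3 + b * (\<eta> - \<zeta>) ^ 3 + b * \<zeta> ^ 3 - a * \<xi> ^ 3\<bar> \<le> 1 / 2;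
      0 \<le> B; \<And>\<xi>. \<bar>\<xi> - m\<bar> \<le> 1 / 4 \<Longrightarrow> B \<le> real_conv \<phi> (real_conv \<psi> \<psi>) \<xi>;
      sobolev_size s (\<lambda>\<xi>. of_real (\<phi> \<xi>)) \<le> x; sobolev_size k (\<lambda>\<xi>. of_real (\<psi> \<xi>)) \<le> y\<rbrakk>
    \<Longrightarrow> t * (N powr s * N * B) / 16 \<le> M * sqrt (x\<^sup>2 + y\<^sup>2) ^ 3"
    by (rule bounded_cubic_response_imp[OF T]) blast
  define D where "D s = sqrt (4 * 10 powr \<bar>s\<bar>)" for s :: real
  \<comment> \<open>The resonance function will be at most (54 |a| + 24 |b|) N^2.\<close>
  define c where "c = min T (1 / (108 * \<bar>a\<bar> + 48 * \<bar>b\<bar> + 2))"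
  have c: "0 < c" "c \<le> T" "c * (54 * \<bar>a\<bar> + 24 * \<bar>b\<bar>) \<le> 1 / 2"
  proof -
    have pos: "0 < 108 * \<bar>a\<bar> + 48 * \<bar>b\<bar> + 2" by simp
    show "0 < c" "c \<le> T" using T pos by (auto simp: c_def)
    have "c \<le> 1 / (108 * \<bar>a\<bar> + 48 * \<bar>b\<bar> + 2)" by (simp add: c_def)
    then have "c * (108 * \<bar>a\<bar> + 48 * \<bar>b\<bar> + 2) \<le> 1" using pos by (simp add: pos_le_divide_eq)
    then show "c * (54 * \<bar>a\<bar> + 24 * \<bar>b\<bar>) \<le> 1 / 2" using \<open>0 < c\<close> by (simp add: algebra_simps)
  qed
  show False
  proof (rule not_bounded_powr)
    show "0 < c / (2048 * pi\<^sup>2)" "0 < - 1 - 2 * k" using c k by simp_all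
    fix N :: real assume N: "3 \<le> N"
    define t where "t = c / N\<^sup>2"
    have t: "t \<in> {0..T}"
    proof -
      have "c / N\<^sup>2 \<le> c / 1" using c one_le_power[of N 2] N by (intro divide_left_mono) auto
      then show ?thesis using c by (simp add: t_def)
    qed
    define \<phi> where "\<phi> \<xi> = N powr (- s) * bumps (2 * N) \<xi>" for \<xi>
    define \<psi> where "\<psi> \<xi> = N powr (- k) * bumps N \<xi>" for \<xi>
    have adm: "admissible (\<lambda>\<xi>. of_real (\<phi> \<xi>))" "admissible (\<lambda>\<xi>. of_real (\<psi> \<xi>))"
      unfolding \<phi>_def \<psi>_def by (rule admissible_bumps)+
    have nonneg: "0 \<le> \<phi> \<xi>" "0 \<le> \<psi> \<xi>" for \<xi> by (simp_all add: \<phi>_def \<psi>_def bumps_nonneg)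
    have phase: "t * \<bar>a * (\<xi> - \<eta>) ^ 3 + b * (\<eta> - \<zeta>) ^ 3 + b * \<zeta> ^ 3 - a * \<xi> ^ 3\<bar> \<le> 1 / 2"
      if "\<bar>\<xi> - 2 * N\<bar> < 1" "\<phi> (\<xi> - \<eta>) \<noteq> 0" "\<psi> (\<eta> - \<zeta>) \<noteq> 0" "\<psi> \<zeta> \<noteq> 0" for \<xi> \<eta> \<zeta>
    proof -
      have near: "\<bar>\<xi> - 2 * N\<bar> < 1" "\<bar>(\<xi> - \<eta>) - 2 * N\<bar> < 1 \<or> \<bar>(\<xi> - \<eta>) + 2 * N\<bar> < 1"
        "\<bar>(\<eta> - \<zeta>) - N\<bar> < 1 \<or> \<bar>(\<eta> - \<zeta>) + N\<bar> < 1" "\<bar>\<zeta> - N\<bar> < 1 \<or> \<bar>\<zeta> + N\<bar> < 1"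
        using that bumps_nz[of "2 * N" "\<xi> - \<eta>"] bumps_nz[of N "\<eta> - \<zeta>"] bumps_nz[of N \<zeta>]
        by (auto simp: \<phi>_def \<psi>_def)
      \<comment> \<open>The sum \<eta> of the frequencies of the second function is within 2 of 0 or of \<plusminus> 2 N, and the
        difference \<xi> - \<eta> rules out the latter: it would have to be near 0 or 4 N.\<close>
      have e: "\<bar>\<eta>\<bar> \<le> 2" using near N by linarith
      have x: "\<bar>(\<xi> - \<eta>) ^ 3 - \<xi> ^ 3\<bar> \<le> 6 * (3 * N)\<^sup>2"
        using near(1,2) N e by (intro abs_cube_diff_le) linarith+
      have z: "\<bar>(\<eta> - \<zeta>) ^ 3 - (- \<zeta>) ^ 3\<bar> \<le> 6 * (2 * N)\<^sup>2"
        using near(3,4) N e by (intro abs_cube_diff_le) linarith+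
      have "a * (\<xi> - \<eta>) ^ 3 + b * (\<eta> - \<zeta>) ^ 3 + b * \<zeta> ^ 3 - a * \<xi> ^ 3
          = a * ((\<xi> - \<eta>) ^ 3 - \<xi> ^ 3) + b * ((\<eta> - \<zeta>) ^ 3 - (- \<zeta>) ^ 3)"
        by (simp add: algebra_simps)
      also have "\<bar>\<dots>\<bar> \<le> \<bar>a\<bar> * (6 * (3 * N)\<^sup>2) + \<bar>b\<bar> * (6 * (2 * N)\<^sup>2)"
        using mult_left_mono[OF x, of "\<bar>a\<bar>"] mult_left_mono[OF z, of "\<bar>b\<bar>"]
          abs_triangle_ineq[of "a * ((\<xi> - \<eta>) ^ 3 - \<xi> ^ 3)" "b * ((\<eta> - \<zeta>) ^ 3 - (- \<zeta>) ^ 3)"]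
        unfolding abs_mult by linarith
      also have "\<dots> = (54 * \<bar>a\<bar> + 24 * \<bar>b\<bar>) * N\<^sup>2" by (simp add: power_mult_distrib algebra_simps)
      finally have "t * \<bar>a * (\<xi> - \<eta>) ^ 3 + b * (\<eta> - \<zeta>) ^ 3 + b * \<zeta> ^ 3 - a * \<xi> ^ 3\<bar>
          \<le> t * ((54 * \<bar>a\<bar> + 24 * \<bar>b\<bar>) * N\<^sup>2)"
        using t by (intro mult_left_mono) auto
      also have "\<dots> = c * (54 * \<bar>a\<bar> + 24 * \<bar>b\<bar>)" using N by (simp add: t_def)
      finally show ?thesis using c(3) by linarith
    qed
    define B1 where "B1 = (N powr (- k) / 2) * (N powr (- k) / 2) / (4 * pi)"
    define B where "B = (N powr (- s) / 2) * B1 / (4 * pi)"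
    have r: "rapid (\<lambda>\<xi>. of_real (\<phi> \<xi>))" "rapid (\<lambda>\<xi>. of_real (\<psi> \<xi>))"
      by (rule admissible_rapid[OF adm(1)] admissible_rapid[OF adm(2)])+
    have r2: "rapid (\<lambda>\<xi>. of_real (real_conv \<psi> \<psi> \<xi>))" using rapid_conv[OF r(2,2)] unfolding conv_of_real .
    have inner: "B1 \<le> real_conv \<psi> \<psi> \<eta>" if "\<bar>\<eta> - 0\<bar> \<le> 1 / 4" for \<eta>
      unfolding B1_def
    proof (rule real_conv_ge[OF integrable_real_conv[OF r(2,2)] nonneg(2) nonneg(2)])
      show "N powr (- k) / 2 \<le> \<psi> x" if "\<bar>x - N\<bar> \<le> 1 / 2" for x
        using mult_left_mono[OF bumps_ge(1)[OF that], of "N powr (- k)"] by (simp add: \<psi>_def)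
      show "N powr (- k) / 2 \<le> \<psi> x" if "\<bar>x - (- N)\<bar> \<le> 1 / 4" for x
        using mult_left_mono[OF bumps_ge(2)[of x N], of "N powr (- k)"] that by (simp add: \<psi>_def)
    qed (use that in auto)
    have B1: "0 \<le> B1" by (simp add: B1_def)
    have outer: "B \<le> real_conv \<phi> (real_conv \<psi> \<psi>) \<xi>" if "\<bar>\<xi> - 2 * N\<bar> \<le> 1 / 4" for \<xi>
      unfolding B_def
    proof (rule real_conv_ge[where p = "2 * N" and q = 0, OF integrable_real_conv[OF r(1) r2] nonneg(1)])
      show "B1 \<le> real_conv \<psi> \<psi> x" if "\<bar>x - 0\<bar> \<le> 1 / 4" for x by (rule inner[OF that])
      show "0 \<le> real_conv \<psi> \<psi> x" for x by (rule real_conv_nonneg[OF nonneg(2,2)])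
      show "N powr (- s) / 2 \<le> \<phi> x" if "\<bar>x - 2 * N\<bar> \<le> 1 / 2" for x
        using mult_left_mono[OF bumps_ge(1)[OF that], of "N powr (- s)"] by (simp add: \<phi>_def)
    qed (use that B1 in auto)
    have "t * (N powr s * N * B) / 16 = c / (2048 * pi\<^sup>2) * N powr (- 1 - 2 * k)"
    proof -
      have p1: "N powr s * N powr (- s) = 1" using N by (simp add: powr_add[symmetric])
      have p2: "N powr (- 1 - 2 * k) = N powr (- k) * N powr (- k) / N"
      proof -
        have "N powr (- 1 - 2 * k) = N powr ((- k) + (- k) + (- 1))" by (simp add: algebra_simps)
        also have "\<dots> = N powr (- k) * N powr (- k) * N powr (- 1)" by (simp only: powr_add)
        finally show ?thesis using N by (simp add: powr_minus_divide)
      qed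
      have "t * (N powr s * N * B) / 16
          = (N powr s * N powr (- s)) * (c / (2048 * pi\<^sup>2) * (N powr (- k) * N powr (- k) / N))"
        using N by (simp add: t_def B_def B1_def power2_eq_square mult_ac)
      then show ?thesis unfolding p1 p2 by simp
    qed
    moreover have "t * (N powr s * N * B) / 16 \<le> M * sqrt ((D s)\<^sup>2 + (D k)\<^sup>2) ^ 3"
    proof (rule M[OF N disjI2[OF refl] t adm(1) nonneg(1) adm(2) nonneg(2) phase _ outer])
      show "sobolev_size s (\<lambda>\<xi>. of_real (\<phi> \<xi>)) \<le> D s" unfolding D_def
        by (rule sobolev_size_bumps_le[OF N, of "2 * N"]) (simp_all add: \<phi>_def bumps_nonneg norm_mult)
      show "sobolev_size k (\<lambda>\<xi>. of_real (\<psi> \<xi>)) \<le> D k" unfolding D_def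
        by (rule sobolev_size_bumps_le[OF N, of N]) (simp_all add: \<psi>_def bumps_nonneg norm_mult)
    qed (use B1 in \<open>simp_all add: B_def\<close>)
    ultimately show "c / (2048 * pi\<^sup>2) * N powr (- 1 - 2 * k) \<le> M * sqrt ((D s)\<^sup>2 + (D k)\<^sup>2) ^ 3"
      by simp
  qed
qed

text \<open>
  When s is much larger than k, one high frequency of the rough function suffices: it is moved into
  the smooth component by two factors of frequency about 0. No cancellation in the resonance
  function is used, whose size is O(N^3). At time t = c / N^3 the response, measured in the norm of
  order s, is of size N^(-3) N N^(s - k).
\<close>

lemma cubic_response_unbounded_regularity_gap:
  assumes T: "0 < T" and sk: "2 < s - k"
  shows "\<not> bounded_cubic_response T a b s k"
proof
  assume "bounded_cubic_response T a b s k"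
  then obtain M where M: "\<And>\<phi> \<psi> t N m B x y. \<lbrakk>3 \<le> N; m = N \<or> m = 2 * N; t \<in> {0..T};
      admissible (\<lambda>\<xi>. of_real (\<phi> \<xi>)); \<And>\<xi>. 0 \<le> \<phi> \<xi>; admissible (\<lambda>\<xi>. of_real (\<psi> \<xi>)); \<And>\<xi>. 0 \<le> \<psi> \<xi>;
      \<And>\<xi> \<eta> \<zeta>. \<lbrakk>\<bar>\<xi> - m\<bar> < 1; \<phi> (\<xi> - \<eta>) \<noteq> 0; \<psi> (\<eta> - \<zeta>) \<noteq> 0; \<psi> \<zeta> \<noteq> 0\<rbrakk>
        \<Longrightarrow> t * \<bar>a * (\<xi> - \<eta>) ^ 3 + b * (\<eta> - \<zeta>) ^ 3 + b * \<zeta> ^ 3 - a * \<xi> ^ 3\<bar> \<le> 1 / 2;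
      0 \<le> B; \<And>\<xi>. \<bar>\<xi> - m\<bar> \<le> 1 / 4 \<Longrightarrow> B \<le> real_conv \<phi> (real_conv \<psi> \<psi>) \<xi>;
      sobolev_size s (\<lambda>\<xi>. of_real (\<phi> \<xi>)) \<le> x; sobolev_size k (\<lambda>\<xi>. of_real (\<psi> \<xi>)) \<le> y\<rbrakk>
    \<Longrightarrow> t * (N powr s * N * B) / 16 \<le> M * sqrt (x\<^sup>2 + y\<^sup>2) ^ 3"
    by (rule bounded_cubic_response_imp[OF T]) blast
  define D where "D = sqrt (4 * 10 powr \<bar>k\<bar>)"
  \<comment> \<open>All frequencies are at most 2 N, so the resonance function is at most (16 |a| + 16 |b|) N^3.\<close>
  define c where "c = min T (1 / (32 * \<bar>a\<bar> + 32 * \<bar>b\<bar> + 2))"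
  have c: "0 < c" "c \<le> T" "c * (16 * \<bar>a\<bar> + 16 * \<bar>b\<bar>) \<le> 1 / 2"
  proof -
    have pos: "0 < 32 * \<bar>a\<bar> + 32 * \<bar>b\<bar> + 2" by simp
    show "0 < c" "c \<le> T" using T pos by (auto simp: c_def)
    have "c \<le> 1 / (32 * \<bar>a\<bar> + 32 * \<bar>b\<bar> + 2)" by (simp add: c_def)
    then have "c * (32 * \<bar>a\<bar> + 32 * \<bar>b\<bar> + 2) \<le> 1" using pos by (simp add: pos_le_divide_eq)
    then show "c * (16 * \<bar>a\<bar> + 16 * \<bar>b\<bar>) \<le> 1 / 2" using \<open>0 < c\<close> by (simp add: algebra_simps)
  qed
  let ?tent = "\<lambda>\<xi>. complex_of_real (tent \<xi>)"
  note r1 = admissible_rapid[OF admissible_tent]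
  show False
  proof (rule not_bounded_powr)
    show "0 < c / (2048 * pi\<^sup>2)" "0 < s - k - 2" using c sk by simp_all
    fix N :: real assume N: "3 \<le> N"
    define t where "t = c / N ^ 3"
    have t: "t \<in> {0..T}"
    proof -
      have "c / N ^ 3 \<le> c / 1" using c one_le_power[of N 3] N by (intro divide_left_mono) auto
      then show ?thesis using c N by (simp add: t_def)
    qed
    define \<psi> where "\<psi> \<xi> = tent \<xi> + N powr (- k) * bumps N \<xi>" for \<xi>
    have \<psi>_eq: "(\<lambda>\<xi>. complex_of_real (\<psi> \<xi>)) = (\<lambda>\<xi>. ?tent \<xi> + of_real (N powr (- k) * bumps N \<xi>))"
      by (simp add: \<psi>_def)
    have adm: "admissible (\<lambda>\<xi>. of_real (\<psi> \<xi>))"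
      unfolding \<psi>_eq by (intro admissible_add admissible_tent admissible_bumps)
    have nonneg: "0 \<le> \<psi> \<xi>" for \<xi> by (simp add: \<psi>_def bumps_nonneg tent_nonneg)
    have supp: "\<bar>\<zeta>\<bar> \<le> 2 * N" if "\<psi> \<zeta> \<noteq> 0" for \<zeta>
      using that tent_nz[of \<zeta>] bumps_nz[of N \<zeta>] N by (cases "tent \<zeta> = 0") (auto simp: \<psi>_def)
    have phase: "t * \<bar>a * (\<xi> - \<eta>) ^ 3 + b * (\<eta> - \<zeta>) ^ 3 + b * \<zeta> ^ 3 - a * \<xi> ^ 3\<bar> \<le> 1 / 2"
      if "\<bar>\<xi> - N\<bar> < 1" "tent (\<xi> - \<eta>) \<noteq> 0" "\<psi> (\<eta> - \<zeta>) \<noteq> 0" "\<psi> \<zeta> \<noteq> 0" for \<xi> \<eta> \<zeta>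
    proof -
      have "\<bar>\<xi>\<bar> \<le> 2 * N" using that(1) N by linarith
      moreover have "\<bar>\<xi> - \<eta>\<bar> \<le> 2 * N" using tent_nz[OF that(2)] N by linarith
      ultimately have cubes: "\<bar>\<xi> ^ 3\<bar> \<le> (2 * N) ^ 3" "\<bar>(\<xi> - \<eta>) ^ 3\<bar> \<le> (2 * N) ^ 3"
        "\<bar>(\<eta> - \<zeta>) ^ 3\<bar> \<le> (2 * N) ^ 3" "\<bar>\<zeta> ^ 3\<bar> \<le> (2 * N) ^ 3"
        using supp[OF that(3)] supp[OF that(4)] abs_cube_le by blast+
      have le: "\<bar>x * y\<bar> \<le> \<bar>x\<bar> * (2 * N) ^ 3" if "\<bar>y\<bar> \<le> (2 * N) ^ 3" for x y
        unfolding abs_mult by (rule mult_left_mono[OF that]) simp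
      have "\<bar>a * (\<xi> - \<eta>) ^ 3 + b * (\<eta> - \<zeta>) ^ 3 + b * \<zeta> ^ 3 - a * \<xi> ^ 3\<bar>
          \<le> \<bar>a\<bar> * (2 * N) ^ 3 + \<bar>b\<bar> * (2 * N) ^ 3 + \<bar>b\<bar> * (2 * N) ^ 3 + \<bar>a\<bar> * (2 * N) ^ 3"
        using le[OF cubes(2), of a] le[OF cubes(3), of b] le[OF cubes(4), of b] le[OF cubes(1), of a] by linarith
      also have "\<dots> = (16 * \<bar>a\<bar> + 16 * \<bar>b\<bar>) * N ^ 3" by (simp add: power_mult_distrib algebra_simps)
      finally have "t * \<bar>a * (\<xi> - \<eta>) ^ 3 + b * (\<eta> - \<zeta>) ^ 3 + b * \<zeta> ^ 3 - a * \<xi> ^ 3\<bar>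
          \<le> t * ((16 * \<bar>a\<bar> + 16 * \<bar>b\<bar>) * N ^ 3)"
        using t by (intro mult_left_mono) auto
      also have "\<dots> = c * (16 * \<bar>a\<bar> + 16 * \<bar>b\<bar>)" using N by (simp add: t_def)
      finally show ?thesis using c(3) by linarith
    qed
    define B1 where "B1 = (N powr (- k) / 2) * (1 / 2) / (4 * pi)"
    define B where "B = (1 / 2) * B1 / (4 * pi)"
    note r = admissible_rapid[OF adm]
    have r2: "rapid (\<lambda>\<xi>. of_real (real_conv \<psi> \<psi> \<xi>))" using rapid_conv[OF r r] unfolding conv_of_real .
    have inner: "B1 \<le> real_conv \<psi> \<psi> \<eta>" if "\<bar>\<eta> - N\<bar> \<le> 1 / 4" for \<eta>
      unfolding B1_def
    proof (rule real_conv_ge[OF integrable_real_conv[OF r r] nonneg nonneg])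
      show "N powr (- k) / 2 \<le> \<psi> x" if "\<bar>x - N\<bar> \<le> 1 / 2" for x
        using mult_left_mono[OF bumps_ge(1)[OF that], of "N powr (- k)"] tent_nonneg[of x] by (simp add: \<psi>_def)
      show "1 / 2 \<le> \<psi> x" if "\<bar>x - 0\<bar> \<le> 1 / 4" for x
        using tent_ge[of x] that bumps_nonneg[of N x] by (simp add: \<psi>_def add_increasing2)
    qed (use that in auto)
    have B1: "0 \<le> B1" by (simp add: B1_def)
    have outer: "B \<le> real_conv tent (real_conv \<psi> \<psi>) \<xi>" if "\<bar>\<xi> - N\<bar> \<le> 1 / 4" for \<xi>
      unfolding B_def
    proof (rule real_conv_ge[where p = 0 and q = N, OF integrable_real_conv[OF r1 r2] tent_nonneg])
      show "B1 \<le> real_conv \<psi> \<psi> x" if "\<bar>x - N\<bar> \<le> 1 / 4" for x by (rule inner[OF that])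
      show "0 \<le> real_conv \<psi> \<psi> x" for x by (rule real_conv_nonneg[OF nonneg nonneg])
      show "1 / 2 \<le> tent x" if "\<bar>x - 0\<bar> \<le> 1 / 2" for x using tent_ge that by simp
    qed (use that B1 in auto)
    have "t * (N powr s * N * B) / 16 = c / (2048 * pi\<^sup>2) * N powr (s - k - 2)"
    proof -
      have p2: "N powr (s - k - 2) = N powr s * N powr (- k) / N\<^sup>2"
        using N by (simp add: powr_diff powr_minus divide_inverse powr_numeral)
      show ?thesis unfolding p2 using N by (simp add: t_def B_def B1_def power2_eq_square power3_eq_cube mult_ac)
    qed
    moreover have "t * (N powr s * N * B) / 16 \<le> M * sqrt ((sobolev_size s ?tent)\<^sup>2 + (sobolev_size k ?tent + D)\<^sup>2) ^ 3"
    proof (rule M[OF N disjI1[OF refl] t admissible_tent tent_nonneg adm nonneg phase _ outer order_refl])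
      let ?b = "\<lambda>\<xi>. complex_of_real (N powr (- k) * bumps N \<xi>)"
      note rb = admissible_rapid[OF admissible_bumps[of "N powr (- k)" N]]
      have "sobolev_size k (\<lambda>\<xi>. of_real (\<psi> \<xi>)) \<le> sobolev_size k ?tent + sobolev_size k ?b"
        unfolding \<psi>_eq
        by (intro sobolev_size_add_le rapid_measurable rapid_sobolev_integrable r1 rb)
      also have "sobolev_size k ?b \<le> D" unfolding D_def
        by (rule sobolev_size_bumps_le[OF N, of N]) (simp_all add: bumps_nonneg norm_mult)
      finally show "sobolev_size k (\<lambda>\<xi>. of_real (\<psi> \<xi>)) \<le> sobolev_size k ?tent + D" by simp
    qed (use B1 in \<open>simp_all add: B_def\<close>)
    ultimately show "c / (2048 * pi\<^sup>2) * N powr (s - k - 2)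
        \<le> M * sqrt ((sobolev_size s ?tent)\<^sup>2 + (sobolev_size k ?tent + D)\<^sup>2) ^ 3"
      by simp
  qed
qed

text \<open>
  The hypotheses on s and k are symmetric, and so is the system when its components are exchanged
  together with the coefficients 1 and \<alpha>. The component in which the response is unbounded is the
  first one if k < - 1/2 or s - k > 2, and the second one otherwise.
\<close>

theorem theorem1p4:
  fixes \<alpha> s k :: real and F :: "complex set"
  assumes "\<alpha> \<noteq> 0" and "\<alpha> \<noteq> 1"
    and "F = \<real> \<or> F = UNIV"
    and "s < - 1 / 2 \<or> k < - 1 / 2 \<or> \<bar>s - k\<bar> > 2"
  shows "\<not> (\<exists>r T S. r > 0 \<and> T > 0 \<and> solution_map F \<alpha> s k r T S \<and>
           C3_at (prod_space (sobolev F s) (sobolev F k))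
                 (prod_space (path_space T (sobolev F s)) (path_space T (sobolev F k))) S 0)"
proof
  assume "\<exists>r T S. r > 0 \<and> T > 0 \<and> solution_map F \<alpha> s k r T S \<and>
           C3_at (prod_space (sobolev F s) (sobolev F k))
                 (prod_space (path_space T (sobolev F s)) (path_space T (sobolev F k))) S 0"
  then obtain r T S where r: "0 < r" and T: "0 < T" and S: "solution_map F \<alpha> s k r T S"
    and C3: "C3_at (prod_space (sobolev F s) (sobolev F k))
                 (prod_space (path_space T (sobolev F s)) (path_space T (sobolev F k))) S 0" by blast
  note bdd = cubic_response_bounded[OF T r assms(3) S C3]
  have "(k < - 1 / 2 \<or> 2 < s - k) \<or> (s < - 1 / 2 \<or> 2 < k - s)" using assms(4) by linarith
  then show False
    using bdd cubic_response_unbounded_low_regularity[OF T] cubic_response_unbounded_regularity_gap[OF T] by blast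
qed

end
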